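(* Let $0<\sigma<2$, $\alpha>0$ and $\tau>1$. Then: (1) For every $\mu>0$ the infimum of $E_\alpha$ over $\mathcal D^\tau_\mu$ is finite and negative, and there exists a unique positive Ground State of $E_\alpha$ at mass $\mu$. (2) A further positive stationary state of $E_\alpha$ at mass $\mu$ (that is, one different from the positive Ground State at mass $\mu$) exists if and only if $\mu>\mu_\alpha$, where $$\mu_\alpha=\frac{(\sigma+1)^{\frac1\sigma}}{\sigma}\left(\frac{\alpha}{\tau^2-1}\right)^{\frac{2-\sigma}{\sigma}}\int_{-1}^{1}(1-t^2)^{\frac1\sigma-1}\,dt .$$
   Context: Write $\mathbb R^-=(-\infty,0)$, $\mathbb R^+=(0,+\infty)$. For $\tau>1$ let $$\mathcal D^\tau=\{u\in H^1(\mathbb R^-)\oplus H^1(\mathbb R^+): u(0^+)=\tau u(0^-)\}$$ (complex-valued functions on $\mathbb R\setminus\{0\}$), and for $\mu>0$ let $\mathcal D^\tau_\mu=\{u\in\mathcal D^\tau:\|u\|_{L^2(\mathbb R)}^2=\mu\}$. The quantity $\|u\|_{L^2(\mathbb R)}^2$ is the mass of $u$. For $u\in\mathcal D^\tau$, $$E_\alpha(u)=\frac12\left(\|u'\|_{L^2(\mathbb R^-)}^2+\|u'\|_{L^2(\mathbb R^+)}^2\right)-\frac{1}{2\sigma+2}\|u\|_{L^{2\sigma+2}(\mathbb R)}^{2\sigma+2}-\frac{\alpha}{2}|u(0^-)|^2 .$$ A Ground State of $E_\alpha$ at mass $\mu$ is a nonnegative minimizer of $E_\alpha$ on $\mathcal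 D^\tau_\mu$. A stationary state of $E_\alpha$ at mass $\mu$ is a critical point of $E_\alpha$ constrained to $\mathcal D^\tau_\mu$, i.e. $u\in\mathcal D^\tau_\mu$ such that the differential of $E_\alpha$ at $u$ (with $\mathcal D^\tau$ regarded as a real Hilbert space with the $H^1(\mathbb R^-)\oplus H^1(\mathbb R^+)$ norm) vanishes on every $\eta\in\mathcal D^\tau$ with $\mathrm{Re}\int_{\mathbb R}u\,\overline{\eta}\,dx=0$. *)

theory Defs
  imports "HOL-Analysis.Analysis"
begin

definition test_fun :: "real set \<Rightarrow> (real \<Rightarrow> real) \<Rightarrow> bool" where
  "test_fun I \<phi> \<longleftrightarrow>
     (\<forall>n x. ((deriv ^^ n) \<phi>) differentiable (at x)) \<and>
     (\<exists>K. compact K \<and> K \<subseteq> I \<and> (\<forall>x. x \<notin> K \<longrightarrow> \<phi> x = 0))"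

definition L2_on :: "real set \<Rightarrow> (real \<Rightarrow> complex) \<Rightarrow> bool" where
  "L2_on I u \<longleftrightarrow>
     set_borel_measurable lborel I u \<and> set_integrable lborel I (\<lambda>x. (norm (u x))\<^sup>2)"

(* Real-valued test functions suffice for complex-valued u, by linearity. *)
definition is_weak_deriv :: "real set \<Rightarrow> (real \<Rightarrow> complex) \<Rightarrow> (real \<Rightarrow> complex) \<Rightarrow> bool" where
  "is_weak_deriv I u g \<longleftrightarrow>
     (\<forall>\<phi>. test_fun I \<phi> \<longrightarrow>
        set_lebesgue_integral lborel I (\<lambda>x. deriv \<phi> x *\<^sub>R u x) =
        - set_lebesgue_integral lborel I (\<lambda>x. \<phi> x *\<^sub>R g x))"

definition H1_on :: "real set \<Rightarrow> (real \<Rightarrow> complex) \<Rightarrow> bool" where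
  "H1_on I u \<longleftrightarrow> L2_on I u \<and> (\<exists>g. L2_on I g \<and> is_weak_deriv I u g)"

(* Determined only almost everywhere; it is used only through its L2 norm below. *)
definition weak_deriv :: "real set \<Rightarrow> (real \<Rightarrow> complex) \<Rightarrow> real \<Rightarrow> complex" where
  "weak_deriv I u = (SOME g. L2_on I g \<and> is_weak_deriv I u g)"

definition L2_normsq_on :: "real set \<Rightarrow> (real \<Rightarrow> complex) \<Rightarrow> real" where
  "L2_normsq_on I u = set_lebesgue_integral lborel I (\<lambda>x. (norm (u x))\<^sup>2)"

(* An element of H1(R-) + H1(R+) is an almost-everywhere class of functions on R - {0}.  It is
   encoded by its unique representative that is continuous on R - {0}, extended by the dummy
   value 0 at the origin.  Hence equality of elements is equality of HOL functions.  The value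
   at 0 carries no information: u(0-) and u(0+) are one-sided limits. *)
definition H1_split :: "(real \<Rightarrow> complex) set" where
  "H1_split = {u. continuous_on (- {0}) u \<and> u 0 = 0 \<and> H1_on {..<0} u \<and> H1_on {0<..} u}"

definition trace_left :: "(real \<Rightarrow> complex) \<Rightarrow> complex" where
  "trace_left u = Lim (at_left 0) u"

definition D_space :: "real \<Rightarrow> (real \<Rightarrow> complex) set" where
  "D_space \<tau> = {u \<in> H1_split. \<exists>c. (u \<longlongrightarrow> c) (at_left 0) \<and>
                                  (u \<longlongrightarrow> of_real \<tau> * c) (at_right 0)}"

definition mass :: "(real \<Rightarrow> complex) \<Rightarrow> real" where
  "mass u = L2_normsq_on UNIV u"

definition D_mass :: "real \<Rightarrow> real \<Rightarrow> (real \<Rightarrow> complex) set" where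
  "D_mass \<tau> \<mu> = {u \<in> D_space \<tau>. mass u = \<mu>}"

definition kinetic :: "(real \<Rightarrow> complex) \<Rightarrow> real" where
  "kinetic u = L2_normsq_on {..<0} (weak_deriv {..<0} u) + L2_normsq_on {0<..} (weak_deriv {0<..} u)"

definition energy :: "real \<Rightarrow> real \<Rightarrow> (real \<Rightarrow> complex) \<Rightarrow> real" where
  "energy \<sigma> \<alpha> u =
     1 / 2 * kinetic u
     - 1 / (2 * \<sigma> + 2) * (\<integral>x. norm (u x) powr (2 * \<sigma> + 2) \<partial>lborel)
     - \<alpha> / 2 * (norm (trace_left u))\<^sup>2"

definition H1_norm :: "(real \<Rightarrow> complex) \<Rightarrow> real" where
  "H1_norm u = sqrt (mass u + kinetic u)"

definition nonneg_fun :: "(real \<Rightarrow> complex) \<Rightarrow> bool" where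
  "nonneg_fun u \<longleftrightarrow> (\<forall>x. x \<noteq> 0 \<longrightarrow> u x \<in> \<real> \<and> 0 \<le> Re (u x))"

definition pos_fun :: "(real \<Rightarrow> complex) \<Rightarrow> bool" where
  "pos_fun u \<longleftrightarrow> (\<forall>x. x \<noteq> 0 \<longrightarrow> u x \<in> \<real> \<and> 0 < Re (u x))"

definition ground_state ::
    "real \<Rightarrow> real \<Rightarrow> real \<Rightarrow> real \<Rightarrow> (real \<Rightarrow> complex) \<Rightarrow> bool" where
  "ground_state \<sigma> \<alpha> \<tau> \<mu> u \<longleftrightarrow>
     u \<in> D_mass \<tau> \<mu> \<and> nonneg_fun u \<and> (\<forall>v \<in> D_mass \<tau> \<mu>. energy \<sigma> \<alpha> u \<le> energy \<sigma> \<alpha> v)"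

(* L is the Frechet differential at u of F : D -> R, where D is a real normed space under the
   H1 norm: L is real-linear, bounded, and F (u + h) = F u + L h + o(norm h).  Spelled out because
   D depends on the parameter tau and is not a type, so has_derivative does not apply. *)
definition is_differential ::
    "real \<Rightarrow> ((real \<Rightarrow> complex) \<Rightarrow> real) \<Rightarrow> (real \<Rightarrow> complex) \<Rightarrow> ((real \<Rightarrow> complex) \<Rightarrow> real) \<Rightarrow> bool"
  where
  "is_differential \<tau> F u L \<longleftrightarrow>
     (\<forall>\<eta> \<in> D_space \<tau>. \<forall>\<xi> \<in> D_space \<tau>. \<forall>a b :: real.
        L (\<lambda>x. a *\<^sub>R \<eta> x + b *\<^sub>R \<xi> x) = a * L \<eta> + b * L \<xi>) \<and>
     (\<exists>C. \<forall>\<eta> \<in> D_space \<tau>. \<bar>L \<eta>\<bar> \<le> C * H1_norm \<eta>) \<and>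
     (\<forall>\<epsilon>>0. \<exists>\<delta>>0. \<forall>\<eta> \<in> D_space \<tau>. H1_norm \<eta> < \<delta> \<longrightarrow>
        \<bar>F (\<lambda>x. u x + \<eta> x) - F u - L \<eta>\<bar> \<le> \<epsilon> * H1_norm \<eta>)"

definition stationary_state ::
    "real \<Rightarrow> real \<Rightarrow> real \<Rightarrow> real \<Rightarrow> (real \<Rightarrow> complex) \<Rightarrow> bool" where
  "stationary_state \<sigma> \<alpha> \<tau> \<mu> u \<longleftrightarrow>
     u \<in> D_mass \<tau> \<mu> \<and>
     (\<exists>L. is_differential \<tau> (energy \<sigma> \<alpha>) u L \<and>
          (\<forall>\<eta> \<in> D_space \<tau>. Re (\<integral>x. u x * cnj (\<eta> x) \<partial>lborel) = 0 \<longrightarrow> L \<eta> = 0))"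

definition mu_crit :: "real \<Rightarrow> real \<Rightarrow> real \<Rightarrow> real" where
  "mu_crit \<sigma> \<alpha> \<tau> =
     (\<sigma> + 1) powr (1 / \<sigma>) / \<sigma> * (\<alpha> / (\<tau>\<^sup>2 - 1)) powr ((2 - \<sigma>) / \<sigma>) *
     set_lebesgue_integral lborel {-1..1} (\<lambda>t. (1 - t\<^sup>2) powr (1 / \<sigma> - 1))"

end

theory Submission
  imports Defs
begin

text \<open>On a half-line, use the mass \<open>s\<close> lying beyond a point as coordinate and the squared modulus \<open>r\<close> as unknown. The least half-line
  energy \<open>W s r\<close> is then explicit (it is attained by pieces of solitons), solves a Hamilton-Jacobi equation and
  so calibrates the energy. Hence \<open>E(u) \<ge> \<Phi>(m, r) = W m r + W (\<mu> - m) (\<tau>\<^sup>2 r) - \<alpha> r / 2\<close>, where \<open>m\<close> is the mass of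
  \<open>u\<close> on the left and \<open>r = |u(0-)|\<^sup>2\<close>, with equality for two glued soliton pieces of these masses.
  Positive stationary states are glued soliton pieces of a common frequency that satisfy two matching conditions at the origin, and their
  mass is strictly monotone along each of the two solution branches. On the branch that decreases away from the origin on the left
  every mass occurs exactly once, and these states minimize \<open>\<Phi>\<close>. The branch with its peak on the left exists exactly for masses above \<open>\<mu>\<^sub>\<alpha>\<close>; moving
  the part of the left half above the jump to the right lowers the energy, so these states are not minimizers.\<close>

section \<open>Smooth test functions\<close>

text \<open>Direct minimization over functions lacks compactness: mass may escape to infinity. In
  the reduced problem this loss is visible only at the edges \<open>m = 0\<close> and
  \<open>m = \<mu>\<close>, where the limiting level is \<open>W \<mu> 0\<close>, the energy of a
  whole soliton far away; one test pair below that level settles existence. The form of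
  \<open>W\<close> is dictated by scaling. The mass of a soliton piece is proportional to
  \<open>k powr ((2 - \<sigma>) / \<sigma>)\<close>, an increasing function of \<open>k\<close> for
  \<open>\<sigma> < 2\<close>, so mass determines frequency and \<open>W\<close> comes down to one
  profile \<open>w\<close> of one variable. The constant \<open>\<mu>_\<alpha>\<close> is a limit:
  at the end of the branch with its peak on the left, the right half disappears and the left half
  becomes a whole soliton with \<open>k = \<alpha> / (\<tau>\<^sup>2 - 1)\<close>. Its mass is
  \<open>\<mu>_\<alpha>\<close>, whence the integral over all of (-1, 1). The calibration needs a
  chain rule along a curve, while the energy is written with weak derivatives that are merely
  selected. Test functions close to indicators of intervals translate membership in the space into
  absolute continuity.\<close>

lemma iterated_deriv_differentiable:
  fixes f :: "real \<Rightarrow> real"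
  assumes "f \<in> A" and "\<And>f x. f \<in> A \<Longrightarrow> f differentiable (at x)" and "\<And>f. f \<in> A \<Longrightarrow> deriv f \<in> A"
  shows "((deriv ^^ n) f) differentiable (at x)"
proof -
  have "(deriv ^^ n) f \<in> A"
    by (induction n) (use assms in auto)
  then show ?thesis using assms by auto
qed

lemma DERIV_zero_of_quadratic_bound:
  fixes f :: "real \<Rightarrow> real"
  assumes "f a = 0" and "\<And>x. \<bar>f x\<bar> \<le> M * (x - a)\<^sup>2"
  shows "(f has_real_derivative 0) (at a)"
  unfolding DERIV_def
proof (rule Lim_null_comparison)
  show "\<forall>\<^sub>F h in at 0. norm ((f (a + h) - f a) / h) \<le> M * \<bar>h\<bar>"
    unfolding eventually_at_topological
  proof (rule exI[of _ UNIV], intro conjI ballI impI)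
    fix h :: real assume "h \<noteq> 0"
    have "\<bar>f (a + h)\<bar> \<le> M * h\<^sup>2" using assms(2)[of "a + h"] by simp
    then show "norm ((f (a + h) - f a) / h) \<le> M * \<bar>h\<bar>"
      using \<open>h \<noteq> 0\<close> assms(1) by (simp add: field_simps power2_eq_square abs_if split: if_splits)
  qed auto
  show "((\<lambda>h. M * \<bar>h\<bar>) \<longlongrightarrow> 0) (at 0)"
    by (auto intro!: tendsto_eq_intros)
qed

lemma power_exp_minus_le:
  fixes x :: real
  assumes "x \<ge> 0"
  shows "x ^ n * exp (- x) \<le> fact n"
proof -
  have "x ^ n / fact n \<le> exp x"
    unfolding exp_def using sum_le_suminf[OF summable_exp_generic[of x], of "{n}"] assms
    by (auto simp: scaleR_conv_of_real field_simps)
  then show ?thesis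
    by (simp add: exp_minus field_simps)
qed

text \<open>With polynomial \<open>p\<close> this family is closed under differentiation: a
  derivative only changes the polynomial and raises \<open>k\<close> by 2.\<close>

definition bump :: "nat \<Rightarrow> (real \<Rightarrow> real) \<Rightarrow> real \<Rightarrow> real" where
  "bump k p t = (if 0 < t \<and> t < 1 then p t / (t * (1 - t)) ^ k * exp (- 1 / (t * (1 - t))) else 0)"

text \<open>Of the \<open>k + 2\<close> powers that the exponential can absorb, \<open>k\<close>
  cancel the denominator and two remain. Vanishing to second order is what makes the extension by 0
  differentiable at the endpoints.\<close>

lemma bump_quadratic_bound:
  assumes "real_polynomial_function p"
  obtains M where "\<And>t. \<bar>bump k p t\<bar> \<le> M * (t * (1 - t))\<^sup>2"
proof -
  have "compact (p ` {0..1})"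
    by (intro compact_continuous_image continuous_on_polymonial_function) (use assms in \<open>auto simp: real_polynomial_function_eq\<close>)
  then obtain B where B: "\<And>t. t \<in> {0..1} \<Longrightarrow> \<bar>p t\<bar> \<le> B"
    by (metis bounded_iff compact_imp_bounded image_eqI real_norm_def)
  then have "0 \<le> B" by (metis abs_ge_zero atLeastAtMost_iff order.trans zero_le_one order_refl)
  have "\<bar>bump k p t\<bar> \<le> (B * fact (k + 2)) * (t * (1 - t))\<^sup>2" for t
  proof (cases "0 < t \<and> t < 1")
    case True
    define D where "D = t * (1 - t)"
    have D: "D > 0" using True by (simp add: D_def)
    have "exp (- (1 / D)) \<le> fact (k + 2) * D ^ (k + 2)"
      using power_exp_minus_le[of "1 / D" "k + 2"] D by (simp add: field_simps)
    then have "exp (- (1 / D)) / D ^ k \<le> fact (k + 2) * D\<^sup>2"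
      using D by (simp add: field_simps power_add power2_eq_square)
    then have "\<bar>p t\<bar> * (exp (- (1 / D)) / D ^ k) \<le> B * (fact (k + 2) * D\<^sup>2)"
      using D True B[of t] \<open>0 \<le> B\<close> by (intro mult_mono) auto
    then show ?thesis
      using True D by (simp add: bump_def D_def[symmetric] abs_mult mult.assoc)
  next
    case False
    then show ?thesis using \<open>0 \<le> B\<close> by (auto simp: bump_def)
  qed
  then show ?thesis using that by blast
qed

lemma bump_deriv:
  assumes p: "real_polynomial_function p"
  obtains p' where "real_polynomial_function p'" "\<And>t. (bump k p has_real_derivative bump (k + 2) p' t) (at t)"
proof -
  obtain dp where dp: "real_polynomial_function dp" "\<And>t. (p has_real_derivative dp t) (at t)"
    using has_real_derivative_polynomial_function[OF p] by blast
  \<comment> \<open>The numerator that the quotient and chain rules give over the common denominator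
    \<open>(t * (1 - t)) ^ (k + 2)\<close>.\<close>
  define p' where "p' = (\<lambda>t. dp t * (t * (1 - t))\<^sup>2 - real k * p t * (1 - 2 * t) * (t * (1 - t)) + p t * (1 - 2 * t))"
  have lin: "real_polynomial_function (\<lambda>t. t :: real)"
    by (intro real_polynomial_function.intros(1) bounded_linear_ident)
  have "real_polynomial_function p'"
    unfolding p'_def power2_eq_square
    by (intro real_polynomial_function_diff real_polynomial_function.intros(2-) dp p lin)
  moreover have "(bump k p has_real_derivative bump (k + 2) p' t) (at t)" for t
  proof -
    consider "0 < t \<and> t < 1" | "t < 0 \<or> t > 1" | "t = 0 \<or> t = 1" by linarith
    then show ?thesis
    proof cases
      case 1
      have nz: "t * (1 - t) \<noteq> 0" using 1 by simp
      have "((\<lambda>t. p t / (t * (1 - t)) ^ k * exp (- 1 / (t * (1 - t)))) has_real_derivative bump (k + 2) p' t) (at t)"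
      proof -
        define D where "D = t * (1 - t)"
        have D: "D > 0" using 1 by (simp add: D_def)
        have 2: "((\<lambda>t. t * (1 - t)) has_real_derivative (1 - 2 * t)) (at t)"
          by (auto intro!: derivative_eq_intros)
        define P E where "P = D ^ k" and "E = exp (- 1 / D)"
        have P: "P > 0" using D by (simp add: P_def)
        have pw: "((\<lambda>t. (t * (1 - t)) ^ k) has_real_derivative (real k * P / D * (1 - 2 * t))) (at t)"
          by (rule DERIV_cong[OF DERIV_power[OF 2, of k]]) (use D 1 in \<open>cases k; simp add: P_def D_def\<close>)
        have ex: "((\<lambda>t. exp (- 1 / (t * (1 - t)))) has_real_derivative (E * ((1 - 2 * t) / (D * D)))) (at t)"
          by (rule DERIV_cong[OF DERIV_chain2[OF DERIV_exp DERIV_divide[OF DERIV_const 2]]])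
             (use D 1 in \<open>simp_all add: E_def D_def\<close>)
        have "((\<lambda>t. p t / (t * (1 - t)) ^ k * exp (- 1 / (t * (1 - t)))) has_real_derivative
           (dp t * P - p t * (real k * P / D * (1 - 2 * t))) / (P * P) * E + E * ((1 - 2 * t) / (D * D)) * (p t / P)) (at t)"
          by (rule DERIV_cong[OF DERIV_mult[OF DERIV_divide[OF dp(2) pw] ex]])
             (use P D 1 in \<open>simp_all add: P_def E_def D_def\<close>)
        moreover have "(dp t * P - p t * (real k * P / D * (1 - 2 * t))) / (P * P) * E + E * ((1 - 2 * t) / (D * D)) * (p t / P)
            = (dp t * D\<^sup>2 - real k * p t * (1 - 2 * t) * D + p t * (1 - 2 * t)) / (P * D\<^sup>2) * E"
          using P D by (simp add: divide_simps power2_eq_square) algebra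
        moreover have "\<dots> = bump (k + 2) p' t"
          using 1 unfolding bump_def p'_def D_def[symmetric] P_def E_def by (simp add: power_add power2_eq_square)
        ultimately show ?thesis by simp
      qed
      then show ?thesis
        by (rule has_field_derivative_transform_within_open[where S = "{0<..<1}"]) (use 1 in \<open>auto simp: bump_def\<close>)
    next
      case 2
      have "((\<lambda>t. 0) has_real_derivative bump (k + 2) p' t) (at t)"
        using 2 by (auto simp: bump_def)
      then show ?thesis
        by (rule has_field_derivative_transform_within_open[where S = "- {0..1}"]) (use 2 in \<open>auto simp: bump_def\<close>)
    next
      case 3
      obtain M where M: "\<And>t. \<bar>bump k p t\<bar> \<le> M * (t * (1 - t))\<^sup>2"
        using bump_quadratic_bound[OF p, of k] by blast
      have M0: "0 \<le> M" using M[of 2] by (auto simp: zero_le_mult_iff)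
      have "\<bar>bump k p x\<bar> \<le> M * (x - t)\<^sup>2" for x
      proof (cases "0 < x \<and> x < 1")
        case True
        then have "\<bar>x * (1 - x)\<bar> \<le> \<bar>x - t\<bar>" using 3 by (elim disjE) (simp_all add: abs_mult mult_left_le mult_left_le_one_le)
        then have "(x * (1 - x))\<^sup>2 \<le> (x - t)\<^sup>2" using abs_le_square_iff by blast
        then show ?thesis using M[of x] M0 by (meson mult_left_mono order.trans)
      qed (use M0 in \<open>auto simp: bump_def\<close>)
      then have "(bump k p has_real_derivative 0) (at t)"
        using 3 by (intro DERIV_zero_of_quadratic_bound[of _ _ M]) (auto simp: bump_def)
      then show ?thesis using 3 by (auto simp: bump_def)
    qed
  qed
  ultimately show ?thesis using that by blast
qed

section \<open>A normalized bump, its primitive, and test functions close to indicators of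
  intervals\<close>

definition bump0 :: "real \<Rightarrow> real" where
  "bump0 t = bump 0 (\<lambda>_. 1) t / integral {0..1} (bump 0 (\<lambda>_. 1))"

text \<open>The lower limit is -1 instead of 0 so that 0 is interior to the range of integration and
  the fundamental theorem gives a two-sided derivative there.\<close>

definition smooth_step :: "real \<Rightarrow> real" where
  "smooth_step t = integral {-1..t} bump0"

lemma bump_isCont: "real_polynomial_function p \<Longrightarrow> isCont (bump k p) t"
  by (metis bump_deriv DERIV_isCont)

lemma bump_integral_pos: "integral {0..1} (bump 0 (\<lambda>_. 1)) > 0"
proof -
  have c: "continuous_on {0..1} (bump 0 (\<lambda>_. 1))"
    by (intro continuous_at_imp_continuous_on ballI bump_isCont real_polynomial_function.intros(2))
  have "bump 0 (\<lambda>_. 1) t \<ge> 0" for t by (auto simp: bump_def)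
  moreover have "integral {0..1} (bump 0 (\<lambda>_. 1)) \<noteq> 0"
  proof
    assume "integral {0..1} (bump 0 (\<lambda>_. 1)) = 0"
    then have "\<forall>x\<in>{0..1}. bump 0 (\<lambda>_. 1) x = 0"
      using integral_eq_0_iff[OF c] \<open>\<And>t. bump 0 (\<lambda>_. 1) t \<ge> 0\<close> by auto
    then have "bump 0 (\<lambda>_. 1) (1/2) = 0" by auto
    then show False by (simp add: bump_def)
  qed
  ultimately show ?thesis
    by (metis integral_nonneg c integrable_continuous_real less_eq_real_def)
qed

lemma bump0_eq: "bump0 = bump 0 (\<lambda>_. 1 / integral {0..1} (bump 0 (\<lambda>_. 1)))"
  by (auto simp: bump0_def bump_def fun_eq_iff)

lemma bump0_isCont: "isCont bump0 t"
  unfolding bump0_eq by (intro bump_isCont real_polynomial_function.intros(2))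

lemma bump0_continuous_on: "continuous_on A bump0"
  by (intro continuous_at_imp_continuous_on ballI bump0_isCont)

lemma bump0_nonneg: "bump0 t \<ge> 0"
  using bump_integral_pos by (auto simp: bump0_def bump_def)

lemma bump0_eq_0: "t \<le> 0 \<or> t \<ge> 1 \<Longrightarrow> bump0 t = 0"
  by (auto simp: bump0_def bump_def)

lemma bump0_has_integral: "(bump0 has_integral 1) {0..1}"
proof -
  have "(bump 0 (\<lambda>_. 1) has_integral integral {0..1} (bump 0 (\<lambda>_. 1))) {0..1}"
    by (intro integrable_integral integrable_continuous_real continuous_at_imp_continuous_on ballI bump_isCont real_polynomial_function.intros(2))
  from has_integral_divide[OF this, of "integral {0..1} (bump 0 (\<lambda>_. 1))"] show ?thesis
    using bump_integral_pos unfolding bump0_def by auto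
qed

lemma smooth_step_eq_0: "t \<le> 0 \<Longrightarrow> smooth_step t = 0"
  unfolding smooth_step_def by (rule integral_unique, rule has_integral_is_0) (auto simp: bump0_eq_0)

lemma smooth_step_eq_1: 
  assumes "t \<ge> 1" 
  shows "smooth_step t = 1"
proof -
  have "(bump0 has_integral 1) {-1..t}"
    by (rule has_integral_on_superset[OF bump0_has_integral]) (use assms in \<open>auto simp: bump0_eq_0\<close>)
  then show ?thesis unfolding smooth_step_def by (rule integral_unique)
qed

lemma smooth_step_deriv: "(smooth_step has_real_derivative bump0 t) (at t)"
proof (cases "t < 0")
  case True
  have "((\<lambda>t. 0) has_real_derivative bump0 t) (at t)"
    using True by (auto simp: bump0_eq_0)
  then show ?thesis
    by (rule has_field_derivative_transform_within_open[where S = "{..<0}"]) (use True in \<open>auto simp: smooth_step_eq_0\<close>)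
next
  case False
  have "((\<lambda>u. integral {-1..u} bump0) has_real_derivative bump0 t) (at t within {-1..t+1})"
    by (rule integral_has_real_derivative[OF bump0_continuous_on]) (use False in auto)
  moreover have "at t within {-1..t+1} = at t"
    by (rule at_within_interior) (use False in auto)
  ultimately show ?thesis
    by (simp add: smooth_step_def[abs_def])
qed

lemma smooth_step_bounds: "0 \<le> smooth_step t" "smooth_step t \<le> 1"
proof -
  have m: "x \<le> y \<Longrightarrow> smooth_step x \<le> smooth_step y" for x y
    using DERIV_nonneg_imp_nondecreasing[of x y smooth_step] smooth_step_deriv bump0_nonneg by metis
  show "0 \<le> smooth_step t" using m[of "min t 0" t] smooth_step_eq_0[of "min t 0"] by auto
  show "smooth_step t \<le> 1" using m[of t "max t 1"] smooth_step_eq_1[of "max t 1"] by auto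
qed

text \<open>The derivative of this function is a difference of approximate point masses at x and y.\<close>
definition plateau :: "real \<Rightarrow> real \<Rightarrow> nat \<Rightarrow> real \<Rightarrow> real" where
  "plateau x y n t = smooth_step (real n * (t - x)) - smooth_step (real n * (t - y))"

lemma DERIV_scaled_shift: "((\<lambda>t. c * (t - a)) has_real_derivative c) (at (x :: real))"
  by (auto intro!: derivative_eq_intros)

lemma smooth_step_scaled_deriv:
  "((\<lambda>t. smooth_step (c * (t - a))) has_real_derivative (bump0 (c * (x - a)) * c)) (at x)"
  by (rule DERIV_chain2[OF smooth_step_deriv DERIV_scaled_shift])

lemma plateau_deriv:
  "(plateau x y n has_real_derivative (bump0 (real n * (t - x)) * real n - bump0 (real n * (t - y)) * real n)) (at t)"
proof -
  have "plateau x y n = (\<lambda>t. smooth_step (real n * (t - x)) - smooth_step (real n * (t - y)))"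
    by (rule ext) (rule plateau_def)
  then show ?thesis
    by (simp only:) (rule DERIV_diff[OF smooth_step_scaled_deriv smooth_step_scaled_deriv])
qed

text \<open>\<open>smooth_step\<close> is not a bump, but its derivative is one. Bumps and multiples
  of \<open>smooth_step\<close> together form a class closed under \<open>deriv\<close>; closure
  under multiples absorbs the factors from the chain rule.\<close>

definition bump_class :: "(real \<Rightarrow> real) set" where
  "bump_class = {f. (\<exists>k p. real_polynomial_function p \<and> f = bump k p) \<or> (\<exists>c. f = (\<lambda>t. c * smooth_step t))}"

lemma bump_class_deriv:
  assumes "f \<in> bump_class"
  obtains f' where "f' \<in> bump_class" "\<And>t. (f has_real_derivative f' t) (at t)"
proof -
  consider k p where "real_polynomial_function p" "f = bump k p" | c where "f = (\<lambda>t. c * smooth_step t)"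
    using assms unfolding bump_class_def by blast
  then show ?thesis
  proof cases
    case 1
    then obtain p' where "real_polynomial_function p'" "\<And>t. (f has_real_derivative bump (k + 2) p' t) (at t)"
      using bump_deriv by metis
    then show ?thesis by (intro that[of "bump (k + 2) p'"]) (auto simp: bump_class_def)
  next
    case 2
    have "(f has_real_derivative bump 0 (\<lambda>_. c / integral {0..1} (bump 0 (\<lambda>_. 1))) t) (at t)" for t
      unfolding 2 by (rule DERIV_cong[OF DERIV_cmult[OF smooth_step_deriv]]) (simp add: bump0_def bump_def)
    moreover have "real_polynomial_function (\<lambda>_::real. c / integral {0..1} (bump 0 (\<lambda>_. 1)))"
      by (rule real_polynomial_function.intros(2))
    ultimately show ?thesis by (intro that) (auto simp: bump_class_def)
  qed
qed

lemma bump_class_scale: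
  assumes "f \<in> bump_class"
  shows "(\<lambda>t. c * f t) \<in> bump_class"
proof -
  consider k p where "real_polynomial_function p" "f = bump k p" | d where "f = (\<lambda>t. d * smooth_step t)"
    using assms unfolding bump_class_def by blast
  then show ?thesis
  proof cases
    case 1
    have "(\<lambda>t. c * f t) = bump k (\<lambda>t. c * p t)" by (auto simp: 1 bump_def fun_eq_iff)
    moreover have "real_polynomial_function (\<lambda>t. c * p t)"
      by (intro real_polynomial_function.intros(2-) 1)
    ultimately show ?thesis unfolding bump_class_def by blast
  next
    case 2
    have "(\<lambda>t. c * f t) = (\<lambda>t. (c * d) * smooth_step t)" by (auto simp: 2)
    then show ?thesis unfolding bump_class_def by blast
  qed
qed

definition plateau_class :: "real \<Rightarrow> real \<Rightarrow> real \<Rightarrow> (real \<Rightarrow> real) set" where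
  "plateau_class c x y = {F. \<exists>f\<in>bump_class. \<exists>g\<in>bump_class. F = (\<lambda>t. f (c * (t - x)) + g (c * (t - y)))}"

lemma plateau_class_deriv:
  assumes "F \<in> plateau_class c x y"
  obtains F' where "F' \<in> plateau_class c x y" "\<And>t. (F has_real_derivative F' t) (at t)"
proof -
  obtain f g where fg: "F = (\<lambda>t. f (c * (t - x)) + g (c * (t - y)))" "f \<in> bump_class" "g \<in> bump_class"
    using assms unfolding plateau_class_def by blast
  obtain f' where f': "f' \<in> bump_class" "\<And>t. (f has_real_derivative f' t) (at t)"
    using bump_class_deriv[OF fg(2)] by blast
  obtain g' where g': "g' \<in> bump_class" "\<And>t. (g has_real_derivative g' t) (at t)"
    using bump_class_deriv[OF fg(3)] by blast
  have "(F has_real_derivative (f' (c * (t - x)) * c + g' (c * (t - y)) * c)) (at t)" for t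
    unfolding fg(1)
    by (intro DERIV_add DERIV_chain2[OF f'(2) DERIV_scaled_shift] DERIV_chain2[OF g'(2) DERIV_scaled_shift])
  moreover have "(\<lambda>t. f' (c * (t - x)) * c + g' (c * (t - y)) * c) \<in> plateau_class c x y"
    unfolding plateau_class_def
    by (rule CollectI, rule bexI[OF _ bump_class_scale[OF f'(1), of c]], rule bexI[OF _ bump_class_scale[OF g'(1), of c]])
       (simp add: mult.commute)
  ultimately show ?thesis by (intro that)
qed

lemma plateau_in_class: "plateau x y n \<in> plateau_class (real n) x y"
proof -
  have c: "(\<lambda>t. 1 * smooth_step t) \<in> bump_class" "(\<lambda>t. (-1) * smooth_step t) \<in> bump_class"
    unfolding bump_class_def by blast+
  show ?thesis
    unfolding plateau_class_def plateau_def[abs_def]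
    by (rule CollectI, rule bexI[OF _ c(1)], rule bexI[OF _ c(2)]) simp
qed

lemma plateau_test_fun:
  assumes "n > 0" "x \<le> y" "{x..y + 1 / real n} \<subseteq> I"
  shows "test_fun I (plateau x y n)"
  unfolding test_fun_def
proof (rule conjI; (intro allI)?)
  show "((deriv ^^ m) (plateau x y n)) differentiable (at t)" for m t
  proof (rule iterated_deriv_differentiable[OF plateau_in_class])
    show "F differentiable (at s)" if F: "F \<in> plateau_class (real n) x y" for F s
      by (rule plateau_class_deriv[OF F]) (auto simp: real_differentiable_def)
    show "deriv F \<in> plateau_class (real n) x y" if F: "F \<in> plateau_class (real n) x y" for F
    proof -
      obtain F' where F': "F' \<in> plateau_class (real n) x y" "\<And>t. (F has_real_derivative F' t) (at t)"
        using plateau_class_deriv[OF F] by blast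
      have "deriv F = F'" by (rule ext) (rule DERIV_imp_deriv[OF F'(2)])
      with F'(1) show ?thesis by simp
    qed
  qed
  show "\<exists>K. compact K \<and> K \<subseteq> I \<and> (\<forall>t. t \<notin> K \<longrightarrow> plateau x y n t = 0)"
  proof (intro exI[of _ "{x..y + 1 / real n}"] conjI allI impI assms)
    fix t assume "t \<notin> {x..y + 1 / real n}"
    then consider "t < x" | "t > y + 1 / real n" by fastforce
    then show "plateau x y n t = 0"
    proof cases
      case 1
      then show ?thesis using assms by (simp add: plateau_def smooth_step_eq_0 mult_nonneg_nonpos)
    next
      case 2
      then have "real n * (t - y) \<ge> 1" using assms by (simp add: field_simps)
      moreover have "real n * (t - x) \<ge> real n * (t - y)" using assms by (simp add: mult_left_mono)
      ultimately show ?thesis by (simp add: plateau_def smooth_step_eq_1)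
    qed
  qed auto
qed

lemma plateau_abs_le: "\<bar>plateau x y n t\<bar> \<le> 1"
  using smooth_step_bounds[of "real n * (t - x)"] smooth_step_bounds[of "real n * (t - y)"]
  unfolding plateau_def by linarith

lemma smooth_step_scaled_tendsto:
  "(\<lambda>n. smooth_step (real n * (t - x))) \<longlonglongrightarrow> (if x < t then 1 else 0)"
proof (cases "x < t")
  case True
  have "filterlim (\<lambda>n. real n * (t - x)) at_top sequentially"
    using True by (intro filterlim_at_top_mult_tendsto_pos[OF tendsto_const] filterlim_real_sequentially) auto
  then have "\<forall>\<^sub>F n in sequentially. real n * (t - x) \<ge> 1"
    by (simp add: filterlim_at_top)
  then have "\<forall>\<^sub>F n in sequentially. smooth_step (real n * (t - x)) = 1"
    by eventually_elim (rule smooth_step_eq_1)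
  then show ?thesis using True by (simp add: tendsto_eventually)
next
  case False
  then show ?thesis by (simp add: smooth_step_eq_0 mult_nonneg_nonpos)
qed

lemma plateau_tendsto:
  assumes "x \<le> y"
  shows "(\<lambda>n. plateau x y n t) \<longlonglongrightarrow> indicator {x<..y} t"
  using tendsto_diff[OF smooth_step_scaled_tendsto[of t x] smooth_step_scaled_tendsto[of t y]] assms
  unfolding plateau_def indicator_def by (auto split: if_splits)

section \<open>Functions with an integrable derivative\<close>

text \<open>\<open>h\<close> is an integrable derivative of \<open>z\<close> on \<open>{a..b}\<close>, i.e. \<open>z\<close> is absolutely continuous.\<close>
definition AC_on :: "real \<Rightarrow> real \<Rightarrow> (real \<Rightarrow> 'e::euclidean_space) \<Rightarrow> (real \<Rightarrow> 'e) \<Rightarrow> bool" where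
  "AC_on a b z h \<longleftrightarrow> set_integrable lborel {a..b} h \<and> (\<forall>t\<in>{a..b}. z t = z a + integral {a..t} h)"

lemma set_integrable_sub:
  fixes h :: "real \<Rightarrow> 'e::euclidean_space"
  assumes "set_integrable lborel {a..b} h" "a \<le> c" "d \<le> b"
  shows "set_integrable lborel {c..d} h"
  by (rule set_integrable_subset[OF assms(1)]) (use assms in auto)

lemma set_integrable_HK:
  fixes h :: "real \<Rightarrow> 'e::euclidean_space"
  assumes "set_integrable lborel {a..b} h"
  shows "h integrable_on {a..b}" "(\<lambda>t. norm (h t)) integrable_on {a..b}" "set_lebesgue_integral lborel {a..b} h = integral {a..b} h"
  using set_borel_integral_eq_integral[OF assms] set_borel_integral_eq_integral[OF set_integrable_norm[OF assms]] by auto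

lemma AC_on_integrable: "AC_on a b z h \<Longrightarrow> set_integrable lborel {a..b} h"
  unfolding AC_on_def by blast

lemma AC_onD: "AC_on a b z h \<Longrightarrow> t \<in> {a..b} \<Longrightarrow> z t = z a + integral {a..t} h"
  unfolding AC_on_def by blast

lemma AC_onI:
  "set_integrable lborel {a..b} h \<Longrightarrow> (\<And>t. t \<in> {a..b} \<Longrightarrow> z t = z a + integral {a..t} h) \<Longrightarrow> AC_on a b z h"
  unfolding AC_on_def by blast

lemma AC_on_diff:
  assumes "AC_on a b z h" "a \<le> s" "s \<le> t" "t \<le> b"
  shows "z t - z s = integral {s..t} h"
proof -
  have "set_integrable lborel {a..t} h"
    using assms set_integrable_sub[OF AC_on_integrable[OF assms(1)]] by blast
  then have "integral {a..s} h + integral {s..t} h = integral {a..t} h"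
    using assms by (intro Henstock_Kurzweil_Integration.integral_combine set_integrable_HK) auto
  moreover have "z t = z a + integral {a..t} h" "z s = z a + integral {a..s} h"
    using assms by (auto intro: AC_onD[OF assms(1)])
  ultimately show ?thesis by (simp add: algebra_simps)
qed

lemma AC_on_continuous:
  assumes "AC_on a b z h"
  shows "continuous_on {a..b} z"
proof -
  have "continuous_on {a..b} (\<lambda>t. z a + integral {a..t} h)"
    by (intro continuous_intros indefinite_integral_continuous_1 set_integrable_HK AC_on_integrable[OF assms])
  then show ?thesis
    by (rule continuous_on_eq) (rule AC_onD[OF assms, symmetric])
qed

lemma set_integrable_mult_bounded:
  fixes c :: "real \<Rightarrow> 'e::euclidean_space" and h :: "real \<Rightarrow> real"
  assumes "set_integrable lborel A h" "set_borel_measurable lborel A c" "\<And>t. t \<in> A \<Longrightarrow> norm (c t) \<le> M" "A \<in> sets lborel"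
  shows "set_integrable lborel A (\<lambda>t. h t *\<^sub>R c t)"
proof -
  have "integrable lborel (\<lambda>t. M * norm (indicator A t *\<^sub>R h t))"
    using assms(1) unfolding set_integrable_def by simp
  note i = this
  have "(\<lambda>t. (indicator A t *\<^sub>R h t) *\<^sub>R (indicator A t *\<^sub>R c t)) \<in> borel_measurable lborel"
    using assms unfolding set_integrable_def set_borel_measurable_def by measurable
  moreover have "(\<lambda>t. (indicator A t *\<^sub>R h t) *\<^sub>R (indicator A t *\<^sub>R c t)) = (\<lambda>t. indicator A t *\<^sub>R (h t *\<^sub>R c t))"
    by (auto simp: indicator_def)
  ultimately have m: "(\<lambda>t. indicator A t *\<^sub>R (h t *\<^sub>R c t)) \<in> borel_measurable lborel" by simp
  have b: "norm (indicator A t *\<^sub>R (h t *\<^sub>R c t)) \<le> norm (M * norm (indicator A t *\<^sub>R h t))" for t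
  proof (cases "t \<in> A")
    case True
    have "\<bar>h t\<bar> * norm (c t) \<le> \<bar>h t\<bar> * \<bar>M\<bar>"
      using assms(3)[OF True] by (intro mult_left_mono) linarith+
    then show ?thesis using True by (simp add: abs_mult mult.commute)
  qed simp
  show ?thesis
    unfolding set_integrable_def by (rule Bochner_Integration.integrable_bound[OF i m AE_I2]) (rule b)
qed

lemma set_integrable_mult_continuous:
  fixes c :: "real \<Rightarrow> 'e::euclidean_space" and h :: "real \<Rightarrow> real"
  assumes "set_integrable lborel {a..b} h" "continuous_on {a..b} c"
  shows "set_integrable lborel {a..b} (\<lambda>t. h t *\<^sub>R c t)"
proof -
  have "bounded (c ` {a..b})" using assms(2) by (intro compact_imp_bounded compact_continuous_image) auto
  then obtain M where "\<And>t. t \<in> {a..b} \<Longrightarrow> norm (c t) \<le> M" unfolding bounded_iff by (metis image_eqI)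
  moreover have "set_borel_measurable lborel {a..b} c"
    using borel_measurable_continuous_on_indicator[OF _ assms(2)] by (simp add: set_borel_measurable_def)
  ultimately show ?thesis using assms(1) by (intro set_integrable_mult_bounded) auto
qed

text \<open>Almost everywhere differentiability is avoided: the defect of the integrated formula
  over a subinterval is at most \<open>e\<close> times the integral of \<open>norm (h r)\<close>,
  for every \<open>e > 0\<close>. This holds on short intervals because \<open>F'\<close> is nearly
  constant on a small ball, and it adds up over adjacent intervals.\<close>

theorem AC_chain_rule:
  fixes z :: "real \<Rightarrow> 'e::euclidean_space" and F :: "'e \<Rightarrow> 'f::euclidean_space" and F' :: "'e \<Rightarrow> 'e \<Rightarrow>\<^sub>L 'f"
  assumes ac: "AC_on a b z h" and ab: "a \<le> b" and S: "\<And>t. t \<in> {a..b} \<Longrightarrow> z t \<in> S" "open S"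
    and F: "\<And>p. p \<in> S \<Longrightarrow> (F has_derivative blinfun_apply (F' p)) (at p)"
    and cont: "continuous_on S F'"
  shows "AC_on a b (\<lambda>t. F (z t)) (\<lambda>t. F' (z t) (h t))"
proof -
  let ?k = "\<lambda>t. F' (z t) (h t)"
  have h: "set_integrable lborel {a..b} h" using ac unfolding AC_on_def by blast
  have zc: "continuous_on {a..b} z" using AC_on_continuous[OF ac] .
  have F'c: "continuous_on {a..b} (\<lambda>t. F' (z t))"
    by (rule continuous_on_compose2[OF cont zc]) (use S in auto)
  have k_eq: "?k t = (\<Sum>i\<in>Basis. (h t \<bullet> i) *\<^sub>R F' (z t) i)" for t
    by (metis (mono_tags, lifting) blinfun.scaleR_right blinfun.sum_right euclidean_representation sum.cong)
  have "set_integrable lborel {a..b} (\<lambda>t. (h t \<bullet> i) *\<^sub>R F' (z t) i)" for i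
  proof (rule set_integrable_mult_continuous)
    show "set_integrable lborel {a..b} (\<lambda>t. h t \<bullet> i)"
      unfolding set_integrable_def using integrable_inner_left[of i lborel "\<lambda>x. indicator {a..b} x *\<^sub>R h x"] h[unfolded set_integrable_def] by simp
    show "continuous_on {a..b} (\<lambda>t. F' (z t) i)"
      by (intro continuous_intros F'c)
  qed
  then have k: "set_integrable lborel {a..b} ?k"
    unfolding k_eq by (simp add: set_integrable_def scaleR_sum_right)
  have sub: "h integrable_on {s..t}" "(\<lambda>t. norm (h t)) integrable_on {s..t}" "?k integrable_on {s..t}" if "a \<le> s" "t \<le> b" for s t
    using set_integrable_HK(1,2)[OF set_integrable_sub[OF h that]] set_integrable_HK(1)[OF set_integrable_sub[OF k that]] by auto
  have main: "norm (F (z t) - F (z s) - integral {s..t} ?k) \<le> e * integral {s..t} (\<lambda>r. norm (h r))"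
    if st: "a \<le> s" "s \<le> t" "t \<le> b" and e: "e > 0" for s t e
  proof -
    define P where "P = (\<lambda>s t. a \<le> s \<and> s \<le> t \<and> t \<le> b \<longrightarrow> 
       norm (F (z t) - F (z s) - integral {s..t} ?k) \<le> e * integral {s..t} (\<lambda>r. norm (h r)))"
    \<comment> \<open>Bisection: additivity over adjacent intervals is the case
      \<open>trans\<close>, validity near each point the case \<open>local\<close>.\<close>
    have "P s t" using \<open>s \<le> t\<close>
    proof (induction rule: Bolzano)
      case (trans x y w)
      show ?case unfolding P_def
      proof (intro impI)
        assume xw: "a \<le> x \<and> x \<le> w \<and> w \<le> b"
        have 1: "norm (F (z y) - F (z x) - integral {x..y} ?k) \<le> e * integral {x..y} (\<lambda>r. norm (h r))"
          "norm (F (z w) - F (z y) - integral {y..w} ?k) \<le> e * integral {y..w} (\<lambda>r. norm (h r))"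
          using trans xw unfolding P_def by auto
        have 2: "integral {x..w} ?k = integral {x..y} ?k + integral {y..w} ?k"
          "integral {x..w} (\<lambda>r. norm (h r)) = integral {x..y} (\<lambda>r. norm (h r)) + integral {y..w} (\<lambda>r. norm (h r))"
          using trans xw sub[of x w] by (auto intro!: Henstock_Kurzweil_Integration.integral_combine[symmetric])
        have "norm (F (z w) - F (z x) - integral {x..w} ?k) \<le> norm (F (z y) - F (z x) - integral {x..y} ?k)
          + norm (F (z w) - F (z y) - integral {y..w} ?k)"
          unfolding 2 by (rule order_trans[OF _ norm_triangle_ineq]) (simp add: algebra_simps)
        then show "norm (F (z w) - F (z x) - integral {x..w} ?k) \<le> e * integral {x..w} (\<lambda>r. norm (h r))"
          using 1 unfolding 2(2) by (simp add: algebra_simps)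
      qed
    next
      case (local x)
      then have x: "x \<in> {a..b}" using st by auto
      define p where "p = z x"
      have p: "p \<in> S" using S x unfolding p_def by auto
      obtain r1 where r1: "r1 > 0" "ball p r1 \<subseteq> S" using S(2) p open_contains_ball by blast
      have "continuous (at p) F'" using cont S(2) p by (simp add: continuous_on_eq_continuous_at)
      then obtain r2 where r2: "r2 > 0" "\<And>q. dist q p < r2 \<Longrightarrow> dist (F' q) (F' p) < e / 2"
        using e unfolding continuous_at_eps_delta by (meson half_gt_zero)
      \<comment> \<open>On this ball \<open>F'\<close> varies by at most \<open>e / 2\<close>. One
        half of the error goes to linearizing \<open>F\<close> at \<open>p\<close>, the other to
        replacing \<open>F' (z y)\<close> by \<open>F' p\<close> under the integral.\<close>
      define r where "r = min r1 r2"
      have r: "r > 0" "\<And>q. q \<in> ball p r \<Longrightarrow> q \<in> S" "\<And>q. q \<in> ball p r \<Longrightarrow> norm (F' q - F' p) \<le> e / 2"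
        using r1 r2 unfolding r_def dist_norm[symmetric] by (auto simp: dist_commute less_imp_le)
      obtain d where d: "d > 0" "\<And>y. y \<in> {a..b} \<Longrightarrow> dist y x < d \<Longrightarrow> dist (z y) (z x) < r"
        using zc x r(1) unfolding continuous_on_iff by metis
      show ?case
      proof (intro exI[of _ d] conjI allI impI)
        fix s t assume sxt: "s \<le> x \<and> x \<le> t \<and> t - s < d"
        show "P s t" unfolding P_def
        proof (intro impI)
          assume st: "a \<le> s \<and> s \<le> t \<and> t \<le> b"
          have zb: "z y \<in> ball p r" if "y \<in> {s..t}" for y
            using d(2)[of y] that sxt st by (auto simp: p_def dist_commute dist_real_def)
          have zd: "z t - z s = integral {s..t} h" using AC_on_diff[OF ac] st by auto
          have ih: "norm (integral {s..t} h) \<le> integral {s..t} (\<lambda>r. norm (h r))"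
            using sub[of s t] st by (intro integral_norm_bound_integral) auto
          have A: "norm (F (z t) - F (z s) - F' p (z t - z s)) \<le> norm (z t - z s) * (e / 2)"
          proof (rule differentiable_bound_linearization[where S = "ball p r" and f' = "\<lambda>q. blinfun_apply (F' q)"])
            show "z s + u *\<^sub>R (z t - z s) \<in> ball p r" if "u \<in> {0..1}" for u
            proof -
              have "(1 - u) *\<^sub>R z s + u *\<^sub>R z t \<in> ball p r"
                using convexD[OF convex_ball zb[of s] zb[of t], of "1 - u" u] that st by auto
              then show ?thesis by (simp add: algebra_simps)
            qed
            show "(F has_derivative blinfun_apply (F' q)) (at q within ball p r)" if "q \<in> ball p r" for q
              using F r(2)[OF that] has_derivative_at_withinI by blast
            show "onorm (blinfun_apply (F' q) - blinfun_apply (F' p)) \<le> e / 2" if "q \<in> ball p r" for q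
              using r(3)[OF that] by (simp add: norm_blinfun.rep_eq minus_blinfun.rep_eq fun_diff_def)
            show "p \<in> ball p r" using r by simp
          qed
          have "(\<lambda>y. F' p (h y)) integrable_on {s..t}" "integral {s..t} (\<lambda>y. F' p (h y)) = F' p (integral {s..t} h)"
            using integrable_linear[OF sub(1)[of s t] blinfun.bounded_linear_right[of "F' p"]]
                integral_linear[OF sub(1)[of s t] blinfun.bounded_linear_right[of "F' p"]] st by (auto simp: o_def)
          then have B: "norm (F' p (z t - z s) - integral {s..t} ?k) \<le> (e / 2) * integral {s..t} (\<lambda>r. norm (h r))"
          proof -
            assume i: "(\<lambda>y. F' p (h y)) integrable_on {s..t}" "integral {s..t} (\<lambda>y. F' p (h y)) = F' p (integral {s..t} h)"
            have "F' p (z t - z s) - integral {s..t} ?k = integral {s..t} (\<lambda>y. F' p (h y) - ?k y)"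
              using i sub(3)[of s t] st zd by (simp add: Henstock_Kurzweil_Integration.integral_diff)
            also have "norm \<dots> \<le> integral {s..t} (\<lambda>y. (e / 2) * norm (h y))"
            proof (rule integral_norm_bound_integral)
              show "(\<lambda>y. F' p (h y) - ?k y) integrable_on {s..t}"
                using i sub(3)[of s t] st by (intro integrable_diff) auto
              show "(\<lambda>y. e / 2 * norm (h y)) integrable_on {s..t}"
                using integrable_cmul[OF sub(2)[of s t], of "e / 2"] st by simp
              show "norm (F' p (h y) - ?k y) \<le> e / 2 * norm (h y)" if "y \<in> {s..t}" for y
              proof -
                have "norm (F' p (h y) - ?k y) = norm ((F' (z y) - F' p) (h y))"
                  by (simp add: blinfun.diff_left norm_minus_commute)
                also have "\<dots> \<le> norm (F' (z y) - F' p) * norm (h y)" by (rule norm_blinfun)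
                also have "\<dots> \<le> (e / 2) * norm (h y)" using r(3)[OF zb[OF that]] by (intro mult_right_mono) auto
                finally show ?thesis .
              qed
            qed
            finally show ?thesis by simp
          qed
          have "norm (F (z t) - F (z s) - integral {s..t} ?k) \<le> norm (F (z t) - F (z s) - F' p (z t - z s)) + norm (F' p (z t - z s) - integral {s..t} ?k)"
            by (rule order_trans[OF _ norm_triangle_ineq]) simp
          also have "\<dots> \<le> integral {s..t} (\<lambda>r. norm (h r)) * (e / 2) + (e / 2) * integral {s..t} (\<lambda>r. norm (h r))"
            using A B ih zd e by (intro add_mono) (auto intro: order_trans[OF _ mult_right_mono])
          finally show "norm (F (z t) - F (z s) - integral {s..t} ?k) \<le> e * integral {s..t} (\<lambda>r. norm (h r))"
            by (simp add: field_simps)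
        qed
      qed (rule d)
    qed
    then show ?thesis using st unfolding P_def by auto
  qed
  show ?thesis
  proof (rule AC_onI[OF k])
    fix t assume t: "t \<in> {a..b}"
    define I where "I = integral {a..t} (\<lambda>r. norm (h r))"
    have I: "I \<ge> 0" unfolding I_def by (rule integral_nonneg) (use sub[of a t] t in auto)
    have "norm (F (z t) - F (z a) - integral {a..t} ?k) \<le> 0"
    proof (rule field_le_epsilon)
      fix e :: real assume "e > 0"
      \<comment> \<open>The denominator \<open>I + 1\<close> covers the case
        \<open>I = 0\<close>.\<close>
      then have "norm (F (z t) - F (z a) - integral {a..t} ?k) \<le> (e / (I + 1)) * I"
        using main[of a t "e / (I + 1)"] t I unfolding I_def by auto
      also have "\<dots> \<le> e" using I \<open>e > 0\<close> by (simp add: field_simps)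
      finally show "norm (F (z t) - F (z a) - integral {a..t} ?k) \<le> 0 + e" by simp
    qed
    then show "F (z t) = F (z a) + integral {a..t} ?k" by (simp add: algebra_simps)
  qed
qed

lemma AC_on_sub:
  assumes "AC_on a b z h" "a \<le> c" "d \<le> b"
  shows "AC_on c d z h"
proof (rule AC_onI)
  show "set_integrable lborel {c..d} h"
    using set_integrable_sub[OF AC_on_integrable[OF assms(1)]] assms by auto
  show "z t = z c + integral {c..t} h" if "t \<in> {c..d}" for t
    using AC_on_diff[OF assms(1), of c t] that assms by (auto simp: algebra_simps)
qed

lemma AC_on_add:
  assumes "AC_on a b z h" "AC_on a b w k"
  shows "AC_on a b (\<lambda>t. z t + w t) (\<lambda>t. h t + k t)"
proof (rule AC_onI)
  have i: "set_integrable lborel {a..b} h" "set_integrable lborel {a..b} k"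
    using AC_on_integrable assms by auto
  show "set_integrable lborel {a..b} (\<lambda>t. h t + k t)"
    using i by (rule set_integral_add)
  fix t assume t: "t \<in> {a..b}"
  have "integral {a..t} (\<lambda>t. h t + k t) = integral {a..t} h + integral {a..t} k"
    using t by (intro Henstock_Kurzweil_Integration.integral_add set_integrable_HK set_integrable_sub[OF i(1)] set_integrable_sub[OF i(2)]) auto
  then show "z t + w t = z a + w a + integral {a..t} (\<lambda>t. h t + k t)"
    using AC_onD[OF assms(1) t] AC_onD[OF assms(2) t] by (simp add: algebra_simps)
qed

lemma AC_on_linear:
  assumes "AC_on a b z h" "bounded_linear f"
  shows "AC_on a b (\<lambda>t. f (z t)) (\<lambda>t. f (h t))"
proof (rule AC_onI)
  have i: "set_integrable lborel {a..b} h"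
    using AC_on_integrable assms by auto
  show "set_integrable lborel {a..b} (\<lambda>t. f (h t))"
    using integrable_bounded_linear[OF assms(2) i[unfolded set_integrable_def]]
    unfolding set_integrable_def by (simp add: linear_simps(5)[OF assms(2)])
  fix t assume t: "t \<in> {a..b}"
  have "integral {a..t} (\<lambda>t. f (h t)) = f (integral {a..t} h)"
    using integral_linear[OF set_integrable_HK(1)[OF set_integrable_sub[OF i]] assms(2), of a t] t by (simp add: o_def)
  then show "f (z t) = f (z a) + integral {a..t} (\<lambda>t. f (h t))"
    using AC_onD[OF assms(1) t] by (simp add: linear_simps(1)[OF assms(2)])
qed

lemma AC_on_diff_fun:
  assumes "AC_on a b z h" "AC_on a b w k"
  shows "AC_on a b (\<lambda>t. z t - w t) (\<lambda>t. h t - k t)"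
  using AC_on_add[OF assms(1) AC_on_linear[OF assms(2) bounded_linear_minus[OF bounded_linear_ident]]] by simp

lemma AC_on_square:
  fixes z h :: "real \<Rightarrow> complex"
  assumes "AC_on a b z h" "a \<le> b"
  shows "AC_on a b (\<lambda>t. (z t)\<^sup>2) (\<lambda>t. 2 * z t * h t)"
proof -
  have "AC_on a b (\<lambda>t. (\<lambda>p. p\<^sup>2) (z t)) (\<lambda>t. blinfun_mult_right (2 * z t) (h t))"
  proof (rule AC_chain_rule[where S = UNIV])
    show "((\<lambda>p. p\<^sup>2) has_derivative blinfun_apply (blinfun_mult_right (2 * p))) (at p)" for p :: complex
      by (auto intro!: derivative_eq_intros simp: blinfun_mult_right.rep_eq)
    show "continuous_on UNIV (\<lambda>p::complex. blinfun_mult_right (2 * p))"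
      by (intro bounded_linear.continuous_on[OF bounded_linear_blinfun_mult_right] continuous_intros)
  qed (use assms in auto)
  then show ?thesis by (simp add: blinfun_mult_right.rep_eq)
qed

text \<open>Polarization: a product is a quarter of the difference of two squares, so the chain rule
  for a function of a single complex variable suffices.\<close>

lemma AC_on_mult:
  fixes z h w k :: "real \<Rightarrow> complex"
  assumes "AC_on a b z h" "AC_on a b w k" "a \<le> b"
  shows "AC_on a b (\<lambda>t. z t * w t) (\<lambda>t. h t * w t + z t * k t)"
proof -
  have "AC_on a b (\<lambda>t. ((z t + w t)\<^sup>2 - (z t - w t)\<^sup>2) / 4)
     (\<lambda>t. (2 * (z t + w t) * (h t + k t) - 2 * (z t - w t) * (h t - k t)) / 4)"
    by (intro AC_on_linear[OF _ bounded_linear_divide] AC_on_diff_fun AC_on_square AC_on_add assms)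
  moreover have "((z t + w t)\<^sup>2 - (z t - w t)\<^sup>2) / 4 = z t * w t" for t
    by (simp add: power2_eq_square algebra_simps)
  moreover have "(2 * (z t + w t) * (h t + k t) - 2 * (z t - w t) * (h t - k t)) / 4 = h t * w t + z t * k t" for t
    by (simp add: algebra_simps)
  ultimately show ?thesis by (simp only:)
qed

lemma AC_on_C1:
  fixes z h :: "real \<Rightarrow> 'e::euclidean_space"
  assumes "\<And>t. t \<in> {a..b} \<Longrightarrow> (z has_vector_derivative h t) (at t within {a..b})" "continuous_on {a..b} h"
  shows "AC_on a b z h"
proof (rule AC_onI)
  show "set_integrable lborel {a..b} h"
    by (rule borel_integrable_atLeastAtMost'[OF assms(2)])
  fix t assume t: "t \<in> {a..b}"
  have "(h has_integral (z t - z a)) {a..t}"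
    using t by (intro fundamental_theorem_of_calculus has_vector_derivative_within_subset[OF assms(1)]) auto
  then show "z t = z a + integral {a..t} h" by (simp add: integral_unique)
qed

lemma AC_on_cong:
  assumes "AC_on a b z h" "\<And>t. t \<in> {a..b} \<Longrightarrow> z t = w t" "\<And>t. t \<in> {a..b} \<Longrightarrow> h t = k t"
  shows "AC_on a b w k"
proof (rule AC_onI)
  show "set_integrable lborel {a..b} k"
    using AC_on_integrable[OF assms(1)] set_integrable_cong[OF refl refl, of "{a..b}" h k lborel] assms(3) by auto
  fix t assume t: "t \<in> {a..b}"
  have "integral {a..t} h = integral {a..t} k"
    by (rule Henstock_Kurzweil_Integration.integral_cong) (use t assms(3) in auto)
  then show "w t = w a + integral {a..t} k"
    using AC_onD[OF assms(1) t] assms(2) t by auto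
qed

section \<open>Weak derivatives\<close>

lemma L2_on_set_integrable:
  fixes g :: "real \<Rightarrow> complex"
  assumes "L2_on I g" "{a..b} \<subseteq> I"
  shows "set_integrable lborel {a..b} g"
proof -
  have 1: "set_borel_measurable lborel I g" and 2: "set_integrable lborel I (\<lambda>x. (norm (g x))\<^sup>2)"
    using assms(1) unfolding L2_on_def by auto
  have i: "integrable lborel (\<lambda>x. indicator {a..b} x + indicator I x *\<^sub>R (norm (g x))\<^sup>2)"
    using 2 unfolding set_integrable_def by (intro Bochner_Integration.integrable_add integrable_real_indicator) (auto simp: emeasure_lborel_Icc_eq)
  have "(\<lambda>x. indicator {a..b} x *\<^sub>R (indicator I x *\<^sub>R g x)) \<in> borel_measurable lborel"
    using 1 unfolding set_borel_measurable_def by measurable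
  moreover have "(\<lambda>x. indicator {a..b} x *\<^sub>R (indicator I x *\<^sub>R g x)) = (\<lambda>x. indicator {a..b} x *\<^sub>R g x)"
    using assms(2) by (auto simp: indicator_def fun_eq_iff)
  ultimately have m: "(\<lambda>x. indicator {a..b} x *\<^sub>R g x) \<in> borel_measurable lborel" by simp
  have b: "norm (indicator {a..b} x *\<^sub>R g x) \<le> norm (indicator {a..b} x + indicator I x *\<^sub>R (norm (g x))\<^sup>2)" for x
  proof (cases "x \<in> {a..b}")
    case True
    have "norm (g x) \<le> 1 + (norm (g x))\<^sup>2"
      using sum_power2_ge_zero[of "norm (g x) - 1/2" 0] by (simp add: power2_eq_square algebra_simps)
    then show ?thesis using True assms(2) by auto
  qed simp
  show ?thesis unfolding set_integrable_def
    by (rule Bochner_Integration.integrable_bound[OF i m AE_I2]) (rule b)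
qed

lemma bump0_bochner: "integrable lborel bump0" "integral\<^sup>L lborel bump0 = 1"
proof -
  have eq: "bump0 = (\<lambda>x. indicator {0..1} x *\<^sub>R bump0 x)"
  proof
    fix x show "bump0 x = indicator {0..1} x *\<^sub>R bump0 x"
      using bump0_eq_0[of x] by (cases "x \<in> {0..1}") auto
  qed
  have i: "set_integrable lborel {0..1} bump0"
    by (rule borel_integrable_atLeastAtMost'[OF bump0_continuous_on])
  then show "integrable lborel bump0" unfolding set_integrable_def using eq by simp
  have "integral\<^sup>L lborel bump0 = set_lebesgue_integral lborel {0..1} bump0"
    unfolding set_lebesgue_integral_def using eq by simp
  then show "integral\<^sup>L lborel bump0 = 1"
    using set_integrable_HK(3)[OF i] integral_unique[OF bump0_has_integral] by simp
qed

text \<open>The substitution \<open>t = x + z / real n\<close> turns the weight into the fixed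
  density \<open>bump0 z\<close>, after which dominated convergence applies. All the weight sits to
  the right of \<open>x\<close>, hence the one-sided condition on
  \<open>{x..x + 1 / real n0}\<close>.\<close>

lemma approx_point_mass:
  fixes u :: "real \<Rightarrow> complex"
  assumes m: "set_borel_measurable lborel I u" and c: "continuous_on I u" and x: "{x..x + 1 / real n0} \<subseteq> I" "n0 > 0"
  shows "\<And>n. n \<ge> n0 \<Longrightarrow> integrable lborel (\<lambda>t. indicator I t *\<^sub>R ((bump0 (real n * (t - x)) * real n) *\<^sub>R u t))"
    and "(\<lambda>n. LINT t|lborel. indicator I t *\<^sub>R ((bump0 (real n * (t - x)) * real n) *\<^sub>R u t)) \<longlonglongrightarrow> u x"
proof -
  define U where "U = (\<lambda>t. indicator I t *\<^sub>R u t)"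
  have U [measurable]: "U \<in> borel_measurable borel"
    using m unfolding U_def set_borel_measurable_def by simp
  have [measurable]: "bump0 \<in> borel_measurable borel"
    by (intro borel_measurable_continuous_onI bump0_continuous_on)
  have "compact (u ` {x..x + 1 / real n0})"
    by (intro compact_continuous_image continuous_on_subset[OF c x(1)]) auto
  then obtain M where M: "\<And>t. t \<in> {x..x + 1 / real n0} \<Longrightarrow> norm (u t) \<le> M"
    unfolding bounded_iff by (metis compact_imp_bounded bounded_iff image_eqI)
  have xI: "x \<in> I" using x by auto
  define f where "f n z = bump0 z *\<^sub>R U (x + z / real n)" for n z
  have fb: "norm (f n z) \<le> M * bump0 z" if n: "n \<ge> n0" for n z
  proof (cases "0 < z \<and> z < 1")
    case True
    have "z / real n \<le> 1 / real n0" using True n x(2) by (intro frac_le) auto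
    then have t: "x + z / real n \<in> {x..x + 1 / real n0}" using True by auto
    have "norm (U (x + z / real n)) \<le> M" using M[OF t] subsetD[OF x(1) t] by (simp add: U_def)
    then show ?thesis unfolding f_def using bump0_nonneg[of z] by (simp add: mult.commute[of M] mult_left_mono)
  next
    case False
    then show ?thesis using bump0_eq_0[of z] by (auto simp: f_def not_less)
  qed
  have bi: "integrable lborel (\<lambda>z. M * bump0 z)" using bump0_bochner by simp
  have fm: "f n \<in> borel_measurable lborel" for n unfolding f_def by measurable
  have fi: "integrable lborel (f n)" if "n \<ge> n0" for n
    by (rule Bochner_Integration.integrable_bound[OF bi fm AE_I2]) (use order_trans[OF fb[OF that] abs_ge_self] in simp)
  have F_eq: "(\<lambda>t. indicator I t *\<^sub>R ((bump0 (real n * (t - x)) * real n) *\<^sub>R u t)) = (\<lambda>t. (bump0 (real n * (t - x)) * real n) *\<^sub>R U t)" for n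
    unfolding U_def by (auto simp: indicator_def)
  have aff: "f n z = (1 / real n) *\<^sub>R ((bump0 (real n * ((x + (1 / real n) * z) - x)) * real n) *\<^sub>R U (x + (1 / real n) * z))" if "n \<ge> n0" for n z
    using that x(2) by (simp add: f_def)
  show int: "integrable lborel (\<lambda>t. indicator I t *\<^sub>R ((bump0 (real n * (t - x)) * real n) *\<^sub>R u t))" if n: "n \<ge> n0" for n
  proof -
    have "(\<lambda>z. real n *\<^sub>R f n z) = (\<lambda>z. (bump0 (real n * ((x + (1 / real n) * z) - x)) * real n) *\<^sub>R U (x + (1 / real n) * z))"
      unfolding aff[OF n] using n x(2) by (simp add: mult.commute)
    moreover have "integrable lborel (\<lambda>z. real n *\<^sub>R f n z)"
      by (rule integrable_scaleR_right) (rule fi[OF n])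
    ultimately have "integrable lborel (\<lambda>z. (bump0 (real n * ((x + (1 / real n) * z) - x)) * real n) *\<^sub>R U (x + (1 / real n) * z))"
      by simp
    then show ?thesis unfolding F_eq
      using lborel_integrable_real_affine_iff[of "1 / real n" "\<lambda>t. (bump0 (real n * (t - x)) * real n) *\<^sub>R U t" x] n x(2) by simp
  qed
  have eq: "(LINT t|lborel. indicator I t *\<^sub>R ((bump0 (real n * (t - x)) * real n) *\<^sub>R u t)) = integral\<^sup>L lborel (f n)" if n: "n \<ge> n0" for n
  proof -
    have "integral\<^sup>L lborel (f n) = (LINT z|lborel. (1 / real n) *\<^sub>R ((bump0 (real n * ((x + (1 / real n) * z) - x)) * real n) *\<^sub>R U (x + (1 / real n) * z)))"
      by (rule Bochner_Integration.integral_cong[OF refl]) (rule aff[OF n])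
    also have "\<dots> = (1 / real n) *\<^sub>R (LINT z|lborel. ((bump0 (real n * ((x + (1 / real n) * z) - x)) * real n) *\<^sub>R U (x + (1 / real n) * z)))"
      by (rule integral_scaleR_right)
    also have "\<dots> = (LINT t|lborel. (bump0 (real n * (t - x)) * real n) *\<^sub>R U t)"
      using n x(2) by (subst lborel_integral_real_affine[where c = "1 / real n" and t = x and f = "\<lambda>t. (bump0 (real n * (t - x)) * real n) *\<^sub>R U t"]) auto
    finally show ?thesis unfolding F_eq by simp
  qed
  have "(\<lambda>n. integral\<^sup>L lborel (f (n + n0))) \<longlonglongrightarrow> (LINT z|lborel. bump0 z *\<^sub>R u x)"
  proof (rule integral_dominated_convergence[where w = "\<lambda>z. M * bump0 z"])
    show "AE z in lborel. (\<lambda>n. f (n + n0) z) \<longlonglongrightarrow> bump0 z *\<^sub>R u x"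
    proof (rule AE_I2)
      fix z
      show "(\<lambda>n. f (n + n0) z) \<longlonglongrightarrow> bump0 z *\<^sub>R u x"
      proof (cases "0 < z \<and> z < 1")
        case True
        have "z / real (n + n0) \<le> 1 / real n0" for n using True x(2) by (intro frac_le) auto
        then have t: "x + z / real (n + n0) \<in> I" for n using True x(1) by (intro subsetD[OF x(1)]) auto
        have "(\<lambda>n. x + z / real (n + n0)) \<longlonglongrightarrow> x + 0"
          by (intro tendsto_add tendsto_const LIMSEQ_ignore_initial_segment lim_const_over_n)
        then have "(\<lambda>n. u (x + z / real (n + n0))) \<longlonglongrightarrow> u x"
          using continuous_on_tendsto_compose[OF c, of "\<lambda>n. x + z / real (n + n0)" x sequentially] xI t by auto
        then have "(\<lambda>n. U (x + z / real (n + n0))) \<longlonglongrightarrow> u x" unfolding U_def using t by simp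
        then show ?thesis unfolding f_def by (intro tendsto_intros)
      next
        case False
        then have "bump0 z = 0" by (intro bump0_eq_0) auto
        then show ?thesis by (simp add: f_def)
      qed
    qed
  qed (use fm fb bi in \<open>auto\<close>)
  moreover have "(LINT z|lborel. bump0 z *\<^sub>R u x) = u x"
    using bump0_bochner by (simp add: integral_scaleR_left)
  ultimately have "(\<lambda>n. integral\<^sup>L lborel (f (n + n0))) \<longlonglongrightarrow> u x" by simp
  then have "(\<lambda>n. LINT t|lborel. indicator I t *\<^sub>R ((bump0 (real (n + n0) * (t - x)) * real (n + n0)) *\<^sub>R u t)) \<longlonglongrightarrow> u x"
    by (simp only: eq le_add2)
  then show "(\<lambda>n. LINT t|lborel. indicator I t *\<^sub>R ((bump0 (real n * (t - x)) * real n) *\<^sub>R u t)) \<longlonglongrightarrow> u x"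
    by (rule LIMSEQ_offset[of _ n0])
qed

text \<open>The test functions are plateaus between \<open>x\<close> and \<open>y\<close>. Their
  derivatives are differences of approximate point masses and yield \<open>u x - u y\<close>; the
  plateaus themselves tend to the indicator of the interval and yield the integral of
  \<open>g\<close>.\<close>

lemma weak_deriv_diff_eq:
  fixes u g :: "real \<Rightarrow> complex"
  assumes I: "open I" and u: "set_borel_measurable lborel I u" "continuous_on I u"
    and g: "L2_on I g" and w: "is_weak_deriv I u g" and xy: "x \<le> y" "{x..y} \<subseteq> I"
  shows "u y - u x = integral {x..y} g"
proof -
  have "y \<in> I" using xy by auto
  then obtain e where e: "e > 0" "ball y e \<subseteq> I" using I open_contains_ball by blast
  \<comment> \<open>A plateau overshoots \<open>y\<close> by \<open>1 / real n\<close>; openness of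
    \<open>I\<close> leaves room for that.\<close>
  obtain n0 where n0: "n0 > 0" "1 / real n0 < e"
    using e(1) nat_approx_posE[of e] by (metis of_nat_Suc zero_less_Suc)
  have sub: "{x..y + 1 / real n0} \<subseteq> I"
  proof
    fix t assume t: "t \<in> {x..y + 1 / real n0}"
    show "t \<in> I"
    proof (cases "t \<le> y")
      case True then show ?thesis using t xy by auto
    next
      case False
      then have "t \<in> ball y e" using t n0 by (auto simp: dist_real_def)
      then show ?thesis using e by auto
    qed
  qed
  have subn: "{x..y + 1 / real n} \<subseteq> I" if "n \<ge> n0" for n
  proof -
    have "1 / real n \<le> 1 / real n0" using that n0 by (intro frac_le) auto
    then show ?thesis using sub by auto
  qed
  have sx: "{x..x + 1 / real n0} \<subseteq> I" and sy: "{y..y + 1 / real n0} \<subseteq> I" using sub xy by auto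
  let ?m = "\<lambda>x n t. indicator I t *\<^sub>R ((bump0 (real n * (t - x)) * real n) *\<^sub>R u t)"
  define G where "G = (\<lambda>t. indicator I t *\<^sub>R g t)"
  have G [measurable]: "G \<in> borel_measurable borel"
    using g unfolding L2_on_def set_borel_measurable_def G_def by simp
  have A: "integral\<^sup>L lborel (?m x n) - integral\<^sup>L lborel (?m y n) = - (LINT t|lborel. plateau x y n t *\<^sub>R G t)" if n: "n \<ge> n0" for n
  proof -
    have "test_fun I (plateau x y n)" using plateau_test_fun[OF _ xy(1) subn[OF n]] n n0 by auto
    then have "set_lebesgue_integral lborel I (\<lambda>t. deriv (plateau x y n) t *\<^sub>R u t) = - set_lebesgue_integral lborel I (\<lambda>t. plateau x y n t *\<^sub>R g t)"
      using w unfolding is_weak_deriv_def by blast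
    moreover have "set_lebesgue_integral lborel I (\<lambda>t. plateau x y n t *\<^sub>R g t) = (LINT t|lborel. plateau x y n t *\<^sub>R G t)"
      unfolding set_lebesgue_integral_def G_def by (intro Bochner_Integration.integral_cong) auto
    moreover have "set_lebesgue_integral lborel I (\<lambda>t. deriv (plateau x y n) t *\<^sub>R u t) = (LINT t|lborel. ?m x n t - ?m y n t)"
      unfolding set_lebesgue_integral_def
    proof (intro Bochner_Integration.integral_cong refl)
      fix t
      have "deriv (plateau x y n) t = bump0 (real n * (t - x)) * real n - bump0 (real n * (t - y)) * real n"
        by (rule DERIV_imp_deriv[OF plateau_deriv])
      then show "indicator I t *\<^sub>R deriv (plateau x y n) t *\<^sub>R u t = ?m x n t - ?m y n t"
        by (simp only: scaleR_diff_left scaleR_diff_right)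
    qed
    moreover have "(LINT t|lborel. ?m x n t - ?m y n t) = integral\<^sup>L lborel (?m x n) - integral\<^sup>L lborel (?m y n)"
      by (intro Bochner_Integration.integral_diff approx_point_mass(1)[OF u sx n0(1) n] approx_point_mass(1)[OF u sy n0(1) n])
    ultimately show ?thesis by simp
  qed
  have lhs: "(\<lambda>n. integral\<^sup>L lborel (?m x n) - integral\<^sup>L lborel (?m y n)) \<longlonglongrightarrow> u x - u y"
    by (intro tendsto_diff approx_point_mass(2)[OF u sx n0(1)] approx_point_mass(2)[OF u sy n0(1)])
  have gi: "set_integrable lborel {x..y + 1 / real n0} g" by (rule L2_on_set_integrable[OF g sub])
  have [measurable]: "plateau x y n \<in> borel_measurable borel" for n
    by (intro borel_measurable_continuous_onI continuous_at_imp_continuous_on ballI DERIV_isCont[OF plateau_deriv])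
  have rhs: "(\<lambda>n. LINT t|lborel. plateau x y (n + n0) t *\<^sub>R G t) \<longlonglongrightarrow> (LINT t|lborel. indicator {x<..y} t *\<^sub>R G t)"
  proof (rule integral_dominated_convergence[where w = "\<lambda>t. norm (indicator {x..y + 1 / real n0} t *\<^sub>R g t)"])
    show "integrable lborel (\<lambda>t. norm (indicator {x..y + 1 / real n0} t *\<^sub>R g t))"
      using gi unfolding set_integrable_def by (rule integrable_norm)
    show "AE t in lborel. (\<lambda>n. plateau x y (n + n0) t *\<^sub>R G t) \<longlonglongrightarrow> indicator {x<..y} t *\<^sub>R G t"
      by (intro AE_I2 tendsto_scaleR tendsto_const LIMSEQ_ignore_initial_segment plateau_tendsto xy)
    show "AE t in lborel. norm (plateau x y (n + n0) t *\<^sub>R G t) \<le> norm (indicator {x..y + 1 / real n0} t *\<^sub>R g t)" for n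
    proof (rule AE_I2)
      fix t
      show "norm (plateau x y (n + n0) t *\<^sub>R G t) \<le> norm (indicator {x..y + 1 / real n0} t *\<^sub>R g t)"
      proof (cases "t \<in> {x..y + 1 / real n0}")
        case True
        then have "G t = g t" using sub by (auto simp: G_def)
        then show ?thesis using True plateau_abs_le[of x y "n + n0" t] by (simp add: mult_left_le_one_le)
      next
        case False
        have "1 / real (n + n0) \<le> 1 / real n0" using n0 by (intro frac_le) auto
        then have "t < x \<or> t > y + 1 / real (n + n0)" using False by auto
        moreover have "real (n + n0) * (t - y) \<ge> 1 \<and> real (n + n0) * (t - x) \<ge> 1" if "t > y + 1 / real (n + n0)"
        proof -
          have "real (n + n0) * (t - y) \<ge> 1" using that n0 by (simp add: field_simps)
          moreover have "real (n + n0) * (t - x) \<ge> real (n + n0) * (t - y)" using xy by (intro mult_left_mono) auto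
          ultimately show ?thesis by simp
        qed
        moreover have "real (n + n0) * (t - y) \<le> 0 \<and> real (n + n0) * (t - x) \<le> 0" if "t < x"
          using that xy by (auto intro!: mult_nonneg_nonpos)
        ultimately have "plateau x y (n + n0) t = 0"
          unfolding plateau_def using smooth_step_eq_0 smooth_step_eq_1 by fastforce
        then show ?thesis by simp
      qed
    qed
  qed (use G in \<open>auto\<close>)
  have "(\<lambda>n. - (LINT t|lborel. plateau x y (n + n0) t *\<^sub>R G t)) \<longlonglongrightarrow> u x - u y"
    using LIMSEQ_ignore_initial_segment[OF lhs, of n0] by (simp only: A le_add2)
  with tendsto_minus[OF rhs] have "u x - u y = - (LINT t|lborel. indicator {x<..y} t *\<^sub>R G t)"
    using LIMSEQ_unique by blast
  moreover have "(LINT t|lborel. indicator {x<..y} t *\<^sub>R G t) = set_lebesgue_integral lborel {x..y} g"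
    unfolding set_lebesgue_integral_def
  proof (rule integral_cong_AE)
    show "AE t in lborel. indicator {x<..y} t *\<^sub>R G t = indicator {x..y} t *\<^sub>R g t"
      using AE_lborel_singleton[of x]
    proof eventually_elim
      case (elim t)
      then show ?case using xy(2) by (cases "t \<in> {x..y}") (auto simp: G_def indicator_def)
    qed
    show "(\<lambda>t. indicator {x..y} t *\<^sub>R g t) \<in> borel_measurable lborel"
      using L2_on_set_integrable[OF g xy(2)] unfolding set_integrable_def by auto
  qed measurable
  ultimately show ?thesis
    using set_integrable_HK(3)[OF L2_on_set_integrable[OF g xy(2)]] by (simp add: algebra_simps)
qed

lemma weak_deriv_imp_AC_on:
  fixes u g :: "real \<Rightarrow> complex"
  assumes "open I" "set_borel_measurable lborel I u" "continuous_on I u" "L2_on I g" "is_weak_deriv I u g" "{a..b} \<subseteq> I"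
  shows "AC_on a b u g"
proof (rule AC_onI)
  show "set_integrable lborel {a..b} g" by (rule L2_on_set_integrable) fact+
  fix t assume "t \<in> {a..b}"
  then have "a \<le> t" "{a..t} \<subseteq> I" using assms(6) by auto
  then show "u t = u a + integral {a..t} g"
    using weak_deriv_diff_eq[OF assms(1-5), of a t] by (simp add: algebra_simps)
qed

text \<open>The product rule for \<open>\<phi>\<close> times \<open>u\<close> is integrated over an
  interval whose endpoints lie in \<open>I\<close> but outside the support of \<open>\<phi>\<close>,
  so no boundary terms appear. That \<open>I\<close> is an interval keeps all of
  \<open>{a..b}\<close> inside it.\<close>

lemma AC_on_imp_weak_deriv:
  fixes u g :: "real \<Rightarrow> complex"
  assumes I: "open I" "is_interval I" and ac: "\<And>a b. {a..b} \<subseteq> I \<Longrightarrow> AC_on a b u g"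
  shows "is_weak_deriv I u g"
  unfolding is_weak_deriv_def
proof (intro allI impI)
  fix \<phi> assume t: "test_fun I \<phi>"
  have d: "\<phi> differentiable (at x)" "deriv \<phi> differentiable (at x)" for x
    using t[unfolded test_fun_def, THEN conjunct1, rule_format, of 0 x] t[unfolded test_fun_def, THEN conjunct1, rule_format, of 1 x] by auto
  have D: "(\<phi> has_real_derivative deriv \<phi> x) (at x)" for x
    using d(1) DERIV_deriv_iff_real_differentiable by blast
  have D': "continuous_on A (deriv \<phi>)" for A
    using d(2) differentiable_imp_continuous_within by (blast intro: continuous_at_imp_continuous_on)
  obtain K where K: "compact K" "K \<subseteq> I" "\<And>x. x \<notin> K \<Longrightarrow> \<phi> x = 0"
    using t unfolding test_fun_def by blast
  have dK: "deriv \<phi> x = 0" if "x \<notin> K" for x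
  proof -
    have "((\<lambda>_. 0) has_real_derivative 0) (at x)" by simp
    then have "(\<phi> has_real_derivative 0) (at x)"
      by (rule has_field_derivative_transform_within_open[where S = "- K"]) (use K that compact_imp_closed in auto)
    then show ?thesis by (rule DERIV_imp_deriv)
  qed
  show "set_lebesgue_integral lborel I (\<lambda>x. deriv \<phi> x *\<^sub>R u x) = - set_lebesgue_integral lborel I (\<lambda>x. \<phi> x *\<^sub>R g x)"
  proof (cases "K = {}")
    case True
    then show ?thesis using K(3) dK by (simp add: set_lebesgue_integral_def)
  next
    case False
    have inf: "Inf K \<in> K" "\<And>x. x \<in> K \<Longrightarrow> Inf K \<le> x" and sup: "Sup K \<in> K" "\<And>x. x \<in> K \<Longrightarrow> x \<le> Sup K"
      using K(1) False by (auto intro!: closed_contains_Inf closed_contains_Sup cInf_lower cSup_upper simp: compact_imp_closed compact_imp_bounded bounded_imp_bdd_below bounded_imp_bdd_above)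
    obtain e1 where e1: "e1 > 0" "cball (Inf K) e1 \<subseteq> I" using I(1) inf(1) K(2) open_contains_cball by blast
    obtain e2 where e2: "e2 > 0" "cball (Sup K) e2 \<subseteq> I" using I(1) sup(1) K(2) open_contains_cball by blast
    define a b where "a = Inf K - e1" and "b = Sup K + e2"
    have ab: "a \<in> I" "b \<in> I" 
      using subsetD[OF e1(2), of a] subsetD[OF e2(2), of b] e1(1) e2(1) by (simp_all add: a_def b_def dist_real_def)
    have Kab: "K \<subseteq> {a..b}"
    proof
      fix x assume "x \<in> K"
      then show "x \<in> {a..b}" using inf(2)[of x] sup(2)[of x] e1(1) e2(1) by (simp add: a_def b_def)
    qed
    have aK: "a \<notin> K" using inf(2)[of a] e1(1) by (auto simp: a_def)
    have bK: "b \<notin> K" using sup(2)[of b] e2(1) by (auto simp: b_def)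
    have abI: "{a..b} \<subseteq> I" using I(2) ab unfolding is_interval_1 by (meson atLeastAtMost_iff subsetI)
    have le: "a \<le> b" using subsetD[OF Kab inf(1)] by simp
    have ac1: "AC_on a b (\<lambda>x. complex_of_real (\<phi> x)) (\<lambda>x. complex_of_real (deriv \<phi> x))"
    proof (rule AC_on_C1)
      show "((\<lambda>x. complex_of_real (\<phi> x)) has_vector_derivative complex_of_real (deriv \<phi> t)) (at t within {a..b})" for t
        by (rule has_vector_derivative_of_real[OF has_field_derivative_at_within[OF D[of t]]])
      show "continuous_on {a..b} (\<lambda>x. complex_of_real (deriv \<phi> x))"
        by (intro continuous_on_of_real D')
    qed
    have ac2: "AC_on a b (\<lambda>x. complex_of_real (\<phi> x) * u x) (\<lambda>x. complex_of_real (deriv \<phi> x) * u x + complex_of_real (\<phi> x) * g x)"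
      by (rule AC_on_mult[OF ac1 ac[OF abI] le])
    have i1: "set_integrable lborel {a..b} (\<lambda>x. deriv \<phi> x *\<^sub>R u x)"
      by (rule borel_integrable_atLeastAtMost') (intro continuous_intros D' AC_on_continuous[OF ac[OF abI]])
    have i2: "set_integrable lborel {a..b} (\<lambda>x. \<phi> x *\<^sub>R g x)"
      using set_integral_diff(1)[OF AC_on_integrable[OF ac2] i1] by (simp add: scaleR_conv_of_real)
    have "0 = integral {a..b} (\<lambda>x. complex_of_real (deriv \<phi> x) * u x + complex_of_real (\<phi> x) * g x)"
      using AC_on_diff[OF ac2 order_refl le order_refl] K(3)[OF aK] K(3)[OF bK] by simp
    also have "\<dots> = integral {a..b} (\<lambda>x. deriv \<phi> x *\<^sub>R u x) + integral {a..b} (\<lambda>x. \<phi> x *\<^sub>R g x)"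
      using Henstock_Kurzweil_Integration.integral_add[OF set_integrable_HK(1)[OF i1] set_integrable_HK(1)[OF i2]]
      by (simp add: scaleR_conv_of_real)
    finally have eq: "set_lebesgue_integral lborel {a..b} (\<lambda>x. deriv \<phi> x *\<^sub>R u x) + set_lebesgue_integral lborel {a..b} (\<lambda>x. \<phi> x *\<^sub>R g x) = 0"
      using set_integrable_HK(3)[OF i1] set_integrable_HK(3)[OF i2] by simp
    have ind: "indicator I x *\<^sub>R (c x *\<^sub>R h x) = indicator {a..b} x *\<^sub>R (c x *\<^sub>R h x)"
      if "\<And>x. x \<notin> K \<Longrightarrow> c x = 0" for c :: "real \<Rightarrow> real" and h :: "real \<Rightarrow> complex" and x
      using that[of x] Kab abI by (cases "x \<in> K") (auto simp: subset_iff)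
    have "set_lebesgue_integral lborel I (\<lambda>x. deriv \<phi> x *\<^sub>R u x) = set_lebesgue_integral lborel {a..b} (\<lambda>x. deriv \<phi> x *\<^sub>R u x)"
      unfolding set_lebesgue_integral_def by (intro Bochner_Integration.integral_cong refl ind dK)
    moreover have "set_lebesgue_integral lborel I (\<lambda>x. \<phi> x *\<^sub>R g x) = set_lebesgue_integral lborel {a..b} (\<lambda>x. \<phi> x *\<^sub>R g x)"
      unfolding set_lebesgue_integral_def by (intro Bochner_Integration.integral_cong refl ind K(3))
    ultimately show ?thesis using eq by (simp add: eq_neg_iff_add_eq_0)
  qed
qed

section \<open>The half-line value function\<close>

locale nls =
  fixes \<sigma> :: real
  assumes sigma_pos: "0 < \<sigma>" and sigma_less: "\<sigma> < 2"
begin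

text \<open>The squared soliton is a multiple of \<open>(1 - t\<^sup>2) powr (1 / \<sigma>)\<close>,
  with \<open>t\<close> a hyperbolic tangent of the position. With \<open>t\<close> as integration
  variable, the mass beyond the point where \<open>t = \<theta>\<close> becomes a multiple of
  \<open>J \<theta>\<close>.\<close>

definition J :: "real \<Rightarrow> real" where
  "J \<theta> = integral {\<theta>..1} (\<lambda>t. (1 - t\<^sup>2) powr (1 / \<sigma> - 1))"

definition CJ :: real where "CJ = (\<sigma> + 1) powr (1 / \<sigma>) / \<sigma>"

text \<open>A soliton piece with frequency \<open>k\<^sup>2\<close> and inward logarithmic slope \<open>- k \<theta>\<close> at the endpoint has mass
  \<open>CJ * J \<theta>\<close> times a power of \<open>k\<close>. It has unit mass when \<open>k = N \<theta>\<close>, and then \<open>R \<theta>\<close> is its squared modulus at the endpoint.\<close>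
definition N :: "real \<Rightarrow> real" where "N \<theta> = (CJ * J \<theta>) powr (- \<sigma> / (2 - \<sigma>))"

definition R :: "real \<Rightarrow> real" where "R \<theta> = ((\<sigma> + 1) * (N \<theta>)\<^sup>2 * (1 - \<theta>\<^sup>2)) powr (1 / \<sigma>)"

lemma CJ_pos: "CJ > 0"
  using sigma_pos by (simp add: CJ_def)

text \<open>For \<open>\<sigma> > 1\<close> the integrand is singular at both ends. The affine map
  onto the unit interval turns it into a Beta integrand with both parameters equal to
  \<open>1 / \<sigma> > 0\<close>.\<close>

lemma J_integrable: "set_integrable lborel {-1..1} (\<lambda>t. (1 - t\<^sup>2) powr (1 / \<sigma> - 1))"
proof -
  let ?b = "\<lambda>t. indicator {0..1} t *\<^sub>R (t powr (1 / \<sigma> - 1) * (1 - t) powr (1 / \<sigma> - 1)) :: real"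
  have "integrable lborel ?b"
    using integrable_Beta[of "1 / \<sigma>" "1 / \<sigma>"] sigma_pos unfolding set_integrable_def by simp
  then have "integrable lborel (\<lambda>x. ?b (1 / 2 + 1 / 2 * x))"
    using lborel_integrable_real_affine_iff[of "1 / 2" ?b "1 / 2"] by simp
  then have "integrable lborel (\<lambda>x. (4 powr (1 / \<sigma> - 1)) * ?b (1 / 2 + 1 / 2 * x))"
    by (rule integrable_mult_right)
  moreover have "(4 powr (1 / \<sigma> - 1)) * ?b (1 / 2 + 1 / 2 * x) = indicator {-1..1} x *\<^sub>R (1 - x\<^sup>2) powr (1 / \<sigma> - 1)" for x :: real
  proof (cases "x \<in> {-1..1}")
    case True
    have "4 powr (1 / \<sigma> - 1) * ((1 / 2 + 1 / 2 * x) powr (1 / \<sigma> - 1) * (1 - (1 / 2 + 1 / 2 * x)) powr (1 / \<sigma> - 1))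
       = (4 * ((1 / 2 + 1 / 2 * x) * (1 - (1 / 2 + 1 / 2 * x)))) powr (1 / \<sigma> - 1)"
      using True by (simp add: powr_mult)
    also have "4 * ((1 / 2 + 1 / 2 * x) * (1 - (1 / 2 + 1 / 2 * x))) = 1 - x\<^sup>2"
      by (simp add: algebra_simps power2_eq_square)
    finally show ?thesis using True by simp
  qed (auto simp: indicator_def)
  ultimately show ?thesis unfolding set_integrable_def by (simp only:)
qed

lemma J_integrable_on: "(\<lambda>t. (1 - t\<^sup>2) powr (1 / \<sigma> - 1)) integrable_on {-1..1}"
  using set_borel_integral_eq_integral(1)[OF J_integrable] .

lemma J_lebesgue: "set_lebesgue_integral lborel {-1..1} (\<lambda>t. (1 - t\<^sup>2) powr (1 / \<sigma> - 1)) = J (-1)"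
  unfolding J_def using set_borel_integral_eq_integral(2)[OF J_integrable] .

lemma J_continuous: "continuous_on {-1..1} J"
  unfolding J_def[abs_def] by (rule indefinite_integral_continuous_1'[OF J_integrable_on])

lemma J_1 [simp]: "J 1 = 0"
  by (simp add: J_def)

lemma sq_less_1: "-1 < \<theta> \<Longrightarrow> \<theta> < 1 \<Longrightarrow> \<theta>\<^sup>2 < (1::real)"
  using abs_square_less_1[of \<theta>] by auto

lemma sq_le_1: "-1 \<le> \<theta> \<Longrightarrow> \<theta> \<le> 1 \<Longrightarrow> \<theta>\<^sup>2 \<le> (1::real)"
  using abs_square_le_1[of \<theta>] by auto

lemma J_deriv:
  assumes "-1 < \<theta>" "\<theta> < 1"
  shows "(J has_real_derivative - ((1 - \<theta>\<^sup>2) powr (1 / \<sigma> - 1))) (at \<theta>)"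
proof -
  let ?f = "\<lambda>t. (1 - t\<^sup>2) powr (1 / \<sigma> - 1)"
  have "continuous (at \<theta> within {-1..1} - {}) ?f"
    using sq_less_1[OF assms] by (intro continuous_intros) auto
  then have "((\<lambda>u. integral {-1..u} ?f) has_vector_derivative ?f \<theta>) (at \<theta> within {-1..1} - {})"
    by (intro integral_has_vector_derivative_continuous_at[OF J_integrable_on]) (use assms in auto)
  moreover have "at \<theta> within {-1..1} - {} = at \<theta>"
    using assms by (auto intro!: at_within_interior)
  ultimately have "((\<lambda>u. integral {-1..u} ?f) has_real_derivative ?f \<theta>) (at \<theta>)"
    by (simp add: has_real_derivative_iff_has_vector_derivative)
  then have "((\<lambda>u. J (-1) - integral {-1..u} ?f) has_real_derivative 0 - ?f \<theta>) (at \<theta>)"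
    by (intro DERIV_diff DERIV_const)
  then have "((\<lambda>u. J (-1) - integral {-1..u} ?f) has_real_derivative - ?f \<theta>) (at \<theta>)" by simp
  then show ?thesis
  proof (rule has_field_derivative_transform_within_open[where S = "{-1<..<1}"])
    fix u :: real assume "u \<in> {-1<..<1}"
    then have "integral {-1..u} ?f + integral {u..1} ?f = integral {-1..1} ?f"
      by (intro Henstock_Kurzweil_Integration.integral_combine J_integrable_on) auto
    then show "J (-1) - integral {-1..u} ?f = J u" by (simp add: J_def)
  qed (use assms in auto)
qed

lemma J_strict_decreasing:
  assumes "-1 \<le> a" "a < b" "b \<le> 1"
  shows "J b < J a"
proof (rule DERIV_neg_imp_decreasing_open[OF assms(2)])
  fix x assume x: "a < x" "x < b"
  then have "(J has_real_derivative - ((1 - x\<^sup>2) powr (1 / \<sigma> - 1))) (at x)" using assms by (intro J_deriv) auto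
  moreover have "x\<^sup>2 < 1" using x assms by (intro sq_less_1) auto
  ultimately show "\<exists>y. (J has_real_derivative y) (at x) \<and> y < 0" by auto
qed (use assms in \<open>auto intro: continuous_on_subset[OF J_continuous]\<close>)

lemma J_pos: "-1 \<le> \<theta> \<Longrightarrow> \<theta> < 1 \<Longrightarrow> J \<theta> > 0"
  using J_strict_decreasing[of \<theta> 1] by simp

lemma sech_powr_deriv:
  assumes "-1 < \<theta>" "\<theta> < 1"
  shows "((\<lambda>\<theta>. (1 - \<theta>\<^sup>2) powr (1 / \<sigma>)) has_real_derivative - (2 / \<sigma>) * \<theta> * (1 - \<theta>\<^sup>2) powr (1 / \<sigma> - 1)) (at \<theta>)"
proof -
  have "((\<lambda>\<theta>. 1 - \<theta>\<^sup>2) has_real_derivative - 2 * \<theta>) (at \<theta>)"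
    by (auto intro!: derivative_eq_intros)
  from DERIV_powr[OF this _ DERIV_const, of "1 / \<sigma>"] show ?thesis
    using sq_less_1[OF assms] by (simp add: powr_diff field_simps)
qed

lemma sech_powr_continuous: "continuous_on {-1..1} (\<lambda>\<theta>. (1 - \<theta>\<^sup>2) powr (1 / \<sigma>))"
  by (intro continuous_on_powr' continuous_intros) (use sigma_pos sq_le_1 in auto)

text \<open>The difference \<open>J x - \<sigma> / 2 * (1 - x\<^sup>2) powr (1 / \<sigma>)\<close>
  vanishes at 1 and has derivative
  \<open>(x - 1) * (1 - x\<^sup>2) powr (1 / \<sigma> - 1) \<le> 0\<close>. For soliton pieces this
  bounds the endpoint density by \<open>2 * k\<close> times the mass.\<close>

lemma J_lower:
  assumes "-1 \<le> \<theta>" "\<theta> \<le> 1"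
  shows "\<sigma> / 2 * (1 - \<theta>\<^sup>2) powr (1 / \<sigma>) \<le> J \<theta>"
proof -
  have "J 1 - \<sigma> / 2 * (1 - 1\<^sup>2) powr (1 / \<sigma>) \<le> J \<theta> - \<sigma> / 2 * (1 - \<theta>\<^sup>2) powr (1 / \<sigma>)"
  proof (rule DERIV_nonpos_imp_decreasing_open[OF assms(2)])
    fix x assume x: "\<theta> < x" "x < 1"
    then have x1: "-1 < x" using assms by simp
    have "((\<lambda>x. J x - \<sigma> / 2 * (1 - x\<^sup>2) powr (1 / \<sigma>)) has_real_derivative 
        - ((1 - x\<^sup>2) powr (1 / \<sigma> - 1)) - \<sigma> / 2 * (- (2 / \<sigma>) * x * (1 - x\<^sup>2) powr (1 / \<sigma> - 1))) (at x)"
      by (intro DERIV_diff DERIV_cmult J_deriv sech_powr_deriv x1 x)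
    moreover have "- ((1 - x\<^sup>2) powr (1 / \<sigma> - 1)) - \<sigma> / 2 * (- (2 / \<sigma>) * x * (1 - x\<^sup>2) powr (1 / \<sigma> - 1)) = (x - 1) * (1 - x\<^sup>2) powr (1 / \<sigma> - 1)"
      using sigma_pos by (simp add: field_simps)
    moreover have "(x - 1) * (1 - x\<^sup>2) powr (1 / \<sigma> - 1) \<le> 0"
      using x by (intro mult_nonpos_nonneg) auto
    ultimately show "\<exists>y. ((\<lambda>x. J x - \<sigma> / 2 * (1 - x\<^sup>2) powr (1 / \<sigma>)) has_real_derivative y) (at x) \<and> y \<le> 0"
      by (intro exI[of _ "(x - 1) * (1 - x\<^sup>2) powr (1 / \<sigma> - 1)"] conjI) (simp only:)
  next
    show "continuous_on {\<theta>..1} (\<lambda>x. J x - \<sigma> / 2 * (1 - x\<^sup>2) powr (1 / \<sigma>))"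
      using assms by (intro continuous_intros continuous_on_subset[OF J_continuous] continuous_on_subset[OF sech_powr_continuous]) auto
  qed
  then show ?thesis by simp
qed

text \<open>The difference of the two sides vanishes at 1 and has derivative \<open>- J x\<close>,
  which is negative. This counterpart of \<open>J_lower\<close> drives the monotonicity of
  \<open>R\<close> and the upper bound on \<open>v\<close>.\<close>

lemma J_upper:
  assumes "-1 \<le> \<theta>" "\<theta> < 1"
  shows "\<theta> * J \<theta> < \<sigma> / 2 * (1 - \<theta>\<^sup>2) powr (1 / \<sigma>)"
proof -
  have "\<sigma> / 2 * (1 - 1\<^sup>2) powr (1 / \<sigma>) - 1 * J 1 < \<sigma> / 2 * (1 - \<theta>\<^sup>2) powr (1 / \<sigma>) - \<theta> * J \<theta>"
  proof (rule DERIV_neg_imp_decreasing_open[OF assms(2)])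
    fix x assume x: "\<theta> < x" "x < 1"
    then have x1: "-1 < x" using assms by simp
    have "((\<lambda>x. \<sigma> / 2 * (1 - x\<^sup>2) powr (1 / \<sigma>) - x * J x) has_real_derivative 
        \<sigma> / 2 * (- (2 / \<sigma>) * x * (1 - x\<^sup>2) powr (1 / \<sigma> - 1)) - (1 * J x + - ((1 - x\<^sup>2) powr (1 / \<sigma> - 1)) * x)) (at x)"
      by (intro DERIV_diff DERIV_cmult DERIV_mult DERIV_ident J_deriv sech_powr_deriv x1 x)
    moreover have "\<sigma> / 2 * (- (2 / \<sigma>) * x * (1 - x\<^sup>2) powr (1 / \<sigma> - 1)) - (1 * J x + - ((1 - x\<^sup>2) powr (1 / \<sigma> - 1)) * x) = - J x"
      using sigma_pos by (simp add: field_simps)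
    ultimately show "\<exists>y. ((\<lambda>x. \<sigma> / 2 * (1 - x\<^sup>2) powr (1 / \<sigma>) - x * J x) has_real_derivative y) (at x) \<and> y < 0"
      using J_pos[of x] x x1 by (intro exI[of _ "- J x"] conjI) (simp_all only: neg_less_0_iff_less less_imp_le)
  next
    show "continuous_on {\<theta>..1} (\<lambda>x. \<sigma> / 2 * (1 - x\<^sup>2) powr (1 / \<sigma>) - x * J x)"
      using assms by (intro continuous_intros continuous_on_subset[OF J_continuous] continuous_on_subset[OF sech_powr_continuous]) auto
  qed
  then show ?thesis by simp
qed

lemma N_pos: "-1 \<le> \<theta> \<Longrightarrow> \<theta> < 1 \<Longrightarrow> N \<theta> > 0"
  using J_pos[of \<theta>] CJ_pos by (simp add: N_def)

lemma N_continuous: "continuous_on {-1..<1} N"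
proof -
  have "continuous_on {-1..<1} (\<lambda>\<theta>. CJ * J \<theta>)"
    by (intro continuous_intros continuous_on_subset[OF J_continuous]) auto
  moreover have "\<forall>x\<in>{-1..<1}. CJ * J x \<noteq> 0"
    using J_pos CJ_pos by (auto simp: less_imp_neq[symmetric])
  ultimately show ?thesis
    unfolding N_def[abs_def] by (rule continuous_on_powr[OF _ continuous_on_const])
qed

lemma N_deriv:
  assumes "-1 < \<theta>" "\<theta> < 1"
  shows "(N has_real_derivative N \<theta> * (\<sigma> / (2 - \<sigma>)) * (1 - \<theta>\<^sup>2) powr (1 / \<sigma> - 1) / J \<theta>) (at \<theta>)"
proof -
  have j: "J \<theta> > 0" using assms J_pos by simp
  have "((\<lambda>\<theta>. CJ * J \<theta>) has_real_derivative CJ * - ((1 - \<theta>\<^sup>2) powr (1 / \<sigma> - 1))) (at \<theta>)"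
    by (intro DERIV_cmult J_deriv assms)
  from DERIV_powr[OF this _ DERIV_const, of "- \<sigma> / (2 - \<sigma>)"]
  have "(N has_real_derivative (CJ * J \<theta>) powr (- \<sigma> / (2 - \<sigma>)) * (CJ * - ((1 - \<theta>\<^sup>2) powr (1 / \<sigma> - 1)) * (- \<sigma> / (2 - \<sigma>)) / (CJ * J \<theta>))) (at \<theta>)"
    unfolding N_def[abs_def] using j CJ_pos by simp
  moreover have "(CJ * J \<theta>) powr (- \<sigma> / (2 - \<sigma>)) * (CJ * - ((1 - \<theta>\<^sup>2) powr (1 / \<sigma> - 1)) * (- \<sigma> / (2 - \<sigma>)) / (CJ * J \<theta>))
     = N \<theta> * (\<sigma> / (2 - \<sigma>)) * (1 - \<theta>\<^sup>2) powr (1 / \<sigma> - 1) / J \<theta>"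
    unfolding N_def[symmetric] using CJ_pos j sigma_less by (simp add: divide_simps)
  ultimately show ?thesis by (simp only:)
qed

lemma N_mono:
  assumes "-1 \<le> a" "a \<le> b" "b < 1"
  shows "N a \<le> N b"
proof (cases "a = b")
  case False
  then have "J b < J a" "J b > 0" using assms J_strict_decreasing[of a b] J_pos[of b] by auto
  then show ?thesis unfolding N_def using CJ_pos sigma_pos sigma_less
    by (intro powr_mono2') (auto intro!: divide_nonpos_nonneg mult_left_mono)
qed simp

text \<open>The exponents satisfy
  \<open>- 2 / (2 - \<sigma>) = - \<sigma> / (2 - \<sigma>) - 1\<close>, so the power of
  \<open>(N \<theta>)\<^sup>2\<close> collapses to \<open>N \<theta>\<close> divided by
  \<open>CJ * J \<theta>\<close>. In this form \<open>R\<close> can be compared with the bounds on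
  \<open>J\<close>.\<close>

lemma R_alt:
  assumes "-1 \<le> \<theta>" "\<theta> < 1"
  shows "R \<theta> = \<sigma> * N \<theta> * (1 - \<theta>\<^sup>2) powr (1 / \<sigma>) / J \<theta>"
proof -
  define X where "X = CJ * J \<theta>"
  have X: "X > 0" using J_pos[OF assms] CJ_pos by (simp add: X_def)
  have n: "N \<theta> = X powr (- \<sigma> / (2 - \<sigma>))" by (simp add: N_def X_def)
  have t: "\<theta>\<^sup>2 \<le> 1" using sq_le_1 assms by auto
  have "((N \<theta>)\<^sup>2) powr (1 / \<sigma>) = X powr (- 2 / (2 - \<sigma>))"
    using X sigma_pos by (simp add: n powr_powr powr_realpow[symmetric] powr_power[symmetric] del: powr_realpow flip: powr_numeral)
  also have "- 2 / (2 - \<sigma>) = - \<sigma> / (2 - \<sigma>) + - 1" using sigma_less by (simp add: field_simps)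
  also have "X powr (- \<sigma> / (2 - \<sigma>) + - 1) = N \<theta> / X"
    unfolding powr_add n using X by (simp add: powr_minus divide_inverse)
  finally have "R \<theta> = (\<sigma> + 1) powr (1 / \<sigma>) * (N \<theta> / X) * (1 - \<theta>\<^sup>2) powr (1 / \<sigma>)"
    unfolding R_def using sigma_pos t by (simp add: powr_mult)
  also have "\<dots> = \<sigma> * N \<theta> * (1 - \<theta>\<^sup>2) powr (1 / \<sigma>) / J \<theta>"
    unfolding X_def CJ_def using sigma_pos J_pos[OF assms] by (simp add: field_simps)
  finally show ?thesis .
qed

lemma R_powr:
  assumes "-1 \<le> \<theta>" "\<theta> < 1"
  shows "R \<theta> powr \<sigma> = (\<sigma> + 1) * (N \<theta>)\<^sup>2 * (1 - \<theta>\<^sup>2)"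
  unfolding R_def using sigma_pos sq_le_1[of \<theta>] assms by (simp add: powr_powr)

lemma R_le: "-1 \<le> \<theta> \<Longrightarrow> \<theta> < 1 \<Longrightarrow> R \<theta> \<le> 2 * N \<theta>"
  using J_lower[of \<theta>] J_pos[of \<theta>] N_pos[of \<theta>] 
  by (simp add: R_alt field_simps)

lemma R_ge: 
  assumes "-1 \<le> \<theta>" "\<theta> < 1"
  shows "2 * \<theta> * N \<theta> \<le> R \<theta>"
proof -
  have "N \<theta> * (2 * (\<theta> * J \<theta>)) \<le> N \<theta> * (\<sigma> * (1 - \<theta>\<^sup>2) powr (1 / \<sigma>))"
    using J_upper[OF assms] N_pos[OF assms] by (intro mult_left_mono) auto
  then show ?thesis using J_pos[OF assms] by (simp add: R_alt[OF assms] field_simps)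
qed

text \<open>\<open>R \<theta>\<close> times the logarithmic derivative of its defining power, with
  that of \<open>N\<close> inserted.\<close>

definition R' :: "real \<Rightarrow> real" where
  "R' \<theta> = R \<theta> / \<sigma> * (2 * \<sigma> / (2 - \<sigma>) * (1 - \<theta>\<^sup>2) powr (1 / \<sigma> - 1) / J \<theta> - 2 * \<theta> / (1 - \<theta>\<^sup>2))"

lemma R_deriv:
  assumes "-1 < \<theta>" "\<theta> < 1"
  shows "(R has_real_derivative R' \<theta>) (at \<theta>)"
proof -
  define e where "e = (1 - \<theta>\<^sup>2) powr (1 / \<sigma> - 1)"
  have t: "1 - \<theta>\<^sup>2 > 0" using sq_less_1[OF assms] by simp
  have j: "J \<theta> > 0" using assms J_pos by simp
  have P: "(1 - \<theta>\<^sup>2) powr (1 / \<sigma>) = e * (1 - \<theta>\<^sup>2)" unfolding e_def using t by (simp add: powr_diff)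
  have "((\<lambda>\<theta>. \<sigma> * N \<theta> * (1 - \<theta>\<^sup>2) powr (1 / \<sigma>) / J \<theta>) has_real_derivative
     ((\<sigma> * (N \<theta> * (\<sigma> / (2 - \<sigma>)) * (1 - \<theta>\<^sup>2) powr (1 / \<sigma> - 1) / J \<theta>) * (1 - \<theta>\<^sup>2) powr (1 / \<sigma>)
       + - (2 / \<sigma>) * \<theta> * (1 - \<theta>\<^sup>2) powr (1 / \<sigma> - 1) * (\<sigma> * N \<theta>)) * J \<theta>
      - \<sigma> * N \<theta> * (1 - \<theta>\<^sup>2) powr (1 / \<sigma>) * - ((1 - \<theta>\<^sup>2) powr (1 / \<sigma> - 1))) / (J \<theta> * J \<theta>)) (at \<theta>)"
    using j by (intro DERIV_divide DERIV_mult DERIV_cmult N_deriv J_deriv sech_powr_deriv assms) auto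
  moreover have "((\<sigma> * (N \<theta> * (\<sigma> / (2 - \<sigma>)) * (1 - \<theta>\<^sup>2) powr (1 / \<sigma> - 1) / J \<theta>) * (1 - \<theta>\<^sup>2) powr (1 / \<sigma>)
       + - (2 / \<sigma>) * \<theta> * (1 - \<theta>\<^sup>2) powr (1 / \<sigma> - 1) * (\<sigma> * N \<theta>)) * J \<theta>
      - \<sigma> * N \<theta> * (1 - \<theta>\<^sup>2) powr (1 / \<sigma>) * - ((1 - \<theta>\<^sup>2) powr (1 / \<sigma> - 1))) / (J \<theta> * J \<theta>) = R' \<theta>"
    unfolding R'_def R_alt[OF less_imp_le[OF assms(1)] assms(2)] P e_def[symmetric]
    using t j sigma_pos sigma_less by (simp add: divide_simps) algebra
  ultimately have "((\<lambda>\<theta>. \<sigma> * N \<theta> * (1 - \<theta>\<^sup>2) powr (1 / \<sigma>) / J \<theta>) has_real_derivative R' \<theta>) (at \<theta>)" by simp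
  then show ?thesis
    by (rule has_field_derivative_transform_within_open[where S = "{-1<..<1}"]) (use assms in \<open>auto simp: R_alt\<close>)
qed

lemma R_pos: "-1 < \<theta> \<Longrightarrow> \<theta> < 1 \<Longrightarrow> R \<theta> > 0"
  using N_pos[of \<theta>] sq_less_1[of \<theta>] sigma_pos unfolding R_def by auto

text \<open>With the coefficient \<open>\<sigma>\<close> in place of
  \<open>2 * \<sigma> / (2 - \<sigma>)\<close> positivity is exactly \<open>J_upper\<close>, and the
  true coefficient is larger. Hence mass and endpoint density determine the slope of a piece, which
  makes \<open>W\<close> single-valued.\<close>

lemma R'_pos:
  assumes "-1 < \<theta>" "\<theta> < 1"
  shows "R' \<theta> > 0"
proof -
  define P where "P = (1 - \<theta>\<^sup>2) powr (1 / \<sigma>)"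
  have t: "1 - \<theta>\<^sup>2 > 0" using sq_less_1[OF assms] by simp
  have j: "J \<theta> > 0" using assms J_pos by simp
  have e: "(1 - \<theta>\<^sup>2) powr (1 / \<sigma> - 1) = P / (1 - \<theta>\<^sup>2)" unfolding P_def using t by (simp add: powr_diff)
  have Ppos: "P > 0" unfolding P_def using t by simp
  have "2 * \<theta> < \<sigma> * P / J \<theta>"
    using J_upper[of \<theta>] assms j unfolding P_def[symmetric] by (simp add: field_simps)
  also have "\<dots> \<le> 2 * \<sigma> / (2 - \<sigma>) * P / J \<theta>"
  proof -
    have "\<sigma> \<le> 2 * \<sigma> / (2 - \<sigma>)" using sigma_pos sigma_less by (simp add: field_simps)
    then show ?thesis using Ppos j by (intro divide_right_mono mult_right_mono) auto
  qed
  finally have "0 < (2 * \<sigma> / (2 - \<sigma>) * P / J \<theta> - 2 * \<theta>) / (1 - \<theta>\<^sup>2)" using t by simp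
  also have "\<dots> = 2 * \<sigma> / (2 - \<sigma>) * (1 - \<theta>\<^sup>2) powr (1 / \<sigma> - 1) / J \<theta> - 2 * \<theta> / (1 - \<theta>\<^sup>2)"
    unfolding e by (simp add: diff_divide_distrib)
  finally show ?thesis unfolding R'_def using R_pos[OF assms] sigma_pos by simp
qed

lemma R_continuous: "continuous_on {-1..<1} R"
proof -
  have "continuous_on {-1..<1} (\<lambda>\<theta>. \<sigma> * N \<theta> * (1 - \<theta>\<^sup>2) powr (1 / \<sigma>) / J \<theta>)"
    using J_pos by (intro continuous_intros N_continuous continuous_on_subset[OF J_continuous] continuous_on_subset[OF sech_powr_continuous]) 
      (auto simp: less_imp_neq[symmetric])
  then show ?thesis by (rule continuous_on_eq) (simp add: R_alt)
qed

lemma R_m1 [simp]: "R (-1) = 0"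
  by (simp add: R_def)

lemma R_strict_mono:
  assumes "-1 \<le> a" "a < b" "b < 1"
  shows "R a < R b"
proof (rule DERIV_pos_imp_increasing_open[OF assms(2)])
  fix x assume x: "a < x" "x < b"
  then show "\<exists>y. (R has_real_derivative y) (at x) \<and> 0 < y"
    using R_deriv[of x] R'_pos[of x] assms by auto
qed (use assms in \<open>auto intro: continuous_on_subset[OF R_continuous]\<close>)

lemma N_unbounded: "\<exists>\<theta>. 1 / 2 \<le> \<theta> \<and> \<theta> < 1 \<and> N \<theta> \<ge> M"
proof -
  define M' where "M' = max M 1"
  \<comment> \<open>The value of \<open>J\<close> at which \<open>N\<close> equals
    \<open>M'\<close>; continuity of \<open>J\<close> at 1 brings \<open>J\<close> below it.\<close>
  define x where "x = M' powr (- (2 - \<sigma>) / \<sigma>) / CJ"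
  have x: "x > 0" unfolding x_def M'_def using CJ_pos by auto
  have "(J \<longlongrightarrow> J 1) (at 1 within {-1..1})"
    using J_continuous unfolding continuous_on_def by (rule bspec) simp
  then have "\<forall>\<^sub>F \<theta> in at 1 within {-1..1}. J \<theta> < x"
    using order_tendstoD(2)[of J "J 1" "at 1 within {-1..1}" x] x by simp
  then obtain d where d: "d > 0" "\<And>\<theta>. \<theta> \<in> {-1..1} \<Longrightarrow> \<theta> \<noteq> 1 \<Longrightarrow> dist \<theta> 1 < d \<Longrightarrow> J \<theta> < x"
    unfolding eventually_at by auto
  define \<theta> where "\<theta> = max (1 / 2) (1 - d / 2)"
  have t: "1 / 2 \<le> \<theta>" "\<theta> < 1" "dist \<theta> 1 < d" using d(1) by (auto simp: \<theta>_def dist_real_def)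
  then have jx: "J \<theta> < x" using d(2)[of \<theta>] by auto
  have "M' = (CJ * x) powr (- \<sigma> / (2 - \<sigma>))"
  proof -
    have "- (2 - \<sigma>) / \<sigma> * (- \<sigma> / (2 - \<sigma>)) = 1" using sigma_pos sigma_less by (simp add: field_simps)
    then have "(M' powr (- (2 - \<sigma>) / \<sigma>)) powr (- \<sigma> / (2 - \<sigma>)) = M'" by (simp only: powr_powr) (simp add: M'_def)
    moreover have "CJ * x = M' powr (- (2 - \<sigma>) / \<sigma>)" unfolding x_def using CJ_pos by simp
    ultimately show ?thesis by simp
  qed
  also have "\<dots> \<le> (CJ * J \<theta>) powr (- \<sigma> / (2 - \<sigma>))"
    using jx J_pos[of \<theta>] t CJ_pos sigma_pos sigma_less
    by (intro powr_mono2') (auto intro!: divide_nonpos_nonneg mult_left_mono)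
  finally show ?thesis using t unfolding N_def M'_def by (intro exI[of _ \<theta>]) auto
qed

lemma R_surj:
  assumes "y \<ge> 0"
  shows "\<exists>!\<theta>. -1 \<le> \<theta> \<and> \<theta> < 1 \<and> R \<theta> = y"
proof -
  obtain b where b: "1 / 2 \<le> b" "b < 1" "N b \<ge> y" using N_unbounded by blast
  have "y \<le> R b"
  proof -
    have "N b \<le> 2 * b * N b" using b N_pos[of b] by (simp add: field_simps)
    then show ?thesis using R_ge[of b] b by linarith
  qed
  moreover have "continuous_on {-1..b} R" by (rule continuous_on_subset[OF R_continuous]) (use b in auto)
  ultimately obtain x where "-1 \<le> x" "x \<le> b" "R x = y"
    using IVT'[of R "-1" y b] assms b by auto
  note x = this
  have "\<theta> = x" if "-1 \<le> \<theta>" "\<theta> < 1" "R \<theta> = y" for \<theta>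
  proof (rule ccontr)
    assume "\<theta> \<noteq> x"
    then consider "\<theta> < x" | "x < \<theta>" by linarith
    then show False
    proof cases
      case 1
      from R_strict_mono[OF that(1) 1] x b that(3) show False by simp
    next
      case 2
      from R_strict_mono[OF x(1) 2 that(2)] x(3) that(3) show False by simp
    qed
  qed
  note uniq = this
  have "x < 1" using x b by simp
  then show ?thesis using x uniq by blast
qed

text \<open>Inverse of \<open>R\<close>, extended to negative arguments by the constant -1, which
  keeps it continuous on the whole line.\<close>

definition \<Theta> :: "real \<Rightarrow> real" where
  "\<Theta> y = (THE \<theta>. -1 \<le> \<theta> \<and> \<theta> < 1 \<and> R \<theta> = max y 0)"

lemma \<Theta>: "-1 \<le> \<Theta> y" "\<Theta> y < 1" "R (\<Theta> y) = max y 0"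
  using theI'[OF R_surj[of "max y 0"]] unfolding \<Theta>_def by auto

lemma \<Theta>_R: "-1 \<le> \<theta> \<Longrightarrow> \<theta> < 1 \<Longrightarrow> \<Theta> (R \<theta>) = \<theta>"
proof -
  assume a: "-1 \<le> \<theta>" "\<theta> < 1"
  then have "R \<theta> \<ge> 0" using R_pos[of \<theta>] by (cases "\<theta> = -1") auto
  then show ?thesis using \<Theta>[of "R \<theta>"] a R_surj[of "R \<theta>"] by (metis max.absorb1)
qed

lemma \<Theta>_nonpos: "y \<le> 0 \<Longrightarrow> \<Theta> y = -1"
  using \<Theta>_R[of "-1"] by (simp add: \<Theta>_def max_def)

lemma \<Theta>_gt: "y > 0 \<Longrightarrow> \<Theta> y > -1"
  using \<Theta>[of y] by (metis R_m1 less_eq_real_def max.absorb3 less_irrefl)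

lemma \<Theta>_less_iff: "y \<ge> 0 \<Longrightarrow> -1 \<le> \<theta> \<Longrightarrow> \<theta> < 1 \<Longrightarrow> \<Theta> y < \<theta> \<longleftrightarrow> y < R \<theta>"
  using \<Theta>[of y] R_strict_mono[of "\<Theta> y" \<theta>] R_strict_mono[of \<theta> "\<Theta> y"]
  by (metis linorder_neqE_linordered_idom less_asym less_irrefl max.absorb1)

lemma \<Theta>_mono: "x \<le> y \<Longrightarrow> \<Theta> x \<le> \<Theta> y"
  using \<Theta>[of y] \<Theta>[of x] R_strict_mono[of "\<Theta> y" "\<Theta> x"] by (cases "\<Theta> x \<le> \<Theta> y") auto

lemma \<Theta>_continuous: "continuous_on A \<Theta>"
proof -
  have "\<Theta> ` {0<..} = {-1<..<1}"
  proof
    show "\<Theta> ` {0<..} \<subseteq> {-1<..<1}" using \<Theta> \<Theta>_gt by auto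
    show "{-1<..<1} \<subseteq> \<Theta> ` {0<..}"
    proof
      fix t :: real assume "t \<in> {-1<..<1}"
      then show "t \<in> \<Theta> ` {0<..}" using \<Theta>_R[of t] R_pos[of t] by (intro image_eqI[of _ _ "R t"]) auto
    qed
  qed
  then have "continuous_on {0<..} \<Theta>"
    by (intro continuous_onI_mono) (auto intro: \<Theta>_mono)
  then have pos: "isCont \<Theta> y" if "y > 0" for y
    using that by (simp add: continuous_on_eq_continuous_at)
  have nonpos: "isCont \<Theta> y" if y: "y \<le> 0" for y
    unfolding continuous_at_eps_delta
  proof (intro allI impI)
    fix e :: real assume e: "e > 0"
    define t where "t = min (-1 + e) 0"
    have t: "-1 < t" "t < 1" "t \<le> -1 + e" using e by (auto simp: t_def)
    show "\<exists>d>0. \<forall>x'. dist x' y < d \<longrightarrow> dist (\<Theta> x') (\<Theta> y) < e"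
    proof (intro exI[of _ "R t"] conjI allI impI)
      show "R t > 0" using R_pos t by auto
      fix x assume "dist x y < R t"
      then have "x < R t" using y by (auto simp: dist_real_def)
      then have "\<Theta> x < t" using \<Theta>_less_iff[of x t] t \<Theta>_nonpos[of x] by (cases "x \<ge> 0") auto
      then show "dist (\<Theta> x) (\<Theta> y) < e" using \<Theta>_nonpos[OF y] \<Theta>(1)[of x] t by (auto simp: dist_real_def)
    qed
  qed
  show ?thesis using pos nonpos by (intro continuous_at_imp_continuous_on) (metis linorder_not_le)
qed

lemma isCont_\<Theta>: "isCont \<Theta> y"
  using \<Theta>_continuous[of UNIV] by (simp add: continuous_on_eq_continuous_at)

lemma \<Theta>_deriv:
  assumes "y > 0"
  shows "(\<Theta> has_real_derivative inverse (R' (\<Theta> y))) (at y)"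
proof (rule DERIV_inverse_function[where f = R and a = 0 and b = "y + 1"])
  show "(R has_real_derivative R' (\<Theta> y)) (at (\<Theta> y))" using \<Theta> \<Theta>_gt[OF assms] by (intro R_deriv) auto
  show "R' (\<Theta> y) \<noteq> 0" using R'_pos[of "\<Theta> y"] \<Theta> \<Theta>_gt[OF assms] by auto
qed (use assms \<Theta> isCont_\<Theta> in auto)

text \<open>A piece of unit mass has \<open>k = N \<theta>\<close> and inward logarithmic slope
  \<open>- k * \<theta>\<close>; half of \<open>k * \<theta>\<close> is the derivative of its energy
  with respect to the endpoint density.\<close>

definition v :: "real \<Rightarrow> real" where "v y = \<Theta> y * N (\<Theta> y) / 2"

text \<open>Homogeneity of the least energy turns its mass derivative \<open>- k\<^sup>2 / 2\<close>
  into a linear relation between \<open>w\<close> and \<open>v\<close>, namely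
  \<open>hamilton_jacobi_1\<close>; this is that relation solved for \<open>w\<close>.\<close>

definition w_alt :: "real \<Rightarrow> real" where
  "w_alt y = (2 * y * v y - (2 - \<sigma>) * (N (\<Theta> y))\<^sup>2 / 2) / (2 + \<sigma>)"

text \<open>Extended linearly to \<open>y < 0\<close> so that the one-sided derivative at the admissible end \<open>y = 0\<close> becomes two-sided.\<close>
definition w :: "real \<Rightarrow> real" where
  "w y = w_alt 0 + (if y \<ge> 0 then integral {0..y} v else v 0 * y)"

lemma N\<Theta>_continuous: "continuous_on A (\<lambda>y. N (\<Theta> y))"
  by (rule continuous_on_compose2[OF N_continuous \<Theta>_continuous]) (use \<Theta> in auto)

lemma N\<Theta>_pos: "N (\<Theta> y) > 0"
  using N_pos \<Theta> by auto

lemma v_continuous: "continuous_on A v"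
  unfolding v_def[abs_def] by (intro continuous_intros N\<Theta>_continuous \<Theta>_continuous) auto

lemma v_nonpos_arg: "y \<le> 0 \<Longrightarrow> v y = v 0"
  by (simp add: v_def \<Theta>_nonpos)

lemma integral_v_nonpos:
  assumes "r \<le> 0" "r \<ge> -1"
  shows "integral {-1..r} v = (r + 1) * v 0"
proof -
  have "integral {-1..r} v = integral {-1..r} (\<lambda>_. v 0)"
    by (rule Henstock_Kurzweil_Integration.integral_cong, rule v_nonpos_arg) (use assms in auto)
  then show ?thesis using assms by simp
qed

lemma w_deriv: "(w has_real_derivative v y) (at y)"
proof (cases "y < 0")
  case True
  have "((\<lambda>y. w_alt 0 + v 0 * y) has_real_derivative v y) (at y)"
    using v_nonpos_arg[OF less_imp_le[OF True]] by (auto intro!: derivative_eq_intros)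
  then show ?thesis
    by (rule has_field_derivative_transform_within_open[where S = "{..<0}"]) (use True in \<open>auto simp: w_def\<close>)
next
  case False
  define c where "c = w_alt 0 - integral {-1..0} v"
  have vi: "v integrable_on {a..b}" for a b by (intro integrable_continuous_real v_continuous)
  have "((\<lambda>u. integral {-1..u} v) has_real_derivative v y) (at y within {-1..y+1})"
    by (rule integral_has_real_derivative[OF v_continuous]) (use False in auto)
  moreover have "at y within {-1..y+1} = at y"
    by (rule at_within_interior) (use False in auto)
  ultimately have "((\<lambda>u. integral {-1..u} v) has_real_derivative v y) (at y)" by (simp only:)
  then have "((\<lambda>u. c + integral {-1..u} v) has_real_derivative v y) (at y)"
    by (auto intro!: derivative_eq_intros)
  then show ?thesis
  proof (rule has_field_derivative_transform_within_open[where S = "{-1<..}"])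
    fix u :: real assume u: "u \<in> {-1<..}"
    show "c + integral {-1..u} v = w u"
    proof (cases "u \<ge> 0")
      case True
      have "integral {-1..0} v + integral {0..u} v = integral {-1..u} v"
        using True by (intro Henstock_Kurzweil_Integration.integral_combine vi) auto
      moreover have "w u = w_alt 0 + integral {0..u} v" unfolding w_def if_P[OF True] ..
      ultimately show ?thesis unfolding c_def by linarith
    next
      case False
      have "integral {-1..u} v = (u + 1) * v 0" using u False by (intro integral_v_nonpos) auto
      moreover have "integral {-1..0} v = v 0" using integral_v_nonpos[of 0] by simp
      moreover have "w u = w_alt 0 + v 0 * u" unfolding w_def if_not_P[OF False] ..
      ultimately show ?thesis unfolding c_def by (simp add: algebra_simps)
    qed
  qed (use False in auto)
qed

text \<open>Consistency of the closed form: differentiating it returns the slope \<open>v\<close>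
  from which it is built. Once \<open>A\<close> and \<open>B\<close> have expressed the density and
  its derivative through \<open>n'\<close>, the claim is the identity \<open>C\<close>.\<close>

lemma w_alt_deriv:
  assumes y: "y > 0"
  shows "(w_alt has_real_derivative v y) (at y)"
proof -
  define \<theta> where "\<theta> = \<Theta> y"
  have t: "-1 < \<theta>" "\<theta> < 1" using \<Theta> \<Theta>_gt[OF y] by (auto simp: \<theta>_def)
  define n n' r' where "n = N \<theta>" and "n' = N \<theta> * (\<sigma> / (2 - \<sigma>)) * (1 - \<theta>\<^sup>2) powr (1 / \<sigma> - 1) / J \<theta>" and "r' = R' \<theta>"
  have r': "r' > 0" using R'_pos t by (simp add: r'_def)
  have T: "1 - \<theta>\<^sup>2 > 0" using sq_less_1[OF t] by simp
  have yR: "y = R \<theta>" using \<Theta>(3)[of y] y by (simp add: \<theta>_def)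
  have j: "J \<theta> > 0" and n: "n > 0" using J_pos[of \<theta>] N_pos[of \<theta>] t by (auto simp: n_def)
  have dT: "(\<Theta> has_real_derivative inverse r') (at y)" using \<Theta>_deriv[OF y] by (simp add: \<theta>_def r'_def)
  have dN: "((\<lambda>y. N (\<Theta> y)) has_real_derivative n' * inverse r') (at y)"
    by (rule DERIV_chain2[OF _ dT]) (use N_deriv[OF t] in \<open>simp add: n'_def \<theta>_def\<close>)
  have dv: "(v has_real_derivative (inverse r' * n + n' * inverse r' * \<theta>) / 2) (at y)"
    unfolding v_def[abs_def] using DERIV_cdivide[OF DERIV_mult[OF dT dN], of 2] by (simp add: n_def \<theta>_def)
  have "(w_alt has_real_derivative ((2 * v y + (inverse r' * n + n' * inverse r' * \<theta>) / 2 * (2 * y)) - (2 - \<sigma>) * (2 * (n' * inverse r') * n) / 2) / (2 + \<sigma>)) (at y)"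
  proof -
    have 1: "((\<lambda>y. 2 * y) has_real_derivative 2) (at y)" by (auto intro!: derivative_eq_intros)
    have 2: "((\<lambda>y. (N (\<Theta> y))\<^sup>2) has_real_derivative 2 * (n' * inverse r') * n) (at y)"
      using DERIV_power[OF dN, of 2] by (simp add: n_def \<theta>_def mult.assoc)
    have "((\<lambda>y. (2 * y * v y - (2 - \<sigma>) * (N (\<Theta> y))\<^sup>2 / 2) / (2 + \<sigma>)) has_real_derivative ((2 * v y + (inverse r' * n + n' * inverse r' * \<theta>) / 2 * (2 * y)) - (2 - \<sigma>) * (2 * (n' * inverse r') * n) / 2) / (2 + \<sigma>)) (at y)"
      by (intro DERIV_cdivide DERIV_diff DERIV_cmult DERIV_mult 1 2 dv)
    then show ?thesis by (simp add: w_alt_def[abs_def])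
  qed
  moreover have "((2 * v y + (inverse r' * n + n' * inverse r' * \<theta>) / 2 * (2 * y)) - (2 - \<sigma>) * (2 * (n' * inverse r') * n) / 2) / (2 + \<sigma>) = v y"
  proof -
    have vy: "v y = \<theta> * n / 2" by (simp add: v_def \<theta>_def n_def)
    have s2: "2 + \<sigma> \<noteq> 0" using sigma_pos by simp
    have A: "(2 - \<sigma>) * n' * (1 - \<theta>\<^sup>2) = y"
    proof -
      have "(1 - \<theta>\<^sup>2) powr (1 / \<sigma>) = (1 - \<theta>\<^sup>2) powr (1 / \<sigma> - 1) * (1 - \<theta>\<^sup>2)" using T by (simp add: powr_diff)
      then show ?thesis unfolding yR n'_def R_alt[OF less_imp_le[OF t(1)] t(2)] using sigma_less by simp
    qed
    have B: "\<sigma> * r' = y * (2 * n' / n - 2 * \<theta> / (1 - \<theta>\<^sup>2))"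
      unfolding r'_def R'_def yR[symmetric] n'_def n_def[symmetric] using sigma_pos n by simp
    have C: "y * (n + n' * \<theta>) - (2 - \<sigma>) * n' * n = \<sigma> * r' * (\<theta> * n / 2)"
    proof -
      have e1: "\<sigma> * r' * (\<theta> * n / 2) * (1 - \<theta>\<^sup>2) = y * (n' * \<theta> * (1 - \<theta>\<^sup>2) - \<theta>\<^sup>2 * n)"
        unfolding B using n T by (simp add: field_simps power2_eq_square)
      have e2: "(y * (n + n' * \<theta>) - (2 - \<sigma>) * n' * n) * (1 - \<theta>\<^sup>2) = y * (n + n' * \<theta>) * (1 - \<theta>\<^sup>2) - n * ((2 - \<sigma>) * n' * (1 - \<theta>\<^sup>2))"
        by (simp add: algebra_simps)
      have "(y * (n + n' * \<theta>) - (2 - \<sigma>) * n' * n) * (1 - \<theta>\<^sup>2) = \<sigma> * r' * (\<theta> * n / 2) * (1 - \<theta>\<^sup>2)"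
        unfolding e2 e1 A by (simp add: algebra_simps)
      then show ?thesis using T by simp
    qed
    have "(2 * v y + (inverse r' * n + n' * inverse r' * \<theta>) / 2 * (2 * y)) - (2 - \<sigma>) * (2 * (n' * inverse r') * n) / 2 
       = \<theta> * n + (y * (n + n' * \<theta>) - (2 - \<sigma>) * n' * n) / r'"
      unfolding vy using r' by (simp add: field_simps)
    also have "\<dots> = (2 + \<sigma>) * v y" unfolding C vy using r' by (simp add: field_simps)
    finally show ?thesis using s2 by simp
  qed
  ultimately show ?thesis by (simp only:)
qed

lemma w_eq: 
  assumes "y \<ge> 0"
  shows "w y = w_alt y"
proof (cases "y = 0")
  case False
  then have y: "y > 0" using assms by simp
  have "(\<lambda>y. w y - w_alt y) y = (\<lambda>y. w y - w_alt y) 0"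
  proof (rule DERIV_isconst2[OF y])
    have "continuous_on {0..y} w" by (intro continuous_at_imp_continuous_on ballI DERIV_isCont[OF w_deriv])
    moreover have "continuous_on {0..y} w_alt" unfolding w_alt_def[abs_def]
      using sigma_pos by (intro continuous_intros v_continuous N\<Theta>_continuous) auto
    ultimately show "continuous_on {0..y} (\<lambda>y. w y - w_alt y)" by (intro continuous_intros)
    fix x assume "0 < x" "x < y"
    then show "((\<lambda>y. w y - w_alt y) has_real_derivative 0) (at x)"
      using DERIV_diff[OF w_deriv w_alt_deriv[of x]] by simp
  qed (use y in auto)
  then show ?thesis by (simp add: w_def)
qed (simp add: w_def)

lemma hamilton_jacobi_1: 
  assumes "y \<ge> 0"
  shows "(2 + \<sigma>) / (2 - \<sigma>) * w y - 2 / (2 - \<sigma>) * y * v y = - (N (\<Theta> y))\<^sup>2 / 2"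
  using sigma_less sigma_pos unfolding w_eq[OF assms] w_alt_def by (simp add: divide_simps) (simp add: algebra_simps)

text \<open>The first integral of the soliton equation at the endpoint: the kinetic part carries the
  fraction \<open>(\<Theta> y)\<^sup>2\<close> of \<open>(N (\<Theta> y))\<^sup>2 / 2\<close>, the
  nonlinear part the rest.\<close>

lemma hamilton_jacobi_2:
  assumes "y \<ge> 0"
  shows "2 * (v y)\<^sup>2 + 1 / (2 * \<sigma> + 2) * y powr \<sigma> = (N (\<Theta> y))\<^sup>2 / 2"
proof -
  have e1: "y powr \<sigma> = (\<sigma> + 1) * (N (\<Theta> y))\<^sup>2 * (1 - (\<Theta> y)\<^sup>2)"
    using R_powr[OF \<Theta>(1,2)[of y]] \<Theta>(3)[of y] assms by simp
  have e2: "1 / (2 * \<sigma> + 2) * ((\<sigma> + 1) * (N (\<Theta> y))\<^sup>2 * (1 - (\<Theta> y)\<^sup>2)) = (N (\<Theta> y))\<^sup>2 * (1 - (\<Theta> y)\<^sup>2) / 2"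
    using sigma_pos by (simp add: divide_simps) (simp add: algebra_simps)
  show ?thesis unfolding e1 e2 by (simp add: v_def power_divide power_mult_distrib field_simps)
qed

lemma v_le: 
  assumes "y \<ge> 0"
  shows "v y \<le> y / 4"
proof -
  have "2 * \<Theta> y * N (\<Theta> y) \<le> y" using R_ge[OF \<Theta>(1,2)[of y]] \<Theta>(3)[of y] assms by simp
  then show ?thesis by (simp add: v_def)
qed

lemma w_0: "w 0 = - (2 - \<sigma>) / (2 * (2 + \<sigma>)) * (N (-1))\<^sup>2"
  using w_eq[of 0] sigma_pos by (simp add: w_alt_def \<Theta>_nonpos field_simps)

lemma w_0_neg: "w 0 < 0"
  using N_pos[of "-1"] sigma_pos sigma_less unfolding w_0 by (intro mult_neg_pos) (auto simp: divide_neg_pos)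

lemma w_le:
  assumes "y \<ge> 0"
  shows "w y \<le> y\<^sup>2 / 8"
proof -
  have "(\<lambda>y. w y - y\<^sup>2 / 8) y \<le> (\<lambda>y. w y - y\<^sup>2 / 8) 0"
  proof (rule DERIV_nonpos_imp_nonincreasing[OF assms])
    fix x :: real assume "0 \<le> x" "x \<le> y"
    moreover have "((\<lambda>y. w y - y\<^sup>2 / 8) has_real_derivative v x - x / 4) (at x)"
      by (auto intro!: derivative_eq_intros w_deriv)
    ultimately show "\<exists>d. ((\<lambda>y. w y - y\<^sup>2 / 8) has_real_derivative d) (at x) \<and> d \<le> 0"
      using v_le[of x] by (intro exI[of _ "v x - x / 4"]) auto
  qed
  then show ?thesis using w_0_neg by simp
qed

text \<open>The split is at slope 1/2. From there on \<open>v y\<close> is at least a quarter of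
  \<open>N (\<Theta> y)\<close>, while \<open>y \<le> 2 * N (\<Theta> y)\<close>; below it
  \<open>y\<close> and \<open>N (\<Theta> y)\<close> are at most \<open>R (1 / 2)\<close> and
  \<open>N (1 / 2)\<close>, which the constant absorbs.\<close>

lemma v_ge:
  assumes "y \<ge> 0"
  shows "y / 8 - (R (1 / 2) / 8 + N (1 / 2) / 2) \<le> v y"
proof (cases "\<Theta> y < 1 / 2")
  case True
  then have "y \<le> R (1 / 2)" using \<Theta>_less_iff[of y "1 / 2"] assms by simp
  moreover have "- N (1 / 2) / 2 \<le> v y"
  proof -
    have "N (\<Theta> y) \<le> N (1 / 2)" using N_mono[of "\<Theta> y" "1 / 2"] True \<Theta> by simp
    moreover have "- N (\<Theta> y) \<le> \<Theta> y * N (\<Theta> y)"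
      using mult_right_mono[OF \<Theta>(1)[of y], of "N (\<Theta> y)"] N\<Theta>_pos[of y] by simp
    ultimately show ?thesis unfolding v_def by simp
  qed
  ultimately show ?thesis by simp
next
  case False
  have "y \<le> 2 * N (\<Theta> y)" using R_le[OF \<Theta>(1,2)[of y]] \<Theta>(3)[of y] assms by simp
  moreover have "1 / 2 * N (\<Theta> y) \<le> \<Theta> y * N (\<Theta> y)" using False N\<Theta>_pos[of y] by (intro mult_right_mono) auto
  moreover have "R (1 / 2) \<ge> 0" "N (1 / 2) \<ge> 0" using R_pos[of "1 / 2"] N_pos[of "1 / 2"] by auto
  ultimately show ?thesis by (simp add: v_def)
qed

text \<open>Integrating \<open>v_ge\<close> gives \<open>y\<^sup>2 / 16 - k * y\<close> up to the
  constant \<open>w 0\<close>; completing the square trades half of the quadratic term for the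
  linear one. This quadratic growth later beats the linear attractive term at the jump.\<close>

lemma w_ge:
  obtains K where "K \<ge> 0" "\<And>y. y \<ge> 0 \<Longrightarrow> y\<^sup>2 / 32 - K \<le> w y"
proof -
  define k where "k = R (1 / 2) / 8 + N (1 / 2) / 2"
  define K where "K = 8 * k\<^sup>2 - w 0"
  have "y\<^sup>2 / 32 - K \<le> w y" if y: "y \<ge> 0" for y
  proof -
    have "(\<lambda>y. w y - (y\<^sup>2 / 16 - k * y)) 0 \<le> (\<lambda>y. w y - (y\<^sup>2 / 16 - k * y)) y"
    proof (rule DERIV_nonneg_imp_nondecreasing[OF y])
      fix x :: real assume "0 \<le> x" "x \<le> y"
      moreover have "((\<lambda>y. w y - (y\<^sup>2 / 16 - k * y)) has_real_derivative v x - (x / 8 - k)) (at x)"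
        by (auto intro!: derivative_eq_intros w_deriv)
      ultimately show "\<exists>d. ((\<lambda>y. w y - (y\<^sup>2 / 16 - k * y)) has_real_derivative d) (at x) \<and> d \<ge> 0"
        using v_ge[of x] by (intro exI[of _ "v x - (x / 8 - k)"]) (auto simp: k_def)
    qed
    moreover have "y\<^sup>2 / 32 - k * y + 8 * k\<^sup>2 \<ge> 0"
      using zero_le_power2[of "y - 16 * k"] by (simp add: power2_eq_square algebra_simps)
    ultimately show ?thesis by (simp add: K_def)
  qed
  moreover have "K \<ge> 0" using w_0_neg zero_le_power2[of k] unfolding K_def by linarith
  ultimately show ?thesis using that by blast
qed

end

section \<open>Square integrable functions\<close>

lemma L2_on_measurable: "L2_on A u \<Longrightarrow> (\<lambda>x. indicator A x *\<^sub>R u x) \<in> borel_measurable lborel"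
  unfolding L2_on_def set_borel_measurable_def by simp

lemma L2_on_normsq: "L2_on A u \<Longrightarrow> set_integrable lborel A (\<lambda>x. (norm (u x))\<^sup>2)"
  unfolding L2_on_def by simp

lemma L2_on_mult:
  assumes "L2_on A u" "L2_on A v"
  shows "set_integrable lborel A (\<lambda>x. u x * v x)"
proof -
  have i: "integrable lborel (\<lambda>x. indicator A x *\<^sub>R (norm (u x))\<^sup>2 + indicator A x *\<^sub>R (norm (v x))\<^sup>2)"
    using L2_on_normsq[OF assms(1)] L2_on_normsq[OF assms(2)] unfolding set_integrable_def
    by (rule Bochner_Integration.integrable_add)
  have "(\<lambda>x. (indicator A x *\<^sub>R u x) * (indicator A x *\<^sub>R v x)) \<in> borel_measurable lborel"
    by (intro borel_measurable_times L2_on_measurable assms)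
  moreover have "(\<lambda>x. (indicator A x *\<^sub>R u x) * (indicator A x *\<^sub>R v x)) = (\<lambda>x. indicator A x *\<^sub>R (u x * v x))"
    by (auto simp: indicator_def)
  ultimately have m: "(\<lambda>x. indicator A x *\<^sub>R (u x * v x)) \<in> borel_measurable lborel" by simp
  have b: "norm (indicator A x *\<^sub>R (u x * v x)) \<le> norm (indicator A x *\<^sub>R (norm (u x))\<^sup>2 + indicator A x *\<^sub>R (norm (v x))\<^sup>2)" for x
  proof -
    have "0 \<le> (norm (u x) - norm (v x))\<^sup>2" by simp
    then have "2 * (norm (u x) * norm (v x)) \<le> (norm (u x))\<^sup>2 + (norm (v x))\<^sup>2"
      by (simp add: power2_diff algebra_simps)
    moreover have "0 \<le> norm (u x) * norm (v x)" by simp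
    ultimately have "norm (u x) * norm (v x) \<le> (norm (u x))\<^sup>2 + (norm (v x))\<^sup>2" by linarith
    then show ?thesis by (simp add: indicator_def norm_mult)
  qed
  show ?thesis unfolding set_integrable_def
    by (rule Bochner_Integration.integrable_bound[OF i m AE_I2]) (rule b)
qed

lemma L2_on_cnj: "L2_on A u \<Longrightarrow> L2_on A (\<lambda>x. cnj (u x))"
proof -
  assume u: "L2_on A u"
  have "(\<lambda>x. cnj (indicator A x *\<^sub>R u x)) \<in> borel_measurable lborel"
    by (rule borel_measurable_continuous_on[OF _ L2_on_measurable[OF u]]) (intro continuous_intros)
  then have "(\<lambda>x. indicator A x *\<^sub>R cnj (u x)) \<in> borel_measurable lborel" by simp
  then show ?thesis using u unfolding L2_on_def set_borel_measurable_def by simp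
qed

lemma L2_on_scaleR: 
  assumes "L2_on A u"
  shows "L2_on A (\<lambda>x. (c::real) *\<^sub>R u x)"
proof -
  have "(\<lambda>x. c *\<^sub>R (indicator A x *\<^sub>R u x)) \<in> borel_measurable lborel"
    by (rule borel_measurable_const_scaleR[OF L2_on_measurable[OF assms]])
  then have "(\<lambda>x. indicator A x *\<^sub>R (c *\<^sub>R u x)) \<in> borel_measurable lborel" by (simp add: mult.commute)
  then show ?thesis using L2_on_normsq[OF assms] unfolding L2_on_def set_borel_measurable_def
    by (simp add: power_mult_distrib)
qed

lemma L2_on_add:
  assumes "L2_on A u" "L2_on A v"
  shows "L2_on A (\<lambda>x. u x + v x)"
proof -
  have "(\<lambda>x. indicator A x *\<^sub>R u x + indicator A x *\<^sub>R v x) \<in> borel_measurable lborel"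
    by (intro borel_measurable_add L2_on_measurable assms)
  then have m: "(\<lambda>x. indicator A x *\<^sub>R (u x + v x)) \<in> borel_measurable lborel" by (simp add: scaleR_add_right)
  have i: "integrable lborel (\<lambda>x. 2 * (indicator A x *\<^sub>R (norm (u x))\<^sup>2 + indicator A x *\<^sub>R (norm (v x))\<^sup>2))"
    using L2_on_normsq[OF assms(1)] L2_on_normsq[OF assms(2)] unfolding set_integrable_def
    by (intro Bochner_Integration.integrable_add integrable_mult_right)
  have "(\<lambda>x. (norm (indicator A x *\<^sub>R (u x + v x)))\<^sup>2) \<in> borel_measurable lborel"
    using m by measurable
  moreover have "(\<lambda>x. (norm (indicator A x *\<^sub>R (u x + v x)))\<^sup>2) = (\<lambda>x. indicator A x *\<^sub>R (norm (u x + v x))\<^sup>2)"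
    by (auto simp: indicator_def)
  ultimately have m2: "(\<lambda>x. indicator A x *\<^sub>R (norm (u x + v x))\<^sup>2) \<in> borel_measurable lborel" by simp
  have b: "norm (indicator A x *\<^sub>R (norm (u x + v x))\<^sup>2) \<le> norm (2 * (indicator A x *\<^sub>R (norm (u x))\<^sup>2 + indicator A x *\<^sub>R (norm (v x))\<^sup>2))" for x
  proof -
    have "(norm (u x + v x))\<^sup>2 \<le> (norm (u x) + norm (v x))\<^sup>2" by (intro power_mono norm_triangle_ineq) auto
    moreover have "0 \<le> (norm (u x) - norm (v x))\<^sup>2" by simp
    ultimately have "(norm (u x + v x))\<^sup>2 \<le> 2 * ((norm (u x))\<^sup>2 + (norm (v x))\<^sup>2)"
      by (simp add: power2_diff power2_sum)
    then show ?thesis by (simp add: indicator_def)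
  qed
  have "set_integrable lborel A (\<lambda>x. (norm (u x + v x))\<^sup>2)"
    unfolding set_integrable_def by (rule Bochner_Integration.integrable_bound[OF i m2 AE_I2]) (rule b)
  then show ?thesis using m unfolding L2_on_def set_borel_measurable_def by simp
qed

lemma L2_on_subset:
  assumes "L2_on A u" "B \<subseteq> A" "B \<in> sets lborel"
  shows "L2_on B u"
proof -
  have "(\<lambda>x. indicator B x *\<^sub>R (indicator A x *\<^sub>R u x)) \<in> borel_measurable lborel"
    using L2_on_measurable[OF assms(1)] assms(3) by measurable
  moreover have "(\<lambda>x. indicator B x *\<^sub>R (indicator A x *\<^sub>R u x)) = (\<lambda>x. indicator B x *\<^sub>R u x)"
    using assms(2) by (auto simp: indicator_def fun_eq_iff)
  ultimately show ?thesis
    using set_integrable_subset[OF L2_on_normsq[OF assms(1)] assms(3,2)] unfolding L2_on_def set_borel_measurable_def by simp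
qed

lemma quadratic_nonneg_imp_discrim:
  fixes a b c :: real
  assumes "\<And>t. 0 \<le> a + 2 * t * b + t\<^sup>2 * c" "c \<ge> 0"
  shows "b\<^sup>2 \<le> a * c"
proof (cases "c = 0")
  case True
  have "b = 0"
  proof (rule ccontr)
    assume "b \<noteq> 0"
    then show False using assms(1)[of "- (a + 1) / (2 * b)"] True by (simp add: field_simps)
  qed
  then show ?thesis using True by simp
next
  case False
  have "0 \<le> c * (a + 2 * (- b / c) * b + (- b / c)\<^sup>2 * c)"
    by (rule mult_nonneg_nonneg) (rule assms)+
  also have "\<dots> = a * c - b\<^sup>2" using False by (simp add: field_simps power2_eq_square)
  finally show ?thesis by simp
qed

lemma L2_normsq_nonneg: "L2_normsq_on A u \<ge> 0"
  unfolding L2_normsq_on_def set_lebesgue_integral_def by (intro Bochner_Integration.integral_nonneg) auto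

lemma cauchy_schwarz_L2:
  assumes u: "L2_on A u" and v: "L2_on A v"
  shows "(LINT x:A|lborel. norm (u x) * norm (v x))\<^sup>2 \<le> L2_normsq_on A u * L2_normsq_on A v"
    and "(norm (LINT x:A|lborel. u x * v x))\<^sup>2 \<le> L2_normsq_on A u * L2_normsq_on A v"
proof -
  define I where "I = (LINT x:A|lborel. norm (u x) * norm (v x))"
  have ii: "set_integrable lborel A (\<lambda>x. norm (u x) * norm (v x))"
    using set_integrable_norm[OF L2_on_mult[OF u v]] by (simp add: norm_mult)
  have "0 \<le> L2_normsq_on A u + 2 * t * I + t\<^sup>2 * L2_normsq_on A v" for t
  proof -
    have "0 \<le> (LINT x:A|lborel. (norm (u x) + t * norm (v x))\<^sup>2)"
      unfolding set_lebesgue_integral_def by (intro Bochner_Integration.integral_nonneg) auto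
    also have "\<dots> = (LINT x:A|lborel. (norm (u x))\<^sup>2 + (2 * t) * (norm (u x) * norm (v x)) + t\<^sup>2 * (norm (v x))\<^sup>2)"
    proof -
      have "(norm (u x) + t * norm (v x))\<^sup>2 = (norm (u x))\<^sup>2 + (2 * t) * (norm (u x) * norm (v x)) + t\<^sup>2 * (norm (v x))\<^sup>2" for x
        by (simp add: power2_eq_square algebra_simps)
      then show ?thesis by (simp only:)
    qed
    also have "\<dots> = L2_normsq_on A u + 2 * t * I + t\<^sup>2 * L2_normsq_on A v"
      unfolding I_def L2_normsq_on_def using ii L2_on_normsq[OF u] L2_on_normsq[OF v]
      by (simp add: set_integral_add set_integral_mult_right set_integrable_mult_right)
    finally show ?thesis .
  qed
  then have *: "I\<^sup>2 \<le> L2_normsq_on A u * L2_normsq_on A v"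
    by (rule quadratic_nonneg_imp_discrim) (rule L2_normsq_nonneg)
  then show "(LINT x:A|lborel. norm (u x) * norm (v x))\<^sup>2 \<le> L2_normsq_on A u * L2_normsq_on A v"
    by (simp add: I_def)
  have "norm (LINT x:A|lborel. u x * v x) \<le> I"
    using set_integral_norm_bound[OF L2_on_mult[OF u v]] unfolding I_def by (simp add: norm_mult)
  then have "(norm (LINT x:A|lborel. u x * v x))\<^sup>2 \<le> I\<^sup>2" by (intro power_mono) auto
  with * show "(norm (LINT x:A|lborel. u x * v x))\<^sup>2 \<le> L2_normsq_on A u * L2_normsq_on A v" by simp
qed

section \<open>Sobolev functions on the half-line\<close>

text \<open>\<open>u\<close> is the continuous representative of an element of \<open>H\<^sup>1\<close> of the half-line, including its value at 0, and \<open>g\<close> is its derivative.\<close>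
definition hl :: "(real \<Rightarrow> complex) \<Rightarrow> (real \<Rightarrow> complex) \<Rightarrow> bool" where
  "hl u g \<longleftrightarrow> L2_on {0..} u \<and> L2_on {0..} g \<and> (\<forall>b. AC_on 0 b u g)"

lemma hlD:
  assumes "hl u g"
  shows "L2_on {0..} u" "L2_on {0..} g" "0 \<le> a \<Longrightarrow> AC_on a b u g"
  using assms AC_on_sub[of 0 b u g a b] unfolding hl_def by auto

lemma hl_add_scale:
  assumes "hl u g" "hl v h"
  shows "hl (\<lambda>x. (a::real) *\<^sub>R u x + (b::real) *\<^sub>R v x) (\<lambda>x. a *\<^sub>R g x + b *\<^sub>R h x)"
  unfolding hl_def
  by (intro conjI allI L2_on_add L2_on_scaleR AC_on_add AC_on_linear[OF _ bounded_linear_scaleR_right] hlD[OF assms(1)] hlD[OF assms(2)]) auto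

lemma set_integrable_atLeast_Icc:
  fixes f :: "real \<Rightarrow> 'e::euclidean_space"
  assumes "set_integrable lborel {0..} f" "0 \<le> a"
  shows "set_integrable lborel {a..b} f"
  by (rule set_integrable_subset[OF assms(1)]) (use assms in auto)

lemma integral_Icc_tendsto_atLeast:
  fixes f :: "real \<Rightarrow> 'e::euclidean_space"
  assumes f: "set_integrable lborel {a..} f"
  shows "((\<lambda>b. integral {a..b} f) \<longlongrightarrow> (LINT x:{a..}|lborel. f x)) at_top"
proof -
  have "((\<lambda>b. LINT x:{a..b}|lborel. f x) \<longlongrightarrow> (LINT x:{a..}|lborel. f x)) at_top"
    using tendsto_set_lebesgue_integral_at_top[OF _ f] by simp
  moreover have "(LINT x:{a..b}|lborel. f x) = integral {a..b} f" for b
    using set_integrable_HK(3)[OF set_integrable_subset[OF f, of "{a..b}"]] by auto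
  ultimately show ?thesis by simp
qed

lemma AC_on_normsq:
  fixes u g :: "real \<Rightarrow> complex"
  assumes "AC_on a b u g" "a \<le> b"
  shows "AC_on a b (\<lambda>x. (norm (u x))\<^sup>2) (\<lambda>x. 2 * Re (cnj (u x) * g x))"
proof -
  have "AC_on a b (\<lambda>x. Re (cnj (u x) * u x)) (\<lambda>x. Re (cnj (g x) * u x + cnj (u x) * g x))"
    by (intro AC_on_linear[OF _ bounded_linear_Re] AC_on_mult AC_on_linear[OF _ bounded_linear_cnj] assms)
  then show ?thesis
    by (rule AC_on_cong) (simp_all add: cmod_power2 algebra_simps flip: power2_eq_square)
qed

lemma set_integral_tendsto_0_imp_limit_0:
  fixes f :: "real \<Rightarrow> real"
  assumes f: "set_integrable lborel {0..} f" and lim: "(f \<longlongrightarrow> L) at_top" and nn: "\<And>x. x \<ge> 0 \<Longrightarrow> f x \<ge> 0"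
  shows "L = 0"
proof (rule ccontr)
  assume "L \<noteq> 0"
  moreover have "L \<ge> 0"
  proof (rule tendsto_lowerbound[OF lim])
    show "\<forall>\<^sub>F x in at_top. 0 \<le> f x" using eventually_ge_at_top[of 0] by eventually_elim (rule nn)
  qed simp
  ultimately have L: "L > 0" by simp
  have "\<forall>\<^sub>F x in at_top. f x > L / 2" using order_tendstoD(1)[OF lim, of "L / 2"] L by simp
  then obtain X where X: "\<And>x. x \<ge> X \<Longrightarrow> f x > L / 2" unfolding eventually_at_top_linorder by blast
  define Y where "Y = max X 0"
  define T where "T = (LINT x:{0..}|lborel. f x)"
  \<comment> \<open>Long enough for a rectangle of height \<open>L / 2\<close> to have area
    \<open>\<bar>T\<bar> + 1\<close>, more than the whole integral.\<close>
  define b where "b = Y + 2 * (\<bar>T\<bar> + 1) / L"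
  have b: "b \<ge> Y" using L by (simp add: b_def)
  have fi: "set_integrable lborel {Y..b} f" by (rule set_integrable_atLeast_Icc[OF f]) (simp add: Y_def)
  have "(b - Y) * (L / 2) = integral {Y..b} (\<lambda>_. L / 2)" using b by simp
  also have "\<dots> \<le> integral {Y..b} f"
    using X by (intro integral_le set_integrable_HK(1)[OF fi]) (auto simp: Y_def less_imp_le)
  also have "\<dots> = (LINT x:{Y..b}|lborel. f x)" using set_integrable_HK(3)[OF fi] by simp
  also have "\<dots> \<le> T" unfolding T_def
    using fi f nn unfolding set_lebesgue_integral_def set_integrable_def
    by (intro Bochner_Integration.integral_mono) (auto simp: indicator_def Y_def)
  finally have "\<bar>T\<bar> + 1 \<le> T" using L by (simp add: b_def)
  then show False by simp
qed

text \<open>The derivative of the squared modulus is integrable, being built from a product of two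
  square integrable functions, so the squared modulus converges; being integrable itself, it can
  only tend to 0.\<close>

lemma hl_normsq_tail:
  assumes "hl u g" "0 \<le> x"
  shows "(norm (u x))\<^sup>2 = - (LINT t:{x..}|lborel. 2 * Re (cnj (u t) * g t))"
    and "((\<lambda>t. (norm (u t))\<^sup>2) \<longlongrightarrow> 0) at_top"
proof -
  let ?h = "\<lambda>t. 2 * Re (cnj (u t) * g t)"
  have u: "L2_on {0..} u" and g: "L2_on {0..} g" using hlD[OF assms(1)] by auto
  have "set_integrable lborel {0..} (\<lambda>t. Re (cnj (u t) * g t))"
    using integrable_bounded_linear[OF bounded_linear_Re L2_on_mult[OF L2_on_cnj[OF u] g, unfolded set_integrable_def]]
    unfolding set_integrable_def by simp
  then have hi0: "set_integrable lborel {0..} ?h" by (rule set_integrable_mult_right[OF impI[THEN mp]]) 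
  then have hi: "set_integrable lborel {x..} ?h" by (rule set_integrable_subset) (use assms in auto)
  have "(norm (u b))\<^sup>2 = (norm (u x))\<^sup>2 + integral {x..b} ?h" if "b \<ge> x" for b
    using AC_onD[OF AC_on_normsq[OF hlD(3)[OF assms(1,2)]], of b b] that by auto
  note eq = this
  have "\<forall>\<^sub>F b in at_top. (norm (u x))\<^sup>2 + integral {x..b} ?h = (norm (u b))\<^sup>2"
    using eventually_ge_at_top[of x] by eventually_elim (rule eq[symmetric])
  moreover have "((\<lambda>b. (norm (u x))\<^sup>2 + integral {x..b} ?h) \<longlongrightarrow> (norm (u x))\<^sup>2 + (LINT t:{x..}|lborel. ?h t)) at_top"
    by (intro tendsto_intros integral_Icc_tendsto_atLeast hi)
  ultimately have lim: "((\<lambda>b. (norm (u b))\<^sup>2) \<longlongrightarrow> (norm (u x))\<^sup>2 + (LINT t:{x..}|lborel. ?h t)) at_top"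
    by (rule Lim_transform_eventually[rotated])
  have "(norm (u x))\<^sup>2 + (LINT t:{x..}|lborel. ?h t) = 0"
    by (rule set_integral_tendsto_0_imp_limit_0[OF L2_on_normsq[OF u] lim]) simp
  then show "(norm (u x))\<^sup>2 = - (LINT t:{x..}|lborel. ?h t)" "((\<lambda>t. (norm (u t))\<^sup>2) \<longlongrightarrow> 0) at_top"
    using lim by auto
qed

text \<open>Stated for tails because the calibration is cut off at a point \<open>x\<close>. With
  \<open>s\<close> the mass beyond \<open>x\<close> and \<open>r\<close> the squared modulus at
  \<open>x\<close> it bounds \<open>r\<^sup>2\<close> by \<open>4 * s\<close> times the kinetic
  tail, which matches the bound \<open>r\<^sup>2 / (8 * s)\<close> on \<open>W\<close>.\<close>

lemma hl_tail_bound: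
  assumes "hl u g" "0 \<le> x"
  shows "((norm (u x))\<^sup>2)\<^sup>2 \<le> 4 * L2_normsq_on {x..} u * L2_normsq_on {x..} g"
proof -
  have u: "L2_on {x..} u" and g: "L2_on {x..} g"
    using hlD[OF assms(1)] by (auto intro: L2_on_subset[where A = "{0..}"] simp: assms(2))
  define Z where "Z = (LINT t:{x..}|lborel. cnj (u t) * g t)"
  have i: "set_integrable lborel {x..} (\<lambda>t. cnj (u t) * g t)" by (rule L2_on_mult[OF L2_on_cnj[OF u] g])
  have "(LINT t:{x..}|lborel. 2 * Re (cnj (u t) * g t)) = 2 * Re Z"
  proof -
    have "(LINT t:{x..}|lborel. Re (cnj (u t) * g t)) = Re Z"
      unfolding Z_def set_lebesgue_integral_def using integral_Re[OF i[unfolded set_integrable_def]] by simp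
    then show ?thesis by (simp only: set_integral_mult_right)
  qed
  then have "(norm (u x))\<^sup>2 = - 2 * Re Z" using hl_normsq_tail(1)[OF assms] by simp
  then have "((norm (u x))\<^sup>2)\<^sup>2 = 4 * (Re Z)\<^sup>2" by (simp add: power2_eq_square)
  also have "\<dots> \<le> 4 * (norm Z)\<^sup>2" using abs_Re_le_cmod[of Z] by (simp add: abs_le_square_iff[symmetric])
  also have "\<dots> \<le> 4 * (L2_normsq_on {x..} (\<lambda>t. cnj (u t)) * L2_normsq_on {x..} g)"
    unfolding Z_def using cauchy_schwarz_L2(2)[OF L2_on_cnj[OF u] g] by simp
  finally show ?thesis by (simp add: L2_normsq_on_def)
qed

lemma L2_normsq_mono:
  assumes "L2_on A u" "B \<subseteq> A" "B \<in> sets lborel"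
  shows "L2_normsq_on B u \<le> L2_normsq_on A u"
  using L2_on_normsq[OF assms(1)] set_integrable_subset[OF L2_on_normsq[OF assms(1)] assms(3,2)] assms(2)
  unfolding L2_normsq_on_def set_lebesgue_integral_def set_integrable_def
  by (intro Bochner_Integration.integral_mono) (auto simp: indicator_def)

lemma hl_sup_bound:
  assumes "hl u g" "0 \<le> x"
  shows "(norm (u x))\<^sup>2 \<le> L2_normsq_on {0..} u + L2_normsq_on {0..} g"
proof -
  define A B where "A = L2_normsq_on {0..} u" and "B = L2_normsq_on {0..} g"
  have AB: "A \<ge> 0" "B \<ge> 0" unfolding A_def B_def by (auto intro: L2_normsq_nonneg)
  have "L2_normsq_on {x..} u \<le> A" "L2_normsq_on {x..} g \<le> B"
    unfolding A_def B_def using assms(2)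
    by (auto intro!: L2_normsq_mono hlD(1)[OF assms(1)] hlD(2)[OF assms(1)])
  then have "L2_normsq_on {x..} u * L2_normsq_on {x..} g \<le> A * B"
    using AB by (intro mult_mono) (auto intro: L2_normsq_nonneg)
  then have "((norm (u x))\<^sup>2)\<^sup>2 \<le> 4 * (A * B)" using hl_tail_bound[OF assms] by simp
  also have "\<dots> \<le> (A + B)\<^sup>2" using zero_le_power2[of "A - B"] by (simp add: power2_diff power2_sum)
  finally have "(norm (u x))\<^sup>2 \<le> A + B" by (rule power2_le_imp_le) (use AB in simp)
  then show ?thesis by (simp add: A_def B_def)
qed

text \<open>The positive and the negative part of \<open>f\<close> are densities of two finite
  measures that agree on all half-lines and therefore coincide.\<close>

lemma AE_zero_of_interval_integrals:
  fixes f :: "real \<Rightarrow> real"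
  assumes f: "integrable lborel f" and z: "\<And>x. (LINT t:{x<..}|lborel. f t) = 0"
  shows "AE x in lborel. f x = 0"
proof -
  have m [measurable]: "f \<in> borel_measurable borel" using f by auto
  let ?p = "\<lambda>x. ennreal (f x)" and ?n = "\<lambda>x. ennreal (- f x)"
  have fin: "emeasure (density lborel (\<lambda>x. ennreal (h x))) A < \<infinity>" if "integrable lborel h" "A \<in> sets lborel" for h :: "real \<Rightarrow> real" and A
  proof -
    have [measurable]: "h \<in> borel_measurable borel" "A \<in> sets borel" using that by auto
    have "emeasure (density lborel (\<lambda>x. ennreal (h x))) A = (\<integral>\<^sup>+x. ennreal (h x) * indicator A x \<partial>lborel)"
      by (rule emeasure_density) auto
    also have "\<dots> \<le> (\<integral>\<^sup>+x. ennreal (norm (h x)) \<partial>lborel)"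
      by (intro nn_integral_mono) (auto simp: indicator_def intro: ennreal_leI)
    also have "\<dots> < \<infinity>" using that(1) unfolding integrable_iff_bounded by simp
    finally show ?thesis .
  qed
  have "density lborel ?p = density lborel ?n"
  proof (rule measure_eqI_lessThan)
    fix x :: real
    show "emeasure (density lborel ?p) {x<..} < \<infinity>" using fin[OF f] by simp
    have fi: "integrable lborel (\<lambda>t. indicator {x<..} t * f t)"
      using integrable_real_mult_indicator[OF _ f, of "{x<..}"] by (simp add: mult.commute)
    have "(LINT t|lborel. indicator {x<..} t * f t) = 0" using z[of x] by (simp add: set_lebesgue_integral_def)
    then have e: "enn2real (\<integral>\<^sup>+t. ennreal (indicator {x<..} t * f t) \<partial>lborel) = enn2real (\<integral>\<^sup>+t. ennreal (- (indicator {x<..} t * f t)) \<partial>lborel)"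
      using real_lebesgue_integral_def[OF fi] by simp
    have 1: "(\<integral>\<^sup>+t. ennreal (indicator {x<..} t * f t) \<partial>lborel) = emeasure (density lborel ?p) {x<..}"
      by (subst emeasure_density) (auto intro!: nn_integral_cong simp: indicator_def)
    have 2: "(\<integral>\<^sup>+t. ennreal (- (indicator {x<..} t * f t)) \<partial>lborel) = emeasure (density lborel ?n) {x<..}"
      by (subst emeasure_density) (auto intro!: nn_integral_cong simp: indicator_def)
    have "integrable lborel (\<lambda>x. - f x)" using f by simp
    then show "emeasure (density lborel ?p) {x<..} = emeasure (density lborel ?n) {x<..}"
      using e fin[OF f, of "{x<..}"] fin[of "\<lambda>x. - f x" "{x<..}"] unfolding 1 2
      by (simp only: sets_lborel borel_open open_greaterThan infinity_ennreal_def) (metis ennreal_enn2real)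
  qed auto
  then have "AE x in lborel. ?p x = ?n x"
    by (intro sigma_finite_measure.density_unique[OF sigma_finite_lborel]) auto
  then show ?thesis
  proof eventually_elim
    case (elim x)
    then show ?case by (cases "f x \<ge> 0") (auto simp: ennreal_neg)
  qed
qed

text \<open>\<open>kinetic\<close> is computed with an arbitrarily selected weak derivative, so any
  two choices must agree up to a null set. Bounded intervals are treated first, then a countable
  union.\<close>

lemma hl_deriv_unique:
  assumes "hl u g" "hl u h"
  shows "AE x in lborel. x \<ge> 0 \<longrightarrow> g x = h x"
proof -
  have "AE x in lborel. x \<in> {0..real n} \<longrightarrow> g x = h x" for n
  proof -
    let ?d = "\<lambda>x. indicator {0..real n} x *\<^sub>R (g x - h x)"
    have di: "set_integrable lborel {0..real n} (\<lambda>x. g x - h x)"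
      using AC_on_integrable[OF hlD(3)[OF assms(1), of 0 "real n"]] AC_on_integrable[OF hlD(3)[OF assms(2), of 0 "real n"]]
      by (intro set_integral_diff) auto
    have z: "integral {a..b} (\<lambda>x. g x - h x) = 0" if "0 \<le> a" "a \<le> b" "b \<le> real n" for a b
    proof -
      have "integral {a..b} g = u b - u a" "integral {a..b} h = u b - u a"
        using AC_on_diff[OF hlD(3)[OF assms(1) that(1)] order_refl that(2) order_refl] 
          AC_on_diff[OF hlD(3)[OF assms(2) that(1)] order_refl that(2) order_refl] by auto
      moreover have "g integrable_on {a..b}" "h integrable_on {a..b}"
        using set_integrable_HK(1)[OF AC_on_integrable[OF hlD(3)[OF assms(1) that(1)]]] set_integrable_HK(1)[OF AC_on_integrable[OF hlD(3)[OF assms(2) that(1)]]] by auto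
      ultimately show ?thesis by (simp add: Henstock_Kurzweil_Integration.integral_diff)
    qed
    have tail: "(LINT t:{x<..}|lborel. ?d t) = 0" for x
    proof (cases "x \<le> real n")
      case True
      define a where "a = max x 0"
      have a: "0 \<le> a" "a \<le> real n" using True by (auto simp: a_def)
      have si: "set_integrable lborel {a..real n} (\<lambda>x. g x - h x)" using set_integrable_sub[OF di] a by simp
      have "(LINT t:{x<..}|lborel. ?d t) = (LINT t:{a..real n}|lborel. g t - h t)"
        unfolding set_lebesgue_integral_def
      proof (rule integral_cong_AE)
        show "AE t in lborel. indicator {x<..} t *\<^sub>R ?d t = indicator {a..real n} t *\<^sub>R (g t - h t)"
          using AE_lborel_singleton[of x] by eventually_elim (auto simp: indicator_def a_def)
        show "(\<lambda>t. indicator {x<..} t *\<^sub>R ?d t) \<in> borel_measurable lborel"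
          using di unfolding set_integrable_def by measurable
        show "(\<lambda>t. indicator {a..real n} t *\<^sub>R (g t - h t)) \<in> borel_measurable lborel"
          using si unfolding set_integrable_def by measurable
      qed
      then show ?thesis using set_integrable_HK(3)[OF si] z[of a "real n"] a by simp
    next
      case False
      then have "(\<lambda>t. indicator {x<..} t *\<^sub>R ?d t) = (\<lambda>t. 0)" by (auto simp: indicator_def fun_eq_iff)
      then show ?thesis unfolding set_lebesgue_integral_def by (simp only: integral_zero)
    qed
    have d: "integrable lborel ?d" using di unfolding set_integrable_def .
    have ti: "integrable lborel (\<lambda>t. indicator {x<..} t *\<^sub>R ?d t)" for x :: real
      using d by (rule integrable_mult_indicator[rotated]) simp
    have "AE x in lborel. Re (?d x) = 0"
    proof (rule AE_zero_of_interval_integrals)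
      show "integrable lborel (\<lambda>x. Re (?d x))" using d by (rule integrable_Re)
      show "(LINT t:{x<..}|lborel. Re (?d t)) = 0" for x
      proof -
        have "indicator {x<..} t *\<^sub>R Re (?d t) = Re (indicator {x<..} t *\<^sub>R ?d t)" for t by simp
        then show ?thesis using integral_Re[OF ti[of x]] tail[of x] unfolding set_lebesgue_integral_def by (simp only: zero_complex.sel)
      qed
    qed
    moreover have "AE x in lborel. Im (?d x) = 0"
    proof (rule AE_zero_of_interval_integrals)
      show "integrable lborel (\<lambda>x. Im (?d x))" using d by (rule integrable_Im)
      show "(LINT t:{x<..}|lborel. Im (?d t)) = 0" for x
      proof -
        have "indicator {x<..} t *\<^sub>R Im (?d t) = Im (indicator {x<..} t *\<^sub>R ?d t)" for t by simp
        then show ?thesis using integral_Im[OF ti[of x]] tail[of x] unfolding set_lebesgue_integral_def by (simp only: zero_complex.sel)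
      qed
    qed
    ultimately show ?thesis
      by eventually_elim (auto simp: complex_eq_iff)
  qed
  then have "AE x in lborel. \<forall>n. x \<in> {0..real n} \<longrightarrow> g x = h x" unfolding AE_all_countable by blast
  then show ?thesis
  proof eventually_elim
    case (elim x)
    then show ?case using real_arch_simple[of x] by auto
  qed
qed

section \<open>Splitting a function at the origin\<close>

text \<open>The left half is reflected, so that both halves are functions on \<open>{0..}\<close>
  and one half-line theory serves for both. The value at the origin is the dummy 0 prescribed by
  \<open>H1_split\<close>.\<close>

definition glue :: "(real \<Rightarrow> 'e::zero) \<Rightarrow> (real \<Rightarrow> 'e) \<Rightarrow> real \<Rightarrow> 'e" where
  "glue a b x = (if x > 0 then b x else if x < 0 then a (- x) else 0)"

lemma glue_simps: "x > 0 \<Longrightarrow> glue a b x = b x" "x < 0 \<Longrightarrow> glue a b x = a (- x)" "glue a b 0 = 0"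
  by (auto simp: glue_def)

lemma glue_comp: "f 0 = 0 \<Longrightarrow> f (glue a b x) = glue (\<lambda>x. f (a x)) (\<lambda>x. f (b x)) x"
  by (auto simp: glue_def)

lemma glue_comp2: "f 0 0 = 0 \<Longrightarrow> f (glue a b x) (glue c d x) = glue (\<lambda>x. f (a x) (c x)) (\<lambda>x. f (b x) (d x)) x"
  by (auto simp: glue_def)

lemma set_integral_Ioi_eq:
  fixes f :: "real \<Rightarrow> 'e::euclidean_space"
  assumes "set_integrable lborel {0..} f"
  shows "set_integrable lborel {0<..} f" "(LINT x:{0<..}|lborel. f x) = (LINT x:{0..}|lborel. f x)"
proof -
  show s: "set_integrable lborel {0<..} f"
    by (rule set_integrable_subset[OF assms]) auto
  show "(LINT x:{0<..}|lborel. f x) = (LINT x:{0..}|lborel. f x)"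
    unfolding set_lebesgue_integral_def
  proof (rule integral_cong_AE)
    show "AE x in lborel. indicator {0<..} x *\<^sub>R f x = indicator {0..} x *\<^sub>R f x"
      using AE_lborel_singleton[of 0] by eventually_elim (auto simp: indicator_def)
  qed (use s assms in \<open>auto simp: set_integrable_def\<close>)
qed

lemma glue_integral:
  fixes a b :: "real \<Rightarrow> 'e::euclidean_space"
  assumes "set_integrable lborel {0..} a" "set_integrable lborel {0..} b"
  shows "integrable lborel (glue a b)"
    "integral\<^sup>L lborel (glue a b) = (LINT x:{0..}|lborel. a x) + (LINT x:{0..}|lborel. b x)"
proof -
  define A where "A = (\<lambda>x. indicator {0<..} x *\<^sub>R a x)"
  define B where "B = (\<lambda>x. indicator {0<..} x *\<^sub>R b x)"
  have eq: "glue a b = (\<lambda>x. A (- x) + B x)"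
    by (auto simp: glue_def A_def B_def fun_eq_iff)
  have A: "integrable lborel A" and B: "integrable lborel B"
    using set_integral_Ioi_eq(1)[OF assms(1)] set_integral_Ioi_eq(1)[OF assms(2)] by (auto simp: set_integrable_def A_def B_def)
  have A': "integrable lborel (\<lambda>x. A (- x))"
    using lborel_integrable_real_affine_iff[of "-1" A 0] A by simp
  have "integral\<^sup>L lborel (\<lambda>x. A (- x)) = integral\<^sup>L lborel A"
    using lborel_integral_real_affine[of "-1" A 0] by simp
  then show "integrable lborel (glue a b)" "integral\<^sup>L lborel (glue a b) = (LINT x:{0..}|lborel. a x) + (LINT x:{0..}|lborel. b x)"
    unfolding eq using A' B set_integral_Ioi_eq(2)[OF assms(1)] set_integral_Ioi_eq(2)[OF assms(2)]
    by (auto simp: set_lebesgue_integral_def A_def B_def)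
qed

lemma L2_on_Ici_cong:
  assumes "L2_on {0<..} u" "\<And>x. x > 0 \<Longrightarrow> u x = v x"
  shows "L2_on {0..} v"
proof -
  have eq1: "(\<lambda>x. indicator {0..} x *\<^sub>R v x) = (\<lambda>x. indicator {0<..} x *\<^sub>R u x + indicator {0} x *\<^sub>R v 0)"
    using assms(2) by (auto simp: indicator_def fun_eq_iff)
  have eq2: "(\<lambda>x. indicator {0..} x *\<^sub>R (norm (v x))\<^sup>2) = (\<lambda>x. indicator {0<..} x *\<^sub>R (norm (u x))\<^sup>2 + indicator {0} x *\<^sub>R (norm (v 0))\<^sup>2)"
    using assms(2) by (auto simp: indicator_def fun_eq_iff)
  have "(\<lambda>x. indicator {0} x *\<^sub>R v 0) \<in> borel_measurable lborel" by measurable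
  then have "(\<lambda>x. indicator {0..} x *\<^sub>R v x) \<in> borel_measurable lborel"
    using borel_measurable_add[OF L2_on_measurable[OF assms(1)]] unfolding eq1 by blast
  moreover have "integrable lborel (\<lambda>x::real. indicator {0} x *\<^sub>R (norm (v 0))\<^sup>2)"
    by (intro integrable_scaleR_left) auto
  then have "integrable lborel (\<lambda>x. indicator {0..} x *\<^sub>R (norm (v x))\<^sup>2)"
    using Bochner_Integration.integrable_add[OF L2_on_normsq[OF assms(1), unfolded set_integrable_def]]
    unfolding eq2 by blast
  ultimately show ?thesis unfolding L2_on_def set_borel_measurable_def set_integrable_def by blast
qed

lemma L2_on_reflect: "L2_on {..<0} u \<longleftrightarrow> L2_on {0<..} (\<lambda>x. u (- x))"
proof -
  have ind: "indicator {..<0} (- x) = (indicator {0<..} x :: real)" for x :: real by (auto simp: indicator_def)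
  have ind2: "indicator {0<..} (- x) = (indicator {..<0} x :: real)" for x :: real by (auto simp: indicator_def)
  have m: "(\<lambda>x::real. f (- x)) \<in> borel_measurable lborel" if "f \<in> borel_measurable lborel" for f :: "real \<Rightarrow> complex"
    using that by measurable
  have "(\<lambda>x. indicator {..<0} x *\<^sub>R u x) \<in> borel_measurable lborel \<longleftrightarrow> (\<lambda>x. indicator {0<..} x *\<^sub>R u (- x)) \<in> borel_measurable lborel"
    using m[of "\<lambda>x. indicator {..<0} x *\<^sub>R u x", unfolded ind] m[of "\<lambda>x. indicator {0<..} x *\<^sub>R u (- x)", unfolded ind2 minus_minus]
    by blast
  moreover have "integrable lborel (\<lambda>x. indicator {0<..} x *\<^sub>R (norm (u (- x)))\<^sup>2) \<longleftrightarrow> integrable lborel (\<lambda>x. indicator {..<0} x *\<^sub>R (norm (u x))\<^sup>2)"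
    using lborel_integrable_real_affine_iff[of "-1" "\<lambda>x. indicator {..<0} x *\<^sub>R (norm (u x))\<^sup>2" 0]
    by (simp only: ind add_0_left mult_minus1 neg_equal_0_iff_equal one_neq_zero not_False_eq_True simp_thms)
  ultimately show ?thesis unfolding L2_on_def set_borel_measurable_def set_integrable_def by blast
qed

lemma L2_normsq_on_reflect: "L2_normsq_on {..<0} u = L2_normsq_on {0<..} (\<lambda>x. u (- x))"
proof -
  have ind: "indicator {..<0} (- x) = (indicator {0<..} x :: real)" for x :: real by (auto simp: indicator_def)
  show ?thesis unfolding L2_normsq_on_def set_lebesgue_integral_def
    using lborel_integral_real_affine[of "-1" "\<lambda>x. indicator {..<0} x *\<^sub>R (norm (u x))\<^sup>2" 0]
    by (simp only: ind add_0_left mult_minus1 neg_equal_0_iff_equal one_neq_zero not_False_eq_True simp_thms abs_minus_cancel abs_one scaleR_one)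
qed

text \<open>The increment formula on \<open>{a..t}\<close> passes to the limit as \<open>a\<close>
  tends to 0, since a square integrable \<open>G\<close> is integrable up to the origin; the
  one-sided limit \<open>c\<close> becomes the value there.\<close>

lemma hl_extend:
  assumes ac: "\<And>a b. 0 < a \<Longrightarrow> AC_on a b U G" and U: "L2_on {0<..} U" and G: "L2_on {0<..} G" and lim: "(U \<longlongrightarrow> c) (at_right 0)"
  shows "hl (U(0 := c)) G"
  unfolding hl_def
proof (intro conjI allI)
  show "L2_on {0..} (U(0 := c))" by (rule L2_on_Ici_cong[OF U]) simp
  show G0: "L2_on {0..} G" by (rule L2_on_Ici_cong[OF G]) simp
  fix b
  show "AC_on 0 b (U(0 := c)) G"
  proof (rule AC_onI)
    show "set_integrable lborel {0..b} G" by (rule L2_on_set_integrable[OF G0]) auto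
    fix t assume t: "t \<in> {0..b}"
    show "(U(0 := c)) t = (U(0 := c)) 0 + integral {0..t} G"
    proof (cases "t = 0")
      case False
      then have t0: "0 < t" using t by simp
      have "set_integrable lborel {0..t} G" by (rule L2_on_set_integrable[OF G0]) auto
      then have "continuous_on {0..t} (\<lambda>a. integral {a..t} G)"
        by (intro indefinite_integral_continuous_1' set_integrable_HK(1))
      then have "((\<lambda>a. integral {a..t} G) \<longlongrightarrow> integral {0..t} G) (at 0 within {0..t})"
        unfolding continuous_on_def using t0 by auto
      then have "((\<lambda>a. integral {a..t} G) \<longlongrightarrow> integral {0..t} G) (at_right 0)"
        using at_within_Icc_at_right[OF t0] by simp
      moreover have "((\<lambda>a. integral {a..t} G) \<longlongrightarrow> U t - c) (at_right 0)"
      proof (rule Lim_transform_eventually)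
        show "((\<lambda>a. U t - U a) \<longlongrightarrow> U t - c) (at_right 0)" by (intro tendsto_intros lim)
        show "\<forall>\<^sub>F a in at_right 0. U t - U a = integral {a..t} G"
          unfolding eventually_at_right_field
        proof (intro exI[of _ t] conjI allI impI t0)
          fix y assume "0 < y" "y < t"
          then show "U t - U y = integral {y..t} G" by (intro AC_on_diff[OF ac[of y t]]) auto
        qed
      qed
      ultimately have "integral {0..t} G = U t - c"
        by (rule tendsto_unique[OF trivial_limit_at_right_real])
      then show ?thesis using t0 by simp
    qed simp
  qed
qed

lemma hl_right:
  assumes "continuous_on {0<..} u" "L2_on {0<..} u" "L2_on {0<..} g" "is_weak_deriv {0<..} u g" "(u \<longlongrightarrow> c) (at_right 0)"
  shows "hl (u(0 := c)) g"
proof (rule hl_extend[OF _ assms(2,3,5)])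
  show "AC_on a b u g" if "0 < a" for a b
    using assms(1,2) by (intro weak_deriv_imp_AC_on[OF _ _ assms(1,3,4)]) (use that in \<open>auto simp: L2_on_def\<close>)
qed

lemma hl_left:
  assumes "continuous_on {..<0} u" "L2_on {..<0} u" "L2_on {..<0} g" "is_weak_deriv {..<0} u g" "(u \<longlongrightarrow> c) (at_left 0)"
  shows "hl ((\<lambda>x. u (- x))(0 := c)) (\<lambda>x. - g (- x))"
proof (rule hl_extend)
  show "L2_on {0<..} (\<lambda>x. u (- x))" using assms(2) by (simp add: L2_on_reflect)
  have g: "L2_on {0<..} (\<lambda>x. g (- x))" using assms(3) by (simp add: L2_on_reflect)
  show "L2_on {0<..} (\<lambda>x. - g (- x))" using L2_on_scaleR[OF g, of "-1"] by simp
  show "((\<lambda>x. u (- x)) \<longlongrightarrow> c) (at_right 0)"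
    using assms(5) by (simp add: at_left_minus filterlim_filtermap)
  fix a b :: real assume a: "0 < a"
  have ac: "AC_on (- b) (- a) u g"
    using assms(1,2) by (intro weak_deriv_imp_AC_on[OF _ _ assms(1,3,4)]) (use a in \<open>auto simp: L2_on_def\<close>)
  show "AC_on a b (\<lambda>x. u (- x)) (\<lambda>x. - g (- x))"
  proof (rule AC_onI)
    show "set_integrable lborel {a..b} (\<lambda>x. - g (- x))"
    proof -
      have "{a..b} \<subseteq> {0<..}" using a by auto
      from L2_on_set_integrable[OF L2_on_scaleR[OF g, of "-1"] this] show ?thesis by simp
    qed
    fix t assume t: "t \<in> {a..b}"
    then have "u (- a) - u (- t) = integral {- t..- a} g" by (intro AC_on_diff[OF ac]) auto
    also have "\<dots> = integral {a..t} (\<lambda>x. g (- x))" using Henstock_Kurzweil_Integration.integral_reflect_real[of t a "\<lambda>x. g (- x)"] by simp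
    finally show "u (- t) = u (- a) + integral {a..t} (\<lambda>x. - g (- x))" by (simp add: algebra_simps)
  qed
qed

lemma hl_cong:
  assumes "hl u g" "\<And>x. x \<ge> 0 \<Longrightarrow> u x = v x"
  shows "hl v g"
  unfolding hl_def
proof (intro conjI allI)
  show "L2_on {0..} v"
  proof (rule L2_on_Ici_cong)
    show "L2_on {0<..} u" using hlD(1)[OF assms(1)] by (rule L2_on_subset) auto
  qed (use assms(2) in auto)
  show "AC_on 0 b v g" for b by (rule AC_on_cong[OF hlD(3)[OF assms(1) order_refl]]) (use assms(2) in auto)
qed (rule hlD(2)[OF assms(1)])

lemma hl_continuous:
  assumes "hl u g"
  shows "continuous_on {0..} u" "x > 0 \<Longrightarrow> isCont u x" "(u \<longlongrightarrow> u 0) (at_right 0)"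
proof -
  have c: "continuous_on {0..b} u" for b using AC_on_continuous[OF hlD(3)[OF assms order_refl]] .
  show 1: "isCont u x" if "x > 0" for x
    using continuous_on_interior[OF c[of "x + 1"], of x] that by simp
  have "(u \<longlongrightarrow> u 0) (at 0 within {0..1})" using c[of 1] unfolding continuous_on_def by auto
  then show 2: "(u \<longlongrightarrow> u 0) (at_right 0)" using at_within_Icc_at_right[of 0 "1::real"] by simp
  show "continuous_on {0..} u" unfolding continuous_on_eq_continuous_within
  proof
    fix x :: real assume "x \<in> {0..}"
    show "continuous (at x within {0..}) u"
    proof (cases "x = 0")
      case True
      then show ?thesis using 2 by (simp add: continuous_within at_within_Ici_at_right)
    next
      case False
      then show ?thesis using 1[of x] \<open>x \<in> {0..}\<close> by (simp add: continuous_at_imp_continuous_within)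
    qed
  qed
qed

lemma hl_glue_H1_split:
  assumes L: "hl uL gL" and R: "hl uR gR"
  shows "glue uL uR \<in> H1_split"
    and "is_weak_deriv {0<..} (glue uL uR) gR" "L2_on {0<..} gR" "L2_on {0<..} (glue uL uR)"
    and "is_weak_deriv {..<0} (glue uL uR) (\<lambda>x. - gL (- x))" "L2_on {..<0} (\<lambda>x. - gL (- x))" "L2_on {..<0} (glue uL uR)"
    and "(glue uL uR \<longlongrightarrow> uL 0) (at_left 0)" "(glue uL uR \<longlongrightarrow> uR 0) (at_right 0)"
    and "continuous_on (- {0}) (glue uL uR)"
proof -
  let ?u = "glue uL uR"
  show wR: "is_weak_deriv {0<..} ?u gR"
  proof (rule AC_on_imp_weak_deriv)
    fix a b :: real assume ab: "{a..b} \<subseteq> {0<..}"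
    show "AC_on a b ?u gR"
    proof (cases "a \<le> b")
      case True
      then have "0 < a" using ab by auto
      then show ?thesis by (intro AC_on_cong[OF hlD(3)[OF R]]) (auto simp: glue_simps)
    qed (auto intro!: AC_onI simp: set_integrable_def)
  qed (auto simp: is_interval_1)
  show lR: "L2_on {0<..} gR" using hlD(2)[OF R] by (rule L2_on_subset) auto
  have "L2_on {0<..} uR" using hlD(1)[OF R] by (rule L2_on_subset) auto
  then have "L2_on {0..} ?u" by (rule L2_on_Ici_cong) (simp add: glue_simps)
  then show uR: "L2_on {0<..} ?u" by (rule L2_on_subset) auto
  show wL: "is_weak_deriv {..<0} ?u (\<lambda>x. - gL (- x))"
  proof (rule AC_on_imp_weak_deriv)
    fix a b :: real assume ab: "{a..b} \<subseteq> {..<0}"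
    show "AC_on a b ?u (\<lambda>x. - gL (- x))"
    proof (cases "a \<le> b")
      case True
      then have b0: "b < 0" using ab by auto
      have ac: "AC_on (- b) (- a) uL gL" by (rule hlD(3)[OF L]) (use b0 in simp)
      show ?thesis
      proof (rule AC_onI)
        have "integrable lborel (\<lambda>x. indicator {- b..- a} (- x) *\<^sub>R gL (- x))"
          using lborel_integrable_real_affine_iff[of "-1" "\<lambda>x. indicator {- b..- a} x *\<^sub>R gL x" 0] AC_on_integrable[OF ac]
          by (simp add: set_integrable_def)
        moreover have "indicator {- b..- a} (- x) = (indicator {a..b} x :: real)" for x by (auto simp: indicator_def)
        ultimately show "set_integrable lborel {a..b} (\<lambda>x. - gL (- x))" unfolding set_integrable_def by simp
        fix t assume t: "t \<in> {a..b}"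
        have "uL (- a) - uL (- t) = integral {- t..- a} gL" by (rule AC_on_diff[OF ac]) (use t in auto)
        also have "\<dots> = integral {a..t} (\<lambda>x. gL (- x))" using Henstock_Kurzweil_Integration.integral_reflect_real[of t a "\<lambda>x. gL (- x)"] by simp
        finally have "uL (- t) = uL (- a) + integral {a..t} (\<lambda>x. - gL (- x))" by (simp add: algebra_simps)
        moreover have "t < 0" "a < 0" using t b0 by auto
        ultimately show "?u t = ?u a + integral {a..t} (\<lambda>x. - gL (- x))" by (simp add: glue_simps)
      qed
    qed (auto intro!: AC_onI simp: set_integrable_def)
  qed (auto simp: is_interval_1)
  have "L2_on {0<..} gL" using hlD(2)[OF L] by (rule L2_on_subset) auto
  from L2_on_scaleR[OF this, of "-1"] show lL: "L2_on {..<0} (\<lambda>x. - gL (- x))" unfolding L2_on_reflect by simp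
  have "L2_on {0<..} uL" using hlD(1)[OF L] by (rule L2_on_subset) auto
  then have "L2_on {0..} (\<lambda>x. ?u (- x))" by (rule L2_on_Ici_cong) (simp add: glue_simps)
  then show uL: "L2_on {..<0} ?u" unfolding L2_on_reflect by (rule L2_on_subset) auto
  show "(?u \<longlongrightarrow> uR 0) (at_right 0)"
    by (rule Lim_transform_eventually[OF hl_continuous(3)[OF R]]) (auto simp: eventually_at_right_field glue_simps intro: exI[of _ 1])
  have "((\<lambda>x. ?u (- x)) \<longlongrightarrow> uL 0) (at_right 0)"
    by (rule Lim_transform_eventually[OF hl_continuous(3)[OF L]]) (auto simp: eventually_at_right_field glue_simps intro: exI[of _ 1])
  then show "(?u \<longlongrightarrow> uL 0) (at_left 0)" by (simp add: at_left_minus filterlim_filtermap)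
  show c: "continuous_on (- {0}) ?u"
  proof (intro continuous_at_imp_continuous_on ballI)
    fix x :: real assume "x \<in> - {0}"
    then consider "x > 0" | "x < 0" by fastforce
    then show "isCont ?u x"
    proof cases
      case 1
      have "continuous_on {0<..} ?u" by (rule continuous_on_eq[OF continuous_on_subset[OF hl_continuous(1)[OF R]]]) (auto simp: glue_simps)
      then show ?thesis using 1 by (simp add: continuous_on_eq_continuous_at)
    next
      case 2
      have "continuous_on {..<0} (\<lambda>x. uL (- x))"
        by (rule continuous_on_compose2[OF hl_continuous(1)[OF L]]) (auto intro!: continuous_intros)
      then have "continuous_on {..<0} ?u" by (rule continuous_on_eq) (auto simp: glue_simps)
      then show ?thesis using 2 by (simp add: continuous_on_eq_continuous_at)
    qed
  qed
  show "?u \<in> H1_split"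
    unfolding H1_split_def H1_on_def using c wR lR uR wL lL uL by (auto simp: glue_simps)
qed

text \<open>The bridge from weak derivatives to absolutely continuous halves: later arguments work
  with such pairs, which interact only through the jump condition at 0.\<close>

theorem D_space_iff:
  "u \<in> D_space \<tau> \<longleftrightarrow> (\<exists>uL gL uR gR. hl uL gL \<and> hl uR gR \<and> uR 0 = of_real \<tau> * uL 0 \<and> u = glue uL uR)"
proof
  assume "u \<in> D_space \<tau>"
  then obtain c where u: "u \<in> H1_split" and l: "(u \<longlongrightarrow> c) (at_left 0)" and r: "(u \<longlongrightarrow> of_real \<tau> * c) (at_right 0)"
    unfolding D_space_def by auto
  have c: "continuous_on (- {0}) u" "u 0 = 0" using u unfolding H1_split_def by auto
  obtain g where g: "L2_on {..<0} g" "is_weak_deriv {..<0} u g" "L2_on {..<0} u"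
    using u unfolding H1_split_def H1_on_def by auto
  obtain h where h: "L2_on {0<..} h" "is_weak_deriv {0<..} u h" "L2_on {0<..} u"
    using u unfolding H1_split_def H1_on_def by auto
  have cl: "continuous_on {..<0} u" "continuous_on {0<..} u" using c(1) by (auto elim!: continuous_on_subset)
  have "hl ((\<lambda>x. u (- x))(0 := c)) (\<lambda>x. - g (- x))" "hl (u(0 := of_real \<tau> * c)) h"
    using hl_left[OF cl(1) g(3,1,2) l] hl_right[OF cl(2) h(3,1,2) r] by auto
  moreover have "u = glue ((\<lambda>x. u (- x))(0 := c)) (u(0 := of_real \<tau> * c))"
    using c(2) by (auto simp: glue_def fun_eq_iff)
  ultimately show "\<exists>uL gL uR gR. hl uL gL \<and> hl uR gR \<and> uR 0 = of_real \<tau> * uL 0 \<and> u = glue uL uR"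
    by (intro exI[of _ "(\<lambda>x. u (- x))(0 := c)"] exI[of _ "\<lambda>x. - g (- x)"] exI[of _ "u(0 := of_real \<tau> * c)"] exI[of _ h]) simp
next
  assume "\<exists>uL gL uR gR. hl uL gL \<and> hl uR gR \<and> uR 0 = of_real \<tau> * uL 0 \<and> u = glue uL uR"
  then obtain uL gL uR gR where h: "hl uL gL" "hl uR gR" "uR 0 = of_real \<tau> * uL 0" "u = glue uL uR" by blast
  show "u \<in> D_space \<tau>"
    unfolding D_space_def h(4) using hl_glue_H1_split[OF h(1,2)] h(3) by auto
qed

lemma L2_normsq_Ioi: "L2_on {0..} u \<Longrightarrow> L2_normsq_on {0<..} u = L2_normsq_on {0..} u"
  unfolding L2_normsq_on_def by (rule set_integral_Ioi_eq(2)[OF L2_on_normsq])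

lemma trace_left_glue: "hl uL gL \<Longrightarrow> hl uR gR \<Longrightarrow> trace_left (glue uL uR) = uL 0"
  unfolding trace_left_def using hl_glue_H1_split(8) by (intro tendsto_Lim) auto

lemma hl_deriv_normsq_unique:
  assumes "hl u g" "hl u h"
  shows "L2_normsq_on {0..} g = L2_normsq_on {0..} h"
  unfolding L2_normsq_on_def set_lebesgue_integral_def
proof (rule integral_cong_AE)
  show "AE x in lborel. indicator {0..} x *\<^sub>R (norm (g x))\<^sup>2 = indicator {0..} x *\<^sub>R (norm (h x))\<^sup>2"
    using hl_deriv_unique[OF assms] by eventually_elim (auto simp: indicator_def)
qed (use L2_on_normsq[OF hlD(2)[OF assms(1)]] L2_on_normsq[OF hlD(2)[OF assms(2)]] in \<open>auto simp: set_integrable_def\<close>)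

text \<open>The selected weak derivatives are turned into \<open>hl\<close> derivatives of the same
  two halves, so \<open>hl_deriv_normsq_unique\<close> identifies their norms with those of
  \<open>gL\<close> and \<open>gR\<close>. Reflection changes a derivative only by its sign.\<close>

lemma kinetic_glue:
  assumes L: "hl uL gL" and R: "hl uR gR"
  shows "kinetic (glue uL uR) = L2_normsq_on {0..} gL + L2_normsq_on {0..} gR"
proof -
  let ?u = "glue uL uR"
  note s = hl_glue_H1_split[OF assms]
  have cl: "continuous_on {..<0} ?u" "continuous_on {0<..} ?u" using s(10) by (auto elim!: continuous_on_subset)
  define h where "h = weak_deriv {0<..} ?u"
  define g where "g = weak_deriv {..<0} ?u"
  have h: "L2_on {0<..} h" "is_weak_deriv {0<..} ?u h"
    using someI[of "\<lambda>g. L2_on {0<..} g \<and> is_weak_deriv {0<..} ?u g" gR] s(2,3) unfolding h_def weak_deriv_def by auto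
  have g: "L2_on {..<0} g" "is_weak_deriv {..<0} ?u g"
    using someI[of "\<lambda>g. L2_on {..<0} g \<and> is_weak_deriv {..<0} ?u g" "\<lambda>x. - gL (- x)"] s(5,6) unfolding g_def weak_deriv_def by auto
  have hh: "hl uR h" by (rule hl_cong[OF hl_right[OF cl(2) s(4) h s(9)]]) (auto simp: glue_simps)
  have hg: "hl uL (\<lambda>x. - g (- x))" by (rule hl_cong[OF hl_left[OF cl(1) s(7) g s(8)]]) (auto simp: glue_simps)
  have "L2_normsq_on {0<..} h = L2_normsq_on {0..} gR"
    using hl_deriv_normsq_unique[OF hh R] L2_normsq_Ioi[OF hlD(2)[OF hh]] by simp
  moreover have "L2_normsq_on {..<0} g = L2_normsq_on {0..} gL"
    using hl_deriv_normsq_unique[OF hg L] L2_normsq_Ioi[OF hlD(2)[OF hg]] unfolding L2_normsq_on_reflect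
    by (simp add: L2_normsq_on_def)
  ultimately show ?thesis unfolding kinetic_def h_def[symmetric] g_def[symmetric] by simp
qed

lemma mass_glue:
  assumes "hl uL gL" "hl uR gR"
  shows "mass (glue uL uR) = L2_normsq_on {0..} uL + L2_normsq_on {0..} uR"
  unfolding mass_def L2_normsq_on_def
  using glue_integral(2)[OF L2_on_normsq[OF hlD(1)[OF assms(1)]] L2_on_normsq[OF hlD(1)[OF assms(2)]]]
  by (simp add: set_lebesgue_integral_def glue_comp[of "\<lambda>z. (norm z)\<^sup>2"])

lemma hl_powr_integrable:
  assumes "hl u g" "p \<ge> 2"
  shows "set_integrable lborel {0..} (\<lambda>x. norm (u x) powr p)"
proof -
  define M where "M = sqrt (L2_normsq_on {0..} u + L2_normsq_on {0..} g)"
  have M: "norm (u x) \<le> M" if "x \<ge> 0" for x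
    unfolding M_def by (rule real_le_rsqrt[OF hl_sup_bound[OF assms(1) that]])
  have i: "integrable lborel (\<lambda>x. M powr (p - 2) * (indicator {0..} x *\<^sub>R (norm (u x))\<^sup>2))"
    using L2_on_normsq[OF hlD(1)[OF assms(1)]] unfolding set_integrable_def by (rule integrable_mult_right)
  have "(\<lambda>x. (norm (indicator {0..} x *\<^sub>R u x)) powr p) \<in> borel_measurable lborel"
    using L2_on_measurable[OF hlD(1)[OF assms(1)]] by measurable
  moreover have "(\<lambda>x. (norm (indicator {0..} x *\<^sub>R u x)) powr p) = (\<lambda>x. indicator {0..} x *\<^sub>R (norm (u x) powr p))"
    by (auto simp: indicator_def)
  ultimately have m: "(\<lambda>x. indicator {0..} x *\<^sub>R (norm (u x) powr p)) \<in> borel_measurable lborel" by simp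
  have b: "norm (indicator {0..} x *\<^sub>R (norm (u x) powr p)) \<le> norm (M powr (p - 2) * (indicator {0..} x *\<^sub>R (norm (u x))\<^sup>2))" for x
  proof (cases "x \<ge> 0 \<and> u x \<noteq> 0")
    case True
    then have "norm (u x) powr p = norm (u x) powr (p - 2) * (norm (u x))\<^sup>2"
      by (simp add: powr_diff powr_numeral)
    also have "\<dots> \<le> M powr (p - 2) * (norm (u x))\<^sup>2"
      using M[of x] True assms(2) by (intro mult_right_mono powr_mono2) auto
    finally show ?thesis using True by (simp add: indicator_def)
  qed (auto simp: indicator_def)
  show ?thesis unfolding set_integrable_def by (rule Bochner_Integration.integrable_bound[OF i m AE_I2]) (rule b)
qed

lemma powr_integral_glue:
  assumes "hl uL gL" "hl uR gR" "p \<ge> 2"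
  shows "(\<integral>x. norm (glue uL uR x) powr p \<partial>lborel) = (LINT x:{0..}|lborel. norm (uL x) powr p) + (LINT x:{0..}|lborel. norm (uR x) powr p)"
  using glue_integral(2)[OF hl_powr_integrable[OF assms(1,3)] hl_powr_integrable[OF assms(2,3)]]
  by (simp add: glue_comp[of "\<lambda>z. norm z powr p"])

lemma inner_integral_glue:
  assumes "hl uL gL" "hl uR gR" "hl vL hL" "hl vR hR"
  shows "(\<integral>x. glue uL uR x * cnj (glue vL vR x) \<partial>lborel) = (LINT x:{0..}|lborel. uL x * cnj (vL x)) + (LINT x:{0..}|lborel. uR x * cnj (vR x))"
  using glue_integral(2)[OF L2_on_mult[OF hlD(1)[OF assms(1)] L2_on_cnj[OF hlD(1)[OF assms(3)]]] L2_on_mult[OF hlD(1)[OF assms(2)] L2_on_cnj[OF hlD(1)[OF assms(4)]]]]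
  by (simp add: glue_comp2[of "\<lambda>z w. z * cnj w"])

definition half_energy :: "real \<Rightarrow> (real \<Rightarrow> complex) \<Rightarrow> (real \<Rightarrow> complex) \<Rightarrow> real" where
  "half_energy \<sigma> u g = 1 / 2 * L2_normsq_on {0..} g - 1 / (2 * \<sigma> + 2) * (LINT x:{0..}|lborel. norm (u x) powr (2 * \<sigma> + 2))"

lemma energy_glue:
  assumes "hl uL gL" "hl uR gR" "\<sigma> \<ge> 0"
  shows "energy \<sigma> \<alpha> (glue uL uR) = half_energy \<sigma> uL gL + half_energy \<sigma> uR gR - \<alpha> / 2 * (norm (uL 0))\<^sup>2"
  unfolding energy_def half_energy_def
  using kinetic_glue[OF assms(1,2)] trace_left_glue[OF assms(1,2)] powr_integral_glue[OF assms(1,2), of "2 * \<sigma> + 2"] assms(3)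
  by (simp add: algebra_simps)

section \<open>The value function of mass and endpoint density\<close>

context nls
begin

text \<open>Together with \<open>\<gamma>\<close> these are the scaling exponents of soliton pieces
  in their mass \<open>s\<close>: densities scale like \<open>s powr \<beta>\<close>, energies like
  \<open>s powr \<gamma>\<close>, and \<open>k\<close> like
  \<open>s powr (\<beta> - 1)\<close>.\<close>

definition \<beta> :: real where "\<beta> = 2 / (2 - \<sigma>)"

definition \<gamma> :: real where "\<gamma> = (2 + \<sigma>) / (2 - \<sigma>)"

text \<open>\<open>W s r\<close> is the least energy on the half-line among functions of mass \<open>s\<close> whose squared modulus at the
  endpoint is \<open>r\<close>. It is written in the scaling variable \<open>r s\<^sup>-\<^sup>\<beta>\<close>.\<close>
definition W :: "real \<Rightarrow> real \<Rightarrow> real" where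
  "W s r = s powr \<gamma> * w (r * s powr (- \<beta>))"

definition Wr :: "real \<Rightarrow> real \<Rightarrow> real" where
  "Wr s r = s powr (\<beta> - 1) * v (r * s powr (- \<beta>))"

definition Ws :: "real \<Rightarrow> real \<Rightarrow> real" where
  "Ws s r = s powr (\<gamma> - 1) * (\<gamma> * w (r * s powr (- \<beta>)) - \<beta> * (r * s powr (- \<beta>)) * v (r * s powr (- \<beta>)))"

definition freq :: "real \<Rightarrow> real \<Rightarrow> real" where
  "freq s r = s powr (\<beta> - 1) * N (\<Theta> (r * s powr (- \<beta>)))"

lemma beta_gamma: "\<gamma> = 2 * \<beta> - 1" "\<beta> - 1 = \<sigma> / (2 - \<sigma>)" "\<beta> > 1" "\<gamma> > 1"
  using sigma_pos sigma_less by (auto simp: \<beta>_def \<gamma>_def field_simps)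

lemma W_0: "W 0 r = 0"
  by (simp add: W_def)

text \<open>Pairs of mass and density are encoded as complex numbers, which makes their plane a
  Euclidean space on which \<open>AC_chain_rule\<close> can act. The linear extension of
  \<open>w\<close> provides a full neighbourhood of the points with density 0.\<close>

lemma W_has_derivative:
  assumes p: "Re p > 0"
  shows "((\<lambda>p. W (Re p) (Im p)) has_derivative (\<lambda>h. Ws (Re p) (Im p) * Re h + Wr (Re p) (Im p) * Im h)) (at p)"
proof -
  define s r where "s = Re p" and "r = Im p"
  define y where "y = r * s powr (- \<beta>)"
  have s: "s > 0" using p by (simp add: s_def)
  have d: "((\<lambda>x. x powr a) has_real_derivative a * s powr (a - 1)) (at s)" for a
    using has_real_derivative_powr[OF s, of a] .
  have dRe: "(Re has_derivative Re) (at p)" and dIm: "(Im has_derivative Im) (at p)"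
    by (auto intro: bounded_linear_imp_has_derivative bounded_linear_Re bounded_linear_Im)
  have dp: "((\<lambda>p. Re p powr a) has_derivative (\<lambda>h. Re h * (a * s powr (a - 1)))) (at p)" for a
    by (rule DERIV_compose_FDERIV[OF _ dRe]) (use d[of a] in \<open>simp add: s_def\<close>)
  have dy: "((\<lambda>p. Im p * Re p powr (- \<beta>)) has_derivative (\<lambda>h. r * (Re h * (- \<beta> * s powr (- \<beta> - 1))) + Im h * s powr (- \<beta>))) (at p)"
    using has_derivative_mult[OF dIm dp[of "- \<beta>"]] by (simp add: r_def s_def)
  have dw: "((\<lambda>p. w (Im p * Re p powr (- \<beta>))) has_derivative (\<lambda>h. (r * (Re h * (- \<beta> * s powr (- \<beta> - 1))) + Im h * s powr (- \<beta>)) * v y)) (at p)"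
    by (rule DERIV_compose_FDERIV[OF _ dy]) (use w_deriv[of y] in \<open>simp add: y_def r_def s_def\<close>)
  have "((\<lambda>p. Re p powr \<gamma> * w (Im p * Re p powr (- \<beta>))) has_derivative 
     (\<lambda>h. s powr \<gamma> * ((r * (Re h * (- \<beta> * s powr (- \<beta> - 1))) + Im h * s powr (- \<beta>)) * v y) + (Re h * (\<gamma> * s powr (\<gamma> - 1))) * w y)) (at p)"
    using has_derivative_mult[OF dp[of \<gamma>] dw] by (simp add: y_def r_def s_def)
  moreover have "s powr \<gamma> * ((r * (Re h * (- \<beta> * s powr (- \<beta> - 1))) + Im h * s powr (- \<beta>)) * v y) + (Re h * (\<gamma> * s powr (\<gamma> - 1))) * w y
     = Ws s r * Re h + Wr s r * Im h" for h
  proof -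
    have 1: "s powr \<gamma> * s powr (- \<beta>) = s powr (\<beta> - 1)" by (simp add: powr_add[symmetric] beta_gamma(1))
    have 2: "s powr \<gamma> * s powr (- \<beta> - 1) = s powr (\<gamma> - 1) * s powr (- \<beta>)" by (simp add: powr_add[symmetric] algebra_simps)
    have e1: "Ws s r * Re h = (s powr (\<gamma> - 1) * s powr (- \<beta>)) * (r * - \<beta> * v y * Re h) + Re h * (\<gamma> * s powr (\<gamma> - 1)) * w y"
      unfolding Ws_def y_def[symmetric] by (simp add: y_def algebra_simps)
    have e2: "Wr s r * Im h = (s powr \<gamma> * s powr (- \<beta>)) * (v y * Im h)"
      unfolding Wr_def y_def[symmetric] 1 by simp
    show ?thesis unfolding e1 e2 2[symmetric] by (simp add: algebra_simps)
  qed
  ultimately show ?thesis unfolding W_def s_def r_def by simp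
qed

lemma Ws_Wr_continuous:
  "continuous_on {p. Re p > 0} (\<lambda>p. Ws (Re p) (Im p))" "continuous_on {p. Re p > 0} (\<lambda>p. Wr (Re p) (Im p))"
proof -
  have wc: "continuous_on UNIV w" by (intro continuous_at_imp_continuous_on ballI DERIV_isCont[OF w_deriv])
  have pc: "continuous_on {p. Re p > 0} (\<lambda>p. Re p powr a)" for a
    by (intro continuous_on_powr continuous_intros) auto
  have yc: "continuous_on {p. Re p > 0} (\<lambda>p. Im p * Re p powr (- \<beta>))" by (intro continuous_intros pc)
  have w': "continuous_on {p. Re p > 0} (\<lambda>p. w (Im p * Re p powr (- \<beta>)))" by (rule continuous_on_compose2[OF wc yc]) auto
  have v': "continuous_on {p. Re p > 0} (\<lambda>p. v (Im p * Re p powr (- \<beta>)))" by (rule continuous_on_compose2[OF v_continuous[of UNIV] yc]) auto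
  show "continuous_on {p. Re p > 0} (\<lambda>p. Ws (Re p) (Im p))" unfolding Ws_def
    by (intro continuous_on_mult continuous_on_diff continuous_on_const pc w' v' yc)
  show "continuous_on {p. Re p > 0} (\<lambda>p. Wr (Re p) (Im p))" unfolding Wr_def
    by (intro continuous_on_mult pc v')
qed

lemma W_curve:
  assumes "(a has_real_derivative a') (at t)" "(b has_real_derivative b') (at t)" "a t > 0"
  shows "((\<lambda>t. W (a t) (b t)) has_real_derivative (Ws (a t) (b t) * a' + Wr (a t) (b t) * b')) (at t)"
proof -
  have d: "((\<lambda>t. Complex (a t) (b t)) has_derivative (\<lambda>h. Complex (h * a') (h * b'))) (at t)"
  proof -
    have "((\<lambda>t. complex_of_real (a t) + \<i> * complex_of_real (b t)) has_derivative (\<lambda>h. complex_of_real (h * a') + \<i> * complex_of_real (h * b'))) (at t)"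
      by (intro has_derivative_add has_derivative_mult_right has_derivative_of_real)
         (use assms(1,2) in \<open>simp_all add: has_field_derivative_def mult_commute_abs\<close>)
    then show ?thesis by (simp only: Complex_eq)
  qed
  have "((\<lambda>t. W (Re (Complex (a t) (b t))) (Im (Complex (a t) (b t)))) has_derivative 
     (\<lambda>h. Ws (a t) (b t) * (h * a') + Wr (a t) (b t) * (h * b'))) (at t)"
    using has_derivative_compose[OF d W_has_derivative[of "Complex (a t) (b t)"]] assms(3) by simp
  moreover have "(\<lambda>h. Ws (a t) (b t) * (h * a') + Wr (a t) (b t) * (h * b')) = (*) (Ws (a t) (b t) * a' + Wr (a t) (b t) * b')"
    by (auto simp: algebra_simps)
  ultimately show ?thesis unfolding has_field_derivative_def by simp
qed

lemma isCont_W: "Re p > 0 \<Longrightarrow> isCont (\<lambda>p. W (Re p) (Im p)) p"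
  using has_derivative_continuous[OF W_has_derivative] .

lemma freq_pos: "s > 0 \<Longrightarrow> freq s r > 0"
  using N\<Theta>_pos by (simp add: freq_def)

lemma Wr_eq: "Wr s r = freq s r * \<Theta> (r * s powr (- \<beta>)) / 2"
  by (simp add: Wr_def freq_def v_def)

text \<open>Homogeneity expresses the mass derivative through \<open>w\<close> and \<open>v\<close>,
  and \<open>hamilton_jacobi_1\<close> evaluates the result. So the mass multiplier is fixed by the
  frequency, and equal mass derivatives on the two sides of the origin mean equal
  frequencies.\<close>

lemma Ws_eq:
  assumes "s > 0" "r \<ge> 0"
  shows "Ws s r = - (freq s r)\<^sup>2 / 2"
proof -
  define y where "y = r * s powr (- \<beta>)"
  have "\<gamma> * w y - \<beta> * y * v y = - (N (\<Theta> y))\<^sup>2 / 2"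
    using hamilton_jacobi_1[of y] assms by (simp add: y_def \<gamma>_def \<beta>_def)
  moreover have "s powr (\<gamma> - 1) = (s powr (\<beta> - 1))\<^sup>2"
    using assms(1) by (simp add: power2_eq_square powr_add[symmetric] beta_gamma(1))
  ultimately show ?thesis unfolding Ws_def freq_def y_def[symmetric] by (simp add: power_mult_distrib)
qed

lemma W_eq:
  assumes "s > 0" "r \<ge> 0"
  shows "W s r = (2 * r * Wr s r - (2 - \<sigma>) * s * (freq s r)\<^sup>2 / 2) / (2 + \<sigma>)"
proof -
  define y where "y = r * s powr (- \<beta>)"
  have y: "y \<ge> 0" using assms by (simp add: y_def)
  have 1: "s powr \<gamma> * (s powr (- \<beta>) * z) = s powr (\<beta> - 1) * z" for z
    using assms(1) by (simp add: powr_add[symmetric] beta_gamma(1) mult.assoc[symmetric])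
  have 2: "s powr \<gamma> = s * (s powr (\<beta> - 1))\<^sup>2"
  proof -
    have "\<gamma> = 1 + ((\<beta> - 1) + (\<beta> - 1))" by (simp add: beta_gamma(1))
    then show ?thesis using assms(1) by (simp only: powr_add power2_eq_square) simp
  qed
  have "W s r = s powr \<gamma> * w_alt y" unfolding W_def y_def[symmetric] using w_eq[OF y] by simp
  also have "\<dots> = (2 * r * (s powr \<gamma> * (s powr (- \<beta>) * v y)) - (2 - \<sigma>) * (s powr \<gamma> * (N (\<Theta> y))\<^sup>2) / 2) / (2 + \<sigma>)"
    unfolding w_alt_def by (simp add: y_def algebra_simps)
  also have "\<dots> = (2 * r * Wr s r - (2 - \<sigma>) * s * (freq s r)\<^sup>2 / 2) / (2 + \<sigma>)"
    unfolding 1 unfolding 2 Wr_def freq_def y_def[symmetric] by (simp add: power_mult_distrib mult.assoc)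
  finally show ?thesis .
qed

text \<open>Scaling out the mass leaves the two one-variable identities; the powers of
  \<open>s\<close> match because \<open>\<beta> * \<sigma> = 2 * (\<beta> - 1)\<close>.\<close>

lemma W_hamilton_jacobi:
  assumes "s > 0" "r \<ge> 0"
  shows "Ws s r + 2 * (Wr s r)\<^sup>2 + 1 / (2 * \<sigma> + 2) * r powr \<sigma> = 0"
proof -
  define y where "y = r * s powr (- \<beta>)"
  have y: "y \<ge> 0" using assms by (simp add: y_def)
  have "y powr \<sigma> = r powr \<sigma> * s powr (- \<beta> * \<sigma>)"
    unfolding y_def using assms by (simp add: powr_mult powr_powr)
  moreover have "- \<beta> * \<sigma> = - ((\<beta> - 1) + (\<beta> - 1))"
    unfolding beta_gamma(2) using sigma_less by (simp add: \<beta>_def)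
  ultimately have "r powr \<sigma> = y powr \<sigma> * (s powr (\<beta> - 1))\<^sup>2"
    using assms(1) by (simp only: powr_minus powr_add) (simp add: power2_eq_square field_simps)
  then have "2 * (Wr s r)\<^sup>2 + 1 / (2 * \<sigma> + 2) * r powr \<sigma> = (s powr (\<beta> - 1))\<^sup>2 * (2 * (v y)\<^sup>2 + 1 / (2 * \<sigma> + 2) * y powr \<sigma>)"
    unfolding Wr_def y_def[symmetric] by (simp add: power_mult_distrib algebra_simps)
  also have "\<dots> = (freq s r)\<^sup>2 / 2"
    unfolding hamilton_jacobi_2[OF y] freq_def y_def[symmetric] by (simp add: power_mult_distrib)
  finally show ?thesis unfolding Ws_eq[OF assms] by linarith
qed

lemma W_scale_square:
  assumes "s > 0"
  shows "s powr \<gamma> * (r * s powr (- \<beta>))\<^sup>2 = r\<^sup>2 / s"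
proof -
  have "s powr \<gamma> * (s powr (- \<beta>))\<^sup>2 = s powr (\<gamma> + (- \<beta> + - \<beta>))" by (simp only: power2_eq_square powr_add)
  also have "\<gamma> + (- \<beta> + - \<beta>) = -1" by (simp add: beta_gamma(1))
  finally show ?thesis using assms by (simp add: power_mult_distrib powr_minus divide_inverse) 
qed

lemma W_le:
  assumes "s > 0" "r \<ge> 0"
  shows "W s r \<le> r\<^sup>2 / (8 * s)"
proof -
  have "W s r \<le> s powr \<gamma> * ((r * s powr (- \<beta>))\<^sup>2 / 8)"
    unfolding W_def using w_le[of "r * s powr (- \<beta>)"] assms by (intro mult_left_mono) auto
  then show ?thesis using W_scale_square[OF assms(1), of r] by simp
qed

lemma W_ge:
  obtains K where "K \<ge> 0" "\<And>s r. s > 0 \<Longrightarrow> r \<ge> 0 \<Longrightarrow> r\<^sup>2 / (32 * s) - K * s powr \<gamma> \<le> W s r"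
proof -
  obtain K where K: "K \<ge> 0" "\<And>y. y \<ge> 0 \<Longrightarrow> y\<^sup>2 / 32 - K \<le> w y" using w_ge by blast
  have "r\<^sup>2 / (32 * s) - K * s powr \<gamma> \<le> W s r" if "s > 0" "r \<ge> 0" for s r
  proof -
    have "s powr \<gamma> * ((r * s powr (- \<beta>))\<^sup>2 / 32 - K) \<le> W s r"
      unfolding W_def using K(2)[of "r * s powr (- \<beta>)"] that by (intro mult_left_mono) auto
    then show ?thesis using W_scale_square[OF that(1), of r] by (simp add: algebra_simps)
  qed
  with K(1) show ?thesis using that by blast
qed

section \<open>Parametrization by frequency and endpoint slope\<close>

definition hmass :: "real \<Rightarrow> real \<Rightarrow> real" where
  "hmass k \<theta> = CJ * J \<theta> * k powr ((2 - \<sigma>) / \<sigma>)"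

text \<open>A soliton with parameter \<open>k\<close> satisfies \<open>u powr (2 * \<sigma>) =
  (\<sigma> + 1) * k\<^sup>2 * (1 - t\<^sup>2)\<close>, where \<open>- k * t\<close> is its
  logarithmic derivative; this is its squared modulus where \<open>t = \<theta>\<close>.\<close>

definition dens :: "real \<Rightarrow> real \<Rightarrow> real" where
  "dens k \<theta> = ((\<sigma> + 1) * k\<^sup>2 * (1 - \<theta>\<^sup>2)) powr (1 / \<sigma>)"

lemma dens_pos: "k > 0 \<Longrightarrow> -1 < \<theta> \<Longrightarrow> \<theta> < 1 \<Longrightarrow> dens k \<theta> > 0"
  using sigma_pos sq_less_1[of \<theta>] by (simp add: dens_def)

lemma hmass_pos: "k > 0 \<Longrightarrow> -1 \<le> \<theta> \<Longrightarrow> \<theta> < 1 \<Longrightarrow> hmass k \<theta> > 0"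
  using CJ_pos J_pos[of \<theta>] by (simp add: hmass_def)

text \<open>Scaling a piece to unit mass leaves its slope \<open>\<theta>\<close> unchanged, and
  \<open>N\<close> and \<open>R\<close> are the outcome of that scaling.\<close>

lemma param_scaled:
  assumes k: "k > 0" and t: "-1 \<le> \<theta>" "\<theta> < 1"
  shows "dens k \<theta> * hmass k \<theta> powr (- \<beta>) = R \<theta>" "hmass k \<theta> powr (\<beta> - 1) * N \<theta> = k"
proof -
  define X where "X = CJ * J \<theta>"
  have X: "X > 0" using J_pos[OF t] CJ_pos by (simp add: X_def)
  have t2: "\<theta>\<^sup>2 \<le> 1" using sq_le_1[of \<theta>] t by simp
  have N: "N \<theta> = X powr (- (\<beta> - 1))" unfolding N_def X_def beta_gamma(2) by simp
  have e: "(2 - \<sigma>) / \<sigma> * (\<beta> - 1) = 1" using sigma_pos sigma_less by (simp add: beta_gamma(2))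
  have "hmass k \<theta> powr (\<beta> - 1) = X powr (\<beta> - 1) * k powr ((2 - \<sigma>) / \<sigma> * (\<beta> - 1))"
    unfolding hmass_def X_def[symmetric] using X k by (simp add: powr_mult powr_powr)
  then have m: "hmass k \<theta> powr (\<beta> - 1) = X powr (\<beta> - 1) * k" unfolding e using k by simp
  show k': "hmass k \<theta> powr (\<beta> - 1) * N \<theta> = k"
    unfolding m N powr_minus using X by simp
  have hp: "hmass k \<theta> > 0" using hmass_pos[OF k t] .
  have "k\<^sup>2 = (hmass k \<theta> powr (\<beta> - 1))\<^sup>2 * (N \<theta>)\<^sup>2" using k' by (simp add: power_mult_distrib[symmetric])
  then have "dens k \<theta> = ((hmass k \<theta> powr (\<beta> - 1))\<^sup>2 * ((\<sigma> + 1) * (N \<theta>)\<^sup>2 * (1 - \<theta>\<^sup>2))) powr (1 / \<sigma>)"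
    unfolding dens_def by (simp add: mult_ac)
  also have "\<dots> = ((hmass k \<theta> powr (\<beta> - 1))\<^sup>2) powr (1 / \<sigma>) * R \<theta>"
    unfolding R_def using sigma_pos t2 by (simp add: powr_mult)
  also have "((hmass k \<theta> powr (\<beta> - 1))\<^sup>2) powr (1 / \<sigma>) = hmass k \<theta> powr \<beta>"
  proof -
    have "(hmass k \<theta> powr (\<beta> - 1))\<^sup>2 = hmass k \<theta> powr ((\<beta> - 1) + (\<beta> - 1))" by (simp only: power2_eq_square powr_add)
    moreover have "((\<beta> - 1) + (\<beta> - 1)) * (1 / \<sigma>) = \<beta>" unfolding beta_gamma(2) using sigma_pos sigma_less by (simp add: \<beta>_def)
    ultimately show ?thesis by (simp only: powr_powr)
  qed
  finally show "dens k \<theta> * hmass k \<theta> powr (- \<beta>) = R \<theta>" using hp by (simp add: powr_minus)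
qed

lemma param_W:
  assumes k: "k > 0" and t: "-1 \<le> \<theta>" "\<theta> < 1"
  shows "freq (hmass k \<theta>) (dens k \<theta>) = k" "Wr (hmass k \<theta>) (dens k \<theta>) = k * \<theta> / 2" "Ws (hmass k \<theta>) (dens k \<theta>) = - k\<^sup>2 / 2"
    "W (hmass k \<theta>) (dens k \<theta>) = (dens k \<theta> * k * \<theta> - (2 - \<sigma>) * hmass k \<theta> * k\<^sup>2 / 2) / (2 + \<sigma>)"
proof -
  note p = param_scaled[OF assms]
  have d: "dens k \<theta> \<ge> 0" by (simp add: dens_def)
  show f: "freq (hmass k \<theta>) (dens k \<theta>) = k" unfolding freq_def p(1) \<Theta>_R[OF t] by (rule p(2))
  show r: "Wr (hmass k \<theta>) (dens k \<theta>) = k * \<theta> / 2" unfolding Wr_eq f p(1) \<Theta>_R[OF t] ..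
  show "Ws (hmass k \<theta>) (dens k \<theta>) = - k\<^sup>2 / 2" using Ws_eq[OF hmass_pos[OF assms] d] f by simp
  show "W (hmass k \<theta>) (dens k \<theta>) = (dens k \<theta> * k * \<theta> - (2 - \<sigma>) * hmass k \<theta> * k\<^sup>2 / 2) / (2 + \<sigma>)"
    using W_eq[OF hmass_pos[OF assms] d] unfolding f r by (simp add: algebra_simps)
qed

lemma param_exists:
  assumes s: "s > 0" and r: "r \<ge> 0"
  defines "\<theta> \<equiv> \<Theta> (r * s powr (- \<beta>))"
  shows "s = hmass (freq s r) \<theta>" "r = dens (freq s r) \<theta>"
proof -
  define y where "y = r * s powr (- \<beta>)"
  have y: "y \<ge> 0" using assms by (simp add: y_def)
  have t: "-1 \<le> \<theta>" "\<theta> < 1" "R \<theta> = y" using \<Theta>[of y] y by (auto simp: \<theta>_def y_def)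
  have k: "freq s r > 0" by (rule freq_pos[OF s])
  have kd: "freq s r = s powr (\<beta> - 1) * N \<theta>" by (simp add: freq_def \<theta>_def)
  have b: "\<beta> - 1 > 0" using beta_gamma by simp
  show m: "s = hmass (freq s r) \<theta>"
  proof -
    have "s powr (\<beta> - 1) * N \<theta> = hmass (freq s r) \<theta> powr (\<beta> - 1) * N \<theta>"
      by (simp only: kd[symmetric] param_scaled(2)[OF k t(1,2)])
    then have "s powr (\<beta> - 1) = hmass (freq s r) \<theta> powr (\<beta> - 1)" using N_pos[OF t(1,2)]
      by (metis less_irrefl mult_right_cancel)
    then have "(s powr (\<beta> - 1)) powr (1 / (\<beta> - 1)) = (hmass (freq s r) \<theta> powr (\<beta> - 1)) powr (1 / (\<beta> - 1))" by simp
    then show ?thesis using b s hmass_pos[OF k t(1,2)] by (simp add: powr_powr)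
  qed
  have "dens (freq s r) \<theta> * s powr (- \<beta>) = r * s powr (- \<beta>)"
    using param_scaled(1)[OF k t(1,2)] t(3) unfolding m[symmetric] y_def by (rule trans)
  then show "r = dens (freq s r) \<theta>" using s by simp
qed

lemma dens_powr:
  assumes "-1 \<le> \<theta>" "\<theta> \<le> 1"
  shows "dens k \<theta> powr \<sigma> = (\<sigma> + 1) * k\<^sup>2 * (1 - \<theta>\<^sup>2)"
  unfolding dens_def using sigma_pos sq_le_1[of \<theta>] assms by (simp add: powr_powr)

text \<open>At fixed density the product \<open>k\<^sup>2 * (1 - \<theta>\<^sup>2)\<close> is fixed.
  More mass lowers the slope, and below 0 this increases its square, so the frequency can only
  grow.\<close>

lemma Ws_beyond_peak:
  assumes k: "k > 0" and t: "-1 < \<theta>" "\<theta> \<le> 0" and s: "s \<ge> hmass k \<theta>"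
  shows "Ws s (dens k \<theta>) \<le> - k\<^sup>2 / 2"
proof -
  define r where "r = dens k \<theta>"
  have r: "r > 0" using dens_pos[of k \<theta>] k t by (simp add: r_def)
  have h: "hmass k \<theta> > 0" using hmass_pos[of k \<theta>] k t by simp
  then have s0: "s > 0" using s by simp
  define k' \<theta>' where "k' = freq s r" and "\<theta>' = \<Theta> (r * s powr (- \<beta>))"
  have "r * s powr (- \<beta>) \<le> r * hmass k \<theta> powr (- \<beta>)"
    using r h s beta_gamma(3) by (intro mult_left_mono powr_mono2') auto
  then have "\<theta>' \<le> \<Theta> (R \<theta>)" unfolding \<theta>'_def using param_scaled(1)[of k \<theta>] k t by (intro \<Theta>_mono) (auto simp: r_def)
  then have "\<theta>' \<le> \<theta>" using \<Theta>_R[of \<theta>] t by simp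
  moreover have t': "-1 \<le> \<theta>'" "\<theta>' < 1" using \<Theta> by (auto simp: \<theta>'_def)
  ultimately have "\<theta>\<^sup>2 \<le> \<theta>'\<^sup>2" using t abs_le_square_iff[of \<theta> \<theta>'] by simp
  have "(\<sigma> + 1) * k'\<^sup>2 * (1 - \<theta>'\<^sup>2) = (\<sigma> + 1) * k\<^sup>2 * (1 - \<theta>\<^sup>2)"
  proof -
    have "r = dens k' \<theta>'" using param_exists(2)[OF s0, of r] r by (simp add: k'_def \<theta>'_def)
    then have "dens k' \<theta>' powr \<sigma> = dens k \<theta> powr \<sigma>" by (simp add: r_def)
    then show ?thesis using dens_powr[of \<theta>' k'] dens_powr[of \<theta> k] t t' by simp
  qed
  then have eq: "k'\<^sup>2 * (1 - \<theta>'\<^sup>2) = k\<^sup>2 * (1 - \<theta>\<^sup>2)" using sigma_pos by simp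
  have pos: "1 - \<theta>\<^sup>2 > 0" using sq_less_1[of \<theta>] t by simp
  have "k\<^sup>2 * (1 - \<theta>\<^sup>2) \<le> k'\<^sup>2 * (1 - \<theta>\<^sup>2)"
    unfolding eq[symmetric] using \<open>\<theta>\<^sup>2 \<le> \<theta>'\<^sup>2\<close> by (intro mult_left_mono) auto
  then have "k\<^sup>2 \<le> k'\<^sup>2" using pos by simp
  then show ?thesis using Ws_eq[OF s0, of r] r by (simp add: k'_def r_def)
qed

end

section \<open>The reduced two-parameter problem\<close>

locale nls_jump = nls +
  fixes \<alpha> \<tau> :: real
  assumes alpha_pos: "\<alpha> > 0" and tau_gt_1: "\<tau> > 1"
begin

definition \<Phi> :: "real \<Rightarrow> real \<Rightarrow> real \<Rightarrow> real" where
  "\<Phi> \<mu> m r = W m r + W (\<mu> - m) (\<tau>\<^sup>2 * r) - \<alpha> / 2 * r"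

lemma tau_sq: "\<tau>\<^sup>2 > 1"
  using tau_gt_1 by (simp add: one_less_power)

lemma \<Phi>_deriv_m:
  assumes "0 < m" "m < \<mu>"
  shows "((\<lambda>m. \<Phi> \<mu> m r) has_real_derivative (Ws m r - Ws (\<mu> - m) (\<tau>\<^sup>2 * r))) (at m)"
proof -
  have 1: "((\<lambda>m. m) has_real_derivative 1) (at m)" "((\<lambda>m. \<mu> - m) has_real_derivative -1) (at m)"
    "((\<lambda>m. r) has_real_derivative 0) (at m)" "((\<lambda>m. \<tau>\<^sup>2 * r) has_real_derivative 0) (at m)" "((\<lambda>m. \<alpha> / 2 * r) has_real_derivative 0) (at m)"
    by (auto intro!: derivative_eq_intros)
  show ?thesis unfolding \<Phi>_def
    using DERIV_diff[OF DERIV_add[OF W_curve[OF 1(1,3)] W_curve[OF 1(2,4)]] 1(5)] assms by simp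
qed

lemma \<Phi>_deriv_r:
  assumes "0 < m" "m < \<mu>"
  shows "((\<lambda>r. \<Phi> \<mu> m r) has_real_derivative (Wr m r + \<tau>\<^sup>2 * Wr (\<mu> - m) (\<tau>\<^sup>2 * r) - \<alpha> / 2)) (at r)"
proof -
  have 1: "((\<lambda>r. r) has_real_derivative 1) (at r)" "((\<lambda>r. m) has_real_derivative 0) (at r)" "((\<lambda>r. \<mu> - m) has_real_derivative 0) (at r)"
    "((\<lambda>r. \<tau>\<^sup>2 * r) has_real_derivative \<tau>\<^sup>2) (at r)" "((\<lambda>r. \<alpha> / 2 * r) has_real_derivative \<alpha> / 2) (at r)"
    by (auto intro!: derivative_eq_intros)
  show ?thesis unfolding \<Phi>_def
    using DERIV_diff[OF DERIV_add[OF W_curve[OF 1(2,1)] W_curve[OF 1(3,4)]] 1(5)] assms by (simp add: mult.commute)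
qed

lemma \<Phi>_continuous:
  "continuous_on {p. 0 < Re p \<and> Re p < \<mu>} (\<lambda>p. \<Phi> \<mu> (Re p) (Im p))"
proof -
  have W: "continuous_on {p. Re p > 0} (\<lambda>p. W (Re p) (Im p))"
    by (intro continuous_at_imp_continuous_on ballI isCont_W) auto
  have 1: "continuous_on {p. 0 < Re p \<and> Re p < \<mu>} (\<lambda>p. W (Re p) (Im p))"
    by (rule continuous_on_subset[OF W]) auto
  have "continuous_on {p. 0 < Re p \<and> Re p < \<mu>} (\<lambda>p. (\<lambda>p. W (Re p) (Im p)) (Complex (\<mu> - Re p) (\<tau>\<^sup>2 * Im p)))"
    by (rule continuous_on_compose2[OF W]) (auto simp: Complex_eq intro!: continuous_intros)
  then show ?thesis unfolding \<Phi>_def using 1 by (intro continuous_intros) auto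
qed

text \<open>Putting a small mass on the left half-line lowers the energy of the half soliton, because \<open>\<tau> > 1\<close>.\<close>
lemma \<Phi>_test_point:
  assumes \<mu>: "\<mu> > 0"
  obtains m r where "0 < m" "m < \<mu>" "r > 0" "\<Phi> \<mu> m r < W \<mu> 0"
proof -
  define k where "k = freq \<mu> 0"
  have k: "k > 0" unfolding k_def by (rule freq_pos[OF \<mu>])
  \<comment> \<open>A multiple of \<open>exp (- k * x)\<close> with mass \<open>m\<close> has
    density \<open>2 * k * m\<close> at 0 and kinetic energy \<open>k\<^sup>2 * m / 2\<close>; the
    latter is also the bound of \<open>W_le\<close> at this density. So \<open>h\<close> bounds
    \<open>\<Phi>\<close> from above, and unlike the left term of \<open>\<Phi>\<close> it is
    visibly differentiable at 0.\<close>
  define h where "h = (\<lambda>m. k\<^sup>2 * m / 2 + W (\<mu> - m) (\<tau>\<^sup>2 * (2 * k * m)) - \<alpha> / 2 * (2 * k * m))"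
  have Wr0: "Wr \<mu> 0 = - k / 2" unfolding Wr_eq k_def by (simp add: \<Theta>_nonpos)
  have Ws0: "Ws \<mu> 0 = - k\<^sup>2 / 2" unfolding k_def using Ws_eq[OF \<mu>, of 0] by simp
  have 1: "((\<lambda>m. k\<^sup>2 * m / 2) has_real_derivative k\<^sup>2 / 2) (at 0)" "((\<lambda>m. \<mu> - m) has_real_derivative -1) (at 0)"
    "((\<lambda>m. \<tau>\<^sup>2 * (2 * k * m)) has_real_derivative \<tau>\<^sup>2 * (2 * k)) (at 0)" "((\<lambda>m. \<alpha> / 2 * (2 * k * m)) has_real_derivative \<alpha> / 2 * (2 * k)) (at 0)"
    by (auto intro!: derivative_eq_intros)
  have "(h has_real_derivative (k\<^sup>2 / 2 + (Ws \<mu> 0 * -1 + Wr \<mu> 0 * (\<tau>\<^sup>2 * (2 * k))) - \<alpha> / 2 * (2 * k))) (at 0)"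
    unfolding h_def using DERIV_diff[OF DERIV_add[OF 1(1) W_curve[OF 1(2,3)]] 1(4)] \<mu> by simp
  moreover have "k\<^sup>2 / 2 + (Ws \<mu> 0 * -1 + Wr \<mu> 0 * (\<tau>\<^sup>2 * (2 * k))) - \<alpha> / 2 * (2 * k) = k\<^sup>2 * (1 - \<tau>\<^sup>2) - \<alpha> * k"
    unfolding Wr0 Ws0 by (simp add: algebra_simps power2_eq_square)
  moreover have "k\<^sup>2 * (1 - \<tau>\<^sup>2) - \<alpha> * k < 0"
  proof -
    have "k\<^sup>2 * (1 - \<tau>\<^sup>2) < 0" using k tau_sq by (intro mult_pos_neg) auto
    moreover have "\<alpha> * k > 0" using k alpha_pos by simp
    ultimately show ?thesis by simp
  qed
  ultimately obtain d where d: "d > 0" "\<And>x. x > 0 \<Longrightarrow> x < d \<Longrightarrow> h (0 + x) < h 0"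
    using DERIV_neg_dec_right[of h _ 0] by metis
  define m where "m = min (d / 2) (\<mu> / 2)"
  have m: "m > 0" "m < d" "m < \<mu>" using d(1) \<mu> by (auto simp: m_def)
  have "W m (2 * k * m) \<le> (2 * k * m)\<^sup>2 / (8 * m)" by (rule W_le) (use m k in auto)
  also have "\<dots> = k\<^sup>2 * m / 2" using m by (simp add: power2_eq_square)
  finally have "\<Phi> \<mu> m (2 * k * m) \<le> h m" by (simp add: \<Phi>_def h_def)
  also have "\<dots> < h 0" using d(2)[of m] m by simp
  also have "h 0 = W \<mu> 0" by (simp add: h_def)
  finally show ?thesis using that[of m "2 * k * m"] m k by simp
qed

lemma W_0_right: "W s 0 = w 0 * s powr \<gamma>"
  by (simp add: W_def)

lemma W_0_neg: "\<mu> > 0 \<Longrightarrow> W \<mu> 0 < 0"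
  using w_0_neg by (simp add: W_0_right mult_neg_pos)

text \<open>A half-line that loses its mass also loses its density, as
  \<open>r\<^sup>2 \<le> C * m\<close>, and what remains is the energy of a soliton escaped to
  infinity on the other side. The factor \<open>B\<close> is \<open>\<tau>\<^sup>2\<close> or 1
  according to which half keeps the mass; the last term allows for the lower bound of
  \<open>W\<close> on the vanishing half.\<close>

lemma W_boundary_limit:
  assumes \<mu>: "\<mu> > 0" and e: "e > 0" and C: "C \<ge> 0" "K \<ge> 0"
  obtains d where "d > 0" "d < \<mu>" "\<forall>m r. 0 < m \<longrightarrow> m < d \<longrightarrow> 0 \<le> r \<longrightarrow> r\<^sup>2 \<le> C * m \<longrightarrow>
     W \<mu> 0 - e < W (\<mu> - m) (B * r) - \<alpha> / 2 * r - K * m powr \<gamma>"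
proof -
  define f where "f = (\<lambda>p. W (\<mu> - Re p) (B * Im p) - \<alpha> / 2 * Im p - K * Re p)"
  have "isCont (\<lambda>p. (\<lambda>p. W (Re p) (Im p)) (Complex (\<mu> - Re p) (B * Im p))) 0"
    by (rule isCont_o2[OF _ isCont_W]) (use \<mu> in \<open>auto simp: Complex_eq intro!: continuous_intros\<close>)
  then have "isCont f 0" unfolding f_def by (intro continuous_intros) simp_all
  then obtain \<delta> where \<delta>: "\<delta> > 0" "\<And>p. dist p 0 < \<delta> \<Longrightarrow> dist (f p) (f 0) < e"
    using e unfolding continuous_at_eps_delta by blast
  define q where "q = (\<delta> / 2)\<^sup>2 / (C + 1)"
  have q: "q > 0" using \<delta>(1) C by (simp add: q_def)
  define d where "d = min (min (\<delta> / 2) 1) (min (\<mu> / 2) q)"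
  have d: "d > 0" "d \<le> \<mu> / 2" "d \<le> \<delta> / 2" "d \<le> 1" "d \<le> (\<delta> / 2)\<^sup>2 / (C + 1)"
    unfolding q_def[symmetric] d_def using \<delta>(1) \<mu> q by linarith+
  then have d\<mu>: "d < \<mu>" using \<mu> by simp
  have "W \<mu> 0 - e < W (\<mu> - m) (B * r) - \<alpha> / 2 * r - K * m powr \<gamma>"
    if m: "0 < m" "m < d" and r: "0 \<le> r" "r\<^sup>2 \<le> C * m" for m r
  proof -
    have "r\<^sup>2 \<le> (C + 1) * m" using r(2) m by (simp add: algebra_simps)
    also have "\<dots> < (C + 1) * ((\<delta> / 2)\<^sup>2 / (C + 1))" using m d(5) C by (intro mult_strict_left_mono) auto
    also have "\<dots> = (\<delta> / 2)\<^sup>2" using C by simp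
    finally have "r < \<delta> / 2" by (rule power2_less_imp_less) (use \<delta> in simp)
    have "dist (Complex m r) 0 \<le> \<bar>m\<bar> + \<bar>r\<bar>" using cmod_le[of "Complex m r"] by simp
    also have "\<dots> < \<delta>" using m r \<open>r < \<delta> / 2\<close> d(3) by simp
    finally have "dist (f (Complex m r)) (f 0) < e" by (rule \<delta>(2))
    then have "W \<mu> 0 - e < W (\<mu> - m) (B * r) - \<alpha> / 2 * r - K * m" by (simp add: f_def dist_real_def)
    moreover have "m powr \<gamma> \<le> m powr 1" using m d(4) beta_gamma(4) by (intro powr_mono') auto
    then have "K * m powr \<gamma> \<le> K * m" using m C(2) by (intro mult_left_mono) auto
    ultimately show ?thesis by simp
  qed
  with d(1) d\<mu> show ?thesis using that by blast
qed

text \<open>Where \<open>\<Phi>\<close> is not positive, the quadratic lower bounds of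
  \<open>W\<close> are compensated by the linear term \<open>\<alpha> / 2 * r\<close> and a
  constant. This bounds \<open>r\<close> first, and then \<open>r\<^sup>2\<close> by a multiple of
  either mass.\<close>

lemma \<Phi>_coercive:
  assumes \<mu>: "\<mu> > 0"
  obtains K C where "C \<ge> 0" "K \<ge> 0" "\<forall>s r. s > 0 \<longrightarrow> r \<ge> 0 \<longrightarrow> - K * s powr \<gamma> \<le> W s r"
    "\<forall>m r. 0 < m \<longrightarrow> m < \<mu> \<longrightarrow> 0 \<le> r \<longrightarrow> \<Phi> \<mu> m r \<le> 0 \<longrightarrow> r\<^sup>2 \<le> C * m \<and> r\<^sup>2 \<le> C * (\<mu> - m)"
proof -
  obtain K where K: "K \<ge> 0" "\<And>s r. s > 0 \<Longrightarrow> r \<ge> 0 \<Longrightarrow> r\<^sup>2 / (32 * s) - K * s powr \<gamma> \<le> W s r"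
    using W_ge by blast
  define c where "c = 2 * K * \<mu> powr \<gamma>"
  \<comment> \<open>A crude solution of
    \<open>r * r \<le> 32 * \<mu> * c + 16 * \<alpha> * \<mu> * r\<close>: either
    \<open>r \<le> 1\<close>, or the constant term may be multiplied by \<open>r\<close> before
    dividing.\<close>
  define R1 where "R1 = 1 + 16 * \<alpha> * \<mu> + 32 * \<mu> * c"
  define C where "C = 32 * (c + \<alpha> / 2 * R1)"
  have c: "c \<ge> 0" using K(1) by (simp add: c_def)
  have R1: "R1 \<ge> 1" using c \<mu> alpha_pos by (simp add: R1_def)
  have C: "C \<ge> 0" using c R1 alpha_pos by (simp add: C_def)
  have "r\<^sup>2 \<le> C * m \<and> r\<^sup>2 \<le> C * (\<mu> - m)" if m: "0 < m" "m < \<mu>" and r: "0 \<le> r" and le: "\<Phi> \<mu> m r \<le> 0" for m r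
  proof -
    define A B where "A = r\<^sup>2 / (32 * m)" and "B = (\<tau>\<^sup>2 * r)\<^sup>2 / (32 * (\<mu> - m))"
    have AB: "A \<ge> 0" "B \<ge> 0" using m by (auto simp: A_def B_def)
    have "A - K * m powr \<gamma> \<le> W m r" "B - K * (\<mu> - m) powr \<gamma> \<le> W (\<mu> - m) (\<tau>\<^sup>2 * r)"
      unfolding A_def B_def using K(2)[OF m(1) r] K(2)[of "\<mu> - m" "\<tau>\<^sup>2 * r"] m r by simp_all
    moreover have "K * m powr \<gamma> \<le> K * \<mu> powr \<gamma>" "K * (\<mu> - m) powr \<gamma> \<le> K * \<mu> powr \<gamma>"
      using m beta_gamma(4) K(1) by (auto intro!: mult_left_mono powr_mono2)
    ultimately have sum: "A + B \<le> c + \<alpha> / 2 * r" using le unfolding \<Phi>_def c_def by simp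
    have r2: "r\<^sup>2 = 32 * m * A" using m by (simp add: A_def)
    have "r\<^sup>2 \<le> 32 * \<mu> * A" unfolding r2 using m AB by (intro mult_right_mono) auto
    also have "\<dots> \<le> 32 * \<mu> * (c + \<alpha> / 2 * r)" using sum AB \<mu> by (intro mult_left_mono) auto
    finally have q: "r * r \<le> 32 * \<mu> * c + 16 * \<alpha> * \<mu> * r" by (simp add: power2_eq_square algebra_simps)
    have rR: "r \<le> R1"
    proof (cases "r \<le> 1")
      case False
      have "32 * \<mu> * c * 1 \<le> 32 * \<mu> * c * r" using False c \<mu> by (intro mult_left_mono) auto
      then have "r * r \<le> (32 * \<mu> * c + 16 * \<alpha> * \<mu>) * r" using q by (simp add: algebra_simps)
      then have "r \<le> 32 * \<mu> * c + 16 * \<alpha> * \<mu>" using False by simp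
      then show ?thesis by (simp add: R1_def)
    qed (use R1 in simp)
    have s2: "A + B \<le> c + \<alpha> / 2 * R1" using sum rR alpha_pos by (smt (verit) mult_left_mono divide_pos_pos)
    have "r\<^sup>2 \<le> 32 * m * (c + \<alpha> / 2 * R1)" unfolding r2 using s2 AB m by (intro mult_left_mono) auto
    moreover have "r\<^sup>2 \<le> 32 * (\<mu> - m) * (c + \<alpha> / 2 * R1)"
    proof -
      have "1 * r \<le> \<tau>\<^sup>2 * r" using tau_sq r by (intro mult_right_mono) auto
      then have "r\<^sup>2 \<le> (\<tau>\<^sup>2 * r)\<^sup>2" using r by (intro power_mono) auto
      also have "\<dots> = 32 * (\<mu> - m) * B" using m by (simp add: B_def)
      also have "\<dots> \<le> 32 * (\<mu> - m) * (c + \<alpha> / 2 * R1)" using s2 AB m by (intro mult_left_mono) auto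
      finally show ?thesis .
    qed
    ultimately show ?thesis by (simp add: C_def algebra_simps)
  qed
  note main = this
  have "- K * s powr \<gamma> \<le> W s r" if "s > 0" "r \<ge> 0" for s r
  proof -
    have "0 \<le> r\<^sup>2 / (32 * s)" using that by simp
    then show ?thesis using K(2)[OF that] by simp
  qed
  note low = this
  show ?thesis
    by (rule that[OF C K(1)]) (use main low in blast)+
qed

text \<open>The value at the test pair lies strictly below \<open>W \<mu> 0\<close>, the limiting
  level at both edges. By \<open>W_boundary_limit\<close> no pair of its sublevel set is close to an
  edge, so this set fits into a compact rectangle.\<close>

lemma \<Phi>_min_exists:
  assumes \<mu>: "\<mu> > 0"
  obtains m r where "0 < m" "m < \<mu>" "r \<ge> 0" "\<Phi> \<mu> m r < W \<mu> 0"
    "\<forall>m' r'. 0 < m' \<longrightarrow> m' < \<mu> \<longrightarrow> r' \<ge> 0 \<longrightarrow> \<Phi> \<mu> m r \<le> \<Phi> \<mu> m' r'"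
proof -
  obtain m0 r0 where p0: "0 < m0" "m0 < \<mu>" "r0 > 0" "\<Phi> \<mu> m0 r0 < W \<mu> 0"
    using \<Phi>_test_point[OF \<mu>] by blast
  define F where "F = \<Phi> \<mu> m0 r0"
  define e where "e = W \<mu> 0 - F"
  have e: "e > 0" using p0 by (simp add: e_def F_def)
  have F: "F < 0" using p0 W_0_neg[OF \<mu>] by (simp add: F_def)
  obtain K C where C: "C \<ge> 0" "K \<ge> 0" and Wlow': "\<forall>s r. s > 0 \<longrightarrow> r \<ge> 0 \<longrightarrow> - K * s powr \<gamma> \<le> W s r"
    and coer': "\<forall>m r. 0 < m \<longrightarrow> m < \<mu> \<longrightarrow> 0 \<le> r \<longrightarrow> \<Phi> \<mu> m r \<le> 0 \<longrightarrow> r\<^sup>2 \<le> C * m \<and> r\<^sup>2 \<le> C * (\<mu> - m)"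
    by (rule \<Phi>_coercive[OF \<mu>])
  note Wlow = Wlow'[rule_format] and coer = coer'[rule_format]
  obtain d1 where d1: "d1 > 0" "d1 < \<mu>" and d1': "\<forall>m r. 0 < m \<longrightarrow> m < d1 \<longrightarrow> 0 \<le> r \<longrightarrow> r\<^sup>2 \<le> C * m \<longrightarrow>
     W \<mu> 0 - e < W (\<mu> - m) (\<tau>\<^sup>2 * r) - \<alpha> / 2 * r - K * m powr \<gamma>"
    by (rule W_boundary_limit[OF \<mu> e C, of "\<tau>\<^sup>2"])
  obtain d2 where d2: "d2 > 0" "d2 < \<mu>" and d2': "\<forall>m r. 0 < m \<longrightarrow> m < d2 \<longrightarrow> 0 \<le> r \<longrightarrow> r\<^sup>2 \<le> C * m \<longrightarrow>
     W \<mu> 0 - e < W (\<mu> - m) (1 * r) - \<alpha> / 2 * r - K * m powr \<gamma>"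
    by (rule W_boundary_limit[OF \<mu> e C, of 1])
  define Q where "Q = {p. d1 \<le> Re p \<and> Re p \<le> \<mu> - d2 \<and> 0 \<le> Im p \<and> Im p \<le> sqrt (C * \<mu>)}"
  have sub: "Complex m r \<in> Q" if m: "0 < m" "m < \<mu>" and r: "0 \<le> r" and le: "\<Phi> \<mu> m r \<le> F" for m r
  proof -
    have c: "r\<^sup>2 \<le> C * m" "r\<^sup>2 \<le> C * (\<mu> - m)" using coer[OF m r] le F by auto
    have "d1 \<le> m"
    proof (rule ccontr)
      assume "\<not> d1 \<le> m"
      then have "F < W (\<mu> - m) (\<tau>\<^sup>2 * r) - \<alpha> / 2 * r - K * m powr \<gamma>" using d1'[rule_format, of m r] m r c by (simp add: e_def)
      also have "\<dots> \<le> \<Phi> \<mu> m r" using Wlow[OF m(1) r] by (simp add: \<Phi>_def)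
      finally show False using le by simp
    qed
    moreover have "m \<le> \<mu> - d2"
    proof (rule ccontr)
      assume "\<not> m \<le> \<mu> - d2"
      then have "F < W m r - \<alpha> / 2 * r - K * (\<mu> - m) powr \<gamma>" using d2'[rule_format, of "\<mu> - m" r] m r c by (simp add: e_def)
      also have "\<dots> \<le> \<Phi> \<mu> m r" using Wlow[of "\<mu> - m" "\<tau>\<^sup>2 * r"] m r by (simp add: \<Phi>_def)
      finally show False using le by simp
    qed
    moreover have "r \<le> sqrt (C * \<mu>)"
    proof (rule real_le_rsqrt)
      have "C * m \<le> C * \<mu>" using m C by (intro mult_left_mono) auto
      then show "r\<^sup>2 \<le> C * \<mu>" using c by simp
    qed
    ultimately show ?thesis using r by (simp add: Q_def)
  qed

  have "Q = cbox (Complex d1 0) (Complex (\<mu> - d2) (sqrt (C * \<mu>)))"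
    unfolding Q_def by (auto simp: in_cbox_complex_iff)
  then have "compact Q" by simp
  moreover have "Complex m0 r0 \<in> Q" using sub[of m0 r0] p0 by (simp add: F_def)
  moreover have "continuous_on Q (\<lambda>p. \<Phi> \<mu> (Re p) (Im p))"
    by (rule continuous_on_subset[OF \<Phi>_continuous[of \<mu>]]) (use d1 d2 in \<open>auto simp: Q_def\<close>)
  ultimately obtain p where p: "p \<in> Q" "\<And>q. q \<in> Q \<Longrightarrow> \<Phi> \<mu> (Re p) (Im p) \<le> \<Phi> \<mu> (Re q) (Im q)"
    using continuous_attains_inf[of Q "\<lambda>p. \<Phi> \<mu> (Re p) (Im p)"] by blast
  have pF: "\<Phi> \<mu> (Re p) (Im p) \<le> F" using p(2)[OF \<open>Complex m0 r0 \<in> Q\<close>] by (simp add: F_def)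
  show ?thesis
  proof (rule that[of "Re p" "Im p"])
    show "0 < Re p" "Re p < \<mu>" "Im p \<ge> 0" using p(1) d1 d2 by (auto simp: Q_def)
    show "\<Phi> \<mu> (Re p) (Im p) < W \<mu> 0" using pF e by (simp add: e_def)
    show "\<forall>m' r'. 0 < m' \<longrightarrow> m' < \<mu> \<longrightarrow> r' \<ge> 0 \<longrightarrow> \<Phi> \<mu> (Re p) (Im p) \<le> \<Phi> \<mu> m' r'"
    proof (intro allI impI)
    fix m' r' :: real assume mr: "0 < m'" "m' < \<mu>" "r' \<ge> 0"
    show "\<Phi> \<mu> (Re p) (Im p) \<le> \<Phi> \<mu> m' r'"
    proof (cases "\<Phi> \<mu> m' r' \<le> F")
      case True
      then show ?thesis using p(2)[OF sub[OF mr True]] by simp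
    next
      case False
      then show ?thesis using pF by simp
    qed
    qed
  qed
qed

text \<open>In terms of \<open>k = \<surd>\<omega>\<close> and the two inward logarithmic slopes \<open>- k \<theta>1\<close>, \<open>- k \<theta>2\<close>, these are the matching conditions at the origin.\<close>
definition triple :: "real \<Rightarrow> real \<Rightarrow> real \<Rightarrow> bool" where
  "triple k \<theta>1 \<theta>2 \<longleftrightarrow> k > 0 \<and> -1 < \<theta>1 \<and> \<theta>1 < 1 \<and> -1 < \<theta>2 \<and> \<theta>2 < 1 \<and>
     dens k \<theta>2 = \<tau>\<^sup>2 * dens k \<theta>1 \<and> k * (\<theta>1 + \<tau>\<^sup>2 * \<theta>2) = \<alpha>"

definition tmass :: "real \<Rightarrow> real \<Rightarrow> real \<Rightarrow> real" where
  "tmass k \<theta>1 \<theta>2 = hmass k \<theta>1 + hmass k \<theta>2"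

text \<open>Stationarity in \<open>m\<close> equates the two frequencies; stationarity in
  \<open>r\<close> balances the two slopes against \<open>\<alpha>\<close>.\<close>

lemma \<Phi>_min_triple:
  assumes \<mu>: "\<mu> > 0"
  obtains k \<theta>1 \<theta>2 where "triple k \<theta>1 \<theta>2" "tmass k \<theta>1 \<theta>2 = \<mu>" "\<Phi> \<mu> (hmass k \<theta>1) (dens k \<theta>1) < W \<mu> 0"
    "\<forall>m' r'. 0 < m' \<longrightarrow> m' < \<mu> \<longrightarrow> r' \<ge> 0 \<longrightarrow> \<Phi> \<mu> (hmass k \<theta>1) (dens k \<theta>1) \<le> \<Phi> \<mu> m' r'"
proof -
  obtain m r where m: "0 < m" "m < \<mu>" and r0: "r \<ge> 0" and less: "\<Phi> \<mu> m r < W \<mu> 0"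
    and min': "\<forall>m' r'. 0 < m' \<longrightarrow> m' < \<mu> \<longrightarrow> r' \<ge> 0 \<longrightarrow> \<Phi> \<mu> m r \<le> \<Phi> \<mu> m' r'"
    by (rule \<Phi>_min_exists[OF \<mu>])
  note min = min'[rule_format]
  have r: "r > 0"
  proof (rule ccontr)
    assume "\<not> r > 0"
    then have "r = 0" using r0 by simp
    \<comment> \<open>At density 0 the slope is -1 on both sides, so raising \<open>r\<close> lowers
      all three terms of \<open>\<Phi>\<close> to first order.\<close>
    have "Wr s 0 < 0" if "s > 0" for s using freq_pos[OF that, of 0] by (simp add: Wr_eq \<Theta>_nonpos)
    then have "Wr m 0 < 0" "\<tau>\<^sup>2 * Wr (\<mu> - m) 0 < 0" using m tau_sq by (auto intro!: mult_pos_neg)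
    then have "Wr m 0 + \<tau>\<^sup>2 * Wr (\<mu> - m) (\<tau>\<^sup>2 * 0) - \<alpha> / 2 < 0" using alpha_pos by simp
    from DERIV_neg_dec_right[OF \<Phi>_deriv_r[OF m, of 0] this]
    obtain d where "d > 0" "\<And>h. h > 0 \<Longrightarrow> h < d \<Longrightarrow> \<Phi> \<mu> m (0 + h) < \<Phi> \<mu> m 0" by blast
    from this(2)[of "d / 2"] this(1) min[OF m, of "d / 2"] \<open>r = 0\<close> show False by simp
  qed
  have "Wr m r + \<tau>\<^sup>2 * Wr (\<mu> - m) (\<tau>\<^sup>2 * r) - \<alpha> / 2 = 0"
    by (rule DERIV_local_min[OF \<Phi>_deriv_r[OF m] r]) (auto intro!: min m)
  then have dr: "Wr m r + \<tau>\<^sup>2 * Wr (\<mu> - m) (\<tau>\<^sup>2 * r) = \<alpha> / 2" by simp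
  have "Ws m r - Ws (\<mu> - m) (\<tau>\<^sup>2 * r) = 0"
    by (rule DERIV_local_min[OF \<Phi>_deriv_m[OF m], of "min m (\<mu> - m)"]) (use m r in \<open>auto intro!: min\<close>)
  then have dm: "Ws m r = Ws (\<mu> - m) (\<tau>\<^sup>2 * r)" by simp
  define k k2 \<theta>1 \<theta>2 where "k = freq m r" and "k2 = freq (\<mu> - m) (\<tau>\<^sup>2 * r)"
    and "\<theta>1 = \<Theta> (r * m powr (- \<beta>))" and "\<theta>2 = \<Theta> (\<tau>\<^sup>2 * r * (\<mu> - m) powr (- \<beta>))"
  have m2: "\<mu> - m > 0" and r2: "\<tau>\<^sup>2 * r > 0" using m r tau_gt_1 by auto
  have k: "k > 0" "k2 > 0" unfolding k_def k2_def using freq_pos m m2 by auto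
  have "k\<^sup>2 = k2\<^sup>2" using dm Ws_eq[OF m(1) r0] Ws_eq[OF m2 less_imp_le[OF r2]] by (simp add: k_def k2_def)
  then have k2: "k2 = k" using k by (simp add: power2_eq_iff)
  have p1: "m = hmass k \<theta>1" "r = dens k \<theta>1" using param_exists[OF m(1) r0] by (simp_all add: k_def \<theta>1_def)
  have p2: "\<mu> - m = hmass k \<theta>2" "\<tau>\<^sup>2 * r = dens k \<theta>2"
    using param_exists[OF m2 less_imp_le[OF r2]] by (simp_all add: k2[symmetric] k2_def \<theta>2_def)
  have t1: "-1 < \<theta>1" "\<theta>1 < 1" unfolding \<theta>1_def using \<Theta>(2) \<Theta>_gt[of "r * m powr (- \<beta>)"] r m by auto
  have t2: "-1 < \<theta>2" "\<theta>2 < 1" unfolding \<theta>2_def using \<Theta>(2) \<Theta>_gt[of "\<tau>\<^sup>2 * r * (\<mu> - m) powr (- \<beta>)"] r2 m2 by auto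
  have "k * \<theta>1 / 2 + \<tau>\<^sup>2 * (k * \<theta>2 / 2) = \<alpha> / 2"
    using dr Wr_eq[of m r] Wr_eq[of "\<mu> - m" "\<tau>\<^sup>2 * r"] by (simp add: k_def[symmetric] k2_def[symmetric] k2 \<theta>1_def[symmetric] \<theta>2_def[symmetric])
  then have "k * (\<theta>1 + \<tau>\<^sup>2 * \<theta>2) = \<alpha>" by (simp add: algebra_simps)
  then have "triple k \<theta>1 \<theta>2" unfolding triple_def using k t1 t2 p1 p2 by simp
  moreover have "tmass k \<theta>1 \<theta>2 = \<mu>" unfolding tmass_def using p1 p2 by simp
  ultimately show ?thesis using that[of k \<theta>1 \<theta>2] less min' unfolding p1[symmetric] by blast
qed

text \<open>If the left half carries the peak (\<open>\<theta>1 < 0\<close>), moving the part of it above the jump to the right half lowers the energy.\<close>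
lemma triple_flip:
  assumes t: "triple k \<theta>1 \<theta>2" and neg: "\<theta>1 < 0"
  obtains m' where "0 < m'" "m' < tmass k \<theta>1 \<theta>2"
    "\<Phi> (tmass k \<theta>1 \<theta>2) m' (dens k \<theta>1) < \<Phi> (tmass k \<theta>1 \<theta>2) (hmass k \<theta>1) (dens k \<theta>1)"
proof -
  define a b r \<mu> where "a = - \<theta>1" and "b = \<theta>2" and "r = dens k \<theta>1" and "\<mu> = tmass k \<theta>1 \<theta>2"
  have k: "k > 0" and a: "0 < a" "a < 1" and b1: "-1 < b" "b < 1" and d: "dens k b = \<tau>\<^sup>2 * r" and fl: "k * (\<tau>\<^sup>2 * b - a) = \<alpha>"
    using t neg unfolding triple_def a_def b_def r_def by auto
  have r: "r > 0" unfolding r_def using t dens_pos[of k \<theta>1] by (simp add: triple_def)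
  \<comment> \<open>The attraction at the jump forces the right half to decrease away from the
    origin when the left half increases.\<close>
  have "\<tau>\<^sup>2 * b - a > 0" using fl k alpha_pos by (metis zero_less_mult_pos)
  then have "\<tau>\<^sup>2 * b > 0" using a by simp
  then have b: "0 < b" "b < 1" using tau_sq b1 by (auto simp: zero_less_mult_iff)
  have ra: "r = dens k a" "r = dens k (- a)" by (auto simp: r_def dens_def a_def)
  have rb: "\<tau>\<^sup>2 * r = dens k (- b)" using d by (simp add: dens_def)
  \<comment> \<open>The right side has the larger density at equal frequency, hence is closer to the
    peak level and has the smaller slope.\<close>
  have ba: "b < a"
  proof (rule ccontr)
    assume "\<not> b < a"
    then have "a\<^sup>2 \<le> b\<^sup>2" using a by (intro power_mono) auto
    then have "(\<sigma> + 1) * k\<^sup>2 * (1 - b\<^sup>2) \<le> (\<sigma> + 1) * k\<^sup>2 * (1 - a\<^sup>2)" using sigma_pos by (intro mult_left_mono) auto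
    then have "dens k b \<le> dens k a" unfolding dens_def
      using sigma_pos sq_le_1[of b] b by (intro powr_mono2) auto
    then show False using d ra(1) r tau_sq by (simp add: mult_le_cancel_right2)
  qed
  \<comment> \<open>\<open>m - m'\<close> is the mass of the symmetric cap of the left half above
    the density \<open>r\<close>, and \<open>s' - s\<close> that of the cap which turns the right
    half into a piece with its peak inside. The second cap is the smaller one, which leaves the
    surplus mass \<open>D\<close>.\<close>
  define m m' s s' where "m = hmass k (- a)" and "m' = hmass k a" and "s = hmass k b" and "s' = hmass k (- b)"
  have pos: "m > 0" "m' > 0" "s > 0" "s' > 0" unfolding m_def m'_def s_def s'_def using k a b by (auto intro!: hmass_pos)
  have \<mu>: "\<mu> = m + s" unfolding \<mu>_def tmass_def m_def s_def a_def b_def by simp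
  have K: "k powr ((2 - \<sigma>) / \<sigma>) > 0" using k by simp
  have mm: "m' < m" unfolding m_def m'_def hmass_def using J_strict_decreasing[of "- a" a] a K CJ_pos by simp
  have "J (- b) < J (- a)" "J a < J b" using J_strict_decreasing[of "- a" "- b"] J_strict_decreasing[of b a] ba a b by auto
  then have "CJ * k powr ((2 - \<sigma>) / \<sigma>) * (J (- b) - J b) < CJ * k powr ((2 - \<sigma>) / \<sigma>) * (J (- a) - J a)"
    using K CJ_pos by (intro mult_strict_left_mono) auto
  then have dd: "s' - s < m - m'" unfolding m_def m'_def s_def s'_def hmass_def by (simp add: algebra_simps)
  have W1: "W m r = (r * k * (- a) - (2 - \<sigma>) * m * k\<^sup>2 / 2) / (2 + \<sigma>)" "W m' r = (r * k * a - (2 - \<sigma>) * m' * k\<^sup>2 / 2) / (2 + \<sigma>)"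
    unfolding m_def m'_def using param_W(4)[OF k, of "- a"] param_W(4)[OF k, of a] a ra by auto
  have W2: "W s (\<tau>\<^sup>2 * r) = (\<tau>\<^sup>2 * r * k * b - (2 - \<sigma>) * s * k\<^sup>2 / 2) / (2 + \<sigma>)" 
      "W s' (\<tau>\<^sup>2 * r) = (\<tau>\<^sup>2 * r * k * (- b) - (2 - \<sigma>) * s' * k\<^sup>2 / 2) / (2 + \<sigma>)"
    unfolding s_def s'_def using param_W(4)[OF k, of "- b"] param_W(4)[OF k, of b] b d rb by auto
  \<comment> \<open>Mass added to the right half beyond \<open>s'\<close> lowers its energy at a
    rate of at least \<open>k\<^sup>2 / 2\<close>.\<close>
  have W3: "W (\<mu> - m') (\<tau>\<^sup>2 * r) + k\<^sup>2 / 2 * (\<mu> - m') \<le> W s' (\<tau>\<^sup>2 * r) + k\<^sup>2 / 2 * s'"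
  proof (rule DERIV_nonpos_imp_nonincreasing[where f = "\<lambda>x. W x (\<tau>\<^sup>2 * r) + k\<^sup>2 / 2 * x"])
    show "s' \<le> \<mu> - m'" using dd \<mu> by simp
    fix x assume x: "s' \<le> x" "x \<le> \<mu> - m'"
    have 1: "((\<lambda>x. x) has_real_derivative 1) (at x)" "((\<lambda>x. \<tau>\<^sup>2 * r) has_real_derivative 0) (at x)" "((\<lambda>x. k\<^sup>2 / 2 * x) has_real_derivative k\<^sup>2 / 2) (at x)"
      by (auto intro!: derivative_eq_intros)
    have "((\<lambda>x. W x (\<tau>\<^sup>2 * r) + k\<^sup>2 / 2 * x) has_real_derivative (Ws x (\<tau>\<^sup>2 * r) + k\<^sup>2 / 2)) (at x)"
      using DERIV_add[OF W_curve[OF 1(1,2)] 1(3)] x pos by simp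
    moreover have "Ws x (\<tau>\<^sup>2 * r) \<le> - k\<^sup>2 / 2"
      using Ws_beyond_peak[OF k, of "- b" x] b x unfolding rb s'_def by simp
    ultimately show "\<exists>y. ((\<lambda>x. W x (\<tau>\<^sup>2 * r) + k\<^sup>2 / 2 * x) has_real_derivative y) (at x) \<and> y \<le> 0"
      by (intro exI[of _ "Ws x (\<tau>\<^sup>2 * r) + k\<^sup>2 / 2"]) simp
  qed
  define D where "D = (m - m') - (s' - s)"
  have D: "D > 0" using dd by (simp add: D_def)
  have "\<Phi> \<mu> m' r - \<Phi> \<mu> m r = W m' r - W m r + (W (\<mu> - m') (\<tau>\<^sup>2 * r) - W s (\<tau>\<^sup>2 * r))"
    unfolding \<Phi>_def using \<mu> by simp
  also have "\<dots> \<le> W m' r - W m r + (W s' (\<tau>\<^sup>2 * r) - W s (\<tau>\<^sup>2 * r)) - k\<^sup>2 / 2 * D"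
  proof -
    have "k\<^sup>2 / 2 * (\<mu> - m') - k\<^sup>2 / 2 * s' = k\<^sup>2 / 2 * D" unfolding D_def \<mu> by (simp add: field_simps)
    then show ?thesis using W3 by linarith
  qed
  also have "\<dots> = (- 2 * r * (k * (\<tau>\<^sup>2 * b - a)) - \<sigma> * k\<^sup>2 * D) / (2 + \<sigma>)"
  proof -
    have Z: "2 + \<sigma> \<noteq> 0" using sigma_pos by simp
    have Wm: "W m r * (2 + \<sigma>) = r * k * (- a) - (2 - \<sigma>) * m * k\<^sup>2 / 2" "W m' r * (2 + \<sigma>) = r * k * a - (2 - \<sigma>) * m' * k\<^sup>2 / 2"
      "W s (\<tau>\<^sup>2 * r) * (2 + \<sigma>) = \<tau>\<^sup>2 * r * k * b - (2 - \<sigma>) * s * k\<^sup>2 / 2"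
      "W s' (\<tau>\<^sup>2 * r) * (2 + \<sigma>) = \<tau>\<^sup>2 * r * k * (- b) - (2 - \<sigma>) * s' * k\<^sup>2 / 2"
      unfolding W1 W2 using Z by (simp_all only: nonzero_eq_divide_eq[symmetric] nonzero_mult_div_cancel_right times_divide_eq_left not_False_eq_True)
    have "(W m' r - W m r + (W s' (\<tau>\<^sup>2 * r) - W s (\<tau>\<^sup>2 * r)) - k\<^sup>2 / 2 * D) * (2 + \<sigma>)
        = W m' r * (2 + \<sigma>) - W m r * (2 + \<sigma>) + (W s' (\<tau>\<^sup>2 * r) * (2 + \<sigma>) - W s (\<tau>\<^sup>2 * r) * (2 + \<sigma>)) - k\<^sup>2 / 2 * D * (2 + \<sigma>)"
      by (simp add: algebra_simps)
    also have "\<dots> = - 2 * r * (k * (\<tau>\<^sup>2 * b - a)) - \<sigma> * k\<^sup>2 * D"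
      unfolding Wm D_def by (simp add: field_simps)
    finally show ?thesis by (simp only: nonzero_eq_divide_eq[OF Z])
  qed
  also have "\<dots> < 0"
  proof -
    have "2 * r * \<alpha> > 0" using r alpha_pos by simp
    moreover have "\<sigma> * k\<^sup>2 * D > 0" using sigma_pos k D by simp
    ultimately have "- 2 * r * \<alpha> - \<sigma> * k\<^sup>2 * D < 0" by linarith
    then show ?thesis unfolding fl using sigma_pos by (intro divide_neg_pos) auto
  qed
  finally have "\<Phi> \<mu> m' r < \<Phi> \<mu> m r" by simp
  moreover have "m' < \<mu>" using mm pos \<mu> by simp
  ultimately show ?thesis using that[of m'] pos unfolding \<mu>_def r_def m_def a_def by simp
qed

end

section \<open>The two branches of matching conditions and the masses along them\<close>

context nls_jump
begin

definition \<kappa> :: real where "\<kappa> = \<tau> powr (2 * \<sigma>)"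

text \<open>The jump of the densities, raised to the power \<open>\<sigma>\<close>, reads
  \<open>1 - b\<^sup>2 = \<kappa> * (1 - \<theta>1\<^sup>2)\<close>; this is its positive solution
  for \<open>\<theta>1\<close>.\<close>

definition hh :: "real \<Rightarrow> real" where "hh b = sqrt (1 - (1 - b\<^sup>2) / \<kappa>)"

text \<open>The two branches of matching conditions: \<open>\<theta>2 = b\<close>, \<open>\<theta>1 = \<epsilon> * hh b\<close> with a sign \<open>\<epsilon>\<close>.\<close>
definition sl :: "real \<Rightarrow> real \<Rightarrow> real" where "sl \<epsilon> b = \<tau>\<^sup>2 * b + \<epsilon> * hh b"

definition Jsum :: "real \<Rightarrow> real \<Rightarrow> real" where "Jsum \<epsilon> b = J (\<epsilon> * hh b) + J b"

lemma kappa_gt_1: "\<kappa> > 1"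
  unfolding \<kappa>_def using tau_gt_1 sigma_pos by (intro gr_one_powr) auto

lemma kappa_powr: "\<kappa> powr (1 / \<sigma>) = \<tau>\<^sup>2" "(\<tau>\<^sup>2) powr \<sigma> = \<kappa>"
proof -
  have t: "\<tau>\<^sup>2 = \<tau> powr 2" using tau_gt_1 by simp
  show "\<kappa> powr (1 / \<sigma>) = \<tau>\<^sup>2" "(\<tau>\<^sup>2) powr \<sigma> = \<kappa>"
    unfolding t \<kappa>_def powr_powr using sigma_pos by simp_all
qed

lemma hh_sq: 
  assumes "-1 \<le> b" "b \<le> 1"
  shows "(hh b)\<^sup>2 = 1 - (1 - b\<^sup>2) / \<kappa>" "0 < hh b" "hh b \<le> 1"
proof -
  have b: "0 \<le> b\<^sup>2" "b\<^sup>2 \<le> 1" using sq_le_1[OF assms] by auto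
  then have "1 - b\<^sup>2 < \<kappa>" using kappa_gt_1 by linarith
  then have "(1 - b\<^sup>2) / \<kappa> < 1" using kappa_gt_1 by simp
  then have p: "1 - (1 - b\<^sup>2) / \<kappa> > 0" by simp
  then show "(hh b)\<^sup>2 = 1 - (1 - b\<^sup>2) / \<kappa>" "0 < hh b" unfolding hh_def by simp_all
  have "(1 - b\<^sup>2) / \<kappa> \<ge> 0" using b kappa_gt_1 by simp
  then show "hh b \<le> 1" unfolding hh_def by simp
qed

lemma hh_1 [simp]: "hh 1 = 1"
  by (simp add: hh_def)

lemma hh_bounds:
  assumes "-1 < b" "b < 1"
  shows "\<bar>b\<bar> < hh b" "hh b < 1"
proof -
  have h: "(hh b)\<^sup>2 = 1 - (1 - b\<^sup>2) / \<kappa>" "0 < hh b" using hh_sq[of b] assms by auto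
  have b: "1 - b\<^sup>2 > 0" using sq_less_1[OF assms] by simp
  have "(1 - b\<^sup>2) / \<kappa> < 1 - b\<^sup>2" using b kappa_gt_1 by (simp add: divide_less_eq mult_less_cancel_left1)
  then have "\<bar>b\<bar>\<^sup>2 < (hh b)\<^sup>2" using h by simp
  then show "\<bar>b\<bar> < hh b" by (rule power2_less_imp_less) (use h in simp)
  have "(1 - b\<^sup>2) / \<kappa> > 0" using b kappa_gt_1 by simp
  then have "(hh b)\<^sup>2 < 1\<^sup>2" using h by simp
  then show "hh b < 1" by (rule power2_less_imp_less) simp
qed

lemma hh_continuous: "continuous_on A hh"
  unfolding hh_def[abs_def] using kappa_gt_1 by (intro continuous_intros) auto

lemma hh_deriv:
  assumes "-1 < b" "b < 1"
  shows "(hh has_real_derivative b / (\<kappa> * hh b)) (at b)"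
proof -
  have h: "(hh b)\<^sup>2 = 1 - (1 - b\<^sup>2) / \<kappa>" "0 < hh b" using hh_sq[of b] assms by auto
  have p: "0 < 1 - (1 - b\<^sup>2) / \<kappa>" using h by (metis zero_less_power)
  have d: "((\<lambda>b. 1 - (1 - b\<^sup>2) / \<kappa>) has_real_derivative 2 * b / \<kappa>) (at b)"
    using kappa_gt_1 by (auto intro!: derivative_eq_intros)
  have "((\<lambda>b. sqrt (1 - (1 - b\<^sup>2) / \<kappa>)) has_real_derivative inverse (sqrt (1 - (1 - b\<^sup>2) / \<kappa>)) / 2 * (2 * b / \<kappa>)) (at b)"
    by (rule DERIV_chain2[OF DERIV_real_sqrt[OF p] d])
  then show ?thesis unfolding hh_def[abs_def] by (simp add: field_simps)
qed

text \<open>The derivative of \<open>hh\<close> has modulus below 1, since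
  \<open>\<bar>b\<bar> < hh b\<close> and \<open>\<kappa> > 1\<close>; whatever the sign, the
  coefficient \<open>\<tau>\<^sup>2 > 1\<close> of \<open>b\<close> dominates.\<close>

lemma sl_strict_mono:
  assumes e: "\<epsilon> = 1 \<or> \<epsilon> = -1" and b: "-1 < b" "b < b'" "b' \<le> 1"
  shows "sl \<epsilon> b < sl \<epsilon> b'"
proof (rule DERIV_pos_imp_increasing_open[OF b(2)])
  fix x assume "b < x" "x < b'"
  then have x: "-1 < x" "x < 1" using b by auto
  have "(sl \<epsilon> has_real_derivative (\<tau>\<^sup>2 * 1 + \<epsilon> * (x / (\<kappa> * hh x)))) (at x)"
    unfolding sl_def[abs_def] by (intro DERIV_add DERIV_cmult DERIV_ident hh_deriv x)
  moreover have "\<bar>\<epsilon> * (x / (\<kappa> * hh x))\<bar> < 1"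
  proof -
    have h: "\<bar>x\<bar> < hh x" using hh_bounds[OF x] by simp
    have "hh x \<le> \<kappa> * hh x" using h kappa_gt_1 by (intro mult_le_cancel_right1[THEN iffD2]) auto
    then have "\<bar>x\<bar> < \<kappa> * hh x" using h by simp
    then show ?thesis using e h kappa_gt_1 by (auto simp: abs_mult)
  qed
  ultimately show "\<exists>y. (sl \<epsilon> has_real_derivative y) (at x) \<and> 0 < y"
    using tau_sq by (intro exI[of _ "\<tau>\<^sup>2 * 1 + \<epsilon> * (x / (\<kappa> * hh x))"] conjI) (assumption, linarith)
next
  show "continuous_on {b..b'} (sl \<epsilon>)" unfolding sl_def[abs_def] by (intro continuous_intros hh_continuous)
qed

lemma Jsum_continuous:
  assumes e: "\<epsilon> = 1 \<or> \<epsilon> = -1" and "-1 \<le> b" "b' \<le> 1"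
  shows "continuous_on {b..b'} (Jsum \<epsilon>)"
proof -
  have "continuous_on {b..b'} (\<lambda>b. J (\<epsilon> * hh b))"
  proof (rule continuous_on_compose2[OF J_continuous])
    show "continuous_on {b..b'} (\<lambda>b. \<epsilon> * hh b)" by (intro continuous_intros hh_continuous)
    show "(\<lambda>b. \<epsilon> * hh b) ` {b..b'} \<subseteq> {-1..1}"
    proof (rule image_subsetI)
      fix x assume "x \<in> {b..b'}"
      then have "0 < hh x" "hh x \<le> 1" using hh_sq[of x] assms by auto
      then show "\<epsilon> * hh x \<in> {-1..1}" using e by auto
    qed
  qed
  then show ?thesis unfolding Jsum_def[abs_def]
    using assms by (intro continuous_on_add continuous_on_subset[OF J_continuous]) auto
qed

text \<open>The two integrands differ by a constant factor because \<open>1 - b\<^sup>2\<close> and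
  \<open>1 - (hh b)\<^sup>2\<close> do. So the derivative is a negative multiple of
  \<open>\<epsilon> * (b / hh b) + \<tau>\<^sup>2\<close>, whose first summand has modulus below
  1.\<close>

lemma Jsum_strict_decreasing:
  assumes e: "\<epsilon> = 1 \<or> \<epsilon> = -1" and b: "-1 < b" "b < b'" "b' \<le> 1"
  shows "Jsum \<epsilon> b' < Jsum \<epsilon> b"
proof (rule DERIV_neg_imp_decreasing_open[OF b(2)])
  fix x assume "b < x" "x < b'"
  then have x: "-1 < x" "x < 1" using b by auto
  have h: "\<bar>x\<bar> < hh x" "hh x < 1" using hh_bounds[OF x] by auto
  have eh: "-1 < \<epsilon> * hh x" "\<epsilon> * hh x < 1" using e h by auto
  define E where "E = (1 - (\<epsilon> * hh x)\<^sup>2) powr (1 / \<sigma> - 1)"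
  have ee: "(\<epsilon> * hh x)\<^sup>2 = (hh x)\<^sup>2" using e by auto
  have pos: "1 - (hh x)\<^sup>2 > 0" using h by (simp add: abs_square_less_1)
  have E: "E > 0" unfolding E_def ee using pos by simp
  have xx: "1 - x\<^sup>2 = \<kappa> * (1 - (hh x)\<^sup>2)" using hh_sq(1)[of x] x kappa_gt_1 by (simp add: field_simps)
  have E2: "(1 - x\<^sup>2) powr (1 / \<sigma> - 1) = \<tau>\<^sup>2 / \<kappa> * E"
    unfolding E_def ee xx using kappa_gt_1 pos kappa_powr(1) by (simp add: powr_mult powr_diff)
  have d1: "((\<lambda>b. \<epsilon> * hh b) has_real_derivative \<epsilon> * (x / (\<kappa> * hh x))) (at x)"
    by (intro DERIV_cmult hh_deriv x)
  have "(Jsum \<epsilon> has_real_derivative (- E * (\<epsilon> * (x / (\<kappa> * hh x))) + - ((1 - x\<^sup>2) powr (1 / \<sigma> - 1)))) (at x)"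
    unfolding Jsum_def[abs_def] E_def by (intro DERIV_add DERIV_chain2[OF J_deriv d1] J_deriv x eh)
  moreover have "- E * (\<epsilon> * (x / (\<kappa> * hh x))) + - ((1 - x\<^sup>2) powr (1 / \<sigma> - 1)) = - (E / \<kappa>) * (\<epsilon> * (x / hh x) + \<tau>\<^sup>2)"
    unfolding E2 using kappa_gt_1 h by (simp add: field_simps)
  moreover have "\<epsilon> * (x / hh x) + \<tau>\<^sup>2 > 0"
  proof -
    have "\<bar>\<epsilon> * (x / hh x)\<bar> < 1" using e h by (auto simp: abs_mult)
    then show ?thesis using tau_sq by linarith
  qed
  then have "- (E / \<kappa>) * (\<epsilon> * (x / hh x) + \<tau>\<^sup>2) < 0" using E kappa_gt_1 by (intro mult_neg_pos) auto
  ultimately show "\<exists>y. (Jsum \<epsilon> has_real_derivative y) (at x) \<and> y < 0"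
    by (intro exI[of _ "- (E / \<kappa>) * (\<epsilon> * (x / hh x) + \<tau>\<^sup>2)"]) (simp only:)
next
  show "continuous_on {b..b'} (Jsum \<epsilon>)" using b by (intro Jsum_continuous e) auto
qed

lemma triple_branch:
  assumes t: "triple k \<theta>1 \<theta>2"
  defines "\<epsilon> \<equiv> (if \<theta>1 < 0 then -1 else 1)"
  shows "\<theta>1 = \<epsilon> * hh \<theta>2" "sl \<epsilon> \<theta>2 > 0" "k = \<alpha> / sl \<epsilon> \<theta>2" "tmass k \<theta>1 \<theta>2 = CJ * Jsum \<epsilon> \<theta>2 * k powr ((2 - \<sigma>) / \<sigma>)" "\<theta>1 \<noteq> 0"
proof -
  have k: "k > 0" and t1: "-1 < \<theta>1" "\<theta>1 < 1" and t2: "-1 < \<theta>2" "\<theta>2 < 1" and d: "dens k \<theta>2 = \<tau>\<^sup>2 * dens k \<theta>1"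
    and f: "k * (\<theta>1 + \<tau>\<^sup>2 * \<theta>2) = \<alpha>" using t unfolding triple_def by auto
  have "dens k \<theta>2 powr \<sigma> = (\<tau>\<^sup>2) powr \<sigma> * dens k \<theta>1 powr \<sigma>"
    unfolding d using dens_pos[OF k t1] by (simp add: powr_mult)
  then have "(\<sigma> + 1) * k\<^sup>2 * (1 - \<theta>2\<^sup>2) = \<kappa> * ((\<sigma> + 1) * k\<^sup>2 * (1 - \<theta>1\<^sup>2))"
    unfolding kappa_powr(2) using dens_powr[of \<theta>1 k] dens_powr[of \<theta>2 k] t1 t2 by simp
  then have "(\<sigma> + 1) * k\<^sup>2 * (1 - \<theta>2\<^sup>2) = (\<sigma> + 1) * k\<^sup>2 * (\<kappa> * (1 - \<theta>1\<^sup>2))" by (simp add: mult_ac)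
  then have "1 - \<theta>2\<^sup>2 = \<kappa> * (1 - \<theta>1\<^sup>2)"
  proof -
    have nz: "(\<sigma> + 1) * k\<^sup>2 \<noteq> 0" using k sigma_pos by simp
    assume "(\<sigma> + 1) * k\<^sup>2 * (1 - \<theta>2\<^sup>2) = (\<sigma> + 1) * k\<^sup>2 * (\<kappa> * (1 - \<theta>1\<^sup>2))"
    then show ?thesis unfolding mult_left_cancel[OF nz] .
  qed
  then have "(hh \<theta>2)\<^sup>2 = \<theta>1\<^sup>2" using hh_sq(1)[of \<theta>2] t2 kappa_gt_1 by simp
  then have "\<bar>\<theta>1\<bar> = hh \<theta>2" using hh_sq(2)[of \<theta>2] t2 by (metis abs_of_pos less_imp_le power2_eq_iff_nonneg abs_ge_zero power2_abs)
  then show th: "\<theta>1 = \<epsilon> * hh \<theta>2" and "\<theta>1 \<noteq> 0" using hh_sq(2)[of \<theta>2] t2 by (auto simp: \<epsilon>_def)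
  have fs: "k * sl \<epsilon> \<theta>2 = \<alpha>" using f th by (simp add: sl_def algebra_simps)
  then show s: "sl \<epsilon> \<theta>2 > 0" using k alpha_pos by (metis zero_less_mult_pos)
  show "k = \<alpha> / sl \<epsilon> \<theta>2" using fs s by (simp add: field_simps)
  show "tmass k \<theta>1 \<theta>2 = CJ * Jsum \<epsilon> \<theta>2 * k powr ((2 - \<sigma>) / \<sigma>)"
    unfolding tmass_def hmass_def Jsum_def th by (simp add: algebra_simps)
qed

lemma branch_mass_less:
  assumes e: "\<epsilon> = 1 \<or> \<epsilon> = -1" and b: "-1 < b" "b < b'" "b' \<le> 1" and s: "sl \<epsilon> b > 0"
  shows "CJ * Jsum \<epsilon> b' * (\<alpha> / sl \<epsilon> b') powr ((2 - \<sigma>) / \<sigma>) < CJ * Jsum \<epsilon> b * (\<alpha> / sl \<epsilon> b) powr ((2 - \<sigma>) / \<sigma>)"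
proof -
  have s': "sl \<epsilon> b < sl \<epsilon> b'" by (rule sl_strict_mono[OF e b])
  have j: "Jsum \<epsilon> b' < Jsum \<epsilon> b" by (rule Jsum_strict_decreasing[OF e b])
  have h': "0 < hh b'" "hh b' \<le> 1" using hh_sq[of b'] b by auto
  have jn: "J z \<ge> 0" if "-1 \<le> z" "z \<le> 1" for z using J_pos[of z] that by (cases "z = 1") auto
  have j0: "Jsum \<epsilon> b' \<ge> 0" unfolding Jsum_def using e h' b by (intro add_nonneg_nonneg jn) auto
  have "(\<alpha> / sl \<epsilon> b') powr ((2 - \<sigma>) / \<sigma>) \<le> (\<alpha> / sl \<epsilon> b) powr ((2 - \<sigma>) / \<sigma>)"
    using s s' alpha_pos sigma_pos sigma_less by (intro powr_mono2 divide_left_mono) auto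
  moreover have "(\<alpha> / sl \<epsilon> b') powr ((2 - \<sigma>) / \<sigma>) > 0" using s s' alpha_pos by simp
  moreover have "CJ * Jsum \<epsilon> b' < CJ * Jsum \<epsilon> b" "0 \<le> CJ * Jsum \<epsilon> b'" using j j0 CJ_pos by auto
  ultimately show ?thesis
    by - (rule mult_less_le_imp_less; assumption)
qed

lemma triple_unique:
  assumes t: "triple k \<theta>1 \<theta>2" "triple k' \<theta>1' \<theta>2'" and sign: "\<theta>1 < 0 \<longleftrightarrow> \<theta>1' < 0" and m: "tmass k \<theta>1 \<theta>2 = tmass k' \<theta>1' \<theta>2'"
  shows "k = k' \<and> \<theta>1 = \<theta>1' \<and> \<theta>2 = \<theta>2'"
proof -
  define \<epsilon> :: real where "\<epsilon> = (if \<theta>1 < 0 then -1 else 1)"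
  have e: "\<epsilon> = 1 \<or> \<epsilon> = -1" by (simp add: \<epsilon>_def)
  note T = triple_branch[OF t(1), folded \<epsilon>_def]
  have "\<epsilon> = (if \<theta>1' < 0 then -1 else 1)" using sign by (simp add: \<epsilon>_def)
  note T' = triple_branch[OF t(2), folded this]
  have r: "-1 < \<theta>2" "\<theta>2 < 1" "-1 < \<theta>2'" "\<theta>2' < 1" using t by (auto simp: triple_def)
  have eq: "CJ * Jsum \<epsilon> \<theta>2 * (\<alpha> / sl \<epsilon> \<theta>2) powr ((2 - \<sigma>) / \<sigma>) = CJ * Jsum \<epsilon> \<theta>2' * (\<alpha> / sl \<epsilon> \<theta>2') powr ((2 - \<sigma>) / \<sigma>)"
    unfolding T(3)[symmetric] T'(3)[symmetric] T(4)[symmetric] T'(4)[symmetric] by (rule m)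
  have "\<theta>2 = \<theta>2'"
  proof (rule ccontr)
    assume "\<theta>2 \<noteq> \<theta>2'"
    then consider "\<theta>2 < \<theta>2'" | "\<theta>2' < \<theta>2" by linarith
    then show False
    proof cases
      case 1
      show False using branch_mass_less[OF e r(1) 1 less_imp_le[OF r(4)] T(2)] eq by simp
    next
      case 2
      show False using branch_mass_less[OF e r(3) 2 less_imp_le[OF r(2)] T'(2)] eq by simp
    qed
  qed
  then show ?thesis using T(1,3) T'(1,3) by simp
qed

text \<open>The threshold is the limit mass at \<open>b = 1\<close> on the branch with negative
  sign. There \<open>\<theta>1 = -1\<close> and \<open>\<theta>2 = 1\<close>: the left half is a
  whole soliton with \<open>k = \<alpha> / (\<tau>\<^sup>2 - 1)\<close> gone to infinity, and
  nothing remains on the right.\<close>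

lemma mu_crit_eq: "mu_crit \<sigma> \<alpha> \<tau> = CJ * Jsum (-1) 1 * (\<alpha> / sl (-1) 1) powr ((2 - \<sigma>) / \<sigma>)"
  unfolding mu_crit_def J_lebesgue by (simp add: CJ_def Jsum_def sl_def)

lemma right_triple_mass:
  assumes "triple k \<theta>1 \<theta>2" "\<theta>1 < 0"
  shows "tmass k \<theta>1 \<theta>2 > mu_crit \<sigma> \<alpha> \<tau>"
proof -
  have "-1 < \<theta>2" "\<theta>2 < 1" using assms by (auto simp: triple_def)
  then show ?thesis unfolding mu_crit_eq
    using triple_branch[OF assms(1)] assms(2) branch_mass_less[of "-1" \<theta>2 1] by simp
qed

text \<open>Intermediate value theorem for the mass between \<open>b1\<close> and 1. At 1 the mass
  is below \<open>\<mu>\<close> by hypothesis; at \<open>b1\<close>, where \<open>k = k1\<close>, it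
  is at least \<open>\<mu>\<close> because \<open>Jsum\<close> exceeds its limit. Starting at a
  point with \<open>sl\<close> positive keeps \<open>k\<close> finite.\<close>

lemma right_triple_exists:
  assumes \<mu>: "\<mu> > mu_crit \<sigma> \<alpha> \<tau>"
  obtains k \<theta>1 \<theta>2 where "triple k \<theta>1 \<theta>2" "\<theta>1 < 0" "tmass k \<theta>1 \<theta>2 = \<mu>"
proof -
  define p where "p = (2 - \<sigma>) / \<sigma>"
  define j where "j = Jsum (-1) 1"
  define M where "M = (\<lambda>b. CJ * Jsum (-1) b * (\<alpha> / sl (-1) b) powr p)"
  have p: "p > 0" using sigma_pos sigma_less by (simp add: p_def)
  have j: "j > 0" unfolding j_def Jsum_def using J_pos[of "-1"] by simp
  have s1: "sl (-1) 1 = \<tau>\<^sup>2 - 1" "sl (-1) 1 > 0" using tau_sq by (auto simp: sl_def)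
  have M1: "M 1 < \<mu>" using \<mu> unfolding mu_crit_eq M_def p_def .
  have \<mu>0: "\<mu> > 0"
  proof -
    have "mu_crit \<sigma> \<alpha> \<tau> > 0" unfolding mu_crit_eq using CJ_pos j alpha_pos s1(2) by (simp add: j_def[symmetric])
    then show ?thesis using \<mu> by simp
  qed
  \<comment> \<open>The value of \<open>k\<close> at which a whole soliton has mass
    \<open>\<mu>\<close>.\<close>
  define k1 where "k1 = (\<mu> / (CJ * j)) powr (1 / p)"
  have k1: "k1 > 0" using \<mu>0 CJ_pos j by (simp add: k1_def)
  have k1p: "k1 powr p = \<mu> / (CJ * j)" unfolding k1_def using p \<mu>0 CJ_pos j by (simp add: powr_powr)
  have "(\<alpha> / sl (-1) 1) powr p < k1 powr p"
    unfolding k1p using M1 CJ_pos j unfolding M_def j_def by (simp add: field_simps)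
  then have "\<alpha> / sl (-1) 1 < k1" using p k1 by (metis powr_mono2 less_imp_le linorder_not_le order_less_le_trans)
  then have less1: "\<alpha> / k1 < sl (-1) 1" using k1 s1(2) by (simp add: field_simps)
  have "sl (-1) 0 < 0" using hh_sq(2)[of 0] by (simp add: sl_def)
  moreover have "\<alpha> / k1 > 0" using alpha_pos k1 by simp
  moreover have slc: "continuous_on {a..b} (sl (-1))" for a b unfolding sl_def[abs_def] by (intro continuous_intros hh_continuous)
  ultimately obtain b1 where b1: "0 \<le> b1" "b1 \<le> 1" "sl (-1) b1 = \<alpha> / k1"
    using IVT'[of "sl (-1)" 0 "\<alpha> / k1" 1] less1 by auto
  have "b1 \<noteq> 1" using b1 less1 by auto
  then have b11: "b1 < 1" using b1 by simp
  have spos: "sl (-1) b > 0" if "b1 \<le> b" "b \<le> 1" for b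
  proof (cases "b1 = b")
    case False
    then have "sl (-1) b1 < sl (-1) b" using that b1 by (intro sl_strict_mono) auto
    then show ?thesis using b1(3) \<open>\<alpha> / k1 > 0\<close> by simp
  qed (use b1(3) \<open>\<alpha> / k1 > 0\<close> in simp)
  have "j \<le> Jsum (-1) b1" unfolding j_def using Jsum_strict_decreasing[of "-1" b1 1] b1 b11 by simp
  then have "CJ * j * (\<mu> / (CJ * j)) \<le> CJ * Jsum (-1) b1 * (\<mu> / (CJ * j))"
    using CJ_pos j \<mu>0 by (intro mult_right_mono mult_left_mono) auto
  also have "\<dots> = M b1" unfolding M_def b1(3) using k1p alpha_pos by simp
  finally have Mb1: "\<mu> \<le> M b1" using CJ_pos j by simp
  have "continuous_on {b1..1} M" unfolding M_def
  proof (intro continuous_on_mult continuous_on_const Jsum_continuous continuous_on_powr continuous_on_divide slc)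
    show "\<forall>x\<in>{b1..1}. sl (-1) x \<noteq> 0" using spos by force
    show "\<forall>x\<in>{b1..1}. \<alpha> / sl (-1) x \<noteq> 0" using spos alpha_pos by force
  qed (use b1 in auto)
  then obtain b where b: "b1 \<le> b" "b \<le> 1" "M b = \<mu>"
    using IVT2'[of M 1 \<mu> b1] M1 Mb1 b11 by auto
  have b1': "b < 1" using b M1 by (cases "b = 1") auto
  have bl: "-1 < b" using b b1 by simp
  define k where "k = \<alpha> / sl (-1) b"
  have s: "sl (-1) b > 0" using spos b by simp
  have k: "k > 0" using s alpha_pos by (simp add: k_def)
  have h: "0 < hh b" "hh b < 1" using hh_sq(2)[of b] hh_bounds[of b] bl b1' by auto
  have tr: "triple k (- hh b) b"
  proof -
    have "1 - b\<^sup>2 = \<kappa> * (1 - (hh b)\<^sup>2)" using hh_sq(1)[of b] bl b1' kappa_gt_1 by (simp add: field_simps)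
    then have "dens k b = (\<kappa> * ((\<sigma> + 1) * k\<^sup>2 * (1 - (hh b)\<^sup>2))) powr (1 / \<sigma>)" unfolding dens_def by (simp add: mult_ac)
    also have "\<dots> = \<tau>\<^sup>2 * dens k (- hh b)"
      unfolding dens_def kappa_powr(1)[symmetric] using kappa_gt_1 sigma_pos sq_le_1[of "hh b"] h by (simp add: powr_mult)
    finally have "dens k b = \<tau>\<^sup>2 * dens k (- hh b)" .
    moreover have "k * (- hh b + \<tau>\<^sup>2 * b) = \<alpha>" using s by (simp add: k_def sl_def field_simps)
    ultimately show ?thesis unfolding triple_def using k h bl b1' by auto
  qed
  moreover have "tmass k (- hh b) b = \<mu>"
    using triple_branch(4)[OF tr] h b(3) unfolding M_def p_def k_def by simp
  ultimately show ?thesis using that h by auto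
qed

lemma \<Phi>_min_left_triple:
  assumes \<mu>: "\<mu> > 0"
  obtains k \<theta>1 \<theta>2 where "triple k \<theta>1 \<theta>2" "\<theta>1 > 0" "tmass k \<theta>1 \<theta>2 = \<mu>" "\<Phi> \<mu> (hmass k \<theta>1) (dens k \<theta>1) < W \<mu> 0"
    "\<forall>m' r'. 0 < m' \<longrightarrow> m' < \<mu> \<longrightarrow> r' \<ge> 0 \<longrightarrow> \<Phi> \<mu> (hmass k \<theta>1) (dens k \<theta>1) \<le> \<Phi> \<mu> m' r'"
proof -
  obtain k \<theta>1 \<theta>2 where t: "triple k \<theta>1 \<theta>2" "tmass k \<theta>1 \<theta>2 = \<mu>" "\<Phi> \<mu> (hmass k \<theta>1) (dens k \<theta>1) < W \<mu> 0"
    and min: "\<forall>m' r'. 0 < m' \<longrightarrow> m' < \<mu> \<longrightarrow> r' \<ge> 0 \<longrightarrow> \<Phi> \<mu> (hmass k \<theta>1) (dens k \<theta>1) \<le> \<Phi> \<mu> m' r'"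
    by (rule \<Phi>_min_triple[OF \<mu>])
  have "\<theta>1 > 0"
  proof (rule ccontr)
    assume "\<not> \<theta>1 > 0"
    then have neg: "\<theta>1 < 0" using triple_branch(5)[OF t(1)] by simp
    obtain m' where m': "0 < m'" "m' < \<mu>" "\<Phi> \<mu> m' (dens k \<theta>1) < \<Phi> \<mu> (hmass k \<theta>1) (dens k \<theta>1)"
      using triple_flip[OF t(1) neg] t(2) by metis
    moreover have "dens k \<theta>1 \<ge> 0" by (simp add: dens_def)
    ultimately show False using min by (meson linorder_not_le)
  qed
  with t min show ?thesis using that by blast
qed

end

section \<open>The calibration inequality on the half-line\<close>

lemma set_integral_Ici_split:
  fixes f :: "real \<Rightarrow> 'e::euclidean_space"
  assumes f: "set_integrable lborel {0..} f" and x: "0 \<le> x"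
  shows "(LINT t:{0..}|lborel. f t) = integral {0..x} f + (LINT t:{x..}|lborel. f t)"
proof -
  have 1: "set_integrable lborel {0..x} f" "set_integrable lborel {x..} f"
    by (rule set_integrable_subset[OF f]; use x in auto)+
  have "(LINT t:{0..}|lborel. f t) = (LINT t:{0..x} \<union> {x..}|lborel. f t)"
    using x by (intro arg_cong[where f = "\<lambda>A. LINT t:A|lborel. f t"]) auto
  also have "\<dots> = (LINT t:{0..x}|lborel. f t) + (LINT t:{x..}|lborel. f t)"
  proof (rule set_integral_Un_AE[OF _ _ _ 1])
    show "AE t in lborel. \<not> (t \<in> {0..x} \<and> t \<in> {x..})"
      using AE_lborel_singleton[of x] by eventually_elim auto
  qed auto
  finally show ?thesis using set_integrable_HK(3)[OF 1(1)] by simp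
qed

context nls
begin

text \<open>By the Hamilton-Jacobi equation the right side exceeds the left by half of
  \<open>(norm (b + 2 * V * a))\<^sup>2\<close>, with \<open>V\<close> the density derivative of
  \<open>W\<close>. Equality means \<open>b = - 2 * V * a\<close>, the first-order equation solved
  by soliton pieces.\<close>

lemma calibration_pointwise:
  fixes a b :: complex
  assumes "s > 0"
  shows "- (Ws s ((norm a)\<^sup>2) * (- (norm a)\<^sup>2) + Wr s ((norm a)\<^sup>2) * (2 * Re (cnj a * b)))
    \<le> 1 / 2 * (norm b)\<^sup>2 - 1 / (2 * \<sigma> + 2) * norm a powr (2 * \<sigma> + 2)"
proof -
  define r V where "r = (norm a)\<^sup>2" and "V = Wr s r"
  have hj: "Ws s r = - 2 * V\<^sup>2 - 1 / (2 * \<sigma> + 2) * r powr \<sigma>"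
    using W_hamilton_jacobi[OF assms, of r] by (simp add: r_def V_def)
  have pw: "r powr \<sigma> * r = norm a powr (2 * \<sigma> + 2)"
  proof (cases "a = 0")
    case False
    then have "r = norm a powr 2" by (simp add: r_def)
    then show ?thesis by (simp only: powr_powr powr_add)
  qed (use sigma_pos in \<open>simp add: r_def\<close>)
  have "0 \<le> (norm (b + complex_of_real (2 * V) * a))\<^sup>2" by simp
  also have "\<dots> = (norm b)\<^sup>2 + 4 * V * Re (cnj a * b) + 4 * V\<^sup>2 * r"
    unfolding r_def by (simp only: cmod_power2) (simp add: power2_eq_square algebra_simps)
  finally have q: "- (V * (2 * Re (cnj a * b))) \<le> 1 / 2 * (norm b)\<^sup>2 + 2 * V\<^sup>2 * r" by linarith
  have "Ws s r * r = - 2 * V\<^sup>2 * r - 1 / (2 * \<sigma> + 2) * norm a powr (2 * \<sigma> + 2)"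
    unfolding hj pw[symmetric] by (simp add: algebra_simps)
  then have "- (Ws s r * (- r) + V * (2 * Re (cnj a * b))) \<le> 1 / 2 * (norm b)\<^sup>2 - 1 / (2 * \<sigma> + 2) * norm a powr (2 * \<sigma> + 2)"
    using q by simp
  then show ?thesis unfolding V_def r_def .
qed

text \<open>The pair of remaining mass and squared modulus is followed along the half-line and the
  pointwise inequality is integrated. The calibration works only while the remaining mass is
  positive, hence the cut at \<open>X\<close> and the separate treatment of functions that vanish
  beyond some point.\<close>

lemma half_energy_ge:
  assumes u: "hl u g"
  shows "W (L2_normsq_on {0..} u) ((norm (u 0))\<^sup>2) \<le> half_energy \<sigma> u g"
proof -
  define m where "m = L2_normsq_on {0..} u"
  define S where "S x = L2_normsq_on {x..} u" for x
  define p where "p = 2 * \<sigma> + 2"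
  have p: "p \<ge> 2" using sigma_pos by (simp add: p_def)
  have L2u: "L2_on {0..} u" and L2g: "L2_on {0..} g" using hlD[OF u] by auto
  note n2 = L2_on_normsq[OF L2u] and g2 = L2_on_normsq[OF L2g] and up = hl_powr_integrable[OF u p]
  have S0: "S 0 = m" by (simp add: S_def m_def)
  have Snn: "S x \<ge> 0" for x unfolding S_def by (rule L2_normsq_nonneg)
  have Seq: "S x = m - integral {0..x} (\<lambda>t. (norm (u t))\<^sup>2)" if "x \<ge> 0" for x
    using set_integral_Ici_split[OF n2 that] by (simp add: S_def m_def L2_normsq_on_def)
  have Smono: "S y \<le> S x" if "0 \<le> x" "x \<le> y" for x y
    unfolding S_def by (rule L2_normsq_mono) (use that L2_on_subset[OF L2u] in auto)
  have S_zero: "u y = 0" if "0 \<le> x" "x \<le> y" "S x = 0" for x y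
  proof -
    have "S y = 0" using Smono[OF that(1,2)] that(3) Snn[of y] by simp
    then have "((norm (u y))\<^sup>2)\<^sup>2 \<le> 0" using hl_tail_bound[OF u, of y] that by (simp add: S_def)
    then show ?thesis by simp
  qed
  have cS: "AC_on 0 b S (\<lambda>t. - (norm (u t))\<^sup>2)" for b
  proof (rule AC_onI)
    show "set_integrable lborel {0..b} (\<lambda>t. - (norm (u t))\<^sup>2)"
      using set_integrable_atLeast_Icc[OF n2 order_refl, of b] unfolding set_integrable_def by simp
    fix t assume "t \<in> {0..b}"
    then show "S t = S 0 + integral {0..t} (\<lambda>t. - (norm (u t))\<^sup>2)" using Seq[of t] S0 by simp
  qed
  \<comment> \<open>The kinetic energy is kept in full while the nonlinear part is cut at
    \<open>X\<close>: the kinetic tail pays for the boundary term of \<open>W\<close> at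
    \<open>X\<close>.\<close>
  define E where "E X = 1 / 2 * L2_normsq_on {0..} g - 1 / p * integral {0..X} (\<lambda>t. norm (u t) powr p)" for X
  have pos: "W m ((norm (u 0))\<^sup>2) \<le> E X" if X: "X \<ge> 0" "S X > 0" for X
  proof -
    define z where "z t = complex_of_real (S t) + \<i> * complex_of_real ((norm (u t))\<^sup>2)" for t
    define h where "h t = complex_of_real (- (norm (u t))\<^sup>2) + \<i> * complex_of_real (2 * Re (cnj (u t) * g t))" for t
    have zi: "Re (z t) = S t" "Im (z t) = (norm (u t))\<^sup>2" "Re (h t) = - (norm (u t))\<^sup>2" "Im (h t) = 2 * Re (cnj (u t) * g t)" for t
      by (simp_all add: z_def h_def)
    have acz: "AC_on 0 X z h" unfolding z_def h_def
      by (intro AC_on_add AC_on_linear[OF cS bounded_linear_of_real] 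
          AC_on_linear[OF AC_on_linear[OF AC_on_normsq[OF hlD(3)[OF u order_refl] X(1)] bounded_linear_of_real] bounded_linear_mult_right])
    define F' where "F' q = Ws (Re q) (Im q) *\<^sub>R Blinfun Re + Wr (Re q) (Im q) *\<^sub>R Blinfun Im" for q
    have F'_apply: "blinfun_apply (F' q) v = Ws (Re q) (Im q) * Re v + Wr (Re q) (Im q) * Im v" for q v
      unfolding F'_def by (simp add: blinfun.add_left blinfun.scaleR_left bounded_linear_Blinfun_apply bounded_linear_Re bounded_linear_Im)
    have "AC_on 0 X (\<lambda>t. (\<lambda>p. W (Re p) (Im p)) (z t)) (\<lambda>t. F' (z t) (h t))"
    proof (rule AC_chain_rule[OF acz X(1)])
      show "z t \<in> {p. Re p > 0}" if "t \<in> {0..X}" for t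
        using Smono[of t X] that X by (simp add: zi)
      show "open {p. Re p > 0}" by (simp add: open_halfspace_Re_gt)
      show "((\<lambda>p. W (Re p) (Im p)) has_derivative blinfun_apply (F' q)) (at q)" if "q \<in> {p. Re p > 0}" for q
        using W_has_derivative[of q] that unfolding F'_apply[abs_def] by simp
      show "continuous_on {p. Re p > 0} F'" unfolding F'_def
        by (intro continuous_intros Ws_Wr_continuous)
    qed
    then have ac: "AC_on 0 X (\<lambda>t. W (S t) ((norm (u t))\<^sup>2)) (\<lambda>t. Ws (S t) ((norm (u t))\<^sup>2) * (- (norm (u t))\<^sup>2) + Wr (S t) ((norm (u t))\<^sup>2) * (2 * Re (cnj (u t) * g t)))"
      unfolding F'_apply zi .
    let ?k = "\<lambda>t. Ws (S t) ((norm (u t))\<^sup>2) * (- (norm (u t))\<^sup>2) + Wr (S t) ((norm (u t))\<^sup>2) * (2 * Re (cnj (u t) * g t))"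
    have ki: "?k integrable_on {0..X}" using set_integrable_HK(1)[OF AC_on_integrable[OF ac]] .
    have gi: "(\<lambda>t. (norm (g t))\<^sup>2) integrable_on {0..X}" using set_integrable_HK(1)[OF set_integrable_atLeast_Icc[OF g2 order_refl]] .
    have pi: "(\<lambda>t. norm (u t) powr p) integrable_on {0..X}" using set_integrable_HK(1)[OF set_integrable_atLeast_Icc[OF up order_refl]] .
    have gi': "(\<lambda>t. 1 / 2 * (norm (g t))\<^sup>2) integrable_on {0..X}" using integrable_cmul[OF gi, of "1 / 2"] unfolding real_scaleR_def .
    have pi': "(\<lambda>t. 1 / p * norm (u t) powr p) integrable_on {0..X}" using integrable_cmul[OF pi, of "1 / p"] unfolding real_scaleR_def .
    have "- integral {0..X} ?k = integral {0..X} (\<lambda>t. - ?k t)" by (rule Henstock_Kurzweil_Integration.integral_neg[symmetric])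
    also have "\<dots> \<le> integral {0..X} (\<lambda>t. 1 / 2 * (norm (g t))\<^sup>2 - 1 / p * norm (u t) powr p)"
    proof (rule integral_le)
      show "(\<lambda>t. - ?k t) integrable_on {0..X}" using ki by (rule integrable_neg)
      show "(\<lambda>t. 1 / 2 * (norm (g t))\<^sup>2 - 1 / p * norm (u t) powr p) integrable_on {0..X}"
        by (intro integrable_diff gi' pi')
      show "- ?k t \<le> 1 / 2 * (norm (g t))\<^sup>2 - 1 / p * norm (u t) powr p" if "t \<in> {0..X}" for t
        unfolding p_def by (rule calibration_pointwise) (use Smono[of t X] that X in simp)
    qed
    also have "\<dots> = 1 / 2 * integral {0..X} (\<lambda>t. (norm (g t))\<^sup>2) - 1 / p * integral {0..X} (\<lambda>t. norm (u t) powr p)"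
      unfolding Henstock_Kurzweil_Integration.integral_diff[OF gi' pi'] by simp
    finally have 1: "- integral {0..X} ?k \<le> 1 / 2 * integral {0..X} (\<lambda>t. (norm (g t))\<^sup>2) - 1 / p * integral {0..X} (\<lambda>t. norm (u t) powr p)" .
    have 2: "W (S X) ((norm (u X))\<^sup>2) - W m ((norm (u 0))\<^sup>2) = integral {0..X} ?k"
      using AC_on_diff[OF ac order_refl X(1) order_refl] by (simp add: S0)
    \<comment> \<open>The constants of \<open>W_le\<close> and \<open>hl_tail_bound\<close> fit
      exactly: \<open>4 * S X / (8 * S X) = 1 / 2\<close>.\<close>
    have 3: "W (S X) ((norm (u X))\<^sup>2) \<le> 1 / 2 * L2_normsq_on {X..} g"
    proof -
      have "W (S X) ((norm (u X))\<^sup>2) \<le> ((norm (u X))\<^sup>2)\<^sup>2 / (8 * S X)" by (rule W_le) (use X in auto)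
      also have "\<dots> \<le> (4 * S X * L2_normsq_on {X..} g) / (8 * S X)"
        using hl_tail_bound[OF u X(1)] X by (intro divide_right_mono) (auto simp: S_def)
      also have "\<dots> = 1 / 2 * L2_normsq_on {X..} g" using X by simp
      finally show ?thesis .
    qed
    have 4: "L2_normsq_on {0..} g = integral {0..X} (\<lambda>t. (norm (g t))\<^sup>2) + L2_normsq_on {X..} g"
      unfolding L2_normsq_on_def by (rule set_integral_Ici_split[OF g2 X(1)])
    show ?thesis using 1 2 3 unfolding E_def 4 by (simp add: algebra_simps)
  qed
  have all: "W m ((norm (u 0))\<^sup>2) \<le> E X" if X: "X \<ge> 0" for X
  proof (cases "S X > 0")
    case False
    then have SX: "S X = 0" using Snn[of X] by simp
    have cont: "continuous_on {0..X} S" using AC_on_continuous[OF cS] .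
    have contE: "continuous_on {0..X} E" unfolding E_def
      by (intro continuous_intros indefinite_integral_continuous_1 set_integrable_HK(1)[OF set_integrable_atLeast_Icc[OF up order_refl]])
    \<comment> \<open>Its least element is the first point at which all the mass is used up. Beyond
      it \<open>u\<close> vanishes, and the bound reaches it by left continuity of
      \<open>E\<close>.\<close>
    define Z where "Z = {x \<in> {0..X}. S x = 0}"
    have "closed Z" unfolding Z_def
      using continuous_closed_preimage_constant[OF cont, of 0] by (simp add: closed_atLeastAtMost)
    moreover have "Z \<noteq> {}" using SX X by (auto simp: Z_def)
    moreover have bdd: "bdd_below Z" by (rule bdd_belowI[of _ 0]) (auto simp: Z_def)
    ultimately have "Inf Z \<in> Z" by (intro closed_contains_Inf)
    define Y where "Y = Inf Z"
    have Y: "0 \<le> Y" "Y \<le> X" "S Y = 0" using \<open>Inf Z \<in> Z\<close> by (auto simp: Z_def Y_def)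
    have below: "S x > 0" if "0 \<le> x" "x < Y" for x
    proof (rule ccontr)
      assume "\<not> S x > 0"
      then have "x \<in> Z" using Snn[of x] that Y by (auto simp: Z_def)
      then have "Y \<le> x" unfolding Y_def by (rule cInf_lower[OF _ bdd])
      then show False using that by simp
    qed
    have EY: "E X = E Y"
    proof -
      have "integral {0..Y} (\<lambda>t. norm (u t) powr p) + integral {Y..X} (\<lambda>t. norm (u t) powr p) = integral {0..X} (\<lambda>t. norm (u t) powr p)"
        using Y by (intro Henstock_Kurzweil_Integration.integral_combine set_integrable_HK(1)[OF set_integrable_atLeast_Icc[OF up order_refl]]) auto
      moreover have "integral {Y..X} (\<lambda>t. norm (u t) powr p) = integral {Y..X} (\<lambda>t. 0)"
        by (rule Henstock_Kurzweil_Integration.integral_cong) (use S_zero[OF Y(1) _ Y(3)] p in auto)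
      ultimately show ?thesis by (simp add: E_def)
    qed
    show ?thesis
    proof (cases "Y = 0")
      case True
      then have m0: "m = 0" using Y S0 by simp
      \<comment> \<open>The default \<open>0 powr \<gamma> = 0\<close> gives \<open>W\<close> the
        right value for a function of zero mass.\<close>
      have "W m ((norm (u 0))\<^sup>2) = 0" by (simp add: m0 W_0)
      moreover have "E Y \<ge> 0" unfolding True E_def using L2_normsq_nonneg[of "{0..}" g] by simp
      ultimately show ?thesis unfolding EY by simp
    next
      case False
      then have Y0: "0 < Y" using Y by simp
      have "(E \<longlongrightarrow> E Y) (at Y within {0..Y})"
        using continuous_on_subset[OF contE, of "{0..Y}"] Y unfolding continuous_on_def by auto
      then have lim: "(E \<longlongrightarrow> E Y) (at_left Y)" using at_within_Icc_at_left[OF Y0] by simp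
      show ?thesis unfolding EY
      proof (rule tendsto_lowerbound[OF lim])
        show "\<forall>\<^sub>F x in at_left Y. W m ((norm (u 0))\<^sup>2) \<le> E x"
          unfolding eventually_at_left_field using Y0 by (intro exI[of _ 0]) (auto intro!: pos below)
      qed simp
    qed
  qed (rule pos[OF X])
  have "(E \<longlongrightarrow> 1 / 2 * L2_normsq_on {0..} g - 1 / p * (LINT t:{0..}|lborel. norm (u t) powr p)) at_top"
    unfolding E_def by (intro tendsto_intros integral_Icc_tendsto_atLeast up)
  then have "W m ((norm (u 0))\<^sup>2) \<le> 1 / 2 * L2_normsq_on {0..} g - 1 / p * (LINT t:{0..}|lborel. norm (u t) powr p)"
  proof (rule tendsto_lowerbound)
    show "\<forall>\<^sub>F X in at_top. W m ((norm (u 0))\<^sup>2) \<le> E X"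
      using eventually_ge_at_top[of 0] by eventually_elim (rule all)
  qed simp
  then show ?thesis by (simp add: half_energy_def m_def p_def)
qed

section \<open>Explicit half-line states\<close>

text \<open>Minus the logarithmic derivative of the soliton, divided by \<open>k\<close>. It solves
  \<open>t' = \<sigma> * k * (1 - t\<^sup>2)\<close>, and the shift by
  \<open>artanh \<theta>\<close> makes it start at \<open>\<theta>\<close>.\<close>

definition th :: "real \<Rightarrow> real \<Rightarrow> real \<Rightarrow> real" where
  "th k \<theta> x = tanh (\<sigma> * k * x + artanh \<theta>)"

definition hstate :: "real \<Rightarrow> real \<Rightarrow> real \<Rightarrow> real" where
  "hstate k \<theta> x = sqrt (dens k (th k \<theta> x))"

lemma tanh_artanh:
  assumes "-1 < y" "y < (1::real)"
  shows "tanh (artanh y) = y"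
proof -
  have "exp (- 2 * artanh y) = (1 - y) / (1 + y)"
    using assms by (simp add: artanh_def exp_minus ln_div[symmetric])
  then have "tanh (artanh y) = (1 - (1 - y) / (1 + y)) / (1 + (1 - y) / (1 + y))" by (simp only: tanh_real_altdef)
  also have "\<dots> = y" using assms by (simp add: field_simps)
  finally show ?thesis .
qed

lemma th_0: "-1 < \<theta> \<Longrightarrow> \<theta> < 1 \<Longrightarrow> th k \<theta> 0 = \<theta>"
  by (simp add: th_def tanh_artanh)

lemma th_bounds: "-1 < th k \<theta> x" "th k \<theta> x < 1"
  unfolding th_def by (rule tanh_real_gt_neg1, rule tanh_real_lt_1)

lemma th_deriv: "(th k \<theta> has_real_derivative \<sigma> * k * (1 - (th k \<theta> x)\<^sup>2)) (at x)"
proof -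
  have 1: "((\<lambda>x. \<sigma> * k * x + artanh \<theta>) has_real_derivative \<sigma> * k) (at x)"
    by (auto intro!: derivative_eq_intros)
  have "((\<lambda>x. tanh (\<sigma> * k * x + artanh \<theta>)) has_real_derivative (1 - (tanh (\<sigma> * k * x + artanh \<theta>))\<^sup>2) * (\<sigma> * k)) (at x)"
    by (rule DERIV_cong[OF has_field_derivative_tanh[OF _ 1]]) (simp_all add: mult.commute)
  then show ?thesis unfolding th_def[abs_def] by (simp add: mult.commute)
qed

lemma th_tendsto:
  assumes "k > 0"
  shows "(th k \<theta> \<longlongrightarrow> 1) at_top"
proof -
  have "filterlim (\<lambda>x. \<sigma> * k * x + artanh \<theta>) at_top at_top"
  proof -
    have "filterlim (\<lambda>x. \<sigma> * k * x) at_top at_top"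
      by (rule filterlim_tendsto_pos_mult_at_top[OF tendsto_const _ filterlim_ident]) (use sigma_pos assms in simp)
    from filterlim_tendsto_add_at_top[OF tendsto_const this, of "artanh \<theta>"] show ?thesis
      by (simp only: add.commute)
  qed
  then show ?thesis unfolding th_def[abs_def] by (rule filterlim_compose[OF tanh_real_at_top])
qed

lemma dens_th_deriv:
  assumes "k > 0"
  shows "((\<lambda>x. dens k (th k \<theta> x)) has_real_derivative - 2 * k * th k \<theta> x * dens k (th k \<theta> x)) (at x)"
proof -
  define t where "t = th k \<theta> x"
  have t: "1 - t\<^sup>2 > 0" using sq_less_1[of t] th_bounds[of k \<theta> x] by (simp add: t_def)
  have c: "(\<sigma> + 1) * k\<^sup>2 * (1 - t\<^sup>2) > 0" using t assms sigma_pos by simp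
  have 1: "((\<lambda>x. (\<sigma> + 1) * k\<^sup>2 * (1 - (th k \<theta> x)\<^sup>2)) has_real_derivative (\<sigma> + 1) * k\<^sup>2 * (0 - 2 * (\<sigma> * k * (1 - t\<^sup>2)) * t)) (at x)"
  proof -
    have "((\<lambda>x. (th k \<theta> x)\<^sup>2) has_real_derivative 2 * (\<sigma> * k * (1 - t\<^sup>2)) * t) (at x)"
      using DERIV_power[OF th_deriv[of k \<theta> x], of 2] by (simp add: t_def mult.assoc)
    then show ?thesis by (intro DERIV_cmult DERIV_diff DERIV_const)
  qed
  have "((\<lambda>x. dens k (th k \<theta> x)) has_real_derivative 
     dens k t * ((\<sigma> + 1) * k\<^sup>2 * (0 - 2 * (\<sigma> * k * (1 - t\<^sup>2)) * t) * (1 / \<sigma>) / ((\<sigma> + 1) * k\<^sup>2 * (1 - t\<^sup>2)))) (at x)"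
    unfolding dens_def using DERIV_powr[OF 1 _ DERIV_const, of "1 / \<sigma>"] c by (simp add: t_def)
  moreover have "dens k t * ((\<sigma> + 1) * k\<^sup>2 * (0 - 2 * (\<sigma> * k * (1 - t\<^sup>2)) * t) * (1 / \<sigma>) / ((\<sigma> + 1) * k\<^sup>2 * (1 - t\<^sup>2))) = - 2 * k * t * dens k t"
    using t assms sigma_pos by (simp add: divide_simps)
  ultimately show ?thesis by (simp add: t_def)
qed

lemma dens_th_pos: "k > 0 \<Longrightarrow> dens k (th k \<theta> x) > 0"
  using dens_pos th_bounds by auto

lemma hstate_pos: "k > 0 \<Longrightarrow> hstate k \<theta> x > 0"
  using dens_th_pos by (simp add: hstate_def)

lemma hstate_sq: "k > 0 \<Longrightarrow> (hstate k \<theta> x)\<^sup>2 = dens k (th k \<theta> x)"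
  using dens_th_pos[of k \<theta> x] by (simp add: hstate_def)

lemma hstate_deriv:
  assumes "k > 0"
  shows "(hstate k \<theta> has_real_derivative - k * th k \<theta> x * hstate k \<theta> x) (at x)"
proof -
  have "((\<lambda>x. sqrt (dens k (th k \<theta> x))) has_real_derivative (inverse (sqrt (dens k (th k \<theta> x))) / 2 * (- 2 * k * th k \<theta> x * dens k (th k \<theta> x)))) (at x)"
    by (rule DERIV_chain2[OF DERIV_real_sqrt[OF dens_th_pos[OF assms]] dens_th_deriv[OF assms]])
  moreover have "inverse (sqrt (dens k (th k \<theta> x))) / 2 * (- 2 * k * th k \<theta> x * dens k (th k \<theta> x)) = - k * th k \<theta> x * sqrt (dens k (th k \<theta> x))"
  proof -
    have "inverse (sqrt d) / 2 * (- 2 * k * t * d) = - k * t * sqrt d" if "d > 0" for d t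
      using that real_sqrt_mult_self[of d] by (simp add: field_simps)
    then show ?thesis using dens_th_pos[OF assms] by blast
  qed
  ultimately show ?thesis by (simp only: hstate_def[abs_def])
qed

lemma FTC_Ici:
  fixes f F :: "real \<Rightarrow> real"
  assumes "f \<in> borel_measurable borel" "\<And>x. (F has_real_derivative f x) (at x)" "\<And>x. f x \<ge> 0" "(F \<longlongrightarrow> T) at_top"
  shows "set_integrable lborel {0..} f" "(LINT x:{0..}|lborel. f x) = T - F 0"
proof -
  have "(\<integral>\<^sup>+x. ennreal (f x) * indicator {0..} x \<partial>lborel) = T - F 0"
    by (rule nn_integral_FTC_atLeast) (use assms in auto)
  moreover have "ennreal (f x) * indicator {0..} x = ennreal (indicator {0..} x *\<^sub>R f x)" for x :: real
    by (auto simp: indicator_def)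
  ultimately have n: "(\<integral>\<^sup>+x. ennreal (indicator {0..} x *\<^sub>R f x) \<partial>lborel) = ennreal (T - F 0)" by simp
  have "T - F 0 \<ge> 0"
  proof -
    have "F 0 \<le> F x" if "x \<ge> 0" for x
      by (rule DERIV_nonneg_imp_nondecreasing[OF that]) (use assms(2,3) in blast)
    note mono = this
    have "F 0 \<le> T"
    proof (rule tendsto_lowerbound[OF assms(4)])
      show "\<forall>\<^sub>F x in at_top. F 0 \<le> F x" using eventually_ge_at_top[of 0] by eventually_elim (rule mono)
    qed simp
    then show ?thesis by simp
  qed
  moreover have "(\<lambda>x. indicator {0..} x *\<^sub>R f x) \<in> borel_measurable lborel" using assms(1) by measurable
  ultimately have "has_bochner_integral lborel (\<lambda>x. indicator {0..} x *\<^sub>R f x) (T - F 0)"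
    using n assms(3) by (intro has_bochner_integral_nn_integral) auto
  then show "set_integrable lborel {0..} f" "(LINT x:{0..}|lborel. f x) = T - F 0"
    unfolding set_integrable_def set_lebesgue_integral_def by (auto simp: has_bochner_integral_iff)
qed

lemma th_continuous: "continuous_on A (th k \<theta>)"
  by (intro continuous_at_imp_continuous_on ballI DERIV_isCont[OF th_deriv])

lemma dens_th_continuous: "k > 0 \<Longrightarrow> continuous_on A (\<lambda>x. dens k (th k \<theta> x))"
  by (intro continuous_at_imp_continuous_on ballI DERIV_isCont[OF dens_th_deriv])

lemma hstate_continuous: "k > 0 \<Longrightarrow> continuous_on A (hstate k \<theta>)"
  by (intro continuous_at_imp_continuous_on ballI DERIV_isCont[OF hstate_deriv])

text \<open>The change of variable behind \<open>J\<close> in differential form. As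
  \<open>hmass k (th k \<theta> x)\<close> also tends to 0 at infinity, it is the mass of the piece
  beyond \<open>x\<close>.\<close>

lemma hmass_th_deriv:
  assumes "k > 0"
  shows "((\<lambda>x. hmass k (th k \<theta> x)) has_real_derivative - dens k (th k \<theta> x)) (at x)"
proof -
  define t where "t = th k \<theta> x"
  have b: "-1 < t" "t < 1" using th_bounds by (auto simp: t_def)
  have t: "1 - t\<^sup>2 > 0" using sq_less_1[OF b] by simp
  have "((\<lambda>x. CJ * J (th k \<theta> x) * k powr ((2 - \<sigma>) / \<sigma>)) has_real_derivative
     CJ * (- ((1 - t\<^sup>2) powr (1 / \<sigma> - 1)) * (\<sigma> * k * (1 - t\<^sup>2))) * k powr ((2 - \<sigma>) / \<sigma>)) (at x)"
    unfolding t_def by (intro DERIV_cmult_right DERIV_cmult DERIV_chain2[OF J_deriv th_deriv] th_bounds)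
  moreover have "CJ * (- ((1 - t\<^sup>2) powr (1 / \<sigma> - 1)) * (\<sigma> * k * (1 - t\<^sup>2))) * k powr ((2 - \<sigma>) / \<sigma>) = - dens k t"
  proof -
    have 1: "(1 - t\<^sup>2) powr (1 / \<sigma> - 1) * (1 - t\<^sup>2) = (1 - t\<^sup>2) powr (1 / \<sigma>)" using t by (simp add: powr_diff)
    have "k * k powr ((2 - \<sigma>) / \<sigma>) = k powr (1 + (2 - \<sigma>) / \<sigma>)" using assms by (simp add: powr_add)
    also have "1 + (2 - \<sigma>) / \<sigma> = 2 * (1 / \<sigma>)" using sigma_pos by (simp add: field_simps)
    also have "k powr (2 * (1 / \<sigma>)) = (k\<^sup>2) powr (1 / \<sigma>)"
    proof -
      have "k\<^sup>2 = k powr 2" using assms by simp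
      then show ?thesis by (simp only: powr_powr)
    qed
    finally have 2: "k * k powr ((2 - \<sigma>) / \<sigma>) = (k\<^sup>2) powr (1 / \<sigma>)" .
    have 3: "CJ * \<sigma> = (\<sigma> + 1) powr (1 / \<sigma>)" using sigma_pos by (simp add: CJ_def)
    have "CJ * (- ((1 - t\<^sup>2) powr (1 / \<sigma> - 1)) * (\<sigma> * k * (1 - t\<^sup>2))) * k powr ((2 - \<sigma>) / \<sigma>) 
      = - ((CJ * \<sigma>) * (k * k powr ((2 - \<sigma>) / \<sigma>)) * ((1 - t\<^sup>2) powr (1 / \<sigma> - 1) * (1 - t\<^sup>2)))" by (simp add: mult_ac)
    also have "\<dots> = - dens k t" unfolding 1 2 3 dens_def using sigma_pos t by (simp add: powr_mult)
    finally show ?thesis .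
  qed
  ultimately show ?thesis unfolding hmass_def t_def by simp
qed

lemma hmass_th_tendsto:
  assumes "k > 0"
  shows "((\<lambda>x. hmass k (th k \<theta> x)) \<longlongrightarrow> 0) at_top" "((\<lambda>x. dens k (th k \<theta> x)) \<longlongrightarrow> 0) at_top"
proof -
  have "((\<lambda>x. J (th k \<theta> x)) \<longlongrightarrow> J 1) at_top"
    by (rule continuous_on_tendsto_compose[OF J_continuous th_tendsto[OF assms]])
       (auto intro!: always_eventually less_imp_le th_bounds)
  then have "((\<lambda>x. CJ * J (th k \<theta> x) * k powr ((2 - \<sigma>) / \<sigma>)) \<longlongrightarrow> CJ * J 1 * k powr ((2 - \<sigma>) / \<sigma>)) at_top"
    by (intro tendsto_intros)
  then show "((\<lambda>x. hmass k (th k \<theta> x)) \<longlongrightarrow> 0) at_top" by (simp add: hmass_def)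
  have "((\<lambda>x. (\<lambda>t. (1 - t\<^sup>2) powr (1 / \<sigma>)) (th k \<theta> x)) \<longlongrightarrow> (1 - 1\<^sup>2) powr (1 / \<sigma>)) at_top"
    by (rule continuous_on_tendsto_compose[OF sech_powr_continuous th_tendsto[OF assms]])
       (auto intro!: always_eventually less_imp_le th_bounds)
  from tendsto_mult[OF tendsto_const this]
  have "((\<lambda>x. ((\<sigma> + 1) * k\<^sup>2) powr (1 / \<sigma>) * (1 - (th k \<theta> x)\<^sup>2) powr (1 / \<sigma>)) \<longlongrightarrow> ((\<sigma> + 1) * k\<^sup>2) powr (1 / \<sigma>) * (1 - 1\<^sup>2) powr (1 / \<sigma>)) at_top" .
  moreover have "dens k (th k \<theta> x) = ((\<sigma> + 1) * k\<^sup>2) powr (1 / \<sigma>) * (1 - (th k \<theta> x)\<^sup>2) powr (1 / \<sigma>)" for x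
    unfolding dens_def using sigma_pos sq_less_1[OF th_bounds, of k \<theta> x] by (simp add: powr_mult)
  ultimately show "((\<lambda>x. dens k (th k \<theta> x)) \<longlongrightarrow> 0) at_top" by simp
qed

definition hslope :: "real \<Rightarrow> real \<Rightarrow> real \<Rightarrow> real" where
  "hslope k \<theta> x = - k * th k \<theta> x * hstate k \<theta> x"

theorem hstate_hl:
  assumes k: "k > 0" and t: "-1 < \<theta>" "\<theta> < 1"
  defines "u \<equiv> (\<lambda>x. complex_of_real (hstate k \<theta> x))" and "g \<equiv> (\<lambda>x. complex_of_real (hslope k \<theta> x))"
  shows "hl u g" "L2_normsq_on {0..} u = hmass k \<theta>" "(norm (u 0))\<^sup>2 = dens k \<theta>" "half_energy \<sigma> u g = W (hmass k \<theta>) (dens k \<theta>)"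
proof -
  let ?D = "\<lambda>x. dens k (th k \<theta> x)" and ?t = "\<lambda>x. th k \<theta> x" and ?s = "\<lambda>x. hmass k (th k \<theta> x)"
  have nu: "(norm (u x))\<^sup>2 = ?D x" for x unfolding u_def using hstate_sq[OF k, of \<theta> x] by simp
  have ng: "(norm (g x))\<^sup>2 = k\<^sup>2 * (?t x)\<^sup>2 * ?D x" for x
    unfolding g_def hslope_def using hstate_sq[OF k, of \<theta> x] by (simp add: power_mult_distrib norm_mult)
  have Dm: "?D \<in> borel_measurable borel" by (intro borel_measurable_continuous_onI dens_th_continuous k)
  have Tm: "?t \<in> borel_measurable borel" by (intro borel_measurable_continuous_onI th_continuous)
  have D0: "?D x \<ge> 0" for x using dens_th_pos[OF k] less_imp_le by blast
  have I1: "set_integrable lborel {0..} ?D" "(LINT x:{0..}|lborel. ?D x) = hmass k \<theta>"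
  proof -
    have d: "((\<lambda>x. - ?s x) has_real_derivative ?D x) (at x)" for x
      using DERIV_minus[OF hmass_th_deriv[OF k]] by simp
    have l: "((\<lambda>x. - ?s x) \<longlongrightarrow> 0) at_top" using tendsto_minus[OF hmass_th_tendsto(1)[OF k]] by simp
    show "set_integrable lborel {0..} ?D" "(LINT x:{0..}|lborel. ?D x) = hmass k \<theta>"
      using FTC_Ici[OF Dm d D0 l] th_0[OF t] by auto
  qed
  \<comment> \<open>The value of \<open>W\<close> at the mass beyond \<open>x\<close> and the
    density at \<open>x\<close>. Along a soliton piece its derivative is minus the energy density,
    which the first integral reduces to \<open>(k\<^sup>2 * t\<^sup>2 - k\<^sup>2 / 2) * D\<close>;
    hence the primitive of the squared slope used below.\<close>
  define Q where "Q x = (?D x * (k * ?t x) - (2 - \<sigma>) * k\<^sup>2 / 2 * ?s x) / (2 + \<sigma>)" for x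
  have I2: "set_integrable lborel {0..} (\<lambda>x. k\<^sup>2 * (?t x)\<^sup>2 * ?D x)" "(LINT x:{0..}|lborel. k\<^sup>2 * (?t x)\<^sup>2 * ?D x) = k\<^sup>2 / 2 * hmass k \<theta> + Q 0"
  proof -
    have d: "((\<lambda>x. - (k\<^sup>2 / 2 * ?s x + Q x)) has_real_derivative k\<^sup>2 * (?t x)\<^sup>2 * ?D x) (at x)" for x
    proof -
      have "((\<lambda>x. - (k\<^sup>2 / 2 * ?s x + Q x)) has_real_derivative - (k\<^sup>2 / 2 * (- ?D x) + 
          ((- 2 * k * ?t x * ?D x) * (k * ?t x) + (k * (\<sigma> * k * (1 - (?t x)\<^sup>2))) * ?D x - (2 - \<sigma>) * k\<^sup>2 / 2 * (- ?D x)) / (2 + \<sigma>))) (at x)"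
        unfolding Q_def by (intro DERIV_minus DERIV_add DERIV_cmult DERIV_cdivide DERIV_diff DERIV_mult hmass_th_deriv[OF k] dens_th_deriv[OF k] th_deriv)
      moreover have "- (k\<^sup>2 / 2 * (- D) + ((- 2 * k * t * D) * (k * t) + (k * (\<sigma> * k * (1 - t\<^sup>2))) * D - (2 - \<sigma>) * k\<^sup>2 / 2 * (- D)) / (2 + \<sigma>)) = k\<^sup>2 * t\<^sup>2 * D" for D t :: real
      proof -
        have Z: "2 + \<sigma> \<noteq> 0" using sigma_pos by simp
        have "(- 2 * k * t * D) * (k * t) + (k * (\<sigma> * k * (1 - t\<^sup>2))) * D - (2 - \<sigma>) * k\<^sup>2 / 2 * (- D) = (k\<^sup>2 / 2 * D - k\<^sup>2 * t\<^sup>2 * D) * (2 + \<sigma>)"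
          by (simp add: field_simps power2_eq_square)
        then show ?thesis using Z by (simp only: nonzero_mult_div_cancel_right[OF Z])
      qed
      ultimately show ?thesis by (simp only:)
    qed
    have l: "((\<lambda>x. - (k\<^sup>2 / 2 * ?s x + Q x)) \<longlongrightarrow> - (k\<^sup>2 / 2 * 0 + (0 * (k * 1) - (2 - \<sigma>) * k\<^sup>2 / 2 * 0) / (2 + \<sigma>))) at_top"
      unfolding Q_def using sigma_pos by (intro tendsto_intros hmass_th_tendsto[OF k] th_tendsto[OF k]) auto
    have m: "(\<lambda>x. k\<^sup>2 * (?t x)\<^sup>2 * ?D x) \<in> borel_measurable borel" using Dm Tm by measurable
    have nn: "k\<^sup>2 * (?t x)\<^sup>2 * ?D x \<ge> 0" for x using D0 by simp
    show "set_integrable lborel {0..} (\<lambda>x. k\<^sup>2 * (?t x)\<^sup>2 * ?D x)" "(LINT x:{0..}|lborel. k\<^sup>2 * (?t x)\<^sup>2 * ?D x) = k\<^sup>2 / 2 * hmass k \<theta> + Q 0"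
      using FTC_Ici[OF m d nn l] th_0[OF t, of k] by auto
  qed
  have um: "set_borel_measurable lborel {0..} u" "set_borel_measurable lborel {0..} g"
    unfolding u_def g_def hslope_def set_borel_measurable_def
    by (intro borel_measurable_scaleR borel_measurable_indicator borel_measurable_of_real borel_measurable_continuous_onI continuous_intros hstate_continuous[OF k] th_continuous; simp)+
  have "AC_on 0 b u g" for b
  proof (rule AC_on_C1)
    show "continuous_on {0..b} g" unfolding g_def hslope_def by (intro continuous_intros hstate_continuous[OF k] th_continuous)
    show "(u has_vector_derivative g x) (at x within {0..b})" for x
      unfolding u_def g_def hslope_def by (rule has_vector_derivative_of_real[OF has_field_derivative_at_within[OF hstate_deriv[OF k]]])
  qed
  then show "hl u g" unfolding hl_def L2_on_def using um I1 I2 by (simp add: nu ng)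
  show nsu: "L2_normsq_on {0..} u = hmass k \<theta>" unfolding L2_normsq_on_def nu by (rule I1(2))
  show "(norm (u 0))\<^sup>2 = dens k \<theta>" unfolding nu th_0[OF t] ..
  have nsg: "L2_normsq_on {0..} g = k\<^sup>2 / 2 * hmass k \<theta> + Q 0" unfolding L2_normsq_on_def ng by (rule I2(2))
  have pw: "norm (u x) powr (2 * \<sigma> + 2) = (\<sigma> + 1) * k\<^sup>2 * ?D x - (\<sigma> + 1) * (k\<^sup>2 * (?t x)\<^sup>2 * ?D x)" for x
  proof -
    have "norm (u x) > 0" unfolding u_def using hstate_pos[OF k, of \<theta> x] by simp
    then have "norm (u x) powr (2 * \<sigma> + 2) = ((norm (u x))\<^sup>2) powr \<sigma> * (norm (u x))\<^sup>2"
      by (simp add: powr_add powr_powr flip: powr_numeral)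
    also have "\<dots> = ?D x powr \<sigma> * ?D x" unfolding nu ..
    also have "\<dots> = (\<sigma> + 1) * k\<^sup>2 * (1 - (?t x)\<^sup>2) * ?D x"
      using dens_powr[of "?t x" k] th_bounds[of k \<theta> x] by simp
    finally show ?thesis by (simp add: algebra_simps)
  qed
  have "(LINT x:{0..}|lborel. norm (u x) powr (2 * \<sigma> + 2)) = (\<sigma> + 1) * k\<^sup>2 * hmass k \<theta> - (\<sigma> + 1) * (k\<^sup>2 / 2 * hmass k \<theta> + Q 0)"
  proof -
    have i1: "set_integrable lborel {0..} (\<lambda>x. (\<sigma> + 1) * k\<^sup>2 * ?D x)" by (rule set_integrable_mult_right) (rule I1(1))
    have i2: "set_integrable lborel {0..} (\<lambda>x. (\<sigma> + 1) * (k\<^sup>2 * (?t x)\<^sup>2 * ?D x))" by (rule set_integrable_mult_right) (rule I2(1))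
    show ?thesis unfolding pw set_integral_diff(2)[OF i1 i2] by (simp only: set_integral_mult_right I1(2) I2(2))
  qed
  then have "half_energy \<sigma> u g = 1 / 2 * (k\<^sup>2 / 2 * hmass k \<theta> + Q 0) - 1 / (2 * \<sigma> + 2) * ((\<sigma> + 1) * k\<^sup>2 * hmass k \<theta> - (\<sigma> + 1) * (k\<^sup>2 / 2 * hmass k \<theta> + Q 0))"
    unfolding half_energy_def nsg by simp
  also have "\<dots> = Q 0"
  proof -
    have "1 / (2 * \<sigma> + 2) * ((\<sigma> + 1) * k\<^sup>2 * h - (\<sigma> + 1) * b) = (k\<^sup>2 * h - b) / 2" for h b
    proof -
      have "(\<sigma> + 1) * k\<^sup>2 * h - (\<sigma> + 1) * b = (2 * \<sigma> + 2) * ((k\<^sup>2 * h - b) / 2)" by (simp add: algebra_simps)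
      then show ?thesis using sigma_pos by simp
    qed
    then show ?thesis by (simp only:) (simp add: field_simps)
  qed
  also have "\<dots> = W (hmass k \<theta>) (dens k \<theta>)"
    using param_W(4)[OF k, of \<theta>] t unfolding Q_def th_0[OF t] by (simp add: mult_ac)
  finally show "half_energy \<sigma> u g = W (hmass k \<theta>) (dens k \<theta>)" .
qed

end

section \<open>The differential of the energy\<close>

text \<open>Convexity of the power: \<open>h\<close> decreases up to \<open>s\<close> and increases
  beyond it, with mere continuity at the endpoint 0.\<close>

lemma powr_tangent_line:
  fixes s t q :: real
  assumes "s \<ge> 0" "t \<ge> 0" "q > 1"
  shows "s powr q + q * s powr (q - 1) * (t - s) \<le> t powr q"
proof (cases "s = 0")
  case False
  then have s: "s > 0" using assms by simp
  define h where "h x = x powr q - q * s powr (q - 1) * x" for x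
  have d: "(h has_real_derivative q * (x powr (q - 1) - s powr (q - 1))) (at x)" if "x > 0" for x
  proof -
    have "(h has_real_derivative q * x powr (q - 1) - q * s powr (q - 1) * 1) (at x)"
      unfolding h_def[abs_def] by (intro DERIV_diff DERIV_cmult DERIV_ident has_real_derivative_powr that)
    then show ?thesis by (simp add: right_diff_distrib)
  qed
  have c: "continuous_on {a..b} h" if "a \<ge> 0" for a b
    unfolding h_def[abs_def] using assms that by (intro continuous_intros continuous_on_powr') auto
  have "h s \<le> h t"
  proof (cases "s \<le> t")
    case True
    show ?thesis
    proof (rule DERIV_nonneg_imp_increasing_open[OF True])
      fix x assume "s < x" "x < t"
      then show "\<exists>y. (h has_real_derivative y) (at x) \<and> 0 \<le> y"
        using d[of x] s assms(3) powr_mono2[of "q - 1" s x] by (intro exI[of _ "q * (x powr (q - 1) - s powr (q - 1))"]) auto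
    qed (use c s in auto)
  next
    case False
    then have "t \<le> s" by simp
    then show ?thesis
    proof (rule DERIV_nonpos_imp_decreasing_open)
      fix x assume "t < x" "x < s"
      then show "\<exists>y. (h has_real_derivative y) (at x) \<and> y \<le> 0"
        using d[of x] s assms(2,3) powr_mono2[of "q - 1" x s] by (intro exI[of _ "q * (x powr (q - 1) - s powr (q - 1))"]) (auto simp: mult_nonneg_nonpos)
    qed (use c assms in auto)
  qed
  then show ?thesis by (simp add: h_def algebra_simps)
qed (use assms in simp)

text \<open>Convexity of the power in the modulus, combined with
  \<open>Re ((a + b) * cnj a) \<le> norm (a + b) * norm a\<close>.\<close>

lemma norm_powr_tangent:
  fixes a b :: complex
  assumes "p > 2"
  shows "norm a powr p + p * (norm a powr (p - 2) * Re (a * cnj b)) \<le> norm (a + b) powr p"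
proof (cases "a = 0")
  case False
  define s t where "s = norm a" and "t = norm (a + b)"
  have s: "s > 0" using False by (simp add: s_def)
  have "Re ((a + b) * cnj a) \<le> t * s" using complex_Re_le_cmod[of "(a + b) * cnj a"] by (simp add: norm_mult s_def t_def)
  moreover have "Re ((a + b) * cnj a) = s\<^sup>2 + Re (a * cnj b)" unfolding s_def by (simp only: cmod_power2) (simp add: power2_eq_square algebra_simps)
  ultimately have "Re (a * cnj b) \<le> s * (t - s)" by (simp add: algebra_simps power2_eq_square)
  then have "p * (s powr (p - 2) * Re (a * cnj b)) \<le> p * (s powr (p - 2) * (s * (t - s)))"
    using assms by (intro mult_left_mono) auto
  also have "s powr (p - 2) * (s * (t - s)) = s powr (p - 1) * (t - s)"
  proof -
    have "s powr (p - 1) = s powr ((p - 2) + 1)" by simp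
    also have "\<dots> = s powr (p - 2) * s" using s by (simp only: powr_add powr_one)
    finally show ?thesis by simp
  qed
  finally have "s powr p + p * (s powr (p - 2) * Re (a * cnj b)) \<le> s powr p + p * s powr (p - 1) * (t - s)" by (simp add: mult.assoc)
  also have "\<dots> \<le> t powr p" by (rule powr_tangent_line) (use s assms in \<open>auto simp: t_def\<close>)
  finally show ?thesis by (simp add: s_def t_def)
qed (use assms in simp)

text \<open>For \<open>r < 1\<close> the power \<open>r\<close> is not Lipschitz near 0; the factor
  \<open>s\<close> compensates. Both orderings of \<open>s\<close> and \<open>t\<close> reduce to
  the tangent line inequality with exponent \<open>r + 1\<close>.\<close>

lemma powr_diff_times_le:
  fixes s t M r :: real
  assumes "0 \<le> s" "0 \<le> t" "s \<le> M" "t \<le> M" "r > 0"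
  shows "\<bar>t powr r - s powr r\<bar> * s \<le> (r + 1) * M powr r * \<bar>t - s\<bar>"
proof -
  have pw: "x powr (r + 1) = x powr r * x" if "x \<ge> 0" for x :: real
    using that by (cases "x = 0") (simp_all add: powr_add)
  have Mt: "t powr r \<le> M powr r" "s powr r \<le> M powr r" using assms by (auto intro!: powr_mono2)
  show ?thesis
  proof (cases "s \<le> t")
    case True
    have "s powr r \<le> t powr r" using True assms by (intro powr_mono2) auto
    then have "\<bar>t powr r - s powr r\<bar> * s = t powr r * s - s powr (r + 1)" using pw[OF assms(1)] by (simp add: left_diff_distrib)
    also have "\<dots> \<le> t powr (r + 1) - s powr (r + 1)" using pw[OF assms(2)] True by (simp add: mult_left_mono)
    also have "\<dots> \<le> (r + 1) * t powr r * (t - s)" using powr_tangent_line[of t s "r + 1"] assms by (simp add: algebra_simps)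
    also have "\<dots> \<le> (r + 1) * M powr r * (t - s)" using Mt True assms by (intro mult_right_mono mult_left_mono) auto
    finally show ?thesis using True by simp
  next
    case False
    have "t powr r \<le> s powr r" using False assms by (intro powr_mono2) auto
    then have "\<bar>t powr r - s powr r\<bar> * s = s powr (r + 1) - t powr r * s" using pw[OF assms(1)] by (simp add: left_diff_distrib)
    also have "\<dots> \<le> s powr (r + 1) - t powr (r + 1)" using pw[OF assms(2)] False by (simp add: mult_left_mono)
    also have "\<dots> \<le> (r + 1) * s powr r * (s - t)" using powr_tangent_line[of s t "r + 1"] assms by (simp add: algebra_simps)
    also have "\<dots> \<le> (r + 1) * M powr r * (s - t)" using Mt False assms by (intro mult_right_mono mult_left_mono) auto
    finally show ?thesis using False by simp
  qed
qed

text \<open>The tangent inequality at \<open>a\<close> bounds the remainder below by 0; the one at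
  \<open>a + b\<close> bounds it above by \<open>p\<close> times the change of the gradient paired
  with \<open>b\<close>. A Lipschitz bound on the gradient therefore replaces second
  derivatives.\<close>

lemma norm_powr_remainder:
  fixes a b :: complex
  assumes p: "p > 2" and M: "norm a + norm b \<le> M"
  shows "\<bar>norm (a + b) powr p - norm a powr p - p * (norm a powr (p - 2) * Re (a * cnj b))\<bar> \<le> p\<^sup>2 * M powr (p - 2) * (norm b)\<^sup>2"
proof -
  define r where "r = p - 2"
  define s t where "s = norm a" and "t = norm (a + b)"
  have r: "r > 0" using p by (simp add: r_def)
  have t: "t \<le> M" unfolding t_def using norm_triangle_ineq[of a b] M by linarith
  have s: "s \<le> M" using M norm_ge_zero[of b] unfolding s_def by linarith
  have st: "\<bar>t - s\<bar> \<le> norm b" unfolding s_def t_def using norm_triangle_ineq3[of "a + b" a] by simp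
  have Mr: "t powr r \<le> M powr r" "M powr r \<ge> 0" using t r by (auto intro!: powr_mono2 simp: t_def)
  define D where "D = complex_of_real (t powr r) * (a + b) - complex_of_real (s powr r) * a"
  have "D = complex_of_real (t powr r) * b + complex_of_real (t powr r - s powr r) * a"
    by (simp add: D_def algebra_simps)
  then have "norm D \<le> norm (complex_of_real (t powr r) * b) + norm (complex_of_real (t powr r - s powr r) * a)"
    by (simp only: norm_triangle_ineq)
  also have "\<dots> = t powr r * norm b + \<bar>t powr r - s powr r\<bar> * s"
    by (simp only: norm_mult norm_of_real s_def abs_of_nonneg[OF powr_ge_zero])
  also have "\<dots> \<le> M powr r * norm b + (r + 1) * M powr r * norm b"
  proof (rule add_mono)
    show "t powr r * norm b \<le> M powr r * norm b" using Mr by (intro mult_right_mono) auto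
    have "\<bar>t powr r - s powr r\<bar> * s \<le> (r + 1) * M powr r * \<bar>t - s\<bar>" by (rule powr_diff_times_le) (use s t r in \<open>auto simp: s_def t_def\<close>)
    also have "\<dots> \<le> (r + 1) * M powr r * norm b" using st r Mr by (intro mult_left_mono) auto
    finally show "\<bar>t powr r - s powr r\<bar> * s \<le> (r + 1) * M powr r * norm b" .
  qed
  finally have D: "norm D \<le> p * M powr r * norm b" by (simp add: r_def algebra_simps)
  have lo: "norm a powr p + p * (norm a powr r * Re (a * cnj b)) \<le> norm (a + b) powr p" unfolding r_def by (rule norm_powr_tangent[OF p])
  have "norm (a + b) powr p + p * (norm (a + b) powr r * Re ((a + b) * cnj (- b))) \<le> norm (a + b + - b) powr p" unfolding r_def by (rule norm_powr_tangent[OF p])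
  moreover have "Re ((a + b) * cnj (- b)) = - Re ((a + b) * cnj b)" "a + b + - b = a" by simp_all
  ultimately have hi: "norm (a + b) powr p - p * (norm (a + b) powr r * Re ((a + b) * cnj b)) \<le> norm a powr p"
    by (simp only: mult_minus_right add_uminus_conv_diff)
  have "t powr r * Re ((a + b) * cnj b) - s powr r * Re (a * cnj b) = Re (D * cnj b)"
    by (simp add: D_def algebra_simps)
  then have mid: "p * (norm (a + b) powr r * Re ((a + b) * cnj b)) - p * (norm a powr r * Re (a * cnj b)) = p * Re (D * cnj b)"
    unfolding s_def t_def by (simp only: right_diff_distrib[symmetric])
  have up: "p * Re (D * cnj b) \<le> p\<^sup>2 * M powr r * (norm b)\<^sup>2"
  proof -
    have "Re (D * cnj b) \<le> norm D * norm b" using complex_Re_le_cmod[of "D * cnj b"] by (simp add: norm_mult)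
    also have "\<dots> \<le> (p * M powr r * norm b) * norm b" using D by (intro mult_right_mono) auto
    finally have "p * Re (D * cnj b) \<le> p * ((p * M powr r * norm b) * norm b)" using p by (intro mult_left_mono) auto
    then show ?thesis by (simp add: power2_eq_square mult_ac)
  qed
  show ?thesis using lo hi mid up unfolding r_def[symmetric] by linarith
qed

section \<open>The first variation of the half-line energy\<close>

definition nlin :: "real \<Rightarrow> complex \<Rightarrow> complex" where
  "nlin \<sigma> z = complex_of_real (norm z powr (2 * \<sigma>)) * z"

lemma L2_on_nlin:
  assumes "hl u g" "\<sigma> > 0"
  shows "L2_on {0..} (\<lambda>x. nlin \<sigma> (u x))"
proof -
  have L2u: "L2_on {0..} u" using hlD[OF assms(1)] by simp
  define M where "M = sqrt (L2_normsq_on {0..} u + L2_normsq_on {0..} g)"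
  have M: "norm (u x) \<le> M" if "x \<ge> 0" for x
    unfolding M_def by (rule real_le_rsqrt[OF hl_sup_bound[OF assms(1) that]])
  have "(\<lambda>x. nlin \<sigma> (indicator {0..} x *\<^sub>R u x)) \<in> borel_measurable lborel"
    unfolding nlin_def using L2_on_measurable[OF L2u] by measurable
  moreover have "(\<lambda>x. nlin \<sigma> (indicator {0..} x *\<^sub>R u x)) = (\<lambda>x. indicator {0..} x *\<^sub>R nlin \<sigma> (u x))"
    by (auto simp: indicator_def nlin_def)
  ultimately have m: "(\<lambda>x. indicator {0..} x *\<^sub>R nlin \<sigma> (u x)) \<in> borel_measurable lborel" by simp
  have i: "integrable lborel (\<lambda>x. (M powr (2 * \<sigma>))\<^sup>2 * (indicator {0..} x *\<^sub>R (norm (u x))\<^sup>2))"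
    using L2_on_normsq[OF L2u] unfolding set_integrable_def by (rule integrable_mult_right)
  have "(\<lambda>x. (norm (indicator {0..} x *\<^sub>R nlin \<sigma> (u x)))\<^sup>2) \<in> borel_measurable lborel" using m by measurable
  moreover have "(\<lambda>x. (norm (indicator {0..} x *\<^sub>R nlin \<sigma> (u x)))\<^sup>2) = (\<lambda>x. indicator {0..} x *\<^sub>R (norm (nlin \<sigma> (u x)))\<^sup>2)"
    by (auto simp: indicator_def)
  ultimately have m2: "(\<lambda>x. indicator {0..} x *\<^sub>R (norm (nlin \<sigma> (u x)))\<^sup>2) \<in> borel_measurable lborel" by simp
  have b: "norm (indicator {0..} x *\<^sub>R (norm (nlin \<sigma> (u x)))\<^sup>2) \<le> norm ((M powr (2 * \<sigma>))\<^sup>2 * (indicator {0..} x *\<^sub>R (norm (u x))\<^sup>2))" for x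
  proof (cases "x \<ge> 0")
    case True
    have "norm (u x) powr (2 * \<sigma>) \<le> M powr (2 * \<sigma>)" using M[OF True] assms(2) by (intro powr_mono2) auto
    then have "(norm (u x) powr (2 * \<sigma>))\<^sup>2 * (norm (u x))\<^sup>2 \<le> (M powr (2 * \<sigma>))\<^sup>2 * (norm (u x))\<^sup>2"
      by (intro mult_right_mono power_mono) auto
    then show ?thesis using True by (simp add: nlin_def norm_mult power_mult_distrib)
  qed simp
  have "set_integrable lborel {0..} (\<lambda>x. (norm (nlin \<sigma> (u x)))\<^sup>2)"
    unfolding set_integrable_def by (rule Bochner_Integration.integrable_bound[OF i m2 AE_I2]) (rule b)
  then show ?thesis using m unfolding L2_on_def set_borel_measurable_def by simp
qed

definition ip :: "(real \<Rightarrow> complex) \<Rightarrow> (real \<Rightarrow> complex) \<Rightarrow> real" where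
  "ip u v = Re (LINT x:{0..}|lborel. u x * cnj (v x))"

lemma ip_alt:
  assumes "L2_on {0..} u" "L2_on {0..} v"
  shows "ip u v = (LINT x:{0..}|lborel. Re (u x * cnj (v x)))" "set_integrable lborel {0..} (\<lambda>x. Re (u x * cnj (v x)))"
proof -
  have i: "integrable lborel (\<lambda>x. indicator {0..} x *\<^sub>R (u x * cnj (v x)))"
    using L2_on_mult[OF assms(1) L2_on_cnj[OF assms(2)]] unfolding set_integrable_def .
  have "(\<lambda>x. Re (indicator {0..} x *\<^sub>R (u x * cnj (v x)))) = (\<lambda>x. indicator {0..} x *\<^sub>R Re (u x * cnj (v x)))" by (simp add: fun_eq_iff)
  then show "ip u v = (LINT x:{0..}|lborel. Re (u x * cnj (v x)))" "set_integrable lborel {0..} (\<lambda>x. Re (u x * cnj (v x)))"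
    using integral_Re[OF i] integrable_Re[OF i] unfolding ip_def set_lebesgue_integral_def set_integrable_def by simp_all
qed

lemma ip_lin:
  assumes "L2_on {0..} u" "L2_on {0..} v" "L2_on {0..} w"
  shows "ip u (\<lambda>x. (a::real) *\<^sub>R v x + (b::real) *\<^sub>R w x) = a * ip u v + b * ip u w"
proof -
  note vv = ip_alt[OF assms(1,2)] and ww = ip_alt[OF assms(1,3)]
  have L2: "L2_on {0..} (\<lambda>x. a *\<^sub>R v x + b *\<^sub>R w x)" by (intro L2_on_add L2_on_scaleR assms)
  have i1: "set_integrable lborel {0..} (\<lambda>x. a * Re (u x * cnj (v x)))" by (rule set_integrable_mult_right) (rule vv(2))
  have i2: "set_integrable lborel {0..} (\<lambda>x. b * Re (u x * cnj (w x)))" by (rule set_integrable_mult_right) (rule ww(2))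
  have "Re (u x * cnj (a *\<^sub>R v x + b *\<^sub>R w x)) = a * Re (u x * cnj (v x)) + b * Re (u x * cnj (w x))" for x
    by (simp add: algebra_simps)
  then show ?thesis unfolding ip_alt(1)[OF assms(1) L2] vv(1) ww(1)
    by (simp only: set_integral_add(2)[OF i1 i2] set_integral_mult_right)
qed

lemma ip_bound:
  assumes "L2_on {0..} u" "L2_on {0..} v"
  shows "\<bar>ip u v\<bar> \<le> sqrt (L2_normsq_on {0..} u) * sqrt (L2_normsq_on {0..} v)"
proof -
  have "L2_normsq_on {0..} (\<lambda>x. cnj (v x)) = L2_normsq_on {0..} v" by (simp add: L2_normsq_on_def)
  then have "(norm (LINT x:{0..}|lborel. u x * cnj (v x)))\<^sup>2 \<le> L2_normsq_on {0..} u * L2_normsq_on {0..} v"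
    using cauchy_schwarz_L2(2)[OF assms(1) L2_on_cnj[OF assms(2)]] by simp
  then have "norm (LINT x:{0..}|lborel. u x * cnj (v x)) \<le> sqrt (L2_normsq_on {0..} u * L2_normsq_on {0..} v)"
    by (rule real_le_rsqrt)
  then show ?thesis unfolding ip_def using abs_Re_le_cmod by (simp add: real_sqrt_mult) (meson order_trans)
qed

lemma ip_self: "L2_on {0..} u \<Longrightarrow> ip u u = L2_normsq_on {0..} u"
proof -
  assume u: "L2_on {0..} u"
  have "Re (u x * cnj (u x)) = (norm (u x))\<^sup>2" for x by (simp only: cmod_power2) (simp add: power2_eq_square)
  then show ?thesis unfolding ip_alt(1)[OF u u] L2_normsq_on_def by (simp only:)
qed

lemma ip_cong_AE:
  assumes "L2_on {0..} u" "L2_on {0..} v" "L2_on {0..} w" "AE x in lborel. x \<ge> 0 \<longrightarrow> v x = w x"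
  shows "ip u v = ip u w"
proof -
  have "(LINT x:{0..}|lborel. u x * cnj (v x)) = (LINT x:{0..}|lborel. u x * cnj (w x))"
    unfolding set_lebesgue_integral_def
  proof (rule integral_cong_AE)
    show "AE x in lborel. indicator {0..} x *\<^sub>R (u x * cnj (v x)) = indicator {0..} x *\<^sub>R (u x * cnj (w x))"
      using assms(4) by eventually_elim (auto simp: indicator_def)
  qed (use L2_on_mult[OF assms(1) L2_on_cnj[OF assms(2)]] L2_on_mult[OF assms(1) L2_on_cnj[OF assms(3)]] in \<open>auto simp: set_integrable_def\<close>)
  then show ?thesis by (simp add: ip_def)
qed

lemma normsq_add:
  assumes "L2_on {0..} u" "L2_on {0..} v"
  shows "L2_normsq_on {0..} (\<lambda>x. u x + v x) = L2_normsq_on {0..} u + 2 * ip u v + L2_normsq_on {0..} v"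
proof -
  have pt: "(norm (u x + v x))\<^sup>2 = ((norm (u x))\<^sup>2 + 2 * Re (u x * cnj (v x))) + (norm (v x))\<^sup>2" for x
    by (simp only: cmod_power2) (simp add: power2_eq_square algebra_simps)
  note a = ip_alt[OF assms]
  have i1: "set_integrable lborel {0..} (\<lambda>x. 2 * Re (u x * cnj (v x)))" by (rule set_integrable_mult_right) (rule a(2))
  have i2: "set_integrable lborel {0..} (\<lambda>x. (norm (u x))\<^sup>2 + 2 * Re (u x * cnj (v x)))" by (intro set_integral_add(1) L2_on_normsq assms i1)
  show ?thesis unfolding L2_normsq_on_def pt
      set_integral_add(2)[OF i2 L2_on_normsq[OF assms(2)]] set_integral_add(2)[OF L2_on_normsq[OF assms(1)] i1] set_integral_mult_right a(1) ..
qed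

lemma normsq_scaleR: "L2_normsq_on A (\<lambda>x. (c::real) *\<^sub>R u x) = c\<^sup>2 * L2_normsq_on A u"
  unfolding L2_normsq_on_def by (simp add: power_mult_distrib)

definition half_diff :: "real \<Rightarrow> (real \<Rightarrow> complex) \<Rightarrow> (real \<Rightarrow> complex) \<Rightarrow> (real \<Rightarrow> complex) \<Rightarrow> (real \<Rightarrow> complex) \<Rightarrow> real" where
  "half_diff \<sigma> u g v h = ip g h - ip (\<lambda>x. nlin \<sigma> (u x)) v"

text \<open>Smallness of the perturbation bounds \<open>v\<close> by 1 pointwise, so one constant
  \<open>M\<close> serves the pointwise remainder estimate on the whole half-line, and the error is
  quadratic in the norm.\<close>

lemma half_energy_expand:
  assumes u: "hl u g" and v: "hl v h" and s: "\<sigma> > 0" and small: "L2_normsq_on {0..} v + L2_normsq_on {0..} h \<le> 1"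
  defines "M \<equiv> sqrt (L2_normsq_on {0..} u + L2_normsq_on {0..} g) + 1"
  shows "\<bar>half_energy \<sigma> (\<lambda>x. u x + v x) (\<lambda>x. g x + h x) - half_energy \<sigma> u g - half_diff \<sigma> u g v h\<bar>
    \<le> (1 + (2 * \<sigma> + 2) * M powr (2 * \<sigma>)) * (L2_normsq_on {0..} v + L2_normsq_on {0..} h)"
proof -
  define p where "p = 2 * \<sigma> + 2"
  have p: "p > 2" "p \<ge> 2" using s by (auto simp: p_def)
  have uv: "hl (\<lambda>x. u x + v x) (\<lambda>x. g x + h x)" using hl_add_scale[OF u v, of 1 1] by simp
  note L2u = hlD(1)[OF u] and L2v = hlD(1)[OF v] and L2g = hlD(2)[OF u] and L2h = hlD(2)[OF v]
  note L2n = L2_on_nlin[OF u s]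
  have Mu: "norm (u x) \<le> M - 1" if "x \<ge> 0" for x
    unfolding M_def using real_le_rsqrt[OF hl_sup_bound[OF u that]] by simp
  have Mv: "norm (v x) \<le> 1" if "x \<ge> 0" for x
  proof -
    have "(norm (v x))\<^sup>2 \<le> 1" using hl_sup_bound[OF v that] small by simp
    then show ?thesis by (simp add: power_le_one_iff)
  qed
  define r where "r x = norm (u x + v x) powr p - norm (u x) powr p - p * Re (nlin \<sigma> (u x) * cnj (v x))" for x
  note nv = ip_alt[OF L2n L2v]
  have i1: "set_integrable lborel {0..} (\<lambda>x. norm (u x + v x) powr p)" by (rule hl_powr_integrable[OF uv p(2)])
  have i2: "set_integrable lborel {0..} (\<lambda>x. norm (u x) powr p)" by (rule hl_powr_integrable[OF u p(2)])
  have i3: "set_integrable lborel {0..} (\<lambda>x. p * Re (nlin \<sigma> (u x) * cnj (v x)))" by (rule set_integrable_mult_right) (rule nv(2))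
  have i12: "set_integrable lborel {0..} (\<lambda>x. norm (u x + v x) powr p - norm (u x) powr p)" by (rule set_integral_diff(1)[OF i1 i2])
  have ri: "set_integrable lborel {0..} r" unfolding r_def[abs_def] by (rule set_integral_diff(1)[OF i12 i3])
  have R: "(LINT x:{0..}|lborel. r x) = (LINT x:{0..}|lborel. norm (u x + v x) powr p) - (LINT x:{0..}|lborel. norm (u x) powr p) - p * ip (\<lambda>x. nlin \<sigma> (u x)) v"
    unfolding r_def[abs_def] set_integral_diff(2)[OF i12 i3] set_integral_diff(2)[OF i1 i2] set_integral_mult_right nv(1) ..
  have rb: "\<bar>r x\<bar> \<le> p\<^sup>2 * M powr (p - 2) * (norm (v x))\<^sup>2" if "x \<ge> 0" for x
  proof -
    have "Re (nlin \<sigma> (u x) * cnj (v x)) = norm (u x) powr (p - 2) * Re (u x * cnj (v x))"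
      by (simp add: nlin_def p_def algebra_simps)
    then show ?thesis unfolding r_def using norm_powr_remainder[OF p(1), of "u x" "v x" M] Mu[OF that] Mv[OF that] by simp
  qed
  have "\<bar>LINT x:{0..}|lborel. r x\<bar> \<le> (LINT x:{0..}|lborel. norm (r x))"
    using set_integral_norm_bound[OF ri] by simp
  also have "\<dots> \<le> (LINT x:{0..}|lborel. p\<^sup>2 * M powr (p - 2) * (norm (v x))\<^sup>2)"
  proof (rule set_integral_mono)
    show "set_integrable lborel {0..} (\<lambda>x. norm (r x))" by (rule set_integrable_norm[OF ri])
    show "set_integrable lborel {0..} (\<lambda>x. p\<^sup>2 * M powr (p - 2) * (norm (v x))\<^sup>2)" by (rule set_integrable_mult_right) (rule L2_on_normsq[OF L2v])
  qed (use rb in auto)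
  also have "\<dots> = p\<^sup>2 * M powr (p - 2) * L2_normsq_on {0..} v" unfolding set_integral_mult_right L2_normsq_on_def ..
  finally have Rb: "\<bar>LINT x:{0..}|lborel. r x\<bar> \<le> p\<^sup>2 * M powr (p - 2) * L2_normsq_on {0..} v" .
  have "half_energy \<sigma> (\<lambda>x. u x + v x) (\<lambda>x. g x + h x) - half_energy \<sigma> u g - half_diff \<sigma> u g v h = 1 / 2 * L2_normsq_on {0..} h - 1 / p * (LINT x:{0..}|lborel. r x)"
    unfolding half_energy_def half_diff_def normsq_add[OF L2g L2h] R p_def[symmetric] using p by (simp add: field_simps)
  also have "\<bar>\<dots>\<bar> \<le> 1 / 2 * L2_normsq_on {0..} h + 1 / p * (p\<^sup>2 * M powr (p - 2) * L2_normsq_on {0..} v)"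
  proof -
    have "\<bar>1 / p * (LINT x:{0..}|lborel. r x)\<bar> \<le> 1 / p * (p\<^sup>2 * M powr (p - 2) * L2_normsq_on {0..} v)"
      using Rb p by (simp only: abs_mult) (intro mult_mono, auto)
    moreover have "0 \<le> L2_normsq_on {0..} h" by (rule L2_normsq_nonneg)
    ultimately show ?thesis by linarith
  qed
  also have "1 / p * (p\<^sup>2 * M powr (p - 2) * L2_normsq_on {0..} v) = p * M powr (2 * \<sigma>) * L2_normsq_on {0..} v"
    using p by (simp add: power2_eq_square p_def)
  also have "1 / 2 * L2_normsq_on {0..} h + p * M powr (2 * \<sigma>) * L2_normsq_on {0..} v \<le> (1 + p * M powr (2 * \<sigma>)) * (L2_normsq_on {0..} v + L2_normsq_on {0..} h)"
  proof -
    have "0 \<le> L2_normsq_on {0..} h" "0 \<le> L2_normsq_on {0..} v" by (rule L2_normsq_nonneg)+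
    moreover have "0 \<le> p * M powr (2 * \<sigma>)" using p by simp
    ultimately have "0 \<le> p * M powr (2 * \<sigma>) * L2_normsq_on {0..} h" "0 \<le> p * M powr (2 * \<sigma>) * L2_normsq_on {0..} v" by simp_all
    then show ?thesis using \<open>0 \<le> L2_normsq_on {0..} h\<close> \<open>0 \<le> L2_normsq_on {0..} v\<close> by (simp add: distrib_right distrib_left)
  qed
  finally show ?thesis by (simp add: p_def)
qed

section \<open>The energy and its differential on the space with the jump condition\<close>

definition dec :: "real \<Rightarrow> (real \<Rightarrow> complex) \<Rightarrow> (real \<Rightarrow> complex) \<Rightarrow> (real \<Rightarrow> complex) \<Rightarrow> (real \<Rightarrow> complex) \<Rightarrow> (real \<Rightarrow> complex) \<Rightarrow> bool" where
  "dec \<tau> \<eta> vL hL vR hR \<longleftrightarrow> hl vL hL \<and> hl vR hR \<and> vR 0 = of_real \<tau> * vL 0 \<and> \<eta> = glue vL vR"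

lemma decD:
  assumes "dec \<tau> \<eta> vL hL vR hR"
  shows "hl vL hL" "hl vR hR" "vR 0 = of_real \<tau> * vL 0" "\<eta> = glue vL vR"
  using assms by (auto simp: dec_def)

lemma D_space_dec: "\<eta> \<in> D_space \<tau> \<longleftrightarrow> (\<exists>vL hL vR hR. dec \<tau> \<eta> vL hL vR hR)"
  unfolding D_space_iff dec_def by blast

lemma D_space_decE:
  assumes "\<eta> \<in> D_space \<tau>"
  obtains vL hL vR hR where "dec \<tau> \<eta> vL hL vR hR"
  using assms unfolding D_space_dec by blast

lemma dec_combine:
  assumes "dec \<tau> \<eta> vL hL vR hR" "dec \<tau> \<xi> wL kL wR kR"
  shows "dec \<tau> (\<lambda>x. (a::real) *\<^sub>R \<eta> x + (b::real) *\<^sub>R \<xi> x) (\<lambda>x. a *\<^sub>R vL x + b *\<^sub>R wL x) (\<lambda>x. a *\<^sub>R hL x + b *\<^sub>R kL x)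
     (\<lambda>x. a *\<^sub>R vR x + b *\<^sub>R wR x) (\<lambda>x. a *\<^sub>R hR x + b *\<^sub>R kR x)"
  unfolding dec_def using hl_add_scale[OF decD(1)[OF assms(1)] decD(1)[OF assms(2)]] hl_add_scale[OF decD(2)[OF assms(1)] decD(2)[OF assms(2)]]
    decD(3,4)[OF assms(1)] decD(3,4)[OF assms(2)]
  by (auto simp: glue_def fun_eq_iff algebra_simps scaleR_conv_of_real)

lemma D_space_combine:
  assumes "\<eta> \<in> D_space \<tau>" "\<xi> \<in> D_space \<tau>"
  shows "(\<lambda>x. (a::real) *\<^sub>R \<eta> x + (b::real) *\<^sub>R \<xi> x) \<in> D_space \<tau>"
  using assms dec_combine unfolding D_space_dec by meson

definition hnorm2 :: "(real \<Rightarrow> complex) \<Rightarrow> (real \<Rightarrow> complex) \<Rightarrow> real" where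
  "hnorm2 v h = L2_normsq_on {0..} v + L2_normsq_on {0..} h"

lemma hnorm2_nonneg: "hnorm2 v h \<ge> 0"
  unfolding hnorm2_def by (intro add_nonneg_nonneg L2_normsq_nonneg)

lemma H1_norm_dec:
  assumes "dec \<tau> \<eta> vL hL vR hR"
  shows "(H1_norm \<eta>)\<^sup>2 = hnorm2 vL hL + hnorm2 vR hR" "H1_norm \<eta> \<ge> 0" "mass \<eta> = L2_normsq_on {0..} vL + L2_normsq_on {0..} vR"
proof -
  note d = decD[OF assms]
  show m: "mass \<eta> = L2_normsq_on {0..} vL + L2_normsq_on {0..} vR" unfolding d(4) by (rule mass_glue[OF d(1,2)])
  have k: "kinetic \<eta> = L2_normsq_on {0..} hL + L2_normsq_on {0..} hR" unfolding d(4) by (rule kinetic_glue[OF d(1,2)])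
  have "mass \<eta> + kinetic \<eta> \<ge> 0" unfolding m k by (intro add_nonneg_nonneg L2_normsq_nonneg)
  then show "(H1_norm \<eta>)\<^sup>2 = hnorm2 vL hL + hnorm2 vR hR" "H1_norm \<eta> \<ge> 0"
    unfolding H1_norm_def by (simp_all add: m k hnorm2_def)
qed

lemma H1_norm_scale:
  assumes "\<eta> \<in> D_space \<tau>"
  shows "H1_norm (\<lambda>x. (a::real) *\<^sub>R \<eta> x) = \<bar>a\<bar> * H1_norm \<eta>"
proof -
  obtain vL hL vR hR where d: "dec \<tau> \<eta> vL hL vR hR" using assms by (rule D_space_decE)
  have d': "dec \<tau> (\<lambda>x. a *\<^sub>R \<eta> x) (\<lambda>x. a *\<^sub>R vL x) (\<lambda>x. a *\<^sub>R hL x) (\<lambda>x. a *\<^sub>R vR x) (\<lambda>x. a *\<^sub>R hR x)"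
    using dec_combine[OF d d, of a 0] by simp
  have "(H1_norm (\<lambda>x. a *\<^sub>R \<eta> x))\<^sup>2 = (\<bar>a\<bar> * H1_norm \<eta>)\<^sup>2"
    unfolding H1_norm_dec(1)[OF d'] power_mult_distrib H1_norm_dec(1)[OF d] hnorm2_def normsq_scaleR by (simp add: algebra_simps)
  then show ?thesis using H1_norm_dec(2)[OF d] H1_norm_dec(2)[OF d'] by (simp add: power2_eq_iff_nonneg)
qed

definition denergy :: "real \<Rightarrow> real \<Rightarrow> (real \<Rightarrow> complex) \<Rightarrow> (real \<Rightarrow> complex) \<Rightarrow> (real \<Rightarrow> complex) \<Rightarrow> (real \<Rightarrow> complex) \<Rightarrow>
    (real \<Rightarrow> complex) \<Rightarrow> (real \<Rightarrow> complex) \<Rightarrow> (real \<Rightarrow> complex) \<Rightarrow> (real \<Rightarrow> complex) \<Rightarrow> real" where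
  "denergy \<sigma> \<alpha> uL gL uR gR vL hL vR hR = half_diff \<sigma> uL gL vL hL + half_diff \<sigma> uR gR vR hR - \<alpha> * Re (uL 0 * cnj (vL 0))"

lemma hl_glue_eq:
  assumes "hl vL hL" "hl vR hR" "hl vL' hL'" "hl vR' hR'" "glue vL vR = glue vL' vR'" "x \<ge> 0"
  shows "vL x = vL' x" "vR x = vR' x"
proof -
  have 1: "vL x = vL' x" "vR x = vR' x" if "x > 0" for x
    using fun_cong[OF assms(5), of "- x"] fun_cong[OF assms(5), of x] that by (auto simp: glue_simps)
  have 2: "vL 0 = vL' 0" "vR 0 = vR' 0"
    using hl_glue_H1_split(8,9)[OF assms(1,2)] hl_glue_H1_split(8,9)[OF assms(3,4)] unfolding assms(5)
    by (auto intro: tendsto_unique[OF trivial_limit_at_left_real] tendsto_unique[OF trivial_limit_at_right_real])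
  show "vL x = vL' x" "vR x = vR' x" using 1[of x] 2 assms(6) by (cases "x = 0"; simp)+
qed

lemma half_diff_unique:
  assumes "hl u g" "\<sigma> > 0" "hl v h" "hl v' h'" "\<And>x. x \<ge> 0 \<Longrightarrow> v x = v' x"
  shows "half_diff \<sigma> u g v h = half_diff \<sigma> u g v' h'"
proof -
  have "hl v h'" by (rule hl_cong[OF assms(4)]) (use assms(5) in auto)
  then have "AE x in lborel. x \<ge> 0 \<longrightarrow> h x = h' x" using hl_deriv_unique[OF assms(3)] by blast
  then have "ip g h = ip g h'" by (intro ip_cong_AE hlD(2)[OF assms(1)] hlD(2)[OF assms(3)] hlD(2)[OF assms(4)])
  moreover have "ip (\<lambda>x. nlin \<sigma> (u x)) v = ip (\<lambda>x. nlin \<sigma> (u x)) v'"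
    by (intro ip_cong_AE L2_on_nlin[OF assms(1,2)] hlD(1)[OF assms(3)] hlD(1)[OF assms(4)]) (use assms(5) in auto)
  ultimately show ?thesis by (simp add: half_diff_def)
qed

text \<open>A decomposition into halves is not unique: derivatives are determined almost everywhere,
  and the halves are arbitrary on the negative axis. Hence the choice, whose outcome
  \<open>dE_eq\<close> shows to be independent of it.\<close>

definition dE :: "real \<Rightarrow> real \<Rightarrow> real \<Rightarrow> (real \<Rightarrow> complex) \<Rightarrow> (real \<Rightarrow> complex) \<Rightarrow> (real \<Rightarrow> complex) \<Rightarrow> (real \<Rightarrow> complex) \<Rightarrow> (real \<Rightarrow> complex) \<Rightarrow> real" where
  "dE \<sigma> \<alpha> \<tau> uL gL uR gR \<eta> = (SOME l. \<exists>vL hL vR hR. dec \<tau> \<eta> vL hL vR hR \<and> l = denergy \<sigma> \<alpha> uL gL uR gR vL hL vR hR)"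

lemma dE_eq:
  assumes u: "dec \<tau> u uL gL uR gR" and s: "\<sigma> > 0" and d: "dec \<tau> \<eta> vL hL vR hR"
  shows "dE \<sigma> \<alpha> \<tau> uL gL uR gR \<eta> = denergy \<sigma> \<alpha> uL gL uR gR vL hL vR hR"
  unfolding dE_def
proof (rule some_equality)
  show "\<exists>vL' hL' vR' hR'. dec \<tau> \<eta> vL' hL' vR' hR' \<and> denergy \<sigma> \<alpha> uL gL uR gR vL hL vR hR = denergy \<sigma> \<alpha> uL gL uR gR vL' hL' vR' hR'"
    using d by blast
  fix l assume "\<exists>vL' hL' vR' hR'. dec \<tau> \<eta> vL' hL' vR' hR' \<and> l = denergy \<sigma> \<alpha> uL gL uR gR vL' hL' vR' hR'"
  then obtain vL' hL' vR' hR' where d': "dec \<tau> \<eta> vL' hL' vR' hR'" and l: "l = denergy \<sigma> \<alpha> uL gL uR gR vL' hL' vR' hR'" by blast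
  have e: "glue vL' vR' = glue vL vR" using decD(4)[OF d] decD(4)[OF d'] by simp
  note eq = hl_glue_eq[OF decD(1,2)[OF d'] decD(1,2)[OF d] e]
  show "l = denergy \<sigma> \<alpha> uL gL uR gR vL hL vR hR"
    unfolding l denergy_def using half_diff_unique[OF decD(1)[OF u] s decD(1)[OF d'] decD(1)[OF d] eq(1)]
      half_diff_unique[OF decD(2)[OF u] s decD(2)[OF d'] decD(2)[OF d] eq(2)] eq(1)[of 0] by simp
qed

lemma half_diff_lin:
  assumes "hl u g" "\<sigma> > 0" "hl v h" "hl w k"
  shows "half_diff \<sigma> u g (\<lambda>x. (a::real) *\<^sub>R v x + (b::real) *\<^sub>R w x) (\<lambda>x. a *\<^sub>R h x + b *\<^sub>R k x) = a * half_diff \<sigma> u g v h + b * half_diff \<sigma> u g w k"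
  unfolding half_diff_def
  using ip_lin[OF hlD(2)[OF assms(1)] hlD(2)[OF assms(3)] hlD(2)[OF assms(4)], of a b] ip_lin[OF L2_on_nlin[OF assms(1,2)] hlD(1)[OF assms(3)] hlD(1)[OF assms(4)], of a b]
  by (simp add: algebra_simps)

lemma half_diff_bound:
  assumes "hl u g" "\<sigma> > 0" "hl v h" "hnorm2 v h \<le> H\<^sup>2" "H \<ge> 0"
  shows "\<bar>half_diff \<sigma> u g v h\<bar> \<le> (sqrt (L2_normsq_on {0..} g) + sqrt (L2_normsq_on {0..} (\<lambda>x. nlin \<sigma> (u x)))) * H"
proof -
  have "0 \<le> L2_normsq_on {0..} v" "0 \<le> L2_normsq_on {0..} h" by (rule L2_normsq_nonneg)+
  then have "sqrt (L2_normsq_on {0..} v) \<le> H" "sqrt (L2_normsq_on {0..} h) \<le> H"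
    using assms(4,5) unfolding hnorm2_def by (auto intro!: real_le_lsqrt)
  then have "sqrt (L2_normsq_on {0..} g) * sqrt (L2_normsq_on {0..} h) \<le> sqrt (L2_normsq_on {0..} g) * H"
    "sqrt (L2_normsq_on {0..} (\<lambda>x. nlin \<sigma> (u x))) * sqrt (L2_normsq_on {0..} v) \<le> sqrt (L2_normsq_on {0..} (\<lambda>x. nlin \<sigma> (u x))) * H"
    by (auto intro!: mult_left_mono L2_normsq_nonneg)
  then show ?thesis unfolding half_diff_def
    using ip_bound[OF hlD(2)[OF assms(1)] hlD(2)[OF assms(3)]] ip_bound[OF L2_on_nlin[OF assms(1,2)] hlD(1)[OF assms(3)]]
    by (simp add: distrib_right)
qed

theorem energy_differential:
  assumes u: "dec \<tau> u uL gL uR gR" and s: "\<sigma> > 0"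
  shows "is_differential \<tau> (energy \<sigma> \<alpha>) u (dE \<sigma> \<alpha> \<tau> uL gL uR gR)"
  unfolding is_differential_def
proof (intro conjI ballI allI impI)
  let ?L = "dE \<sigma> \<alpha> \<tau> uL gL uR gR"
  note du = decD[OF u]
  fix \<eta> \<xi> :: "real \<Rightarrow> complex" and a b :: real
  assume "\<eta> \<in> D_space \<tau>" "\<xi> \<in> D_space \<tau>"
  then obtain vL hL vR hR wL kL wR kR where d: "dec \<tau> \<eta> vL hL vR hR" and e: "dec \<tau> \<xi> wL kL wR kR"
    by (meson D_space_dec)
  show "?L (\<lambda>x. a *\<^sub>R \<eta> x + b *\<^sub>R \<xi> x) = a * ?L \<eta> + b * ?L \<xi>"
    unfolding dE_eq[OF u s dec_combine[OF d e]] dE_eq[OF u s d] dE_eq[OF u s e] denergy_def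
      half_diff_lin[OF du(1) s decD(1)[OF d] decD(1)[OF e]] half_diff_lin[OF du(2) s decD(2)[OF d] decD(2)[OF e]]
    by (simp add: algebra_simps)
next
  let ?L = "dE \<sigma> \<alpha> \<tau> uL gL uR gR"
  note du = decD[OF u]
  define CL where "CL = sqrt (L2_normsq_on {0..} gL) + sqrt (L2_normsq_on {0..} (\<lambda>x. nlin \<sigma> (uL x)))"
  define CR where "CR = sqrt (L2_normsq_on {0..} gR) + sqrt (L2_normsq_on {0..} (\<lambda>x. nlin \<sigma> (uR x)))"
  show "\<exists>C. \<forall>\<eta>\<in>D_space \<tau>. \<bar>?L \<eta>\<bar> \<le> C * H1_norm \<eta>"
  proof (intro exI[of _ "CL + CR + \<bar>\<alpha>\<bar> * norm (uL 0)"] ballI)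
    fix \<eta> assume "\<eta> \<in> D_space \<tau>"
    then obtain vL hL vR hR where d: "dec \<tau> \<eta> vL hL vR hR" by (rule D_space_decE)
    define H where "H = H1_norm \<eta>"
    have H: "H \<ge> 0" "hnorm2 vL hL \<le> H\<^sup>2" "hnorm2 vR hR \<le> H\<^sup>2"
      using H1_norm_dec[OF d] hnorm2_nonneg[of vL hL] hnorm2_nonneg[of vR hR] by (auto simp: H_def)
    have "(norm (vL 0))\<^sup>2 \<le> H\<^sup>2" using hl_sup_bound[OF decD(1)[OF d], of 0] H(2) by (simp add: hnorm2_def)
    then have v0: "norm (vL 0) \<le> H" using H(1) by (rule power2_le_imp_le)
    have "\<bar>Re (uL 0 * cnj (vL 0))\<bar> \<le> norm (uL 0) * norm (vL 0)"
      using abs_Re_le_cmod[of "uL 0 * cnj (vL 0)"] by (simp only: norm_mult complex_mod_cnj)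
    also have "\<dots> \<le> norm (uL 0) * H" using v0 by (intro mult_left_mono) auto
    finally have "\<bar>\<alpha> * Re (uL 0 * cnj (vL 0))\<bar> \<le> \<bar>\<alpha>\<bar> * (norm (uL 0) * H)"
      by (simp only: abs_mult) (intro mult_left_mono, auto)
    then show "\<bar>?L \<eta>\<bar> \<le> (CL + CR + \<bar>\<alpha>\<bar> * norm (uL 0)) * H1_norm \<eta>"
      unfolding dE_eq[OF u s d] denergy_def H_def[symmetric]
      using half_diff_bound[OF du(1) s decD(1)[OF d] H(2,1), folded CL_def] half_diff_bound[OF du(2) s decD(2)[OF d] H(3,1), folded CR_def]
      by (simp add: distrib_right mult.assoc)
  qed
next
  let ?L = "dE \<sigma> \<alpha> \<tau> uL gL uR gR"
  note du = decD[OF u]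
  fix \<epsilon> :: real assume \<epsilon>: "\<epsilon> > 0"
  define KL where "KL = 1 + (2 * \<sigma> + 2) * (sqrt (L2_normsq_on {0..} uL + L2_normsq_on {0..} gL) + 1) powr (2 * \<sigma>)"
  define KR where "KR = 1 + (2 * \<sigma> + 2) * (sqrt (L2_normsq_on {0..} uR + L2_normsq_on {0..} gR) + 1) powr (2 * \<sigma>)"
  define K where "K = KL + KR + \<bar>\<alpha>\<bar>"
  have K: "KL \<ge> 1" "KR \<ge> 1" "K > 0" using s by (auto simp: KL_def KR_def K_def intro!: add_pos_nonneg add_nonneg_nonneg)
  show "\<exists>\<delta>>0. \<forall>\<eta>\<in>D_space \<tau>. H1_norm \<eta> < \<delta> \<longrightarrow> \<bar>energy \<sigma> \<alpha> (\<lambda>x. u x + \<eta> x) - energy \<sigma> \<alpha> u - ?L \<eta>\<bar> \<le> \<epsilon> * H1_norm \<eta>"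
  \<comment> \<open>The 1 makes \<open>half_energy_expand\<close> applicable;
    \<open>\<epsilon> / K\<close> turns the quadratic error \<open>K * H\<^sup>2\<close> into
    \<open>\<epsilon> * H\<close>.\<close>
  proof (intro exI[of _ "min 1 (\<epsilon> / K)"] conjI ballI impI)
    show "min 1 (\<epsilon> / K) > 0" using \<epsilon> K by simp
    fix \<eta> assume "\<eta> \<in> D_space \<tau>" and small: "H1_norm \<eta> < min 1 (\<epsilon> / K)"
    then obtain vL hL vR hR where d: "dec \<tau> \<eta> vL hL vR hR" by (meson D_space_dec)
    define H where "H = H1_norm \<eta>"
    have H: "H \<ge> 0" "H\<^sup>2 = hnorm2 vL hL + hnorm2 vR hR" using H1_norm_dec[OF d] by (auto simp: H_def)
    have nn: "hnorm2 vL hL \<ge> 0" "hnorm2 vR hR \<ge> 0" by (rule hnorm2_nonneg)+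
    have H1: "H < 1" "H < \<epsilon> / K" using small by (auto simp: H_def)
    then have "H\<^sup>2 \<le> 1" using H(1) by (simp add: power_le_one)
    then have le1: "hnorm2 vL hL \<le> 1" "hnorm2 vR hR \<le> 1" using H(2) nn by auto
    have dd: "dec \<tau> (\<lambda>x. u x + \<eta> x) (\<lambda>x. uL x + vL x) (\<lambda>x. gL x + hL x) (\<lambda>x. uR x + vR x) (\<lambda>x. gR x + hR x)"
      using dec_combine[OF u d, of 1 1] by simp
    have eL: "\<bar>half_energy \<sigma> (\<lambda>x. uL x + vL x) (\<lambda>x. gL x + hL x) - half_energy \<sigma> uL gL - half_diff \<sigma> uL gL vL hL\<bar> \<le> KL * hnorm2 vL hL"
      using half_energy_expand[OF du(1) decD(1)[OF d] s] le1(1) unfolding hnorm2_def KL_def by simp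
    have eR: "\<bar>half_energy \<sigma> (\<lambda>x. uR x + vR x) (\<lambda>x. gR x + hR x) - half_energy \<sigma> uR gR - half_diff \<sigma> uR gR vR hR\<bar> \<le> KR * hnorm2 vR hR"
      using half_energy_expand[OF du(2) decD(2)[OF d] s] le1(2) unfolding hnorm2_def KR_def by simp
    have e0: "(norm (uL 0 + vL 0))\<^sup>2 = (norm (uL 0))\<^sup>2 + 2 * Re (uL 0 * cnj (vL 0)) + (norm (vL 0))\<^sup>2"
      by (simp only: cmod_power2) (simp add: power2_eq_square algebra_simps)
    have v0: "(norm (vL 0))\<^sup>2 \<le> hnorm2 vL hL" using hl_sup_bound[OF decD(1)[OF d], of 0] by (simp add: hnorm2_def)
    have a0: "\<bar>\<alpha> / 2 * (norm (vL 0))\<^sup>2\<bar> \<le> \<bar>\<alpha>\<bar> * hnorm2 vL hL"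
    proof -
      have "\<bar>\<alpha> / 2 * (norm (vL 0))\<^sup>2\<bar> = \<bar>\<alpha>\<bar> * (norm (vL 0))\<^sup>2 / 2" by (simp add: abs_mult)
      also have "\<dots> \<le> \<bar>\<alpha>\<bar> * (norm (vL 0))\<^sup>2" by simp
      also have "\<dots> \<le> \<bar>\<alpha>\<bar> * hnorm2 vL hL" using v0 by (intro mult_left_mono) auto
      finally show ?thesis .
    qed
    have en: "energy \<sigma> \<alpha> (\<lambda>x. u x + \<eta> x) = half_energy \<sigma> (\<lambda>x. uL x + vL x) (\<lambda>x. gL x + hL x) + half_energy \<sigma> (\<lambda>x. uR x + vR x) (\<lambda>x. gR x + hR x) - \<alpha> / 2 * (norm (uL 0 + vL 0))\<^sup>2"
      "energy \<sigma> \<alpha> u = half_energy \<sigma> uL gL + half_energy \<sigma> uR gR - \<alpha> / 2 * (norm (uL 0))\<^sup>2"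
      using energy_glue[OF decD(1,2)[OF dd] less_imp_le[OF s], of \<alpha>] decD(4)[OF dd] energy_glue[OF du(1,2) less_imp_le[OF s], of \<alpha>] du(4) by simp_all
    have "\<bar>energy \<sigma> \<alpha> (\<lambda>x. u x + \<eta> x) - energy \<sigma> \<alpha> u - ?L \<eta>\<bar> \<le> KL * hnorm2 vL hL + KR * hnorm2 vR hR + \<bar>\<alpha>\<bar> * hnorm2 vL hL"
    proof -
      define X Y Z where "X = half_energy \<sigma> (\<lambda>x. uL x + vL x) (\<lambda>x. gL x + hL x) - half_energy \<sigma> uL gL - half_diff \<sigma> uL gL vL hL"
        and "Y = half_energy \<sigma> (\<lambda>x. uR x + vR x) (\<lambda>x. gR x + hR x) - half_energy \<sigma> uR gR - half_diff \<sigma> uR gR vR hR"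
        and "Z = \<alpha> / 2 * (norm (vL 0))\<^sup>2"
      have "energy \<sigma> \<alpha> (\<lambda>x. u x + \<eta> x) - energy \<sigma> \<alpha> u - ?L \<eta> = X + Y - Z"
        unfolding en dE_eq[OF u s d] denergy_def e0 X_def Y_def Z_def by (simp add: distrib_left)
      moreover have "\<bar>X + Y - Z\<bar> \<le> \<bar>X\<bar> + \<bar>Y\<bar> + \<bar>Z\<bar>" by linarith
      ultimately show ?thesis using eL eR a0 unfolding X_def[symmetric] Y_def[symmetric] Z_def[symmetric] by linarith
    qed
    also have "\<dots> \<le> K * H\<^sup>2"
    proof -
      have "KL * hnorm2 vL hL \<le> KL * H\<^sup>2" "KR * hnorm2 vR hR \<le> KR * H\<^sup>2" "\<bar>\<alpha>\<bar> * hnorm2 vL hL \<le> \<bar>\<alpha>\<bar> * H\<^sup>2"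
        using H(2) nn K by (auto intro!: mult_left_mono)
      then show ?thesis unfolding K_def by (simp add: distrib_right)
    qed
    also have "\<dots> = (K * H) * H" by (simp add: power2_eq_square)
    also have "\<dots> \<le> \<epsilon> * H"
    proof -
      have "K * H \<le> \<epsilon>" using H1(2) K(3) by (simp add: field_simps)
      then show ?thesis using H(1) by (rule mult_right_mono)
    qed
    finally show "\<bar>energy \<sigma> \<alpha> (\<lambda>x. u x + \<eta> x) - energy \<sigma> \<alpha> u - ?L \<eta>\<bar> \<le> \<epsilon> * H1_norm \<eta>" by (simp add: H_def)
  qed
qed

section \<open>Stationary states\<close>

text \<open>Both expansions are compared at a small multiple of \<open>\<eta>\<close>. A direction
  of norm 0 cannot be rescaled in this way and is settled by the boundedness of the
  differentials.\<close>

lemma differential_unique: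
  assumes L1: "is_differential \<tau> F u L1" and L2: "is_differential \<tau> F u L2" and \<eta>: "\<eta> \<in> D_space \<tau>"
  shows "L1 \<eta> = L2 \<eta>"
proof (rule ccontr)
  assume ne: "L1 \<eta> \<noteq> L2 \<eta>"
  define H where "H = H1_norm \<eta>"
  define D where "D = \<bar>L1 \<eta> - L2 \<eta>\<bar>"
  have D: "D > 0" using ne by (simp add: D_def)
  have H0: "H \<ge> 0" using \<eta> H1_norm_dec(2) unfolding H_def D_space_dec by blast
  have "H \<noteq> 0"
  proof
    assume "H = 0"
    obtain C1 where "\<bar>L1 \<eta>\<bar> \<le> C1 * H1_norm \<eta>" using L1 \<eta> unfolding is_differential_def by blast
    moreover obtain C2 where "\<bar>L2 \<eta>\<bar> \<le> C2 * H1_norm \<eta>" using L2 \<eta> unfolding is_differential_def by blast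
    ultimately show False using ne \<open>H = 0\<close> by (simp add: H_def)
  qed
  then have H: "H > 0" using H0 by simp
  \<comment> \<open>Makes the two errors together half of the supposed difference
    \<open>t * D\<close>.\<close>
  define \<epsilon> where "\<epsilon> = D / (4 * H)"
  have \<epsilon>: "\<epsilon> > 0" using D H by (simp add: \<epsilon>_def)
  obtain d1 where d1: "d1 > 0" "\<And>\<eta>. \<eta> \<in> D_space \<tau> \<Longrightarrow> H1_norm \<eta> < d1 \<Longrightarrow> \<bar>F (\<lambda>x. u x + \<eta> x) - F u - L1 \<eta>\<bar> \<le> \<epsilon> * H1_norm \<eta>"
    using L1 \<epsilon> unfolding is_differential_def by blast
  obtain d2 where d2: "d2 > 0" "\<And>\<eta>. \<eta> \<in> D_space \<tau> \<Longrightarrow> H1_norm \<eta> < d2 \<Longrightarrow> \<bar>F (\<lambda>x. u x + \<eta> x) - F u - L2 \<eta>\<bar> \<le> \<epsilon> * H1_norm \<eta>"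
    using L2 \<epsilon> unfolding is_differential_def by blast
  define t where "t = min d1 d2 / (2 * H)"
  have t: "t > 0" using d1(1) d2(1) H by (simp add: t_def)
  define \<xi> where "\<xi> = (\<lambda>x. t *\<^sub>R \<eta> x)"
  have \<xi>: "\<xi> \<in> D_space \<tau>" using D_space_combine[OF \<eta> \<eta>, of t 0] by (simp add: \<xi>_def)
  have nx: "H1_norm \<xi> = t * H" unfolding \<xi>_def H1_norm_scale[OF \<eta>] H_def using t by simp
  have "t * H = min d1 d2 / 2" using H by (simp add: t_def)
  then have sm: "H1_norm \<xi> < d1" "H1_norm \<xi> < d2" using nx d1(1) d2(1) by auto
  have l: "L1 \<xi> = t * L1 \<eta>" "L2 \<xi> = t * L2 \<eta>"
  proof -
    have "L1 (\<lambda>x. t *\<^sub>R \<eta> x + 0 *\<^sub>R \<eta> x) = t * L1 \<eta> + 0 * L1 \<eta>" using L1 \<eta> unfolding is_differential_def by blast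
    moreover have "L2 (\<lambda>x. t *\<^sub>R \<eta> x + 0 *\<^sub>R \<eta> x) = t * L2 \<eta> + 0 * L2 \<eta>" using L2 \<eta> unfolding is_differential_def by blast
    ultimately show "L1 \<xi> = t * L1 \<eta>" "L2 \<xi> = t * L2 \<eta>" by (simp_all add: \<xi>_def)
  qed
  have "\<bar>L1 \<xi> - L2 \<xi>\<bar> \<le> 2 * \<epsilon> * (t * H)" using d1(2)[OF \<xi> sm(1)] d2(2)[OF \<xi> sm(2)] unfolding nx by linarith
  moreover have "\<bar>L1 \<xi> - L2 \<xi>\<bar> = t * D" unfolding l D_def using t by (simp add: abs_mult right_diff_distrib[symmetric])
  moreover have "2 * \<epsilon> * (t * H) = t * D / 2" using H by (simp add: \<epsilon>_def)
  ultimately have "t * D \<le> t * D / 2" by argo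
  then show False using mult_pos_pos[OF t D] by argo
qed

lemma ip_sym:
  assumes "L2_on {0..} u" "L2_on {0..} v"
  shows "ip u v = ip v u"
proof -
  have "Re (u x * cnj (v x)) = Re (v x * cnj (u x))" for x by (simp add: algebra_simps)
  then show ?thesis unfolding ip_alt(1)[OF assms] ip_alt(1)[OF assms(2,1)] by (simp only:)
qed

lemma inner_dec:
  assumes u: "dec \<tau> u uL gL uR gR" and d: "dec \<tau> \<eta> vL hL vR hR"
  shows "Re (\<integral>x. u x * cnj (\<eta> x) \<partial>lborel) = ip uL vL + ip uR vR"
  unfolding decD(4)[OF u] decD(4)[OF d] inner_integral_glue[OF decD(1,2)[OF u] decD(1,2)[OF d]] ip_def by simp

text \<open>Subtracting the component along \<open>u\<close> makes any direction orthogonal to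
  \<open>u\<close>; linearity then gives the multiplier as the differential in the direction
  \<open>u\<close> divided by the mass.\<close>

lemma lagrange_multiplier:
  assumes u: "dec \<tau> u uL gL uR gR" and s: "\<sigma> > 0" and m: "mass u > 0"
    and orth: "\<And>\<eta>. \<eta> \<in> D_space \<tau> \<Longrightarrow> Re (\<integral>x. u x * cnj (\<eta> x) \<partial>lborel) = 0 \<Longrightarrow> dE \<sigma> \<alpha> \<tau> uL gL uR gR \<eta> = 0"
  obtains l where "\<forall>vL hL vR hR. hl vL hL \<longrightarrow> hl vR hR \<longrightarrow> vR 0 = of_real \<tau> * vL 0 \<longrightarrow>
     denergy \<sigma> \<alpha> uL gL uR gR vL hL vR hR = l * (ip uL vL + ip uR vR)"
proof -
  let ?L = "dE \<sigma> \<alpha> \<tau> uL gL uR gR"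
  define \<mu> where "\<mu> = mass u"
  have diff: "is_differential \<tau> (energy \<sigma> \<alpha>) u ?L" by (rule energy_differential[OF u s])
  have uD: "u \<in> D_space \<tau>" using u D_space_dec by blast
  note du = decD[OF u]
  define l where "l = ?L u / \<mu>"
  have "denergy \<sigma> \<alpha> uL gL uR gR vL hL vR hR = l * (ip uL vL + ip uR vR)"
    if v: "hl vL hL" "hl vR hR" "vR 0 = of_real \<tau> * vL 0" for vL hL vR hR
  proof -
    define \<eta> where "\<eta> = glue vL vR"
    have d: "dec \<tau> \<eta> vL hL vR hR" using v by (simp add: dec_def \<eta>_def)
    then have \<eta>D: "\<eta> \<in> D_space \<tau>" using D_space_dec by blast
    define q where "q = ip uL vL + ip uR vR"
    define c where "c = - (q / \<mu>)"
    note dc = dec_combine[OF d u, of 1 c]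
    have "Re (\<integral>x. u x * cnj (1 *\<^sub>R \<eta> x + c *\<^sub>R u x) \<partial>lborel) = 0"
    proof -
      have L: "ip uL (\<lambda>x. 1 *\<^sub>R vL x + c *\<^sub>R uL x) = 1 * ip uL vL + c * ip uL uL"
        by (intro ip_lin hlD(1)[OF du(1)] hlD(1)[OF v(1)])
      have R: "ip uR (\<lambda>x. 1 *\<^sub>R vR x + c *\<^sub>R uR x) = 1 * ip uR vR + c * ip uR uR"
        by (intro ip_lin hlD(1)[OF du(2)] hlD(1)[OF v(2)])
      have "ip uL uL + ip uR uR = \<mu>" unfolding \<mu>_def H1_norm_dec(3)[OF u] ip_self[OF hlD(1)[OF du(1)]] ip_self[OF hlD(1)[OF du(2)]] ..
      then have "1 * ip uL vL + c * ip uL uL + (1 * ip uR vR + c * ip uR uR) = q + c * \<mu>" by (simp add: q_def distrib_left[symmetric])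
      also have "\<dots> = 0" using m by (simp add: c_def \<mu>_def)
      finally show ?thesis unfolding inner_dec[OF u dc] L R .
    qed
    then have "?L (\<lambda>x. 1 *\<^sub>R \<eta> x + c *\<^sub>R u x) = 0" by (intro orth D_space_combine \<eta>D uD)
    moreover have "?L (\<lambda>x. 1 *\<^sub>R \<eta> x + c *\<^sub>R u x) = 1 * ?L \<eta> + c * ?L u"
      using diff \<eta>D uD unfolding is_differential_def by blast
    ultimately have "?L \<eta> = l * q" by (simp add: l_def c_def)
    then show ?thesis unfolding dE_eq[OF u s d] q_def .
  qed
  then show ?thesis using that by blast
qed

lemma L2_on_extend_zero:
  assumes "L2_on B c" "B \<subseteq> {0..}"
  shows "L2_on {0..} (\<lambda>x. if x \<in> B then c x else 0)"
proof -
  have 1: "(\<lambda>x. indicator {0..} x *\<^sub>R (if x \<in> B then c x else 0)) = (\<lambda>x. indicator B x *\<^sub>R c x)"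
    using assms(2) by (auto simp: indicator_def fun_eq_iff)
  have 2: "(\<lambda>x. indicator {0..} x *\<^sub>R (norm (if x \<in> B then c x else 0))\<^sup>2) = (\<lambda>x. indicator B x *\<^sub>R (norm (c x))\<^sup>2)"
    using assms(2) by (auto simp: indicator_def fun_eq_iff)
  show ?thesis using assms(1) unfolding L2_on_def set_borel_measurable_def set_integrable_def 1 2 .
qed

lemma L2_on_continuous:
  fixes c :: "real \<Rightarrow> complex"
  assumes "continuous_on {a..b} c"
  shows "L2_on {a..b} c"
  unfolding L2_on_def set_borel_measurable_def
proof
  show "(\<lambda>x. indicator {a..b} x *\<^sub>R c x) \<in> borel_measurable lborel"
    using borel_measurable_continuous_on_indicator[OF _ assms] by simp
  show "set_integrable lborel {a..b} (\<lambda>x. (norm (c x))\<^sup>2)"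
    by (rule borel_integrable_atLeastAtMost') (intro continuous_intros assms)
qed

lemma L2_normsq_0_AE:
  assumes "L2_on {0..} h" "L2_normsq_on {0..} h = 0"
  shows "AE x in lborel. x \<ge> 0 \<longrightarrow> h x = 0"
proof -
  have "AE x in lborel. indicator {0..} x *\<^sub>R (norm (h x))\<^sup>2 = 0"
    using assms(2) integral_nonneg_eq_0_iff_AE[OF L2_on_normsq[OF assms(1), unfolded set_integrable_def]]
    unfolding L2_normsq_on_def set_lebesgue_integral_def by auto
  then show ?thesis by eventually_elim (auto simp: indicator_def split: if_splits)
qed

lemma ip_eq_Icc:
  assumes "L2_on {0..} p" "L2_on {0..} q" "X \<ge> 0" "\<And>x. x \<ge> X \<Longrightarrow> q x = 0"
  shows "ip p q = Re (integral {0..X} (\<lambda>x. p x * cnj (q x)))"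
proof -
  have "(LINT t:{X..}|lborel. p t * cnj (q t)) = (LINT t:{X..}|lborel. 0)"
    unfolding set_lebesgue_integral_def by (rule Bochner_Integration.integral_cong) (auto simp: indicator_def assms(4))
  then show ?thesis unfolding ip_def set_integral_Ici_split[OF L2_on_mult[OF assms(1) L2_on_cnj[OF assms(2)]] assms(3)]
    by (simp add: set_lebesgue_integral_def)
qed

text \<open>Du Bois-Reymond: test with the primitive of \<open>g + F\<close> minus its mean, where \<open>F\<close> is a primitive of \<open>f\<close>.\<close>
lemma weak_equation_Icc:
  assumes u: "hl u g" and f: "L2_on {0..} f"
    and weak: "\<And>v h. hl v h \<Longrightarrow> v 0 = 0 \<Longrightarrow> ip g h = ip f v" and X: "X > 0"
  shows "\<exists>m. AE x in lborel. 0 \<le> x \<and> x < X \<longrightarrow> g x = m - integral {0..x} f"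
proof -
  define F where "F x = integral {0..x} f" for x
  have fi: "set_integrable lborel {0..b} f" for b by (rule L2_on_set_integrable[OF f]) auto
  have acF: "AC_on 0 b F f" for b by (rule AC_onI[OF fi]) (simp add: F_def)
  have cF: "continuous_on {0..b} F" for b by (rule AC_on_continuous[OF acF])
  \<comment> \<open>The mean of \<open>g + F\<close>. Subtracting it makes \<open>v\<close> return
    to 0 at \<open>X\<close>, so that \<open>v\<close> stays 0 from there on and is an admissible
    test function.\<close>
  define m where "m = (1 / X) *\<^sub>R integral {0..X} (\<lambda>x. g x + F x)"
  define k where "k x = g x + (F x - m)" for x
  define h where "h x = (if x \<in> {0..<X} then k x else 0)" for x
  have gL: "L2_on {0..X} g" by (rule L2_on_subset[OF hlD(2)[OF u]]) auto
  have "L2_on {0..X} k" unfolding k_def[abs_def] by (intro L2_on_add gL L2_on_continuous continuous_intros cF)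
  then have kL: "L2_on {0..<X} k" by (rule L2_on_subset) auto
  have hL: "L2_on {0..} h" unfolding h_def[abs_def] by (rule L2_on_extend_zero[OF kL]) auto
  have hi: "set_integrable lborel {0..b} h" for b by (rule L2_on_set_integrable[OF hL]) auto
  define v where "v x = integral {0..x} h" for x
  have acv: "AC_on 0 b v h" for b by (rule AC_onI[OF hi]) (simp add: v_def)
  have v0: "v 0 = 0" by (simp add: v_def)
  have gi: "g integrable_on {0..X}" by (rule set_integrable_HK(1)[OF L2_on_set_integrable[OF hlD(2)[OF u]]]) auto
  have Fi: "F integrable_on {0..X}" by (intro integrable_continuous_real cF)
  have "v X = integral {0..X} k" unfolding v_def
    by (rule integral_spike[of "{X}"]) (auto simp: h_def)
  also have "\<dots> = integral {0..X} (\<lambda>x. g x + F x) - integral {0..X} (\<lambda>_. m)"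
    unfolding k_def using Henstock_Kurzweil_Integration.integral_diff[OF integrable_add[OF gi Fi] integrable_const_ivl[where c=m and a=0 and b=X]]
    by (simp add: add_diff_eq)
  also have "\<dots> = 0" using X by (simp add: m_def scaleR_conv_of_real)
  finally have vX: "v X = 0" .
  have vz: "v x = 0" if "x \<ge> X" for x
  proof -
    have "v x - v X = integral {X..x} h" by (rule AC_on_diff[OF acv]) (use X that in auto)
    also have "\<dots> = integral {X..x} (\<lambda>_. 0)" by (rule Henstock_Kurzweil_Integration.integral_cong) (simp add: h_def)
    finally show ?thesis using vX by simp
  qed
  have vL: "L2_on {0..} v"
  proof -
    have "L2_on {0..X} v" by (rule L2_on_continuous[OF AC_on_continuous[OF acv]])
    then have "L2_on {0..} (\<lambda>x. if x \<in> {0..X} then v x else 0)" by (rule L2_on_extend_zero) auto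
    then have "L2_on {0<..} (\<lambda>x. if x \<in> {0..X} then v x else 0)" by (rule L2_on_subset) auto
    then show ?thesis by (rule L2_on_Ici_cong) (auto simp: vz)
  qed
  have hv: "hl v h" unfolding hl_def using vL hL acv by blast
  have "ip g h = ip f v" by (rule weak[OF hv v0])
  moreover have "ip g h = Re (integral {0..X} (\<lambda>x. g x * cnj (h x)))" by (rule ip_eq_Icc[OF hlD(2)[OF u] hL]) (use X in \<open>auto simp: h_def\<close>)
  moreover have "ip f v = Re (integral {0..X} (\<lambda>x. f x * cnj (v x)))" by (rule ip_eq_Icc[OF f vL]) (use X vz in auto)
  moreover have "integral {0..X} (\<lambda>x. f x * cnj (v x)) = - integral {0..X} (\<lambda>x. F x * cnj (h x))"
  proof -
    have X0: "0 \<le> X" using X by simp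
    note ac = AC_on_mult[OF acF AC_on_linear[OF acv bounded_linear_cnj] X0]
    have "0 = integral {0..X} (\<lambda>x. f x * cnj (v x) + F x * cnj (h x))"
      using AC_on_diff[OF ac order_refl X0 order_refl] vX v0 by simp
    also have "\<dots> = integral {0..X} (\<lambda>x. f x * cnj (v x)) + integral {0..X} (\<lambda>x. F x * cnj (h x))"
    proof (rule Henstock_Kurzweil_Integration.integral_add)
      show 1: "(\<lambda>x. f x * cnj (v x)) integrable_on {0..X}"
        by (rule set_integrable_HK(1)[OF set_integrable_atLeast_Icc[OF L2_on_mult[OF f L2_on_cnj[OF vL]]]]) simp
      show "(\<lambda>x. F x * cnj (h x)) integrable_on {0..X}"
        using integrable_diff[OF set_integrable_HK(1)[OF AC_on_integrable[OF ac]] 1] by simp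
    qed
    finally show ?thesis by (simp add: eq_neg_iff_add_eq_0)
  qed
  ultimately have "Re (integral {0..X} (\<lambda>x. g x * cnj (h x)) + integral {0..X} (\<lambda>x. F x * cnj (h x))) = 0" by simp
  moreover have "integral {0..X} (\<lambda>x. m * cnj (h x)) = 0"
  proof -
    have "integral {0..X} (\<lambda>x. cnj (h x)) = cnj (v X)" unfolding v_def
      using integral_linear[OF set_integrable_HK(1)[OF hi] bounded_linear_cnj, of X] by (simp add: o_def)
    then show ?thesis using vX by simp
  qed
  moreover have "integral {0..X} (\<lambda>x. h x * cnj (h x)) = integral {0..X} (\<lambda>x. g x * cnj (h x)) + integral {0..X} (\<lambda>x. F x * cnj (h x)) - integral {0..X} (\<lambda>x. m * cnj (h x))"
  proof -
    have ghi: "(\<lambda>x. g x * cnj (h x)) integrable_on {0..X}"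
      by (rule set_integrable_HK(1)[OF set_integrable_atLeast_Icc[OF L2_on_mult[OF hlD(2)[OF u] L2_on_cnj[OF hL]]]]) simp
    have hc: "(\<lambda>x. cnj (h x)) integrable_on {0..X}"
      using integrable_linear[OF set_integrable_HK(1)[OF hi] bounded_linear_cnj, of X] by (simp add: o_def)
    have mhi: "(\<lambda>x. m * cnj (h x)) integrable_on {0..X}" by (rule integrable_on_mult_right[OF hc])
    have FL: "L2_on {0..X} F" by (rule L2_on_continuous[OF cF])
    have hL': "L2_on {0..X} h" by (rule L2_on_subset[OF hL]) auto
    have Fhi: "(\<lambda>x. F x * cnj (h x)) integrable_on {0..X}"
      by (rule set_integrable_HK(1)[OF L2_on_mult[OF FL L2_on_cnj[OF hL']]])
    have "integral {0..X} (\<lambda>x. h x * cnj (h x)) = integral {0..X} (\<lambda>x. g x * cnj (h x) + F x * cnj (h x) - m * cnj (h x))"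
      by (rule Henstock_Kurzweil_Integration.integral_cong) (auto simp: h_def k_def algebra_simps)
    then show ?thesis
      unfolding Henstock_Kurzweil_Integration.integral_diff[OF integrable_add[OF ghi Fhi] mhi] Henstock_Kurzweil_Integration.integral_add[OF ghi Fhi] .
  qed
  ultimately have "Re (integral {0..X} (\<lambda>x. h x * cnj (h x))) = 0" by (simp only: diff_0_right)
  moreover have "ip h h = Re (integral {0..X} (\<lambda>x. h x * cnj (h x)))" by (rule ip_eq_Icc[OF hL hL]) (use X in \<open>auto simp: h_def\<close>)
  ultimately have "L2_normsq_on {0..} h = 0" using ip_self[OF hL] by simp
  from L2_normsq_0_AE[OF hL this] have "AE x in lborel. 0 \<le> x \<and> x < X \<longrightarrow> g x = m - integral {0..x} f"
    by eventually_elim (auto simp: h_def k_def F_def algebra_simps)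
  then show ?thesis by blast
qed

lemma weak_equation:
  assumes u: "hl u g" and f: "L2_on {0..} f"
    and weak: "\<And>v h. hl v h \<Longrightarrow> v 0 = 0 \<Longrightarrow> ip g h = ip f v"
  obtains a where "AE x in lborel. 0 \<le> x \<longrightarrow> g x = a - integral {0..x} f"
    "\<forall>t\<ge>0. u t = u 0 + integral {0..t} (\<lambda>x. a - integral {0..x} f)"
proof -
  define F where "F x = integral {0..x} f" for x
  have fi: "set_integrable lborel {0..b} f" for b by (rule L2_on_set_integrable[OF f]) auto
  have cF: "continuous_on {0..b} F" for b unfolding F_def by (intro indefinite_integral_continuous_1 set_integrable_HK(1) fi)
  have Fi: "F integrable_on {0..t}" for t by (intro integrable_continuous_real cF)
  have "\<exists>m. AE x in lborel. 0 \<le> x \<and> x < real (Suc n) \<longrightarrow> g x = m - F x" for n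
    unfolding F_def by (rule weak_equation_Icc[OF u f weak]) auto
  then obtain m where m: "\<And>n. AE x in lborel. 0 \<le> x \<and> x < real (Suc n) \<longrightarrow> g x = m n - F x" by metis
  have rep: "u t = u 0 + integral {0..t} (\<lambda>x. m n - F x)" if t: "0 \<le> t" "t \<le> real (Suc n)" for t n
  proof -
    have gi: "set_integrable lborel {0..t} g" by (rule L2_on_set_integrable[OF hlD(2)[OF u]]) auto
    have ci: "set_integrable lborel {0..t} (\<lambda>x. m n - F x)" by (rule borel_integrable_atLeastAtMost') (intro continuous_intros cF)
    have "(LINT x:{0..t}|lborel. g x) = (LINT x:{0..t}|lborel. m n - F x)"
      unfolding set_lebesgue_integral_def
    proof (rule integral_cong_AE)
      show "AE x in lborel. indicator {0..t} x *\<^sub>R g x = indicator {0..t} x *\<^sub>R (m n - F x)"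
        using m[of n] AE_lborel_singleton[of "real (Suc n)"] by eventually_elim (use t in \<open>auto simp: indicator_def\<close>)
    qed (use gi ci in \<open>auto simp: set_integrable_def\<close>)
    then have "integral {0..t} g = integral {0..t} (\<lambda>x. m n - F x)" using set_integrable_HK(3)[OF gi] set_integrable_HK(3)[OF ci] by simp
    then show ?thesis using AC_onD[OF hlD(3)[OF u order_refl], of t t] t by simp
  qed
  have ei: "integral {0..t} (\<lambda>x. m n - F x) = of_real t * m n - integral {0..t} F" if "t \<ge> 0" for t n
    using Henstock_Kurzweil_Integration.integral_diff[OF integrable_const_ivl[where c="m n" and a=0 and b=t] Fi[of t]] that by (simp add: scaleR_conv_of_real)
  \<comment> \<open>Every interval contains \<open>{0..1}\<close>, and the value of \<open>u\<close>
    at 1 determines the constant.\<close>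
  have "m n = m 0" for n
    using rep[of 1 n] rep[of 1 0] ei[of 1 n] ei[of 1 0] by simp
  then have mm: "m n = m 0" for n .
  have 1: "u t = u 0 + integral {0..t} (\<lambda>x. m 0 - integral {0..x} f)" if "t \<ge> 0" for t
  proof -
    obtain n where "t \<le> real n" using real_arch_simple by blast
    then have "t \<le> real (Suc n)" by simp
    from rep[OF that this] show ?thesis unfolding mm[of n] F_def .
  qed
  have "AE x in lborel. \<forall>n. 0 \<le> x \<and> x < real (Suc n) \<longrightarrow> g x = m n - F x" unfolding AE_all_countable using m by blast
  then have 2: "AE x in lborel. 0 \<le> x \<longrightarrow> g x = m 0 - integral {0..x} f"
  proof eventually_elim
    case (elim x)
    obtain n where "x \<le> real n" using real_arch_simple by blast
    then have "x < real (Suc n)" by simp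
    then show ?case using elim[rule_format, of n] unfolding mm[of n] F_def by blast
  qed
  show ?thesis by (rule that[OF 2]) (intro allI impI 1)
qed

section \<open>Positive solutions of the stationary equation on a half-line\<close>

context nls
begin

text \<open>The first integral \<open>I\<close> is conserved, and it is 0 because
  \<open>(d x)\<^sup>2\<close> converges to it and is integrable. This lowers the order: the scaled
  logarithmic slope \<open>t\<close> satisfies the differential equation of a hyperbolic
  tangent.\<close>

lemma positive_solution:
  fixes y d :: "real \<Rightarrow> real"
  assumes pos: "\<And>x. x > 0 \<Longrightarrow> y x > 0" and y: "\<And>x. x > 0 \<Longrightarrow> (y has_real_derivative d x) (at x)"
    and d: "\<And>x. x > 0 \<Longrightarrow> (d has_real_derivative c * y x - y x powr (2 * \<sigma> + 1)) (at x)"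
    and lim: "(y \<longlongrightarrow> 0) at_top" and int: "set_integrable lborel {0..} (\<lambda>x. (d x)\<^sup>2)"
  obtains k \<theta> where "k > 0" "-1 < \<theta>" "\<theta> < 1" "c = k\<^sup>2" "\<forall>x>0. y x = hstate k \<theta> x" "\<forall>x>0. d x = hslope k \<theta> x"
proof -
  define P where "P x = y x powr (2 * \<sigma> + 2) / (\<sigma> + 1)" for x
  have pw: "y x powr (2 * \<sigma> + 2) = y x powr (2 * \<sigma> + 1) * y x" if "x > 0" for x
  proof -
    have "y x powr (2 * \<sigma> + 2) = y x powr ((2 * \<sigma> + 1) + 1)" by (simp add: add.assoc)
    then show ?thesis using pos[OF that] by (simp only: powr_add powr_one)
  qed
  have dP: "(P has_real_derivative 2 * y x powr (2 * \<sigma> + 1) * d x) (at x)" if "x > 0" for x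
  proof -
    have "((\<lambda>x. y x powr (2 * \<sigma> + 2)) has_real_derivative (2 * \<sigma> + 2) * y x powr (2 * \<sigma> + 1) * d x) (at x)"
    proof (rule DERIV_cong[OF DERIV_chain2[OF has_real_derivative_powr[OF pos[OF that]] y[OF that]]])
      have "2 * \<sigma> + 2 - 1 = 2 * \<sigma> + 1" by simp
      then show "(2 * \<sigma> + 2) * y x powr (2 * \<sigma> + 2 - 1) * d x = (2 * \<sigma> + 2) * y x powr (2 * \<sigma> + 1) * d x" by (simp only:)
    qed
    from DERIV_cdivide[OF this, of "\<sigma> + 1"]
    have "(P has_real_derivative (2 * \<sigma> + 2) * y x powr (2 * \<sigma> + 1) * d x / (\<sigma> + 1)) (at x)" unfolding P_def[abs_def] .
    moreover have "(2 * \<sigma> + 2) * y x powr (2 * \<sigma> + 1) * d x / (\<sigma> + 1) = 2 * y x powr (2 * \<sigma> + 1) * d x"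
    proof -
      have "2 * \<sigma> + 2 = (\<sigma> + 1) * 2" by simp
      then show ?thesis using sigma_pos by (simp only: mult.assoc) simp
    qed
    ultimately show ?thesis by simp
  qed
  define I where "I x = (d x)\<^sup>2 - c * (y x)\<^sup>2 + P x" for x
  have dI: "(I has_real_derivative 0) (at x)" if "x > 0" for x
  proof -
    have 1: "((\<lambda>x. (d x)\<^sup>2) has_real_derivative 2 * ((c * y x - y x powr (2 * \<sigma> + 1)) * d x)) (at x)"
      using DERIV_power[OF d[OF that], of 2] by simp
    have 2: "((\<lambda>x. (y x)\<^sup>2) has_real_derivative 2 * (d x * y x)) (at x)"
      using DERIV_power[OF y[OF that], of 2] by simp
    have "(I has_real_derivative 2 * ((c * y x - y x powr (2 * \<sigma> + 1)) * d x) - c * (2 * (d x * y x)) + 2 * y x powr (2 * \<sigma> + 1) * d x) (at x)"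
      unfolding I_def[abs_def] by (intro DERIV_add DERIV_diff DERIV_cmult 1 2 dP that)
    then show ?thesis by (simp add: algebra_simps)
  qed
  have Ic: "I x = I 1" if "x > 0" for x
    by (rule has_field_derivative_zero_constant[of "{0<..}" I, THEN exE])
       (use dI that in \<open>auto intro: has_field_derivative_at_within\<close>)
  have limP: "(P \<longlongrightarrow> 0) at_top"
  proof -
    have "((\<lambda>x. y x powr (2 * \<sigma> + 2)) \<longlongrightarrow> 0) at_top"
    proof (rule tendsto_zero_powrI[OF lim tendsto_const])
      show "\<forall>\<^sub>F x in at_top. 0 \<le> y x" using eventually_gt_at_top[of 0]
        by eventually_elim (use pos in \<open>auto intro: less_imp_le\<close>)
    qed (use sigma_pos in auto)
    then show ?thesis unfolding P_def[abs_def] by (rule tendsto_divide_zero)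
  qed
  have "((\<lambda>x. I 1 + c * (y x)\<^sup>2 - P x) \<longlongrightarrow> I 1 + c * 0\<^sup>2 - 0) at_top"
    by (intro tendsto_intros lim limP)
  moreover have "\<forall>\<^sub>F x in at_top. I 1 + c * (y x)\<^sup>2 - P x = (d x)\<^sup>2"
    using eventually_gt_at_top[of 0]
  proof eventually_elim
    case (elim x)
    then show ?case using Ic[of x] by (simp add: I_def)
  qed
  ultimately have "((\<lambda>x. (d x)\<^sup>2) \<longlongrightarrow> I 1) at_top" by (simp add: Lim_transform_eventually)
  then have "I 1 = 0" by (rule set_integral_tendsto_0_imp_limit_0[OF int]) simp
  then have first: "(d x)\<^sup>2 = c * (y x)\<^sup>2 - P x" if "x > 0" for x using Ic[OF that] by (simp add: I_def)
  have Pp: "P x > 0" if "x > 0" for x unfolding P_def using pos[OF that] sigma_pos by simp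
  \<comment> \<open>Conservation with value 0 makes \<open>c * (y 1)\<^sup>2\<close> at least the
    positive term \<open>P 1\<close>.\<close>
  have "c > 0"
  proof -
    have "0 \<le> (d 1)\<^sup>2" by simp
    then have "0 < c * (y 1)\<^sup>2" using first[of 1] Pp[of 1] by linarith
    then show ?thesis using zero_less_mult_pos2[of c "(y 1)\<^sup>2"] pos[of 1] by simp
  qed
  define k where "k = sqrt c"
  have k: "k > 0" "c = k\<^sup>2" using \<open>c > 0\<close> by (auto simp: k_def)
  define t where "t x = - d x / (k * y x)" for x
  have t2: "k\<^sup>2 * (1 - (t x)\<^sup>2) * (y x)\<^sup>2 = P x" if "x > 0" for x
  proof -
    have "(t x)\<^sup>2 * (k\<^sup>2 * (y x)\<^sup>2) = (d x)\<^sup>2" unfolding t_def using k(1) pos[OF that] by (simp add: power_divide power_mult_distrib)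
    then show ?thesis using first[OF that] k(2) by (simp add: algebra_simps)
  qed
  have tb: "(t x)\<^sup>2 < 1" if "x > 0" for x
  proof -
    have "0 < (1 - (t x)\<^sup>2) * (k\<^sup>2 * (y x)\<^sup>2)" using t2[OF that] Pp[OF that] by (simp add: mult_ac)
    then show ?thesis using k(1) pos[OF that] zero_less_mult_pos2[of "1 - (t x)\<^sup>2" "k\<^sup>2 * (y x)\<^sup>2"] by simp
  qed
  then have tb': "-1 < t x" "t x < 1" if "x > 0" for x using tb[OF that] abs_square_less_1[of "t x"] by auto
  have dt: "(t has_real_derivative \<sigma> * k * (1 - (t x)\<^sup>2)) (at x)" if x: "x > 0" for x
  proof -
    have nz: "k * y x \<noteq> 0" using k(1) pos[OF x] by simp
    have "(t has_real_derivative (- (c * y x - y x powr (2 * \<sigma> + 1)) * (k * y x) - - d x * (k * d x)) / ((k * y x) * (k * y x))) (at x)"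
      unfolding t_def[abs_def] by (intro DERIV_divide DERIV_minus DERIV_cmult d y x nz)
    moreover have "(- (c * y x - y x powr (2 * \<sigma> + 1)) * (k * y x) - - d x * (k * d x)) / ((k * y x) * (k * y x)) = \<sigma> * k * (1 - (t x)\<^sup>2)"
    proof -
      have "- (c * y x - y x powr (2 * \<sigma> + 1)) * (k * y x) - - d x * (k * d x) = k * ((d x)\<^sup>2 - c * (y x)\<^sup>2 + y x powr (2 * \<sigma> + 2))"
        unfolding pw[OF x] by (simp add: algebra_simps power2_eq_square)
      also have "\<dots> = k * (\<sigma> * P x)" unfolding first[OF x] P_def using sigma_pos by (simp add: field_simps)
      also have "\<dots> = \<sigma> * k * (1 - (t x)\<^sup>2) * ((k * y x) * (k * y x))" unfolding t2[OF x, symmetric] by (simp add: power2_eq_square)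
      finally show ?thesis using nz by simp
    qed
    ultimately show ?thesis by simp
  qed
  \<comment> \<open>In the variable \<open>artanh (t x)\<close> the slope moves at the constant
    speed \<open>\<sigma> * k\<close>, so \<open>A\<close> is the constant of integration that fixes
    \<open>\<theta>\<close>.\<close>
  define A where "A x = artanh (t x) - \<sigma> * k * x" for x
  have dA: "(A has_real_derivative 0) (at x)" if x: "x > 0" for x
  proof -
    have "1 - (t x)\<^sup>2 \<noteq> 0" using tb[OF x] by simp
    moreover have "(A has_real_derivative (\<sigma> * k * (1 - (t x)\<^sup>2)) / (1 - (t x)\<^sup>2) - \<sigma> * k * 1) (at x)"
    proof -
      have a: "(artanh has_real_derivative 1 / (1 - (t x)\<^sup>2)) (at (t x))"
        using artanh_real_has_field_derivative[of "t x" UNIV] tb'[OF x] by simp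
      show ?thesis unfolding A_def[abs_def]
        using DERIV_diff[OF DERIV_chain2[OF a dt[OF x]] DERIV_cmult[OF DERIV_ident, of "\<sigma> * k"]] by simp
    qed
    ultimately show ?thesis by simp
  qed
  have Ac: "A x = A 1" if "x > 0" for x
    by (rule has_field_derivative_zero_constant[of "{0<..}" A, THEN exE])
       (use dA that in \<open>auto intro: has_field_derivative_at_within\<close>)
  define \<theta> where "\<theta> = tanh (A 1)"
  have \<theta>: "-1 < \<theta>" "\<theta> < 1" unfolding \<theta>_def by (rule tanh_real_gt_neg1, rule tanh_real_lt_1)
  have tt: "t x = th k \<theta> x" if x: "x > 0" for x
  proof -
    have "artanh (t x) = \<sigma> * k * x + A 1" using Ac[OF x] by (simp add: A_def)
    then have "tanh (\<sigma> * k * x + A 1) = t x" using tanh_artanh[OF tb'[OF x]] by simp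
    then show ?thesis unfolding th_def \<theta>_def artanh_tanh_real by simp
  qed
  have yx: "y x = hstate k \<theta> x" if x: "x > 0" for x
  proof -
    have "(\<sigma> + 1) * k\<^sup>2 * (1 - (t x)\<^sup>2) * (y x)\<^sup>2 = y x powr (2 * \<sigma> + 2)"
      using t2[OF x] sigma_pos unfolding P_def by (simp add: field_simps)
    also have "\<dots> = y x powr (2 * \<sigma>) * (y x)\<^sup>2" using pos[OF x] by (simp add: powr_add flip: powr_numeral)
    finally have "(\<sigma> + 1) * k\<^sup>2 * (1 - (t x)\<^sup>2) = y x powr (2 * \<sigma>)" using pos[OF x] by simp
    then have "dens k (t x) = (y x powr (2 * \<sigma>)) powr (1 / \<sigma>)" by (simp add: dens_def)
    also have "\<dots> = (y x)\<^sup>2" using pos[OF x] sigma_pos by (simp add: powr_powr flip: powr_numeral)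
    finally show ?thesis using pos[OF x] by (simp add: hstate_def tt[OF x, symmetric])
  qed
  have dx: "d x = hslope k \<theta> x" if x: "x > 0" for x
  proof -
    have "k * y x \<noteq> 0" using k(1) pos[OF x] by simp
    then have "d x = - (k * y x) * t x" unfolding t_def by (simp only: divide_minus_left minus_mult_minus nonzero_mult_div_cancel_left times_divide_eq_right not_False_eq_True)
    then show ?thesis unfolding tt[OF x] hslope_def yx[OF x, symmetric] by (simp add: mult_ac)
  qed
  show ?thesis
  proof (rule that[OF k(1) \<theta> k(2)])
    show "\<forall>x>0. y x = hstate k \<theta> x" using yx by (intro allI impI)
    show "\<forall>x>0. d x = hslope k \<theta> x" using dx by (intro allI impI)
  qed
qed

end

lemma ip_lin_left:
  assumes "L2_on {0..} u" "L2_on {0..} v" "L2_on {0..} w"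
  shows "ip (\<lambda>x. (a::real) *\<^sub>R v x + (b::real) *\<^sub>R w x) u = a * ip v u + b * ip w u"
proof -
  have "L2_on {0..} (\<lambda>x. a *\<^sub>R v x + b *\<^sub>R w x)" by (intro L2_on_add L2_on_scaleR assms)
  then show ?thesis using ip_lin[OF assms] ip_sym assms by simp
qed

lemma hl_integration_by_parts:
  assumes g: "hl g q" and v: "hl v h"
  shows "ip g h + ip q v = - Re (g 0 * cnj (v 0))"
proof -
  have i1: "set_integrable lborel {0..} (\<lambda>x. q x * cnj (v x))" by (rule L2_on_mult[OF hlD(2)[OF g] L2_on_cnj[OF hlD(1)[OF v]]])
  have i2: "set_integrable lborel {0..} (\<lambda>x. g x * cnj (h x))" by (rule L2_on_mult[OF hlD(1)[OF g] L2_on_cnj[OF hlD(2)[OF v]]])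
  have i3: "set_integrable lborel {0..} (\<lambda>x. g x * cnj (v x))" by (rule L2_on_mult[OF hlD(1)[OF g] L2_on_cnj[OF hlD(1)[OF v]]])
  have i: "set_integrable lborel {0..} (\<lambda>x. q x * cnj (v x) + g x * cnj (h x))" by (rule set_integral_add(1)[OF i1 i2])
  define Z where "Z = (LINT x:{0..}|lborel. q x * cnj (v x) + g x * cnj (h x))"
  have eq: "g X * cnj (v X) = g 0 * cnj (v 0) + integral {0..X} (\<lambda>x. q x * cnj (v x) + g x * cnj (h x))" if "X \<ge> 0" for X
    by (rule AC_onD[OF AC_on_mult[OF hlD(3)[OF g order_refl] AC_on_linear[OF hlD(3)[OF v order_refl] bounded_linear_cnj]], of X X]) (use that in auto)
  have "((\<lambda>X. g 0 * cnj (v 0) + integral {0..X} (\<lambda>x. q x * cnj (v x) + g x * cnj (h x))) \<longlongrightarrow> g 0 * cnj (v 0) + Z) at_top"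
    unfolding Z_def by (intro tendsto_intros integral_Icc_tendsto_atLeast i)
  moreover have "\<forall>\<^sub>F X in at_top. g 0 * cnj (v 0) + integral {0..X} (\<lambda>x. q x * cnj (v x) + g x * cnj (h x)) = g X * cnj (v X)"
    using eventually_ge_at_top[of 0] by eventually_elim (rule eq[symmetric])
  ultimately have "((\<lambda>X. g X * cnj (v X)) \<longlongrightarrow> g 0 * cnj (v 0) + Z) at_top" by (rule Lim_transform_eventually)
  then have lim: "((\<lambda>X. norm (g X * cnj (v X))) \<longlongrightarrow> norm (g 0 * cnj (v 0) + Z)) at_top" by (rule tendsto_norm)
  have "set_integrable lborel {0..} (\<lambda>x. norm (g x * cnj (v x)))" by (rule set_integrable_norm[OF i3])
  from set_integral_tendsto_0_imp_limit_0[OF this lim] have "g 0 * cnj (v 0) + Z = 0" by simp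
  moreover have "Re Z = ip q v + ip g h" unfolding Z_def set_integral_add(2)[OF i1 i2] ip_def by simp
  ultimately show ?thesis by (metis add.commute add_eq_0_iff plus_complex.simps(1) zero_complex.simps(1))
qed

text \<open>Orthogonality cancels the cross terms of the two half-lines against each other, though
  not on each half-line separately.\<close>

lemma mass_combine:
  assumes u: "u \<in> D_space \<tau>" and v: "\<eta> \<in> D_space \<tau>" and orth: "Re (\<integral>x. u x * cnj (\<eta> x) \<partial>lborel) = 0"
  shows "mass (\<lambda>x. (a::real) *\<^sub>R u x + (b::real) *\<^sub>R \<eta> x) = a\<^sup>2 * mass u + b\<^sup>2 * mass \<eta>"
proof -
  obtain uL gL uR gR where du: "dec \<tau> u uL gL uR gR" using u by (rule D_space_decE)
  obtain vL hL vR hR where dv: "dec \<tau> \<eta> vL hL vR hR" using v by (rule D_space_decE)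
  have N: "L2_normsq_on {0..} (\<lambda>x. a *\<^sub>R p x + b *\<^sub>R q x) = a\<^sup>2 * L2_normsq_on {0..} p + 2 * (a * b * ip p q) + b\<^sup>2 * L2_normsq_on {0..} q"
    if p: "L2_on {0..} p" and q: "L2_on {0..} q" for p q
  proof -
    have "ip (\<lambda>x. a *\<^sub>R p x) (\<lambda>x. b *\<^sub>R q x) = a * b * ip p q"
      using ip_lin[OF L2_on_scaleR[OF p] q q, of a b 0] ip_lin_left[OF q p p, of a 0] by simp
    then show ?thesis unfolding normsq_add[OF L2_on_scaleR[OF p] L2_on_scaleR[OF q]] normsq_scaleR by simp
  qed
  have "ip uL vL + ip uR vR = 0" using orth unfolding inner_dec[OF du dv] .
  then have "a * b * ip uL vL + a * b * ip uR vR = 0" by (simp add: distrib_left[symmetric])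
  then show ?thesis unfolding H1_norm_dec(3)[OF dec_combine[OF du dv]] H1_norm_dec(3)[OF du] H1_norm_dec(3)[OF dv]
    N[OF hlD(1)[OF decD(1)[OF du]] hlD(1)[OF decD(1)[OF dv]]] N[OF hlD(1)[OF decD(2)[OF du]] hlD(1)[OF decD(2)[OF dv]]]
    by (simp add: distrib_left)
qed

lemma H1_norm_combine_le:
  assumes u: "u \<in> D_space \<tau>" and v: "\<eta> \<in> D_space \<tau>"
  shows "(H1_norm (\<lambda>x. (a::real) *\<^sub>R u x + (b::real) *\<^sub>R \<eta> x))\<^sup>2 \<le> 2 * (a\<^sup>2 * (H1_norm u)\<^sup>2 + b\<^sup>2 * (H1_norm \<eta>)\<^sup>2)"
proof -
  obtain uL gL uR gR where du: "dec \<tau> u uL gL uR gR" using u by (rule D_space_decE)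
  obtain vL hL vR hR where dv: "dec \<tau> \<eta> vL hL vR hR" using v by (rule D_space_decE)
  have N: "L2_normsq_on {0..} (\<lambda>x. a *\<^sub>R p x + b *\<^sub>R q x) \<le> 2 * (a\<^sup>2 * L2_normsq_on {0..} p + b\<^sup>2 * L2_normsq_on {0..} q)"
    if p: "L2_on {0..} p" and q: "L2_on {0..} q" for p q
  proof -
    note p' = L2_on_scaleR[OF p, of a] and q' = L2_on_scaleR[OF q, of b] and q'' = L2_on_scaleR[OF q, of "- b"]
    have "ip (\<lambda>x. a *\<^sub>R p x) (\<lambda>x. (- b) *\<^sub>R q x) = - ip (\<lambda>x. a *\<^sub>R p x) (\<lambda>x. b *\<^sub>R q x)"
      using ip_lin[OF p' q q, of b 0] ip_lin[OF p' q q, of "- b" 0] by simp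
    moreover have "0 \<le> L2_normsq_on {0..} (\<lambda>x. a *\<^sub>R p x + (- b) *\<^sub>R q x)" by (rule L2_normsq_nonneg)
    ultimately show ?thesis unfolding normsq_add[OF p' q'] normsq_add[OF p' q''] normsq_scaleR by (simp add: algebra_simps)
  qed
  show ?thesis unfolding H1_norm_dec(1)[OF dec_combine[OF du dv]] H1_norm_dec(1)[OF du] H1_norm_dec(1)[OF dv] hnorm2_def
    using N[OF hlD(1)[OF decD(1)[OF du]] hlD(1)[OF decD(1)[OF dv]]] N[OF hlD(1)[OF decD(2)[OF du]] hlD(1)[OF decD(2)[OF dv]]]
      N[OF hlD(2)[OF decD(1)[OF du]] hlD(2)[OF decD(1)[OF dv]]] N[OF hlD(2)[OF decD(2)[OF du]] hlD(2)[OF decD(2)[OF dv]]]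
    by (simp add: distrib_left)
qed

text \<open>The competitor \<open>c * (u + t * \<eta>)\<close> is rescaled to the right mass.
  Orthogonality makes \<open>1 - c\<close> of order \<open>t\<^sup>2\<close>, so a negative
  \<open>L \<eta>\<close> would dominate the energy change for small \<open>t\<close> and contradict
  minimality.\<close>

lemma normalised_minimizer_differential_nonneg:
  assumes u: "u \<in> D_mass \<tau> \<mu>" and \<mu>: "\<mu> > 0" and min: "\<And>v. v \<in> D_mass \<tau> \<mu> \<Longrightarrow> F u \<le> F v"
    and L: "is_differential \<tau> F u L" and \<eta>: "\<eta> \<in> D_space \<tau>" and orth: "Re (\<integral>x. u x * cnj (\<eta> x) \<partial>lborel) = 0"
  shows "L \<eta> \<ge> 0"
proof (rule ccontr)
  assume "\<not> L \<eta> \<ge> 0"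
  define D where "D = - L \<eta>"
  have D: "D > 0" using \<open>\<not> L \<eta> \<ge> 0\<close> by (simp add: D_def)
  have uD: "u \<in> D_space \<tau>" and mu: "mass u = \<mu>" using u by (auto simp: D_mass_def)
  define K where "K = mass \<eta> / \<mu>"
  have "mass \<eta> \<ge> 0" unfolding mass_def by (rule L2_normsq_nonneg)
  then have K: "K \<ge> 0" using \<mu> by (simp add: K_def)
  \<comment> \<open>\<open>t * C\<close> will bound the norm of the perturbation
    \<open>\<xi>\<close>, since \<open>1 - c \<le> t * K\<close> and
    \<open>c \<le> 1\<close>.\<close>
  define C where "C = sqrt (2 * (K\<^sup>2 * (H1_norm u)\<^sup>2 + (H1_norm \<eta>)\<^sup>2))"
  have C: "C \<ge> 0" "C\<^sup>2 = 2 * (K\<^sup>2 * (H1_norm u)\<^sup>2 + (H1_norm \<eta>)\<^sup>2)" by (auto simp: C_def)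
  define \<epsilon> where "\<epsilon> = D / (8 * (C + 1))"
  have \<epsilon>: "\<epsilon> > 0" "\<epsilon> * C \<le> D / 8" using D C(1) by (auto simp: \<epsilon>_def field_simps)
  obtain d where d: "d > 0" "\<And>\<xi>. \<xi> \<in> D_space \<tau> \<Longrightarrow> H1_norm \<xi> < d \<Longrightarrow> \<bar>F (\<lambda>x. u x + \<xi> x) - F u - L \<xi>\<bar> \<le> \<epsilon> * H1_norm \<xi>"
    using L \<epsilon>(1) unfolding is_differential_def by blast
  \<comment> \<open>The four bounds serve, in order, for \<open>t\<^sup>2 \<le> t\<close>, for
    \<open>c \<ge> 1 / 2\<close>, for \<open>\<xi>\<close> to lie where the expansion holds, and for
    the contribution of \<open>L u\<close> to be at most \<open>t * D / 8\<close>. With an error of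
    at most \<open>t * D / 8\<close> this stays below the gain \<open>t * D / 2\<close>.\<close>
  define t where "t = min (min 1 (1 / (2 * (K + 1)))) (min (d / (2 * (C + 1))) (D / (8 * (K * \<bar>L u\<bar> + 1))))"
  have t: "t > 0" "t \<le> 1" "t \<le> 1 / (2 * (K + 1))" "t \<le> d / (2 * (C + 1))" "t \<le> D / (8 * (K * \<bar>L u\<bar> + 1))"
  proof -
    show "t > 0" using K C D d(1) by (auto simp: t_def intro!: divide_pos_pos add_nonneg_pos mult_nonneg_nonneg)
  qed (simp_all only: t_def min_le_iff_disj order_refl simp_thms)
  have tK: "t * K \<le> 1 / 2" using t(3) K t(1) by (simp add: field_simps)
  have tC: "t * C < d" using t(4) C t(1) d(1) by (simp add: field_simps)
  have KL: "K * \<bar>L u\<bar> \<ge> 0" using K by simp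
  have tL: "t * (K * \<bar>L u\<bar>) \<le> D / 8"
  proof -
    have "t * (8 * (K * \<bar>L u\<bar> + 1)) \<le> D" using t(5) KL by (simp add: le_divide_eq)
    then show ?thesis using t(1) by (simp add: algebra_simps)
  qed
  define c where "c = 1 / sqrt (1 + t\<^sup>2 * K)"
  have ge1: "1 + t\<^sup>2 * K \<ge> 1" using K by simp
  then have c: "0 < c" "c \<le> 1" "c\<^sup>2 * (1 + t\<^sup>2 * K) = 1" by (auto simp: c_def power_divide)
  have c1: "1 - c \<le> t\<^sup>2 * K"
  proof -
    have "c\<^sup>2 \<le> c" using c by (simp add: power2_eq_square)
    then have "1 - c \<le> 1 - c\<^sup>2" by simp
    also have "\<dots> = c\<^sup>2 * (t\<^sup>2 * K)" using c(3) by (simp add: distrib_left)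
    also have "\<dots> \<le> 1 * (t\<^sup>2 * K)" using c K by (intro mult_right_mono) (auto simp: power_le_one)
    finally show ?thesis by simp
  qed
  have t2: "t\<^sup>2 * K \<le> t * K" using t K by (intro mult_right_mono) (auto simp: power2_eq_square)
  have ch: "c \<ge> 1 / 2" using c1 t2 tK by linarith
  define \<xi> where "\<xi> = (\<lambda>x. (c - 1) *\<^sub>R u x + (c * t) *\<^sub>R \<eta> x)"
  have \<xi>: "\<xi> \<in> D_space \<tau>" unfolding \<xi>_def by (rule D_space_combine[OF uD \<eta>])
  have v: "(\<lambda>x. u x + \<xi> x) = (\<lambda>x. c *\<^sub>R u x + (c * t) *\<^sub>R \<eta> x)" by (simp add: \<xi>_def fun_eq_iff algebra_simps)
  have "mass (\<lambda>x. c *\<^sub>R u x + (c * t) *\<^sub>R \<eta> x) = c\<^sup>2 * (\<mu> + t\<^sup>2 * mass \<eta>)"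
    unfolding mass_combine[OF uD \<eta> orth] mu by (simp add: algebra_simps power_mult_distrib)
  also have "\<mu> + t\<^sup>2 * mass \<eta> = \<mu> * (1 + t\<^sup>2 * K)" using \<mu> by (simp add: K_def distrib_left)
  also have "c\<^sup>2 * (\<mu> * (1 + t\<^sup>2 * K)) = \<mu>" using c(3) by (simp add: mult.left_commute)
  finally have "(\<lambda>x. u x + \<xi> x) \<in> D_mass \<tau> \<mu>" unfolding v D_mass_def using D_space_combine[OF uD \<eta>] by simp
  then have ge: "F u \<le> F (\<lambda>x. u x + \<xi> x)" by (rule min)
  have "(H1_norm \<xi>)\<^sup>2 \<le> 2 * ((c - 1)\<^sup>2 * (H1_norm u)\<^sup>2 + (c * t)\<^sup>2 * (H1_norm \<eta>)\<^sup>2)"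
    unfolding \<xi>_def by (rule H1_norm_combine_le[OF uD \<eta>])
  also have "\<dots> \<le> 2 * ((t * K)\<^sup>2 * (H1_norm u)\<^sup>2 + t\<^sup>2 * (H1_norm \<eta>)\<^sup>2)"
  proof (intro mult_left_mono add_mono mult_right_mono)
    have "(1 - c)\<^sup>2 \<le> (t * K)\<^sup>2" using c c1 t2 by (intro power_mono) auto
    then show "(c - 1)\<^sup>2 \<le> (t * K)\<^sup>2" by (simp add: power2_commute)
    show "(c * t)\<^sup>2 \<le> t\<^sup>2" using c t by (intro power_mono) (auto simp: mult_left_le_one_le)
  qed auto
  also have "\<dots> = (t * C)\<^sup>2" unfolding power_mult_distrib C(2) by (simp add: algebra_simps)
  finally have n: "H1_norm \<xi> \<le> t * C" by (rule power2_le_imp_le) (rule mult_nonneg_nonneg[OF less_imp_le[OF t(1)] C(1)])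
  then have "H1_norm \<xi> < d" using tC by simp
  from d(2)[OF \<xi> this] ge have "0 \<le> L \<xi> + \<epsilon> * H1_norm \<xi>" by linarith
  also have "\<epsilon> * H1_norm \<xi> \<le> \<epsilon> * (t * C)" using n \<epsilon> by (intro mult_left_mono) auto
  also have "L \<xi> = (c - 1) * L u + (c * t) * L \<eta>" using L uD \<eta> unfolding is_differential_def \<xi>_def by blast
  finally have 1: "0 \<le> (c - 1) * L u + (c * t) * L \<eta> + \<epsilon> * (t * C)" by simp
  have "(c - 1) * L u \<le> \<bar>c - 1\<bar> * \<bar>L u\<bar>" using abs_ge_self[of "(c - 1) * L u"] by (simp only: abs_mult)
  also have "\<dots> \<le> (t\<^sup>2 * K) * \<bar>L u\<bar>" using c c1 by (intro mult_right_mono) auto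
  also have "\<dots> = t * (t * (K * \<bar>L u\<bar>))" by (simp add: power2_eq_square)
  also have "\<dots> \<le> t * (D / 8)" using tL t by (intro mult_left_mono) auto
  finally have 2: "(c - 1) * L u \<le> t * (D / 8)" .
  have 3: "\<epsilon> * (t * C) \<le> t * (D / 8)" using mult_left_mono[OF \<epsilon>(2), of t] t by (simp add: mult_ac)
  have "(c * t) * D \<ge> (1 / 2 * t) * D" using ch t D by (intro mult_right_mono) auto
  then have 4: "(c * t) * L \<eta> \<le> - (t * D / 2)" by (simp add: D_def)
  have "t * D > 0" using t D by simp
  then show False using 1 2 3 4 by simp
qed

lemma minimizer_stationary:
  assumes u: "u \<in> D_mass \<tau> \<mu>" and \<mu>: "\<mu> > 0" and s: "\<sigma> > 0"
    and min: "\<And>v. v \<in> D_mass \<tau> \<mu> \<Longrightarrow> energy \<sigma> \<alpha> u \<le> energy \<sigma> \<alpha> v"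
  shows "stationary_state \<sigma> \<alpha> \<tau> \<mu> u"
proof -
  have uD: "u \<in> D_space \<tau>" using u by (simp add: D_mass_def)
  then obtain uL gL uR gR where du: "dec \<tau> u uL gL uR gR" by (rule D_space_decE)
  define L where "L = dE \<sigma> \<alpha> \<tau> uL gL uR gR"
  have L: "is_differential \<tau> (energy \<sigma> \<alpha>) u L" unfolding L_def by (rule energy_differential[OF du s])
  have "L \<eta> = 0" if \<eta>: "\<eta> \<in> D_space \<tau>" and orth: "Re (\<integral>x. u x * cnj (\<eta> x) \<partial>lborel) = 0" for \<eta>
  proof -
    define \<zeta> where "\<zeta> = (\<lambda>x. (-1) *\<^sub>R \<eta> x + 0 *\<^sub>R \<eta> x)"
    have z: "\<zeta> \<in> D_space \<tau>" unfolding \<zeta>_def by (rule D_space_combine[OF \<eta> \<eta>])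
    have "L \<zeta> = (-1) * L \<eta> + 0 * L \<eta>" using L \<eta> unfolding is_differential_def \<zeta>_def by blast
    moreover have "Re (\<integral>x. u x * cnj (\<zeta> x) \<partial>lborel) = 0" using orth by (simp add: \<zeta>_def)
    ultimately show ?thesis using normalised_minimizer_differential_nonneg[OF u \<mu> min L \<eta> orth]
      normalised_minimizer_differential_nonneg[OF u \<mu> min L z] by simp
  qed
  then show ?thesis unfolding stationary_state_def using u L by blast
qed

section \<open>Soliton pieces as critical points, and the converse\<close>

context nls
begin

lemma hstate_powr: 
  assumes "k > 0"
  shows "hstate k \<theta> x powr (2 * \<sigma>) = (\<sigma> + 1) * k\<^sup>2 * (1 - (th k \<theta> x)\<^sup>2)"
proof -
  have "(hstate k \<theta> x)\<^sup>2 = hstate k \<theta> x powr 2" using hstate_pos[OF assms, of \<theta> x] by simp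
  then have "hstate k \<theta> x powr (2 * \<sigma>) = ((hstate k \<theta> x)\<^sup>2) powr \<sigma>" by (simp only: powr_powr)
  then show ?thesis unfolding hstate_sq[OF assms] using dens_powr[of "th k \<theta> x" k] th_bounds[of k \<theta> x] by simp
qed

lemma hslope_deriv:
  assumes "k > 0"
  shows "(hslope k \<theta> has_real_derivative k\<^sup>2 * hstate k \<theta> x - hstate k \<theta> x powr (2 * \<sigma>) * hstate k \<theta> x) (at x)"
proof -
  have "(hslope k \<theta> has_real_derivative (- k * (\<sigma> * k * (1 - (th k \<theta> x)\<^sup>2))) * hstate k \<theta> x + (- k * th k \<theta> x * hstate k \<theta> x) * (- k * th k \<theta> x)) (at x)"
    unfolding hslope_def[abs_def] by (intro DERIV_mult DERIV_cmult th_deriv hstate_deriv assms)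
  then show ?thesis unfolding hstate_powr[OF assms] by (rule DERIV_cong) (simp add: algebra_simps power2_eq_square)
qed

lemma nlin_hstate: "k > 0 \<Longrightarrow> nlin \<sigma> (complex_of_real (hstate k \<theta> x)) = complex_of_real (hstate k \<theta> x powr (2 * \<sigma>) * hstate k \<theta> x)"
  using hstate_pos[of k \<theta> x] by (simp add: nlin_def)

text \<open>Integration by parts with the soliton equation leaves the mass term with multiplier
  \<open>- k\<^sup>2\<close> and a boundary term from the slope at 0, to be balanced later against
  the other half and the \<open>\<alpha>\<close> term.\<close>

lemma half_diff_hstate:
  assumes k: "k > 0" and t: "-1 < \<theta>" "\<theta> < 1" and \<eta>: "hl \<eta> h"
  shows "half_diff \<sigma> (\<lambda>x. complex_of_real (hstate k \<theta> x)) (\<lambda>x. complex_of_real (hslope k \<theta> x)) \<eta> h =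
    - k\<^sup>2 * ip (\<lambda>x. complex_of_real (hstate k \<theta> x)) \<eta> + k * \<theta> * hstate k \<theta> 0 * Re (\<eta> 0)"
proof -
  define u g where "u = (\<lambda>x. complex_of_real (hstate k \<theta> x))" and "g = (\<lambda>x. complex_of_real (hslope k \<theta> x))"
  define q where "q = (\<lambda>x. k\<^sup>2 *\<^sub>R u x + (-1) *\<^sub>R nlin \<sigma> (u x))"
  have ug: "hl u g" unfolding u_def g_def by (rule hstate_hl(1)[OF k t])
  have nl: "L2_on {0..} (\<lambda>x. nlin \<sigma> (u x))" by (rule L2_on_nlin[OF ug sigma_pos])
  have qe: "q x = complex_of_real (k\<^sup>2 * hstate k \<theta> x - hstate k \<theta> x powr (2 * \<sigma>) * hstate k \<theta> x)" for x
    unfolding q_def u_def nlin_hstate[OF k] by (simp add: scaleR_conv_of_real)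
  have "AC_on 0 b g q" for b
  proof (rule AC_on_C1)
    fix x show "(g has_vector_derivative q x) (at x within {0..b})"
      unfolding g_def qe by (intro has_vector_derivative_of_real has_vector_derivative_at_within)
        (use hslope_deriv[OF k, of \<theta> x] in \<open>simp add: has_real_derivative_iff_has_vector_derivative\<close>)
    show "continuous_on {0..b} q" unfolding qe[abs_def]
      by (intro continuous_intros continuous_on_powr' hstate_continuous k) (use hstate_pos[OF k] in \<open>auto intro: less_imp_le simp: less_imp_neq[symmetric]\<close>)
  qed
  moreover have "L2_on {0..} q" unfolding q_def by (intro L2_on_add L2_on_scaleR hlD(1)[OF ug] nl)
  ultimately have gq: "hl g q" unfolding hl_def using hlD(2)[OF ug] by blast
  have "ip q \<eta> = k\<^sup>2 * ip u \<eta> + (-1) * ip (\<lambda>x. nlin \<sigma> (u x)) \<eta>"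
    unfolding q_def by (rule ip_lin_left[OF hlD(1)[OF \<eta>] hlD(1)[OF ug] nl])
  then have "half_diff \<sigma> u g \<eta> h = - k\<^sup>2 * ip u \<eta> - Re (g 0 * cnj (\<eta> 0))"
    using hl_integration_by_parts[OF gq \<eta>] by (simp add: half_diff_def)
  also have "Re (g 0 * cnj (\<eta> 0)) = - (k * \<theta> * hstate k \<theta> 0 * Re (\<eta> 0))" by (simp add: g_def hslope_def th_0[OF t])
  finally show ?thesis by (simp add: u_def g_def)
qed

text \<open>The weak equation yields a continuous representative of \<open>g\<close>, then a
  classical second-order equation for the real part, to which \<open>positive_solution\<close>
  applies. Positivity is given away from the origin; the value there follows by continuity.\<close>

lemma positive_half_solution:
  assumes u: "hl u g" and pos: "\<And>x. x > 0 \<Longrightarrow> u x \<in> \<real> \<and> Re (u x) > 0"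
    and weak: "\<And>v h. hl v h \<Longrightarrow> v 0 = 0 \<Longrightarrow> half_diff \<sigma> u g v h = l * ip u v"
  obtains k \<theta> where "k > 0" "-1 < \<theta>" "\<theta> < 1" "k\<^sup>2 = - l" "\<forall>x\<ge>0. u x = complex_of_real (hstate k \<theta> x)"
proof -
  define f where "f = (\<lambda>x. 1 *\<^sub>R nlin \<sigma> (u x) + l *\<^sub>R u x)"
  have nl: "L2_on {0..} (\<lambda>x. nlin \<sigma> (u x))" by (rule L2_on_nlin[OF u sigma_pos])
  have fL: "L2_on {0..} f" unfolding f_def by (intro L2_on_add L2_on_scaleR nl hlD(1)[OF u])
  have w: "ip g h = ip f v" if v: "hl v h" "v 0 = 0" for v h
  proof -
    have "ip f v = 1 * ip (\<lambda>x. nlin \<sigma> (u x)) v + l * ip u v" unfolding f_def by (rule ip_lin_left[OF hlD(1)[OF v(1)] nl hlD(1)[OF u]])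
    then show ?thesis using weak[OF v] by (simp add: half_diff_def)
  qed
  obtain a where ga: "AE x in lborel. 0 \<le> x \<longrightarrow> g x = a - integral {0..x} f"
    and ua: "\<forall>t\<ge>0. u t = u 0 + integral {0..t} (\<lambda>x. a - integral {0..x} f)"
    by (rule weak_equation[OF u fL w])
  have cu: "continuous_on {0..b} u" for b by (rule AC_on_continuous[OF hlD(3)[OF u order_refl]])
  have cf: "continuous_on {0..b} f" for b unfolding f_def nlin_def
    by (intro continuous_intros cu continuous_on_powr') (use sigma_pos in auto)
  define F where "F x = integral {0..x} f" for x
  have cF: "continuous_on {0..b} F" for b unfolding F_def by (intro indefinite_integral_continuous_1 integrable_continuous_real cf)
  \<comment> \<open>\<open>d\<close> is the continuous representative of the real part of
    \<open>g\<close>. The two agree almost everywhere, which is enough to transfer square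
    integrability from \<open>g\<close>.\<close>
  define y d where "y x = Re (u x)" and "d x = Re (a - F x)" for x
  have loc: "at x within {0..x + 1} = at x" if "x > 0" for x :: real
    by (rule at_within_Icc_at) (use that in auto)
  have dF: "(F has_vector_derivative f x) (at x)" if x: "x > 0" for x
    using integral_has_vector_derivative[OF cf, of x "x + 1"] x unfolding loc[OF x] F_def[abs_def] by simp
  have du: "(u has_vector_derivative a - F x) (at x)" if x: "x > 0" for x
  proof -
    have "((\<lambda>t. integral {0..t} (\<lambda>x. a - F x)) has_vector_derivative a - F x) (at x within {0..x + 1})"
      by (rule integral_has_vector_derivative) (use x in \<open>auto intro!: continuous_intros cF\<close>)
    then have "((\<lambda>t. u 0 + integral {0..t} (\<lambda>x. a - F x)) has_vector_derivative 0 + (a - F x)) (at x)"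
      unfolding loc[OF x] by (intro has_vector_derivative_add has_vector_derivative_const)
    then have D: "((\<lambda>t. u 0 + integral {0..t} (\<lambda>x. a - F x)) has_vector_derivative a - F x) (at x)" by simp
    show ?thesis
    proof (rule has_vector_derivative_transform_within_open[OF D, of "{0<..}"])
      fix t :: real assume "t \<in> {0<..}"
      then show "u 0 + integral {0..t} (\<lambda>x. a - F x) = u t" using ua[rule_format, of t] unfolding F_def by simp
    qed (use x in auto)
  qed
  have dy: "(y has_real_derivative d x) (at x)" if x: "x > 0" for x
    using bounded_linear.has_vector_derivative[OF bounded_linear_Re du[OF x]]
    unfolding y_def[abs_def] d_def has_real_derivative_iff_has_vector_derivative .
  have Ref: "Re (f x) = y x powr (2 * \<sigma> + 1) + l * y x" if x: "x > 0" for x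
  proof -
    have ux: "u x = of_real (y x)" using pos[OF x] unfolding y_def by (auto elim: Reals_cases)
    have yp: "y x > 0" using pos[OF x] by (simp add: y_def)
    have "y x powr (2 * \<sigma> + 1) = y x powr (2 * \<sigma>) * y x" using yp by (simp only: powr_add powr_one)
    then show ?thesis unfolding f_def nlin_def ux using yp by simp
  qed
  have dd: "(d has_real_derivative (- l) * y x - y x powr (2 * \<sigma> + 1)) (at x)" if x: "x > 0" for x
  proof -
    have "((\<lambda>x. a - F x) has_vector_derivative 0 - f x) (at x)" by (intro has_vector_derivative_diff has_vector_derivative_const dF x)
    from bounded_linear.has_vector_derivative[OF bounded_linear_Re this]
    have "(d has_real_derivative Re (0 - f x)) (at x)" unfolding d_def[abs_def] has_real_derivative_iff_has_vector_derivative .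
    then show ?thesis by (rule DERIV_cong) (simp add: Ref[OF x])
  qed
  have lim: "(y \<longlongrightarrow> 0) at_top"
  proof (rule Lim_null_comparison)
    have "((\<lambda>t. sqrt ((norm (u t))\<^sup>2)) \<longlongrightarrow> sqrt 0) at_top" by (rule tendsto_real_sqrt[OF hl_normsq_tail(2)[OF u order_refl]])
    then show "((\<lambda>t. norm (u t)) \<longlongrightarrow> 0) at_top" by simp
    show "\<forall>\<^sub>F x in at_top. norm (y x) \<le> norm (u x)" by (simp add: y_def abs_Re_le_cmod)
  qed
  have int: "set_integrable lborel {0..} (\<lambda>x. (d x)\<^sup>2)"
    unfolding set_integrable_def
  proof (rule Bochner_Integration.integrable_bound)
    show "integrable lborel (\<lambda>x. indicator {0..} x *\<^sub>R (norm (g x))\<^sup>2)"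
      using L2_on_normsq[OF hlD(2)[OF u]] unfolding set_integrable_def .
    \<comment> \<open>For measurability: continuity on every bounded interval gives continuity on
      the half-line.\<close>
    have "continuous_on {0..} F"
    proof (rule continuous_on_subset[of "\<Union>n. {0..<real n}"])
      show "continuous_on (\<Union>n. {0..<real n}) F"
        unfolding continuous_on_eq_continuous_within
      proof
        fix x assume "x \<in> (\<Union>n. {0..<real n})"
        then have x: "x \<ge> 0" by auto
        have "continuous (at x within {0..x + 1}) F" using cF[of "x + 1"] x by (auto simp: continuous_on_eq_continuous_within)
        moreover have "at x within {0..x + 1} = at x within {0..}"
          by (rule at_within_nhd[of _ "{..<x + 1}"]) auto
        moreover have "(\<Union>n. {0..<real n}) = {0..}" using reals_Archimedean2 by (auto simp: atLeast_def)
        ultimately show "continuous (at x within (\<Union>n. {0..<real n})) F" by simp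
      qed
      show "{0..} \<subseteq> (\<Union>n. {0..<real n})" using reals_Archimedean2 by auto
    qed
    then have "continuous_on {0..} (\<lambda>x. (d x)\<^sup>2)" unfolding d_def[abs_def] by (intro continuous_intros)
    then show "(\<lambda>x. indicator {0..} x *\<^sub>R (d x)\<^sup>2) \<in> borel_measurable lborel"
      using borel_measurable_continuous_on_indicator[of "{0..}" "\<lambda>x. (d x)\<^sup>2"] by simp
    show "AE x in lborel. norm (indicator {0..} x *\<^sub>R (d x)\<^sup>2) \<le> norm (indicator {0..} x *\<^sub>R (norm (g x))\<^sup>2)"
      using ga
    proof eventually_elim
      case (elim x)
      have "(Re (g x))\<^sup>2 \<le> (norm (g x))\<^sup>2" using abs_Re_le_cmod[of "g x"] by (simp add: abs_le_square_iff[symmetric])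
      then show ?case using elim by (auto simp: indicator_def d_def F_def)
    qed
  qed
  obtain k \<theta> where k: "k > 0" "-1 < \<theta>" "\<theta> < 1" "- l = k\<^sup>2" and yk: "\<forall>x>0. y x = hstate k \<theta> x"
    by (rule positive_solution[of y d "- l"]) (use dy dd lim int pos in \<open>auto simp: y_def\<close>)
  have ux: "u x = complex_of_real (hstate k \<theta> x)" if x: "x > 0" for x
    using pos[OF x] yk x unfolding y_def by (metis of_real_Re)
  have "(u \<longlongrightarrow> u 0) (at_right 0)"
    using cu[of 1] unfolding continuous_on_def at_within_Icc_at_right[of 0 "1::real", simplified, symmetric] by simp
  then have "((\<lambda>x. complex_of_real (hstate k \<theta> x)) \<longlongrightarrow> u 0) (at_right 0)"
    by (rule Lim_transform_eventually) (use eventually_at_right_less[of 0] ux in \<open>auto elim: eventually_mono\<close>)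
  moreover have "((\<lambda>x. complex_of_real (hstate k \<theta> x)) \<longlongrightarrow> complex_of_real (hstate k \<theta> 0)) (at_right 0)"
    using DERIV_isCont[OF hstate_deriv[OF k(1), where \<theta>=\<theta> and x=0]] unfolding isCont_def
    by (intro tendsto_of_real) (simp add: filterlim_at_split)
  ultimately have "u 0 = complex_of_real (hstate k \<theta> 0)" by (rule tendsto_unique[OF trivial_limit_at_right_real])
  then have "u x = complex_of_real (hstate k \<theta> x)" if "x \<ge> 0" for x using ux[of x] that by (cases "x = 0") auto
  then show ?thesis using that[of k \<theta>] k by simp
qed

end

section \<open>States on the line: classification, minimality and uniqueness\<close>

context nls_jump
begin

definition state :: "real \<Rightarrow> real \<Rightarrow> real \<Rightarrow> real \<Rightarrow> complex" where
  "state k \<theta>1 \<theta>2 = glue (\<lambda>x. of_real (hstate k \<theta>1 x)) (\<lambda>x. of_real (hstate k \<theta>2 x))"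

abbreviation state_dec :: "real \<Rightarrow> real \<Rightarrow> real \<Rightarrow> (real \<Rightarrow> complex) \<Rightarrow> bool" where
  "state_dec k \<theta>1 \<theta>2 u \<equiv> dec \<tau> u (\<lambda>x. of_real (hstate k \<theta>1 x)) (\<lambda>x. of_real (hslope k \<theta>1 x))
     (\<lambda>x. of_real (hstate k \<theta>2 x)) (\<lambda>x. of_real (hslope k \<theta>2 x))"

lemma hstate_0: "-1 < \<theta> \<Longrightarrow> \<theta> < 1 \<Longrightarrow> hstate k \<theta> 0 = sqrt (dens k \<theta>)"
  by (simp add: hstate_def th_0)

lemma triple_jump:
  assumes "triple k \<theta>1 \<theta>2"
  shows "hstate k \<theta>2 0 = \<tau> * hstate k \<theta>1 0"
  using assms tau_gt_1 by (simp add: triple_def hstate_0 real_sqrt_mult)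

lemma state_dec:
  assumes "triple k \<theta>1 \<theta>2"
  shows "state_dec k \<theta>1 \<theta>2 (state k \<theta>1 \<theta>2)"
  unfolding dec_def state_def using assms triple_jump[OF assms] by (auto simp: triple_def intro!: hstate_hl(1))

lemma state_D_mass:
  assumes "triple k \<theta>1 \<theta>2"
  shows "state k \<theta>1 \<theta>2 \<in> D_mass \<tau> (tmass k \<theta>1 \<theta>2)"
proof -
  have k: "k > 0" "-1 < \<theta>1" "\<theta>1 < 1" "-1 < \<theta>2" "\<theta>2 < 1" using assms by (auto simp: triple_def)
  show ?thesis unfolding D_mass_def
    using H1_norm_dec(3)[OF state_dec[OF assms]] state_dec[OF assms] hstate_hl(2)[OF k(1,2,3)] hstate_hl(2)[OF k(1,4,5)]
    by (auto simp: D_space_dec tmass_def)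
qed

lemma state_pos_fun:
  assumes "k > 0"
  shows "pos_fun (state k \<theta>1 \<theta>2)"
  unfolding pos_fun_def
proof (intro allI impI)
  fix x :: real assume "x \<noteq> 0"
  then show "state k \<theta>1 \<theta>2 x \<in> \<real> \<and> 0 < Re (state k \<theta>1 \<theta>2 x)"
    using hstate_pos[OF assms] by (cases "x > 0") (auto simp: state_def glue_simps)
qed

lemma state_energy:
  assumes "triple k \<theta>1 \<theta>2"
  shows "energy \<sigma> \<alpha> (state k \<theta>1 \<theta>2) = \<Phi> (tmass k \<theta>1 \<theta>2) (hmass k \<theta>1) (dens k \<theta>1)"
proof -
  have k: "k > 0" "-1 < \<theta>1" "\<theta>1 < 1" "-1 < \<theta>2" "\<theta>2 < 1" and d: "dens k \<theta>2 = \<tau>\<^sup>2 * dens k \<theta>1" using assms by (auto simp: triple_def)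
  note L = hstate_hl[OF k(1,2,3)] and R = hstate_hl[OF k(1,4,5)]
  show ?thesis unfolding state_def energy_glue[OF L(1) R(1) less_imp_le[OF sigma_pos]] L(3,4) R(4) d \<Phi>_def by (simp add: tmass_def)
qed

text \<open>Both boundary terms are multiples of \<open>hstate k \<theta>1 0 * Re (vL 0)\<close>. On
  the right the jump enters twice, through the state and through the variation, whence the factor
  \<open>\<tau>\<^sup>2\<close>.\<close>

lemma denergy_state:
  assumes k: "k > 0" "-1 < \<theta>1" "\<theta>1 < 1" "-1 < \<theta>2" "\<theta>2 < 1" and jump: "hstate k \<theta>2 0 = \<tau> * hstate k \<theta>1 0"
    and d: "dec \<tau> \<eta> vL hL vR hR"
  shows "denergy \<sigma> \<alpha> (\<lambda>x. of_real (hstate k \<theta>1 x)) (\<lambda>x. of_real (hslope k \<theta>1 x)) (\<lambda>x. of_real (hstate k \<theta>2 x)) (\<lambda>x. of_real (hslope k \<theta>2 x)) vL hL vR hR =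
    - k\<^sup>2 * (ip (\<lambda>x. of_real (hstate k \<theta>1 x)) vL + ip (\<lambda>x. of_real (hstate k \<theta>2 x)) vR) + (k * (\<theta>1 + \<tau>\<^sup>2 * \<theta>2) - \<alpha>) * (hstate k \<theta>1 0 * Re (vL 0))"
  unfolding denergy_def half_diff_hstate[OF k(1,2,3) decD(1)[OF d]] half_diff_hstate[OF k(1,4,5) decD(2)[OF d]] jump decD(3)[OF d]
  by (simp add: algebra_simps power2_eq_square)

lemma state_stationary:
  assumes t: "triple k \<theta>1 \<theta>2"
  shows "stationary_state \<sigma> \<alpha> \<tau> (tmass k \<theta>1 \<theta>2) (state k \<theta>1 \<theta>2)"
proof -
  have k: "k > 0" "-1 < \<theta>1" "\<theta>1 < 1" "-1 < \<theta>2" "\<theta>2 < 1" and fl: "k * (\<theta>1 + \<tau>\<^sup>2 * \<theta>2) = \<alpha>" using t by (auto simp: triple_def)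
  note d = state_dec[OF t]
  let ?L = "dE \<sigma> \<alpha> \<tau> (\<lambda>x. of_real (hstate k \<theta>1 x)) (\<lambda>x. of_real (hslope k \<theta>1 x)) (\<lambda>x. of_real (hstate k \<theta>2 x)) (\<lambda>x. of_real (hslope k \<theta>2 x))"
  have "?L \<eta> = 0" if \<eta>: "\<eta> \<in> D_space \<tau>" and orth: "Re (\<integral>x. state k \<theta>1 \<theta>2 x * cnj (\<eta> x) \<partial>lborel) = 0" for \<eta>
  proof -
    obtain vL hL vR hR where e: "dec \<tau> \<eta> vL hL vR hR" using \<eta> by (rule D_space_decE)
    show ?thesis unfolding dE_eq[OF d sigma_pos e] denergy_state[OF k triple_jump[OF t] e] using orth[unfolded inner_dec[OF d e]] fl by simp
  qed
  then show ?thesis unfolding stationary_state_def using state_D_mass[OF t] energy_differential[OF d sigma_pos] by blast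
qed

text \<open>Testing with variations supported in one half-line gives the equation there, with the Lagrange multiplier as frequency;
  testing with the state itself then gives the slope condition at the origin.\<close>
lemma positive_stationary_is_state:
  assumes st: "stationary_state \<sigma> \<alpha> \<tau> \<mu> u" and pos: "pos_fun u" and \<mu>: "\<mu> > 0"
  obtains k \<theta>1 \<theta>2 where "triple k \<theta>1 \<theta>2" "tmass k \<theta>1 \<theta>2 = \<mu>" "u = state k \<theta>1 \<theta>2"
proof -
  have uD: "u \<in> D_space \<tau>" and m: "mass u = \<mu>" using st by (auto simp: stationary_state_def D_mass_def)
  obtain L where L: "is_differential \<tau> (energy \<sigma> \<alpha>) u L"
    and orth: "\<And>\<eta>. \<eta> \<in> D_space \<tau> \<Longrightarrow> Re (\<integral>x. u x * cnj (\<eta> x) \<partial>lborel) = 0 \<Longrightarrow> L \<eta> = 0"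
    using st unfolding stationary_state_def by blast
  obtain uL gL uR gR where d: "dec \<tau> u uL gL uR gR" using uD by (rule D_space_decE)
  have LE: "dE \<sigma> \<alpha> \<tau> uL' gL' uR' gR' \<eta> = L \<eta>" if "\<eta> \<in> D_space \<tau>" "dec \<tau> u uL' gL' uR' gR'" for \<eta> uL' gL' uR' gR'
    by (rule differential_unique[OF energy_differential[OF that(2) sigma_pos] L that(1)])
  have m0: "mass u > 0" using m \<mu> by simp
  have o': "dE \<sigma> \<alpha> \<tau> uL gL uR gR \<eta> = 0" if "\<eta> \<in> D_space \<tau>" "Re (\<integral>x. u x * cnj (\<eta> x) \<partial>lborel) = 0" for \<eta>
    using orth[OF that] LE[OF that(1) d] by simp
  obtain l where l: "\<forall>vL hL vR hR. hl vL hL \<longrightarrow> hl vR hR \<longrightarrow> vR 0 = of_real \<tau> * vL 0 \<longrightarrow>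
     denergy \<sigma> \<alpha> uL gL uR gR vL hL vR hR = l * (ip uL vL + ip uR vR)"
    by (rule lagrange_multiplier[OF d sigma_pos m0 o'])
  note du = decD[OF d]
  have hl0: "hl (\<lambda>_. 0) (\<lambda>_. 0)" using hl_add_scale[OF du(1) du(1), of 0 0] by simp
  have z: "half_diff \<sigma> p q (\<lambda>_. 0) (\<lambda>_. 0) = 0" "ip p (\<lambda>_. 0) = 0" for p q by (simp_all add: half_diff_def ip_def)
  have pL: "uL x \<in> \<real> \<and> Re (uL x) > 0" if "x > 0" for x
    using pos[unfolded pos_fun_def, rule_format, of "- x"] that unfolding du(4) by (simp add: glue_simps)
  have pR: "uR x \<in> \<real> \<and> Re (uR x) > 0" if "x > 0" for x
    using pos[unfolded pos_fun_def, rule_format, of x] that unfolding du(4) by (simp add: glue_simps)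
  have wL: "half_diff \<sigma> uL gL v h = l * ip uL v" if "hl v h" "v 0 = 0" for v h
    using l[rule_format, OF that(1) hl0] that(2) z by (simp add: denergy_def)
  have wR: "half_diff \<sigma> uR gR v h = l * ip uR v" if "hl v h" "v 0 = 0" for v h
    using l[rule_format, OF hl0 that(1)] that(2) z by (simp add: denergy_def)
  obtain k \<theta>1 where k: "k > 0" "-1 < \<theta>1" "\<theta>1 < 1" "k\<^sup>2 = - l" and uLe: "\<forall>x\<ge>0. uL x = complex_of_real (hstate k \<theta>1 x)"
    by (rule positive_half_solution[OF du(1) pL wL])
  obtain k' \<theta>2 where k': "k' > 0" "-1 < \<theta>2" "\<theta>2 < 1" "k'\<^sup>2 = - l" and uRe': "\<forall>x\<ge>0. uR x = complex_of_real (hstate k' \<theta>2 x)"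
    by (rule positive_half_solution[OF du(2) pR wR])
  \<comment> \<open>Both halves share the multiplier \<open>l\<close>, hence the frequency.\<close>
  have "k' = k" by (rule power2_eq_imp_eq) (use k(1,4) k'(1,4) in auto)
  then have uRe: "\<forall>x\<ge>0. uR x = complex_of_real (hstate k \<theta>2 x)" using uRe' by simp
  have us: "u = state k \<theta>1 \<theta>2"
  proof
    fix x show "u x = state k \<theta>1 \<theta>2 x"
      unfolding du(4) state_def using uLe[rule_format, of "- x"] uRe[rule_format, of x]
      by (cases x "0::real" rule: linorder_cases) (simp_all add: glue_simps)
  qed
  have jump: "hstate k \<theta>2 0 = \<tau> * hstate k \<theta>1 0"
  proof -
    have "complex_of_real (hstate k \<theta>2 0) = complex_of_real (\<tau> * hstate k \<theta>1 0)" using du(3) uLe[rule_format, of 0] uRe[rule_format, of 0] by simp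
    then show ?thesis by (simp only: of_real_eq_iff)
  qed
  have dens: "dens k \<theta>2 = \<tau>\<^sup>2 * dens k \<theta>1"
    using arg_cong[OF jump, of "\<lambda>x. x\<^sup>2"] hstate_sq[OF k(1), of _ 0] th_0[OF k(2,3)] th_0[OF k'(2,3)] by (simp add: power_mult_distrib)
  have d': "state_dec k \<theta>1 \<theta>2 u"
    unfolding dec_def us state_def using hstate_hl(1)[OF k(1,2,3)] hstate_hl(1)[OF k(1) k'(2,3)] jump by simp
  have i: "ip p p + ip q q = \<mu>" if "dec \<tau> u p p' q q'" for p p' q q'
    using H1_norm_dec(3)[OF that] m ip_self[OF hlD(1)[OF decD(1)[OF that]]] ip_self[OF hlD(1)[OF decD(2)[OF that]]] by simp
  \<comment> \<open>The differential in the direction \<open>u\<close> is computed twice, from the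
    multiplier and from the explicit state. The mass terms cancel, and since \<open>u\<close> has a
    nonzero trace the slope condition remains.\<close>
  have "l * \<mu> = dE \<sigma> \<alpha> \<tau> uL gL uR gR u"
    unfolding dE_eq[OF d sigma_pos d] using l[rule_format, OF du(1,2,3)] i[OF d] by simp
  also have "\<dots> = L u" by (rule LE[OF uD d])
  also have "\<dots> = - k\<^sup>2 * \<mu> + (k * (\<theta>1 + \<tau>\<^sup>2 * \<theta>2) - \<alpha>) * (hstate k \<theta>1 0 * hstate k \<theta>1 0)"
    using LE[OF uD d'] unfolding dE_eq[OF d' sigma_pos d'] denergy_state[OF k(1,2,3) k'(2,3) jump d'] i[OF d'] by simp
  finally have "(k * (\<theta>1 + \<tau>\<^sup>2 * \<theta>2) - \<alpha>) * (hstate k \<theta>1 0 * hstate k \<theta>1 0) = 0" using k(4) by simp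
  then have "k * (\<theta>1 + \<tau>\<^sup>2 * \<theta>2) = \<alpha>" using hstate_pos[OF k(1), of \<theta>1 0] by simp
  then have t: "triple k \<theta>1 \<theta>2" unfolding triple_def using k k' dens by simp
  have "tmass k \<theta>1 \<theta>2 = \<mu>" using state_D_mass[OF t] m us by (simp add: D_mass_def)
  then show ?thesis using that t us by blast
qed

text \<open>The half-line bounds reduce the claim to \<open>\<Phi>\<close>, about which
  \<open>e\<close> is known only for masses strictly inside the interval. If one half is empty, the
  endpoint density vanishes as well, and the energy is at least \<open>W \<mu> 0\<close>, which
  exceeds \<open>e\<close>.\<close>

lemma energy_ge_min:
  assumes \<mu>: "\<mu> > 0" and u: "u \<in> D_mass \<tau> \<mu>" and e0: "e < W \<mu> 0"
    and e: "\<And>m r. 0 < m \<Longrightarrow> m < \<mu> \<Longrightarrow> r \<ge> 0 \<Longrightarrow> e \<le> \<Phi> \<mu> m r"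
  shows "e \<le> energy \<sigma> \<alpha> u"
proof -
  have uD: "u \<in> D_space \<tau>" and mu: "mass u = \<mu>" using u by (auto simp: D_mass_def)
  obtain uL gL uR gR where d: "dec \<tau> u uL gL uR gR" using uD by (rule D_space_decE)
  note du = decD[OF d]
  define m r where "m = L2_normsq_on {0..} uL" and "r = (norm (uL 0))\<^sup>2"
  have mR: "L2_normsq_on {0..} uR = \<mu> - m" using H1_norm_dec(3)[OF d] mu by (simp add: m_def)
  have rR: "(norm (uR 0))\<^sup>2 = \<tau>\<^sup>2 * r" unfolding du(3) r_def by (simp add: norm_mult power_mult_distrib)
  have "energy \<sigma> \<alpha> u = half_energy \<sigma> uL gL + half_energy \<sigma> uR gR - \<alpha> / 2 * r"
    using energy_glue[OF du(1,2) less_imp_le[OF sigma_pos], of \<alpha>] du(4) by (simp add: r_def)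
  then have ge: "\<Phi> \<mu> m r \<le> energy \<sigma> \<alpha> u"
    using half_energy_ge[OF du(1)] half_energy_ge[OF du(2)] unfolding \<Phi>_def mR rR m_def[symmetric] r_def[symmetric] by linarith
  have r0: "r \<ge> 0" by (simp add: r_def)
  have m0: "m \<ge> 0" "\<mu> - m \<ge> 0" unfolding mR[symmetric] unfolding m_def by (rule L2_normsq_nonneg)+
  consider "m = 0" | "m = \<mu>" | "0 < m" "m < \<mu>" using m0 by linarith
  then show ?thesis
  proof cases
    case 1
    then have "r\<^sup>2 \<le> 0" using hl_tail_bound[OF du(1) order_refl] by (simp add: m_def r_def)
    then have "r = 0" by simp
    then show ?thesis using ge e0 1 by (simp add: \<Phi>_def W_0)
  next
    case 2
    then have "(\<tau>\<^sup>2 * r)\<^sup>2 \<le> 0" using hl_tail_bound[OF du(2) order_refl] mR rR by simp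
    then have "r = 0" using tau_gt_1 by simp
    then show ?thesis using ge e0 2 by (simp add: \<Phi>_def W_0)
  next
    case 3
    then show ?thesis using e[OF 3 r0] ge by simp
  qed
qed

text \<open>A positive minimizer is stationary, hence a glued state; \<open>triple_flip\<close>
  excludes slopes \<open>\<theta>1 < 0\<close>, and on the other branch the mass determines the
  state. The strict energy gap in the last clause later tells the two kinds of states apart.\<close>

lemma positive_ground_state:
  assumes \<mu>: "\<mu> > 0"
  obtains k \<theta>1 \<theta>2 where "triple k \<theta>1 \<theta>2" "\<theta>1 > 0" "tmass k \<theta>1 \<theta>2 = \<mu>" "energy \<sigma> \<alpha> (state k \<theta>1 \<theta>2) < 0"
    "\<forall>u. ground_state \<sigma> \<alpha> \<tau> \<mu> u \<and> pos_fun u \<longleftrightarrow> u = state k \<theta>1 \<theta>2"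
    "\<forall>k' \<theta>1' \<theta>2'. triple k' \<theta>1' \<theta>2' \<longrightarrow> tmass k' \<theta>1' \<theta>2' = \<mu> \<longrightarrow> \<theta>1' < 0 \<longrightarrow>
       energy \<sigma> \<alpha> (state k \<theta>1 \<theta>2) < energy \<sigma> \<alpha> (state k' \<theta>1' \<theta>2')"
proof -
  obtain k \<theta>1 \<theta>2 where t: "triple k \<theta>1 \<theta>2" "\<theta>1 > 0" "tmass k \<theta>1 \<theta>2 = \<mu>" and less: "\<Phi> \<mu> (hmass k \<theta>1) (dens k \<theta>1) < W \<mu> 0"
    and min: "\<forall>m' r'. 0 < m' \<longrightarrow> m' < \<mu> \<longrightarrow> r' \<ge> 0 \<longrightarrow> \<Phi> \<mu> (hmass k \<theta>1) (dens k \<theta>1) \<le> \<Phi> \<mu> m' r'"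
    by (rule \<Phi>_min_left_triple[OF \<mu>])
  define s where "s = state k \<theta>1 \<theta>2"
  have E: "energy \<sigma> \<alpha> s = \<Phi> \<mu> (hmass k \<theta>1) (dens k \<theta>1)" unfolding s_def state_energy[OF t(1)] t(3) ..
  have k: "k > 0" using t(1) by (simp add: triple_def)
  have sD: "s \<in> D_mass \<tau> \<mu>" unfolding s_def using state_D_mass[OF t(1)] t(3) by simp
  have le: "energy \<sigma> \<alpha> s \<le> energy \<sigma> \<alpha> u" if "u \<in> D_mass \<tau> \<mu>" for u
    unfolding E by (rule energy_ge_min[OF \<mu> that less]) (rule min[rule_format])
  have neg: "energy \<sigma> \<alpha> s < 0" using E less W_0_neg[OF \<mu>] by linarith
  have sp: "pos_fun s" unfolding s_def by (rule state_pos_fun[OF k])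
  have right: "energy \<sigma> \<alpha> s < energy \<sigma> \<alpha> (state k' \<theta>1' \<theta>2')"
    if t': "triple k' \<theta>1' \<theta>2'" "tmass k' \<theta>1' \<theta>2' = \<mu>" "\<theta>1' < 0" for k' \<theta>1' \<theta>2'
  proof -
    obtain m' where m': "0 < m'" "m' < tmass k' \<theta>1' \<theta>2'"
      "\<Phi> (tmass k' \<theta>1' \<theta>2') m' (dens k' \<theta>1') < \<Phi> (tmass k' \<theta>1' \<theta>2') (hmass k' \<theta>1') (dens k' \<theta>1')"
      by (rule triple_flip[OF t'(1,3)])
    have "dens k' \<theta>1' \<ge> 0" by (simp add: dens_def)
    then have "\<Phi> \<mu> (hmass k \<theta>1) (dens k \<theta>1) \<le> \<Phi> \<mu> m' (dens k' \<theta>1')" using min m' t'(2) by simp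
    then show ?thesis using m'(3) unfolding E state_energy[OF t'(1)] t'(2) by linarith
  qed
  have gs: "ground_state \<sigma> \<alpha> \<tau> \<mu> s" unfolding ground_state_def using sD le sp by (auto simp: nonneg_fun_def pos_fun_def less_imp_le)
  have uniq: "u = s" if u: "ground_state \<sigma> \<alpha> \<tau> \<mu> u" "pos_fun u" for u
  proof -
    have uD: "u \<in> D_mass \<tau> \<mu>" and um: "\<And>v. v \<in> D_mass \<tau> \<mu> \<Longrightarrow> energy \<sigma> \<alpha> u \<le> energy \<sigma> \<alpha> v" using u(1) by (auto simp: ground_state_def)
    have st: "stationary_state \<sigma> \<alpha> \<tau> \<mu> u" by (rule minimizer_stationary[OF uD \<mu> sigma_pos um])
    obtain k' \<theta>1' \<theta>2' where t': "triple k' \<theta>1' \<theta>2'" "tmass k' \<theta>1' \<theta>2' = \<mu>" "u = state k' \<theta>1' \<theta>2'"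
      by (rule positive_stationary_is_state[OF st u(2) \<mu>])
    have "\<not> \<theta>1' < 0" using right[OF t'(1,2)] um[OF sD] t'(3) by auto
    then show ?thesis using triple_unique[OF t(1) t'(1)] t(2,3) t'(2,3) by (simp add: s_def)
  qed
  show ?thesis
  proof (rule that[OF t])
    show "energy \<sigma> \<alpha> (state k \<theta>1 \<theta>2) < 0" using neg by (simp add: s_def)
    show "\<forall>u. ground_state \<sigma> \<alpha> \<tau> \<mu> u \<and> pos_fun u \<longleftrightarrow> u = state k \<theta>1 \<theta>2" using gs sp uniq unfolding s_def by blast
    show "\<forall>k' \<theta>1' \<theta>2'. triple k' \<theta>1' \<theta>2' \<longrightarrow> tmass k' \<theta>1' \<theta>2' = \<mu> \<longrightarrow> \<theta>1' < 0 \<longrightarrow>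
       energy \<sigma> \<alpha> (state k \<theta>1 \<theta>2) < energy \<sigma> \<alpha> (state k' \<theta>1' \<theta>2')" using right unfolding s_def by blast
  qed
qed

end

theorem theorem2p1:
  fixes \<sigma> \<alpha> \<tau> :: real
  assumes "0 < \<sigma>" and "\<sigma> < 2" and "\<alpha> > 0" and "\<tau> > 1"
  shows "(\<forall>\<mu>>0.
            D_mass \<tau> \<mu> \<noteq> {} \<and>
            bdd_below (energy \<sigma> \<alpha> ` D_mass \<tau> \<mu>) \<and>
            (INF u \<in> D_mass \<tau> \<mu>. energy \<sigma> \<alpha> u) < 0 \<and>
            (\<exists>!u. ground_state \<sigma> \<alpha> \<tau> \<mu> u \<and> pos_fun u))
       \<and> (\<forall>\<mu>>0.
            (\<exists>v. stationary_state \<sigma> \<alpha> \<tau> \<mu> v \<and> pos_fun v \<and>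
                 v \<noteq> (THE u. ground_state \<sigma> \<alpha> \<tau> \<mu> u \<and> pos_fun u))
            \<longleftrightarrow> \<mu> > mu_crit \<sigma> \<alpha> \<tau>)"
proof -
  interpret nls_jump \<sigma> \<alpha> \<tau> by unfold_locales (use assms in auto)
  show ?thesis
  proof (rule conjI; intro allI impI)
    fix \<mu> :: real assume "\<mu> > 0"
    then obtain k \<theta>1 \<theta>2 where t: "triple k \<theta>1 \<theta>2" "tmass k \<theta>1 \<theta>2 = \<mu>" and neg: "energy \<sigma> \<alpha> (state k \<theta>1 \<theta>2) < 0"
      and gs: "\<forall>u. ground_state \<sigma> \<alpha> \<tau> \<mu> u \<and> pos_fun u \<longleftrightarrow> u = state k \<theta>1 \<theta>2"
      by (rule positive_ground_state)
    define s where "s = state k \<theta>1 \<theta>2"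
    have g: "ground_state \<sigma> \<alpha> \<tau> \<mu> s" using gs unfolding s_def by blast
    then have sD: "s \<in> D_mass \<tau> \<mu>" and le: "\<And>v. v \<in> D_mass \<tau> \<mu> \<Longrightarrow> energy \<sigma> \<alpha> s \<le> energy \<sigma> \<alpha> v"
      by (auto simp: ground_state_def)
    have bdd: "bdd_below (energy \<sigma> \<alpha> ` D_mass \<tau> \<mu>)" using le by (intro bdd_belowI2)
    have "(INF u \<in> D_mass \<tau> \<mu>. energy \<sigma> \<alpha> u) \<le> energy \<sigma> \<alpha> s" by (rule cINF_lower[OF bdd sD])
    then have "(INF u \<in> D_mass \<tau> \<mu>. energy \<sigma> \<alpha> u) < 0" using neg by (simp add: s_def)
    moreover have "\<exists>!u. ground_state \<sigma> \<alpha> \<tau> \<mu> u \<and> pos_fun u" unfolding gs[rule_format] by simp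
    ultimately show "D_mass \<tau> \<mu> \<noteq> {} \<and> bdd_below (energy \<sigma> \<alpha> ` D_mass \<tau> \<mu>) \<and>
        (INF u \<in> D_mass \<tau> \<mu>. energy \<sigma> \<alpha> u) < 0 \<and> (\<exists>!u. ground_state \<sigma> \<alpha> \<tau> \<mu> u \<and> pos_fun u)"
      using sD bdd by blast
  next
    fix \<mu> :: real assume \<mu>: "\<mu> > 0"
    then obtain k \<theta>1 \<theta>2 where t: "triple k \<theta>1 \<theta>2" "\<theta>1 > 0" "tmass k \<theta>1 \<theta>2 = \<mu>"
      and gs: "\<forall>u. ground_state \<sigma> \<alpha> \<tau> \<mu> u \<and> pos_fun u \<longleftrightarrow> u = state k \<theta>1 \<theta>2"
      and right: "\<forall>k' \<theta>1' \<theta>2'. triple k' \<theta>1' \<theta>2' \<longrightarrow> tmass k' \<theta>1' \<theta>2' = \<mu> \<longrightarrow> \<theta>1' < 0 \<longrightarrow>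
       energy \<sigma> \<alpha> (state k \<theta>1 \<theta>2) < energy \<sigma> \<alpha> (state k' \<theta>1' \<theta>2')"
      by (rule positive_ground_state)
    have the: "(THE u. ground_state \<sigma> \<alpha> \<tau> \<mu> u \<and> pos_fun u) = state k \<theta>1 \<theta>2" unfolding gs[rule_format] by simp
    show "(\<exists>v. stationary_state \<sigma> \<alpha> \<tau> \<mu> v \<and> pos_fun v \<and>
                 v \<noteq> (THE u. ground_state \<sigma> \<alpha> \<tau> \<mu> u \<and> pos_fun u)) \<longleftrightarrow> \<mu> > mu_crit \<sigma> \<alpha> \<tau>"
      unfolding the
    proof
      assume "\<exists>v. stationary_state \<sigma> \<alpha> \<tau> \<mu> v \<and> pos_fun v \<and> v \<noteq> state k \<theta>1 \<theta>2"
      then obtain v where v: "stationary_state \<sigma> \<alpha> \<tau> \<mu> v" "pos_fun v" and ne: "v \<noteq> state k \<theta>1 \<theta>2" by blast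
      obtain k' \<theta>1' \<theta>2' where t': "triple k' \<theta>1' \<theta>2'" "tmass k' \<theta>1' \<theta>2' = \<mu>" "v = state k' \<theta>1' \<theta>2'"
        by (rule positive_stationary_is_state[OF v \<mu>])
      have "\<theta>1' < 0"
      proof (rule ccontr)
        assume "\<not> \<theta>1' < 0"
        then show False using triple_unique[OF t(1) t'(1)] t(2,3) t'(2,3) ne by simp
      qed
      then show "\<mu> > mu_crit \<sigma> \<alpha> \<tau>" using right_triple_mass[OF t'(1)] t'(2) by simp
    next
      assume "\<mu> > mu_crit \<sigma> \<alpha> \<tau>"
      then obtain k' \<theta>1' \<theta>2' where t': "triple k' \<theta>1' \<theta>2'" "\<theta>1' < 0" "tmass k' \<theta>1' \<theta>2' = \<mu>" by (rule right_triple_exists)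
      \<comment> \<open>The energies differ, so the functions differ; their profiles need not be
        compared.\<close>
      have "state k' \<theta>1' \<theta>2' \<noteq> state k \<theta>1 \<theta>2" using right t' by fastforce
      moreover have "pos_fun (state k' \<theta>1' \<theta>2')" using t'(1) by (intro state_pos_fun) (simp add: triple_def)
      ultimately show "\<exists>v. stationary_state \<sigma> \<alpha> \<tau> \<mu> v \<and> pos_fun v \<and> v \<noteq> state k \<theta>1 \<theta>2"
        using state_stationary[OF t'(1)] unfolding t'(3) by blast
    qed
  qed
qed

end
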